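(* Assume $\mathrm{RP}_{\mathrm{internal}}$. Then for every ring $R$ with $|R|\le\aleph_1$ and every quotient-hereditary class $\mathcal{C}$ of countably presented $R$-modules, the class of $R$-modules that are not $\sigma$-closed potentially $\mathcal{C}$-filtered, ordered by pure embeddability, is an Abstract Elementary Class with Löwenheim–Skolem number at most $\aleph_1$. In particular, the class of abelian groups that are not $\sigma$-closed potentially free, under the pure embeddability ordering, is an AEC with Löwenheim–Skolem number $\aleph_1$.
   Context: $M$ is $\mathcal{C}$-filtered if it has a filtration $\langle M_i:i<\eta\rangle$ (increasing, continuous at limits, union $M$) with $M_0=\{0\}$ and each $M_{i+1}/M_i$ isomorphic to a member of $\mathcal{C}$. $\mathcal{C}$ is quotient-hereditary if whenever $Z\subseteq Z'$ with $Z$, $Z'/Z$ $\mathcal{C}$-filtered, then for every submodule $U'\le Z'$, $U'\cap Z$ and $U'/(U'\cap Z)$ are $\mathcal{C}$-filtered. $M$ is $\sigma$-closed potentially $\mathcal{C}$-filtered if some $\sigma$-closed forcing poset forces $M$ to be $\mathcal{C}$-filtered; $\sigma$-closed potentially free is the case $R=\mathbb{Z}$, $\mathcal{C}=\{\mathbb{Z}\}$. An AEC $(K,\prec_K)$: (i) $K$ closed under isomorphism; (ii) $\prec_K$ isomorphism-invariant; (iii) $M\prec_K N$ implies $M$ a substructure of $N$; (iv) if $M_0\subseteq M_1$ (substructure), $M_0\prec_K M_2$, $M_1\prec_K M_2$, all in $K$, then $M_0\prec_K M_1$; (v) for any continuous increasing $\prec_K$-chain in $K$, the union is in $K$, lies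 $\prec_K$-above each member, and is $\prec_K$-below any $N\in K$ lying $\prec_K$-above every member; (vi) there is a cardinal $\mathrm{LS}$ with: whenever $A\subseteq B\in K$ there is $A'\in K$, $A\subseteq A'\prec_K B$, $|A'|\le|A|+\mathrm{LS}$ (least such is the Löwenheim–Skolem number). $\mathrm{RP}_{\mathrm{internal}}$: for every uncountable $X$, stationary $S\subseteq[X]^\omega$, regular $\theta$ with $X\in H_\theta$, and first-order structure $\mathfrak{A}$ in a countable language expanding $(H_\theta,\in,X,S)$, there is $W\prec\mathfrak{A}$ with $|W|=\omega_1\subseteq W$ and $S\cap W\cap[W\cap X]^\omega$ stationary in $[W\cap X]^\omega$. *)

theory Defs
  imports "HOL-Library.Countable_Set" "HOL-Algebra.IntRing" "HOL-Algebra.Module"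
begin

unbundle cardinal_syntax

section \<open>The set-theoretic universe\<close>

text \<open>
  The elements of a type of this class are the sets of a universe of ZFC in its second-order
  form (Choice is inherited from HOL); this is the axiomatisation of the type V of ZFC in HOL.
  A class is a HOL set of elements, a set is a class of the form \<open>elts x\<close>.
\<close>

class zfc =
  fixes elts :: "'a \<Rightarrow> 'a set"
  assumes extensionality: "elts x = elts y \<Longrightarrow> x = y"
    and foundation: "wf {(x, y). x \<in> elts y}"
    and separation: "A \<subseteq> elts x \<Longrightarrow> \<exists>y. elts y = A"
    and union: "\<exists>y. elts y = (\<Union>z\<in>elts x. elts z)"
    and power: "\<exists>y. elts y = {z. elts z \<subseteq> elts x}"
    and replacement: "\<exists>y. elts y = f ` elts x"
    and infinity: "\<exists>w. (\<exists>z\<in>elts w. elts z = {}) \<and>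
      (\<forall>x\<in>elts w. \<exists>y\<in>elts w. elts y = insert x (elts x))"

definition small :: "'v::zfc set \<Rightarrow> bool" where
  "small A \<longleftrightarrow> A \<in> range elts"

definition vset :: "'v::zfc set \<Rightarrow> 'v" where
  "vset A = (THE x. elts x = A)"

definition vpair :: "'v::zfc \<Rightarrow> 'v \<Rightarrow> 'v" where
  "vpair x y = vset {vset {x}, vset {x, y}}"

definition vord :: "'v::zfc \<Rightarrow> bool" where
  "vord x \<longleftrightarrow> (\<forall>y\<in>elts x. elts y \<subseteq> elts x) \<and> (\<forall>y\<in>elts x. \<forall>z\<in>elts y. elts z \<subseteq> elts y)"

definition vsucc :: "'v::zfc \<Rightarrow> 'v \<Rightarrow> bool" where
  "vsucc i j \<longleftrightarrow> elts j = insert i (elts i)"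

definition vlimit :: "'v::zfc \<Rightarrow> bool" where
  "vlimit i \<longleftrightarrow> vord i \<and> elts i \<noteq> {} \<and> (\<forall>j\<in>elts i. \<exists>k\<in>elts i. j \<in> elts k)"

definition omega1 :: "'v::zfc set" where
  "omega1 = {i. vord i \<and> countable (elts i)}"

text \<open>The cardinals of the universe are the library cardinals with a small field.\<close>

definition vcardinal :: "'v::zfc rel \<Rightarrow> bool" where
  "vcardinal \<kappa> \<longleftrightarrow> Card_order \<kappa> \<and> small (Field \<kappa>)"

abbreviation aleph1 :: "nat set rel" where
  "aleph1 \<equiv> cardSuc natLeq"

definition trcl :: "'v::zfc \<Rightarrow> 'v set" where
  "trcl x = {y. (y, x) \<in> {(y, x). y \<in> elts x}\<^sup>+}"

definition Hset :: "'v::zfc rel \<Rightarrow> 'v set" where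
  "Hset \<theta> = {x. |trcl x| <o \<theta>}"


section \<open>First-order structures\<close>

record ('f, 'p) lang =
  funs :: "'f set"
  farity :: "'f \<Rightarrow> nat"
  rels :: "'p set"
  rarity :: "'p \<Rightarrow> nat"

record ('f, 'p, 'a) fo_struct =
  univ :: "'a set"
  fn :: "'f \<Rightarrow> 'a list \<Rightarrow> 'a"
  rl :: "'p \<Rightarrow> 'a list \<Rightarrow> bool"

text \<open>
  The last two conditions fix the irrelevant values, so that equality of records is equality of
  structures.
\<close>

definition is_struct :: "('f, 'p) lang \<Rightarrow> ('f, 'p, 'v::zfc) fo_struct \<Rightarrow> bool" where
  "is_struct L A \<longleftrightarrow> small (univ A) \<and>
     (\<forall>f\<in>funs L. \<forall>xs. length xs = farity L f \<and> set xs \<subseteq> univ A \<longrightarrow> fn A f xs \<in> univ A) \<and>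
     (\<forall>f xs. \<not> (f \<in> funs L \<and> length xs = farity L f \<and> set xs \<subseteq> univ A) \<longrightarrow> fn A f xs = undefined) \<and>
     (\<forall>p xs. rl A p xs \<longrightarrow> p \<in> rels L \<and> length xs = rarity L p \<and> set xs \<subseteq> univ A)"

definition substructure ::
  "('f, 'p) lang \<Rightarrow> ('f, 'p, 'v::zfc) fo_struct \<Rightarrow> ('f, 'p, 'v) fo_struct \<Rightarrow> bool" where
  "substructure L A B \<longleftrightarrow> is_struct L A \<and> is_struct L B \<and> univ A \<subseteq> univ B \<and>
     (\<forall>f\<in>funs L. \<forall>xs. length xs = farity L f \<and> set xs \<subseteq> univ A \<longrightarrow> fn A f xs = fn B f xs) \<and>
     (\<forall>p\<in>rels L. \<forall>xs. length xs = rarity L p \<and> set xs \<subseteq> univ A \<longrightarrow> rl A p xs = rl B p xs)"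

definition struct_iso ::
  "('f, 'p) lang \<Rightarrow> ('v \<Rightarrow> 'v) \<Rightarrow> ('f, 'p, 'v::zfc) fo_struct \<Rightarrow> ('f, 'p, 'v) fo_struct \<Rightarrow> bool" where
  "struct_iso L h A B \<longleftrightarrow> bij_betw h (univ A) (univ B) \<and>
     (\<forall>f\<in>funs L. \<forall>xs. length xs = farity L f \<and> set xs \<subseteq> univ A \<longrightarrow>
        h (fn A f xs) = fn B f (map h xs)) \<and>
     (\<forall>p\<in>rels L. \<forall>xs. length xs = rarity L p \<and> set xs \<subseteq> univ A \<longrightarrow>
        rl A p xs = rl B p (map h xs))"

datatype 'f tm = Var nat | App 'f "'f tm list"

datatype ('f, 'p) fm =
    Eq "'f tm" "'f tm"
  | Rel 'p "'f tm list"
  | Neg "('f, 'p) fm"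
  | Conj "('f, 'p) fm" "('f, 'p) fm"
  | Ex nat "('f, 'p) fm"

fun wf_tm :: "('f, 'p) lang \<Rightarrow> 'f tm \<Rightarrow> bool" where
  "wf_tm L (Var n) = True"
| "wf_tm L (App f ts) = (f \<in> funs L \<and> length ts = farity L f \<and> (\<forall>t\<in>set ts. wf_tm L t))"

fun wf_fm :: "('f, 'p) lang \<Rightarrow> ('f, 'p) fm \<Rightarrow> bool" where
  "wf_fm L (Eq s t) = (wf_tm L s \<and> wf_tm L t)"
| "wf_fm L (Rel p ts) = (p \<in> rels L \<and> length ts = rarity L p \<and> (\<forall>t\<in>set ts. wf_tm L t))"
| "wf_fm L (Neg \<phi>) = wf_fm L \<phi>"
| "wf_fm L (Conj \<phi> \<psi>) = (wf_fm L \<phi> \<and> wf_fm L \<psi>)"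
| "wf_fm L (Ex n \<phi>) = wf_fm L \<phi>"

fun tm_val :: "('f, 'p, 'a) fo_struct \<Rightarrow> (nat \<Rightarrow> 'a) \<Rightarrow> 'f tm \<Rightarrow> 'a" where
  "tm_val A e (Var n) = e n"
| "tm_val A e (App f ts) = fn A f (map (tm_val A e) ts)"

fun sat :: "('f, 'p, 'a) fo_struct \<Rightarrow> (nat \<Rightarrow> 'a) \<Rightarrow> ('f, 'p) fm \<Rightarrow> bool" where
  "sat A e (Eq s t) = (tm_val A e s = tm_val A e t)"
| "sat A e (Rel p ts) = rl A p (map (tm_val A e) ts)"
| "sat A e (Neg \<phi>) = (\<not> sat A e \<phi>)"
| "sat A e (Conj \<phi> \<psi>) = (sat A e \<phi> \<and> sat A e \<psi>)"
| "sat A e (Ex n \<phi>) = (\<exists>a\<in>univ A. sat A (e(n := a)) \<phi>)"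

definition elementary_substructure ::
  "('f, 'p) lang \<Rightarrow> ('f, 'p, 'v::zfc) fo_struct \<Rightarrow> ('f, 'p, 'v) fo_struct \<Rightarrow> bool" where
  "elementary_substructure L A B \<longleftrightarrow> substructure L A B \<and> univ A \<noteq> {} \<and>
     (\<forall>\<phi> e. wf_fm L \<phi> \<and> range e \<subseteq> univ A \<longrightarrow> sat A e \<phi> = sat B e \<phi>)"


section \<open>Stationary sets of countable sets, and the reflection principle\<close>

definition ctbl_sets :: "'v::zfc set \<Rightarrow> 'v set" where
  "ctbl_sets X = {x. elts x \<subseteq> X \<and> |elts x| =o natLeq}"

definition club :: "'v::zfc set \<Rightarrow> 'v set \<Rightarrow> bool" where
  "club X D \<longleftrightarrow> D \<subseteq> ctbl_sets X \<and>
     (\<forall>x\<in>ctbl_sets X. \<exists>y\<in>D. elts x \<subseteq> elts y) \<and>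
     (\<forall>s :: nat \<Rightarrow> 'v. (\<forall>n. s n \<in> D \<and> elts (s n) \<subseteq> elts (s (Suc n))) \<longrightarrow>
        (\<exists>y\<in>D. elts y = (\<Union>n. elts (s n))))"

definition stationary :: "'v::zfc set \<Rightarrow> 'v set \<Rightarrow> bool" where
  "stationary X S \<longleftrightarrow> S \<subseteq> ctbl_sets X \<and> (\<forall>D. club X D \<longrightarrow> S \<inter> D \<noteq> {})"

text \<open>
  \<open>X\<close> and \<open>S\<close> enter the structure as unary predicates: \<open>S\<close> is a subset of \<open>Hset \<theta>\<close> but need not be
  an element of it.
\<close>

definition expands_H ::
  "('f, 'p) lang \<Rightarrow> ('f, 'p, 'v::zfc) fo_struct \<Rightarrow> 'v rel \<Rightarrow> 'v \<Rightarrow> 'v set \<Rightarrow> bool" where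
  "expands_H L A \<theta> X S \<longleftrightarrow> is_struct L A \<and> univ A = Hset \<theta> \<and>
     (\<exists>p\<in>rels L. rarity L p = 2 \<and> (\<forall>a\<in>Hset \<theta>. \<forall>b\<in>Hset \<theta>. rl A p [a, b] \<longleftrightarrow> a \<in> elts b)) \<and>
     (\<exists>p\<in>rels L. rarity L p = 1 \<and> (\<forall>a\<in>Hset \<theta>. rl A p [a] \<longleftrightarrow> a \<in> elts X)) \<and>
     (\<exists>p\<in>rels L. rarity L p = 1 \<and> (\<forall>a\<in>Hset \<theta>. rl A p [a] \<longleftrightarrow> a \<in> S))"

text \<open>
  Taking the symbols from \<open>nat\<close> restricts the language to a countable one. Stationary subsets
  \<open>S\<close> of \<open>[X]\<^sup>\<omega>\<close> are automatically small.
\<close>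

definition RP_internal :: "'v::zfc itself \<Rightarrow> bool" where
  "RP_internal _ \<longleftrightarrow>
     (\<forall>(X::'v) S \<theta> (L :: (nat, nat) lang) A.
        uncountable (elts X) \<and> stationary (elts X) S \<and>
        vcardinal \<theta> \<and> regularCard \<theta> \<and> X \<in> Hset \<theta> \<and> expands_H L A \<theta> X S \<longrightarrow>
        (\<exists>N. elementary_substructure L N A \<and> |univ N| =o aleph1 \<and> omega1 \<subseteq> univ N \<and>
           stationary (univ N \<inter> elts X) (S \<inter> univ N \<inter> ctbl_sets (univ N \<inter> elts X))))"


section \<open>Modules\<close>

text \<open>
  Left modules over a ring which need not be commutative; otherwise as the library's
  \<open>module\<close>. The fields \<open>mult\<close> and \<open>one\<close> of a module record play no role.
\<close>

locale lmodule = R?: ring R + M?: abelian_group M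
  for R (structure) and M :: "('r, 'm) module" (structure) +
  assumes smult_closed: "\<lbrakk>a \<in> carrier R; x \<in> carrier M\<rbrakk> \<Longrightarrow> a \<odot>\<^bsub>M\<^esub> x \<in> carrier M"
    and smult_l_distr: "\<lbrakk>a \<in> carrier R; b \<in> carrier R; x \<in> carrier M\<rbrakk> \<Longrightarrow>
      (a \<oplus>\<^bsub>R\<^esub> b) \<odot>\<^bsub>M\<^esub> x = a \<odot>\<^bsub>M\<^esub> x \<oplus>\<^bsub>M\<^esub> b \<odot>\<^bsub>M\<^esub> x"
    and smult_r_distr: "\<lbrakk>a \<in> carrier R; x \<in> carrier M; y \<in> carrier M\<rbrakk> \<Longrightarrow>
      a \<odot>\<^bsub>M\<^esub> (x \<oplus>\<^bsub>M\<^esub> y) = a \<odot>\<^bsub>M\<^esub> x \<oplus>\<^bsub>M\<^esub> a \<odot>\<^bsub>M\<^esub> y"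
    and smult_assoc: "\<lbrakk>a \<in> carrier R; b \<in> carrier R; x \<in> carrier M\<rbrakk> \<Longrightarrow>
      (a \<otimes>\<^bsub>R\<^esub> b) \<odot>\<^bsub>M\<^esub> x = a \<odot>\<^bsub>M\<^esub> (b \<odot>\<^bsub>M\<^esub> x)"
    and smult_one: "x \<in> carrier M \<Longrightarrow> \<one>\<^bsub>R\<^esub> \<odot>\<^bsub>M\<^esub> x = x"

definition vmodule :: "'r ring \<Rightarrow> ('r, 'v::zfc) module \<Rightarrow> bool" where
  "vmodule R M \<longleftrightarrow> lmodule R M \<and> small (carrier M)"

definition mod_hom :: "'r ring \<Rightarrow> ('r, 'm) module \<Rightarrow> ('r, 'n) module \<Rightarrow> ('m \<Rightarrow> 'n) \<Rightarrow> bool" where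
  "mod_hom R M N h \<longleftrightarrow>
     (\<forall>x\<in>carrier M. h x \<in> carrier N) \<and>
     (\<forall>x\<in>carrier M. \<forall>y\<in>carrier M. h (x \<oplus>\<^bsub>M\<^esub> y) = h x \<oplus>\<^bsub>N\<^esub> h y) \<and>
     (\<forall>r\<in>carrier R. \<forall>x\<in>carrier M. h (r \<odot>\<^bsub>M\<^esub> x) = r \<odot>\<^bsub>N\<^esub> h x)"

definition mod_iso :: "'r ring \<Rightarrow> ('r, 'm) module \<Rightarrow> ('r, 'n) module \<Rightarrow> bool" where
  "mod_iso R M N \<longleftrightarrow> (\<exists>h. mod_hom R M N h \<and> bij_betw h (carrier M) (carrier N))"

text \<open>The library's locale \<open>submodule\<close> does not presuppose that the ring is commutative.\<close>

abbreviation submodule_of :: "('r, 'm) module \<Rightarrow> 'm set \<Rightarrow> ('r, 'm) module" where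
  "submodule_of M U \<equiv> M\<lparr>carrier := U\<rparr>"

definition quotient_module :: "('r, 'm) module \<Rightarrow> 'm set \<Rightarrow> ('r, 'm set) module" where
  "quotient_module M U =
     \<lparr>carrier = a_rcosets\<^bsub>M\<^esub> U, mult = undefined, one = undefined, zero = U,
      add = set_add M, smult = \<lambda>r X. set_add M ((\<lambda>x. r \<odot>\<^bsub>M\<^esub> x) ` X) U\<rparr>"

definition mod_span :: "'r ring \<Rightarrow> ('r, 'm) module \<Rightarrow> 'm set \<Rightarrow> 'm set" where
  "mod_span R M B = \<Inter>{U. submodule U R M \<and> B \<subseteq> U}"

definition free_module :: "'r ring \<Rightarrow> 'i set \<Rightarrow> ('r, 'i \<Rightarrow> 'r) module" where
  "free_module R I =
     \<lparr>carrier = {c. (\<forall>i. c i \<in> carrier R) \<and> (\<forall>i. i \<notin> I \<longrightarrow> c i = \<zero>\<^bsub>R\<^esub>) \<and> finite {i. c i \<noteq> \<zero>\<^bsub>R\<^esub>}},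
      mult = undefined, one = undefined, zero = (\<lambda>i. \<zero>\<^bsub>R\<^esub>),
      add = \<lambda>c d i. c i \<oplus>\<^bsub>R\<^esub> d i, smult = \<lambda>r c i. r \<otimes>\<^bsub>R\<^esub> c i\<rparr>"

definition regular_module :: "'r ring \<Rightarrow> ('r, 'r) module" where
  "regular_module R =
     \<lparr>carrier = carrier R, mult = undefined, one = undefined, zero = \<zero>\<^bsub>R\<^esub>,
      add = add R, smult = mult R\<rparr>"

definition countably_presented :: "'r ring \<Rightarrow> ('r, 'm) module \<Rightarrow> bool" where
  "countably_presented R M \<longleftrightarrow>
     (\<exists>(I :: nat set) h B. let F = free_module R I in
        mod_hom R F M h \<and> h ` carrier F = carrier M \<and>
        countable B \<and> B \<subseteq> carrier F \<and>
        {c \<in> carrier F. h c = \<zero>\<^bsub>M\<^esub>} = mod_span R F B)"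

definition pure_in :: "'r ring \<Rightarrow> 'm set \<Rightarrow> ('r, 'm) module \<Rightarrow> bool" where
  "pure_in R U M \<longleftrightarrow> submodule U R M \<and>
     (\<forall>(m::nat) (n::nat) a b.
        (\<forall>i<m. \<forall>j<n. a i j \<in> carrier R) \<and> (\<forall>i<m. b i \<in> U) \<and>
        (\<exists>x. (\<forall>j<n. x j \<in> carrier M) \<and> (\<forall>i<m. finsum M (\<lambda>j. a i j \<odot>\<^bsub>M\<^esub> x j) {..<n} = b i)) \<longrightarrow>
        (\<exists>x. (\<forall>j<n. x j \<in> U) \<and> (\<forall>i<m. finsum M (\<lambda>j. a i j \<odot>\<^bsub>M\<^esub> x j) {..<n} = b i)))"


section \<open>Filtered modules\<close>

definition filtration ::
  "'r ring \<Rightarrow> ('r, 'v) module set \<Rightarrow> ('r, 'm) module \<Rightarrow> 'v::zfc \<Rightarrow> ('v \<Rightarrow> 'm set) \<Rightarrow> bool" where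
  "filtration R C M \<eta> F \<longleftrightarrow> vord \<eta> \<and> elts \<eta> \<noteq> {} \<and>
     (\<forall>i\<in>elts \<eta>. submodule (F i) R M) \<and>
     (\<forall>i\<in>elts \<eta>. elts i = {} \<longrightarrow> F i = {\<zero>\<^bsub>M\<^esub>}) \<and>
     (\<forall>j\<in>elts \<eta>. \<forall>i\<in>elts j. F i \<subseteq> F j) \<and>
     (\<forall>j\<in>elts \<eta>. vlimit j \<longrightarrow> F j = (\<Union>i\<in>elts j. F i)) \<and>
     carrier M = (\<Union>i\<in>elts \<eta>. F i) \<and>
     (\<forall>i\<in>elts \<eta>. \<forall>j\<in>elts \<eta>. vsucc i j \<longrightarrow>
        (\<exists>N\<in>C. mod_iso R (quotient_module (submodule_of M (F j)) (F i)) N))"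

definition filtered :: "'r ring \<Rightarrow> ('r, 'v::zfc) module set \<Rightarrow> ('r, 'm) module \<Rightarrow> bool" where
  "filtered R C M \<longleftrightarrow> (\<exists>\<eta> F. filtration R C M \<eta> F)"

definition quotient_hereditary :: "'r ring \<Rightarrow> ('r, 'v::zfc) module set \<Rightarrow> bool" where
  "quotient_hereditary R C \<longleftrightarrow>
     (\<forall>(Z' :: ('r, 'v) module) Z.
        vmodule R Z' \<and> submodule Z R Z' \<and>
        filtered R C (submodule_of Z' Z) \<and> filtered R C (quotient_module Z' Z) \<longrightarrow>
        (\<forall>U. submodule U R Z' \<longrightarrow>
           filtered R C (submodule_of Z' (U \<inter> Z)) \<and>
           filtered R C (quotient_module (submodule_of Z' U) (U \<inter> Z))))"


section \<open>Forcing\<close>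

text \<open>
  A sentence of the forcing language is represented by the predicate telling which conditions
  force it; the connectives \<open>\<not>\<close>, \<open>\<and>\<close>, \<open>\<forall>\<close> follow the usual recursive clauses and the others are
  abbreviations. Quantifiers carry their range: \<open>Nm\<close>, the class of all names, for the sets of the
  extension, or a ground model class, for its elements. Posets need not have a largest element,
  so the check names use all conditions.
\<close>

function check :: "'v::zfc set \<Rightarrow> 'v \<Rightarrow> 'v" where
  "check P x = vset ((\<lambda>(y, p). vpair (check P y) p) ` (elts x \<times> P))"
  by auto
termination
  by (relation "inv_image {(x, y). x \<in> elts y} snd") (auto simp: foundation)

declare check.simps [simp del]

locale forcing_poset =
  fixes P :: "'v::zfc set" and le :: "'v \<Rightarrow> 'v \<Rightarrow> bool" (infix "\<preceq>" 50)
  assumes P_small: "small P"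
    and P_nonempty: "P \<noteq> {}"
    and P_refl: "p \<in> P \<Longrightarrow> p \<preceq> p"
    and P_trans: "\<lbrakk>p \<in> P; q \<in> P; r \<in> P; p \<preceq> q; q \<preceq> r\<rbrakk> \<Longrightarrow> p \<preceq> r"
begin

definition sigma_closed :: bool where
  "sigma_closed \<longleftrightarrow> (\<forall>s :: nat \<Rightarrow> 'v. (\<forall>n. s n \<in> P \<and> s (Suc n) \<preceq> s n) \<longrightarrow>
     (\<exists>q\<in>P. \<forall>n. q \<preceq> s n))"

inductive is_name :: "'v \<Rightarrow> bool" where
  "\<forall>z\<in>elts x. \<exists>y p. z = vpair y p \<and> p \<in> P \<and> is_name y \<Longrightarrow> is_name x"

definition Nm :: "'v set" where
  "Nm = {x. is_name x}"

definition dense_below :: "('v \<Rightarrow> bool) \<Rightarrow> 'v \<Rightarrow> bool" where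
  "dense_below D p \<longleftrightarrow> (\<forall>q\<in>P. q \<preceq> p \<longrightarrow> (\<exists>r\<in>P. r \<preceq> q \<and> D r))"

text \<open>
  The recursion for the forcing of equalities of names has a unique solution by foundation; as it
  is monotone, it can be written as an inductive definition.
\<close>

inductive fEq :: "'v \<Rightarrow> 'v \<Rightarrow> 'v \<Rightarrow> bool" where
  "\<lbrakk>\<forall>s u. vpair s u \<in> elts x \<longrightarrow> (\<forall>q\<in>P. q \<preceq> p \<and> q \<preceq> u \<longrightarrow>
       (\<exists>r\<in>P. r \<preceq> q \<and> (\<exists>t w. vpair t w \<in> elts y \<and> r \<preceq> w \<and> fEq s t r)));
    \<forall>t w. vpair t w \<in> elts y \<longrightarrow> (\<forall>q\<in>P. q \<preceq> p \<and> q \<preceq> w \<longrightarrow>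
       (\<exists>r\<in>P. r \<preceq> q \<and> (\<exists>s u. vpair s u \<in> elts x \<and> r \<preceq> u \<and> fEq s t r)))\<rbrakk>
   \<Longrightarrow> fEq x y p"

notation fEq (infix "\<^bold>=" 50)

definition fMem :: "'v \<Rightarrow> 'v \<Rightarrow> 'v \<Rightarrow> bool" (infix "\<^bold>\<in>" 50) where
  "x \<^bold>\<in> y = dense_below (\<lambda>r. \<exists>s u. vpair s u \<in> elts y \<and> r \<preceq> u \<and> (x \<^bold>= s) r)"

text \<open>\<open>Gr Q xs\<close>: the tuple \<open>xs\<close> belongs to the relation \<open>Q\<close> of the ground model.\<close>

definition Gr :: "'v list set \<Rightarrow> 'v list \<Rightarrow> 'v \<Rightarrow> bool" where
  "Gr Q xs = dense_below (\<lambda>r. \<exists>vs\<in>Q. list_all2 (\<lambda>x v. (x \<^bold>= check P v) r) xs vs)"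

definition fNot :: "('v \<Rightarrow> bool) \<Rightarrow> 'v \<Rightarrow> bool" ("\<^bold>\<not> _" [40] 40) where
  "(\<^bold>\<not> \<phi>) p \<longleftrightarrow> (\<forall>q\<in>P. q \<preceq> p \<longrightarrow> \<not> \<phi> q)"

definition fAnd :: "('v \<Rightarrow> bool) \<Rightarrow> ('v \<Rightarrow> bool) \<Rightarrow> 'v \<Rightarrow> bool" (infixr "\<^bold>\<and>" 35) where
  "(\<phi> \<^bold>\<and> \<psi>) p \<longleftrightarrow> \<phi> p \<and> \<psi> p"

definition fAll :: "'i set \<Rightarrow> ('i \<Rightarrow> 'v \<Rightarrow> bool) \<Rightarrow> 'v \<Rightarrow> bool" where
  "fAll A \<Phi> p \<longleftrightarrow> (\<forall>x\<in>A. \<Phi> x p)"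

abbreviation fOr :: "('v \<Rightarrow> bool) \<Rightarrow> ('v \<Rightarrow> bool) \<Rightarrow> 'v \<Rightarrow> bool" (infixr "\<^bold>\<or>" 30) where
  "\<phi> \<^bold>\<or> \<psi> \<equiv> \<^bold>\<not> ((\<^bold>\<not> \<phi>) \<^bold>\<and> (\<^bold>\<not> \<psi>))"

abbreviation fImp :: "('v \<Rightarrow> bool) \<Rightarrow> ('v \<Rightarrow> bool) \<Rightarrow> 'v \<Rightarrow> bool" (infixr "\<^bold>\<longrightarrow>" 25) where
  "\<phi> \<^bold>\<longrightarrow> \<psi> \<equiv> \<^bold>\<not> (\<phi> \<^bold>\<and> (\<^bold>\<not> \<psi>))"

abbreviation fIff :: "('v \<Rightarrow> bool) \<Rightarrow> ('v \<Rightarrow> bool) \<Rightarrow> 'v \<Rightarrow> bool" (infixr "\<^bold>\<longleftrightarrow>" 25) where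
  "\<phi> \<^bold>\<longleftrightarrow> \<psi> \<equiv> (\<phi> \<^bold>\<longrightarrow> \<psi>) \<^bold>\<and> (\<psi> \<^bold>\<longrightarrow> \<phi>)"

abbreviation fEx :: "'i set \<Rightarrow> ('i \<Rightarrow> 'v \<Rightarrow> bool) \<Rightarrow> 'v \<Rightarrow> bool" where
  "fEx A \<Phi> \<equiv> \<^bold>\<not> (fAll A (\<lambda>x. \<^bold>\<not> (\<Phi> x)))"

abbreviation fALL :: "('v \<Rightarrow> 'v \<Rightarrow> bool) \<Rightarrow> 'v \<Rightarrow> bool" (binder "\<^bold>\<forall>" 10) where
  "fALL \<Phi> \<equiv> fAll Nm \<Phi>"

abbreviation fEX :: "('v \<Rightarrow> 'v \<Rightarrow> bool) \<Rightarrow> 'v \<Rightarrow> bool" (binder "\<^bold>\<exists>" 10) where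
  "fEX \<Phi> \<equiv> fEx Nm \<Phi>"

subsection \<open>Set-theoretic vocabulary of the forcing language\<close>

definition fSub :: "'v \<Rightarrow> 'v \<Rightarrow> 'v \<Rightarrow> bool" (infix "\<^bold>\<subseteq>" 50) where
  "x \<^bold>\<subseteq> y = (\<^bold>\<forall>z. z \<^bold>\<in> x \<^bold>\<longrightarrow> z \<^bold>\<in> y)"

definition fEmpty :: "'v \<Rightarrow> 'v \<Rightarrow> bool" where
  "fEmpty x = (\<^bold>\<forall>z. \<^bold>\<not> (z \<^bold>\<in> x))"

definition fOrd :: "'v \<Rightarrow> 'v \<Rightarrow> bool" where
  "fOrd x = ((\<^bold>\<forall>y. y \<^bold>\<in> x \<^bold>\<longrightarrow> y \<^bold>\<subseteq> x) \<^bold>\<and> (\<^bold>\<forall>y. y \<^bold>\<in> x \<^bold>\<longrightarrow> (\<^bold>\<forall>z. z \<^bold>\<in> y \<^bold>\<longrightarrow> z \<^bold>\<subseteq> y)))"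

definition fSucc :: "'v \<Rightarrow> 'v \<Rightarrow> 'v \<Rightarrow> bool" where
  "fSucc i j = (\<^bold>\<forall>k. k \<^bold>\<in> j \<^bold>\<longleftrightarrow> (k \<^bold>= i \<^bold>\<or> k \<^bold>\<in> i))"

definition fLimit :: "'v \<Rightarrow> 'v \<Rightarrow> bool" where
  "fLimit i = (fOrd i \<^bold>\<and> (\<^bold>\<not> (fEmpty i)) \<^bold>\<and> (\<^bold>\<forall>j. j \<^bold>\<in> i \<^bold>\<longrightarrow> (\<^bold>\<exists>k. k \<^bold>\<in> i \<^bold>\<and> j \<^bold>\<in> k)))"

definition fPair :: "'v \<Rightarrow> 'v \<Rightarrow> 'v \<Rightarrow> 'v \<Rightarrow> bool" where
  "fPair z x y = (\<^bold>\<forall>w. w \<^bold>\<in> z \<^bold>\<longleftrightarrow>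
     ((\<^bold>\<forall>u. u \<^bold>\<in> w \<^bold>\<longleftrightarrow> u \<^bold>= x) \<^bold>\<or> (\<^bold>\<forall>u. u \<^bold>\<in> w \<^bold>\<longleftrightarrow> (u \<^bold>= x \<^bold>\<or> u \<^bold>= y))))"

definition fMaps :: "'v \<Rightarrow> 'v \<Rightarrow> 'v \<Rightarrow> 'v \<Rightarrow> bool" where
  "fMaps f x y = (\<^bold>\<exists>z. fPair z x y \<^bold>\<and> z \<^bold>\<in> f)"

definition fFun :: "('v \<Rightarrow> 'v \<Rightarrow> bool) \<Rightarrow> 'v \<Rightarrow> 'v \<Rightarrow> bool" where
  \<comment> \<open>\<open>f\<close> is a function whose domain consists of the \<open>x\<close> such that \<open>D x\<close>\<close>
  "fFun D f =
     ((\<^bold>\<forall>z. z \<^bold>\<in> f \<^bold>\<longrightarrow> (\<^bold>\<exists>x. D x \<^bold>\<and> (\<^bold>\<exists>y. fPair z x y))) \<^bold>\<and>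
      (\<^bold>\<forall>x. D x \<^bold>\<longrightarrow> (\<^bold>\<exists>y. fMaps f x y)) \<^bold>\<and>
      (\<^bold>\<forall>x. \<^bold>\<forall>y. \<^bold>\<forall>y'. (fMaps f x y \<^bold>\<and> fMaps f x y') \<^bold>\<longrightarrow> y \<^bold>= y'))"

subsection \<open>Ground model modules in the extension\<close>

definition fCarrier :: "('r, 'v) module \<Rightarrow> 'v \<Rightarrow> 'v \<Rightarrow> bool" where
  "fCarrier M x = Gr {[a] |a. a \<in> carrier M} [x]"

definition fZero :: "('r, 'v) module \<Rightarrow> 'v \<Rightarrow> 'v \<Rightarrow> bool" where
  "fZero M x = Gr {[\<zero>\<^bsub>M\<^esub>]} [x]"

definition fAdd :: "('r, 'v) module \<Rightarrow> 'v \<Rightarrow> 'v \<Rightarrow> 'v \<Rightarrow> 'v \<Rightarrow> bool" where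
  "fAdd M x y z = Gr {[a, b, a \<oplus>\<^bsub>M\<^esub> b] |a b. a \<in> carrier M \<and> b \<in> carrier M} [x, y, z]"

definition fMinus :: "('r, 'v) module \<Rightarrow> 'v \<Rightarrow> 'v \<Rightarrow> 'v \<Rightarrow> bool" where
  "fMinus M x y = Gr {[a, \<ominus>\<^bsub>M\<^esub> a] |a. a \<in> carrier M} [x, y]"

definition fSmult :: "('r, 'v) module \<Rightarrow> 'r \<Rightarrow> 'v \<Rightarrow> 'v \<Rightarrow> 'v \<Rightarrow> bool" where
  "fSmult M r x y = Gr {[a, r \<odot>\<^bsub>M\<^esub> a] |a. a \<in> carrier M} [x, y]"

definition fSubmodule :: "'r ring \<Rightarrow> ('r, 'v) module \<Rightarrow> 'v \<Rightarrow> 'v \<Rightarrow> bool" where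
  "fSubmodule R M A =
     ((\<^bold>\<forall>x. x \<^bold>\<in> A \<^bold>\<longrightarrow> fCarrier M x) \<^bold>\<and>
      (\<^bold>\<forall>x. fZero M x \<^bold>\<longrightarrow> x \<^bold>\<in> A) \<^bold>\<and>
      (\<^bold>\<forall>x. \<^bold>\<forall>y. \<^bold>\<forall>z. (x \<^bold>\<in> A \<^bold>\<and> y \<^bold>\<in> A \<^bold>\<and> fAdd M x y z) \<^bold>\<longrightarrow> z \<^bold>\<in> A) \<^bold>\<and>
      (\<^bold>\<forall>x. \<^bold>\<forall>y. (x \<^bold>\<in> A \<^bold>\<and> fMinus M x y) \<^bold>\<longrightarrow> y \<^bold>\<in> A) \<^bold>\<and>
      fAll (carrier R) (\<lambda>r. \<^bold>\<forall>x. \<^bold>\<forall>y. (x \<^bold>\<in> A \<^bold>\<and> fSmult M r x y) \<^bold>\<longrightarrow> y \<^bold>\<in> A))"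

definition fCoset :: "('r, 'v) module \<Rightarrow> 'v \<Rightarrow> 'v \<Rightarrow> 'v \<Rightarrow> 'v \<Rightarrow> bool" where
  \<comment> \<open>\<open>X\<close> is the coset \<open>A + x\<close>\<close>
  "fCoset M A x X = (\<^bold>\<forall>z. z \<^bold>\<in> X \<^bold>\<longleftrightarrow> (\<^bold>\<exists>a. a \<^bold>\<in> A \<^bold>\<and> fAdd M a x z))"

definition fQuotientIso ::
  "'r ring \<Rightarrow> ('r, 'v) module \<Rightarrow> 'v \<Rightarrow> 'v \<Rightarrow> ('r, 'v) module \<Rightarrow> 'v \<Rightarrow> bool" where
  \<comment> \<open>the quotient \<open>B / A\<close> of submodules of \<open>M\<close> is isomorphic to \<open>N\<close>\<close>
  "fQuotientIso R M B A N = (\<^bold>\<exists>h.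
     fFun (\<lambda>X. \<^bold>\<exists>x. x \<^bold>\<in> B \<^bold>\<and> fCoset M A x X) h \<^bold>\<and>
     (\<^bold>\<forall>X. \<^bold>\<forall>u. fMaps h X u \<^bold>\<longrightarrow> fCarrier N u) \<^bold>\<and>
     (\<^bold>\<forall>X. \<^bold>\<forall>X'. \<^bold>\<forall>u. (fMaps h X u \<^bold>\<and> fMaps h X' u) \<^bold>\<longrightarrow> X \<^bold>= X') \<^bold>\<and>
     (\<^bold>\<forall>u. fCarrier N u \<^bold>\<longrightarrow> (\<^bold>\<exists>X. fMaps h X u)) \<^bold>\<and>
     (\<^bold>\<forall>x. \<^bold>\<forall>y. \<^bold>\<forall>z. \<^bold>\<forall>X. \<^bold>\<forall>Y. \<^bold>\<forall>Z. \<^bold>\<forall>u. \<^bold>\<forall>v. \<^bold>\<forall>w.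
        (x \<^bold>\<in> B \<^bold>\<and> y \<^bold>\<in> B \<^bold>\<and> fAdd M x y z \<^bold>\<and>
         fCoset M A x X \<^bold>\<and> fCoset M A y Y \<^bold>\<and> fCoset M A z Z \<^bold>\<and>
         fMaps h X u \<^bold>\<and> fMaps h Y v \<^bold>\<and> fMaps h Z w) \<^bold>\<longrightarrow> fAdd N u v w) \<^bold>\<and>
     fAll (carrier R) (\<lambda>r. \<^bold>\<forall>x. \<^bold>\<forall>y. \<^bold>\<forall>X. \<^bold>\<forall>Y. \<^bold>\<forall>u. \<^bold>\<forall>v.
        (x \<^bold>\<in> B \<^bold>\<and> fSmult M r x y \<^bold>\<and> fCoset M A x X \<^bold>\<and> fCoset M A y Y \<^bold>\<and>
         fMaps h X u \<^bold>\<and> fMaps h Y v) \<^bold>\<longrightarrow> fSmult N r u v))"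

text \<open>
  The translation of \<open>filtration\<close> into the forcing language; \<open>C\<close> denotes the same class of
  modules in the extension as in the ground model.
\<close>

definition fFiltration ::
  "'r ring \<Rightarrow> ('r, 'v) module set \<Rightarrow> ('r, 'v) module \<Rightarrow> 'v \<Rightarrow> 'v \<Rightarrow> 'v \<Rightarrow> bool" where
  "fFiltration R C M \<eta> F =
     (fOrd \<eta> \<^bold>\<and> (\<^bold>\<not> (fEmpty \<eta>)) \<^bold>\<and> fFun (\<lambda>i. i \<^bold>\<in> \<eta>) F \<^bold>\<and>
      (\<^bold>\<forall>i. \<^bold>\<forall>A. fMaps F i A \<^bold>\<longrightarrow> fSubmodule R M A) \<^bold>\<and>
      (\<^bold>\<forall>i. \<^bold>\<forall>A. (fMaps F i A \<^bold>\<and> fEmpty i) \<^bold>\<longrightarrow> (\<^bold>\<forall>x. x \<^bold>\<in> A \<^bold>\<longleftrightarrow> fZero M x)) \<^bold>\<and>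
      (\<^bold>\<forall>i. \<^bold>\<forall>j. \<^bold>\<forall>A. \<^bold>\<forall>B. (i \<^bold>\<in> j \<^bold>\<and> fMaps F i A \<^bold>\<and> fMaps F j B) \<^bold>\<longrightarrow> A \<^bold>\<subseteq> B) \<^bold>\<and>
      (\<^bold>\<forall>j. \<^bold>\<forall>B. (fMaps F j B \<^bold>\<and> fLimit j) \<^bold>\<longrightarrow>
         (\<^bold>\<forall>x. x \<^bold>\<in> B \<^bold>\<longleftrightarrow> (\<^bold>\<exists>i. \<^bold>\<exists>A. i \<^bold>\<in> j \<^bold>\<and> fMaps F i A \<^bold>\<and> x \<^bold>\<in> A))) \<^bold>\<and>
      (\<^bold>\<forall>x. fCarrier M x \<^bold>\<longleftrightarrow> (\<^bold>\<exists>i. \<^bold>\<exists>A. fMaps F i A \<^bold>\<and> x \<^bold>\<in> A)) \<^bold>\<and>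
      (\<^bold>\<forall>i. \<^bold>\<forall>j. \<^bold>\<forall>A. \<^bold>\<forall>B. (fSucc i j \<^bold>\<and> fMaps F i A \<^bold>\<and> fMaps F j B) \<^bold>\<longrightarrow>
         fEx C (\<lambda>N. fQuotientIso R M B A N)))"

definition forces_filtered :: "'r ring \<Rightarrow> ('r, 'v) module set \<Rightarrow> ('r, 'v) module \<Rightarrow> bool" where
  "forces_filtered R C M \<longleftrightarrow> (\<forall>p\<in>P. (\<^bold>\<exists>\<eta>. \<^bold>\<exists>F. fFiltration R C M \<eta> F) p)"

end

definition potentially_filtered ::
  "'r ring \<Rightarrow> ('r, 'v::zfc) module set \<Rightarrow> ('r, 'v) module \<Rightarrow> bool" where
  "potentially_filtered R C M \<longleftrightarrow>
     (\<exists>P le. forcing_poset P le \<and> forcing_poset.sigma_closed P le \<and>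
        forcing_poset.forces_filtered P le R C M)"

text \<open>The class \<open>{\<int>}\<close>, with all isomorphic copies of \<open>\<int>\<close> in the universe.\<close>

definition int_class :: "(int, 'v::zfc) module set" where
  "int_class = {N. vmodule \<Z> N \<and> mod_iso \<Z> (regular_module \<Z>) N}"

definition potentially_free :: "(int, 'v::zfc) module \<Rightarrow> bool" where
  "potentially_free M \<longleftrightarrow> potentially_filtered \<Z> int_class M"


section \<open>Abstract elementary classes\<close>

definition is_union ::
  "('f, 'p) lang \<Rightarrow> 'i set \<Rightarrow> ('i \<Rightarrow> ('f, 'p, 'v::zfc) fo_struct) \<Rightarrow> ('f, 'p, 'v) fo_struct \<Rightarrow> bool" where
  "is_union L I M U \<longleftrightarrow> univ U = (\<Union>i\<in>I. univ (M i)) \<and> (\<forall>i\<in>I. substructure L (M i) U)"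

definition continuous_chain ::
  "('f, 'p) lang \<Rightarrow> ('f, 'p, 'v::zfc) fo_struct set \<Rightarrow>
   (('f, 'p, 'v) fo_struct \<Rightarrow> ('f, 'p, 'v) fo_struct \<Rightarrow> bool) \<Rightarrow>
   'v \<Rightarrow> ('v \<Rightarrow> ('f, 'p, 'v) fo_struct) \<Rightarrow> bool" where
  "continuous_chain L K prec \<delta> M \<longleftrightarrow> vord \<delta> \<and> elts \<delta> \<noteq> {} \<and>
     (\<forall>i\<in>elts \<delta>. M i \<in> K) \<and>
     (\<forall>j\<in>elts \<delta>. \<forall>i\<in>elts j. prec (M i) (M j)) \<and>
     (\<forall>j\<in>elts \<delta>. vlimit j \<longrightarrow> is_union L (elts j) M (M j))"

definition LS_property ::
  "('f, 'p, 'v::zfc) fo_struct set \<Rightarrow> (('f, 'p, 'v) fo_struct \<Rightarrow> ('f, 'p, 'v) fo_struct \<Rightarrow> bool) \<Rightarrow>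
   'v rel \<Rightarrow> bool" where
  "LS_property K prec \<kappa> \<longleftrightarrow>
     (\<forall>B\<in>K. \<forall>A\<subseteq>univ B. \<exists>A'\<in>K. A \<subseteq> univ A' \<and> prec A' B \<and> |univ A'| \<le>o |A| +c \<kappa>)"

text \<open>
  Being a partial order is part of what it means for \<open>K\<close> to be ordered by \<open>prec\<close>; only the
  restriction of \<open>prec\<close> to \<open>K\<close> matters.
\<close>

definition AEC ::
  "('f, 'p) lang \<Rightarrow> ('f, 'p, 'v::zfc) fo_struct set \<Rightarrow>
   (('f, 'p, 'v) fo_struct \<Rightarrow> ('f, 'p, 'v) fo_struct \<Rightarrow> bool) \<Rightarrow> bool" where
  "AEC L K prec \<longleftrightarrow>
     (\<forall>M\<in>K. is_struct L M) \<and>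
     partial_order_on K {(M, N). M \<in> K \<and> N \<in> K \<and> prec M N} \<and>
     (\<forall>M\<in>K. \<forall>N h. is_struct L N \<and> struct_iso L h M N \<longrightarrow> N \<in> K) \<and>
     (\<forall>M\<in>K. \<forall>N\<in>K. \<forall>M' N' h. prec M N \<and> is_struct L M' \<and> is_struct L N' \<and>
        struct_iso L h N N' \<and> struct_iso L h M M' \<longrightarrow> prec M' N') \<and>
     (\<forall>M\<in>K. \<forall>N\<in>K. prec M N \<longrightarrow> substructure L M N) \<and>
     (\<forall>M0\<in>K. \<forall>M1\<in>K. \<forall>M2\<in>K.
        substructure L M0 M1 \<and> prec M0 M2 \<and> prec M1 M2 \<longrightarrow> prec M0 M1) \<and>
     (\<forall>\<delta> M. continuous_chain L K prec \<delta> M \<longrightarrow>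
        (\<exists>U\<in>K. is_union L (elts \<delta>) M U \<and> (\<forall>i\<in>elts \<delta>. prec (M i) U) \<and>
           (\<forall>N\<in>K. (\<forall>i\<in>elts \<delta>. prec (M i) N) \<longrightarrow> prec U N))) \<and>
     (\<exists>\<kappa>. vcardinal \<kappa> \<and> LS_property K prec \<kappa>)"

definition LS_number ::
  "('f, 'p, 'v::zfc) fo_struct set \<Rightarrow> (('f, 'p, 'v) fo_struct \<Rightarrow> ('f, 'p, 'v) fo_struct \<Rightarrow> bool) \<Rightarrow>
   'v rel \<Rightarrow> bool" where
  "LS_number K prec \<kappa> \<longleftrightarrow> vcardinal \<kappa> \<and> LS_property K prec \<kappa> \<and>
     (\<forall>\<mu> :: 'v rel. vcardinal \<mu> \<and> LS_property K prec \<mu> \<longrightarrow> \<kappa> \<le>o \<mu>)"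


section \<open>Modules as first-order structures\<close>

datatype 'r mod_sym = Zero | Plus | Scal 'r

definition mod_lang :: "'r ring \<Rightarrow> ('r mod_sym, unit) lang" where
  "mod_lang R =
     \<lparr>funs = {Zero, Plus} \<union> Scal ` carrier R,
      farity = case_mod_sym 0 2 (\<lambda>_. 1),
      rels = {}, rarity = \<lambda>_. 0\<rparr>"

definition module_of :: "('r mod_sym, unit, 'v::zfc) fo_struct \<Rightarrow> ('r, 'v) module" where
  "module_of A =
     \<lparr>carrier = univ A, mult = undefined, one = undefined, zero = fn A Zero [],
      add = \<lambda>x y. fn A Plus [x, y], smult = \<lambda>r x. fn A (Scal r) [x]\<rparr>"

definition mod_structs :: "'r ring \<Rightarrow> ('r mod_sym, unit, 'v::zfc) fo_struct set" where
  "mod_structs R = {A. is_struct (mod_lang R) A \<and> lmodule R (module_of A)}"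

definition pure_sub ::
  "'r ring \<Rightarrow> ('r mod_sym, unit, 'v::zfc) fo_struct \<Rightarrow> ('r mod_sym, unit, 'v) fo_struct \<Rightarrow> bool" where
  "pure_sub R A B \<longleftrightarrow> substructure (mod_lang R) A B \<and> pure_in R (univ A) (module_of B)"

end

theory Submission
  imports Defs "HOL-Library.Countable_Set_Type"
begin

text \<open>
  Call \<open>M\<close> good if club many countable subsets \<open>x\<close> are such that for all countable \<open>y \<supseteq> x\<close> both \<open>\<langle>y\<rangle>\<close>
  and \<open>\<langle>y\<rangle> / \<langle>x\<rangle>\<close> are filtered. This is equivalent to being \<open>\<sigma>\<close>-closed potentially filtered. If a
  filtration is forced, a descending sequence of conditions can decide enough of it, by countable
  presentability of the members of \<open>C\<close>, to filter \<open>\<langle>y\<rangle>\<close> and \<open>\<langle>y\<rangle> / \<langle>x\<rangle>\<close> for any \<open>x\<close> closed under certain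
  finitary operations. Conversely, for good \<open>M\<close> the filtrations of the groups \<open>\<langle>x\<rangle>\<close>, \<open>x\<close> in the club,
  ordered by end extension, form a \<open>\<sigma>\<close>-closed poset adding a filtration of \<open>M\<close>. This poset also works for
  submodules of \<open>M\<close> because \<open>C\<close> is quotient-hereditary, so not being potentially filtered is preserved
  upwards. If \<open>M\<close> is not good, the set of bad \<open>x\<close> is stationary, and by reflection it stays so in some
  submodule of size at most \<open>\<aleph>\<^sub>1\<close>, which is therefore not good either; a pure closure of it gives the
  Loewenheim--Skolem property. For \<open>\<int>\<close>, the Baer--Specker group is not good, but its countable subgroups are free.
\<close>

text \<open>Two obstacles shape the proof. First, being potentially filtered quantifies over all
  posets, so reflection cannot act on it directly; goodness is a ground model statement about
  countable sets, to which clubs and stationary sets apply. Second, \<open>R\<close> may have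
  aleph_1 elements: the span of a countable set may be uncountable, and a descending sequence of
  length omega cannot decide all of it. What it can decide is a countable set \<open>x\<close> of
  generators and, at each index where the filtration grows on \<open>x\<close>, countably many
  generators and relations of the new factor; these determine the trace on the whole span of
  \<open>x\<close>. The bound on \<open>R\<close> is used in the reflection: the reflecting
  structure contains \<open>omega1\<close>, so a listing of \<open>R\<close> by countable ordinals
  closes it under all scalars. It also carries, for each bad set, an enumeration of a countable
  witness of badness, so that badness survives in the submodule. No generic filters occur: forcing
  is a relation between conditions and predicates, and every argument about the extension is a
  density argument.\<close>

abbreviation (input) iff_in (infixr "<->" 25) where "A <-> B == A = (B :: bool)"
abbreviation (input) add_in ("(_ +[_]/ _)" [65, 0, 66] 65) where "x +[M] y == x \<oplus>\<^bsub>M\<^esub> y"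
abbreviation (input) smult_in ("(_ *[_]/ _)" [71, 0, 70] 70) where "r *[M] x == r \<odot>\<^bsub>M\<^esub> x"
abbreviation (input) zero_in ("0[_]") where "0[M] == \<zero>\<^bsub>M\<^esub>"
notation (input) subset_eq (infix "=<" 50) and subset (infix "<<" 50)

section \<open>Sets and ordinals of the universe\<close>

lemma elts_inject: "elts x = elts y <-> x = y"
 using extensionality by blast

lemma small_elts [simp]: "small (elts x)"
 by (simp add: small_def)

lemma elts_vset: "small A==>elts (vset A) = A"
 unfolding small_def vset_def by (auto simp: elts_inject)

lemma vset_elts [simp]: "vset (elts x) = x"
 by (simp add: vset_def elts_inject)

lemma vset_inject: "small A==>small B==>vset A = vset B <-> A = B"
 by (metis elts_vset)

lemma small_subset: "small B==>A =< B==>small A"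
 using separation unfolding small_def by (metis imageE rangeI)

lemma small_image:
 fixes f :: "'v::zfc => 'v"
 assumes "small A"
 shows "small (f ` A)"
proof -
 obtain x where "A = elts x"
 using assms unfolding small_def by auto
 thus ?thesis
 using replacement[of f x] by (metis small_elts)
qed

text \<open>The axiom of union speaks of elements of the universe, so the family is first replaced
  by the set of its codes \<open>vset (f x)\<close>.\<close>

lemma small_UN:
 fixes f :: "'v::zfc => 'v set"
 assumes "small A" and "!!x. x:A==>small (f x)"
 shows "small (\<Union>x\<in>A. f x)"
proof -
 define z where "z = vset ((%x. vset (f x)) ` A)"
 have "elts z = (%x. vset (f x)) ` A"
 using assms by (simp add: z_def elts_vset small_image)
 hence "(\<Union>y\<in>elts z. elts y) = (\<Union>x\<in>A. f x)"
 using assms by (simp add: elts_vset)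
 thus ?thesis
 using union[of z] unfolding small_def by (metis rangeI)
qed

text \<open>Subsets of \<open>A\<close> are HOL sets and not elements of the universe; what the
  power axiom collects are their codes.\<close>

lemma small_Pow:
 assumes "small A"
 shows "small (vset ` Pow A)"
proof -
 obtain x where x: "A = elts x"
 using assms unfolding small_def by auto
 have "z:vset ` Pow A" if "elts z =< A" for z
 using that image_eqI[of z vset "elts z" "Pow A"] by simp
 moreover have "elts z =< A" if "z:vset ` Pow A" for z
 using that assms elts_vset small_subset by blast
 ultimately have "vset ` Pow A = {z. elts z =< elts x}"
 using x by blast
 thus ?thesis
 using zfc_class.power[of x] unfolding small_def by (metis rangeI)
qed

lemma vset_inj_on_Pow: "small A==>inj_on vset (Pow A)"
 by (auto simp: inj_on_def vset_inject small_subset)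

lemma mem_not_refl [simp]: "x \<notin> elts x"
 using wf_not_refl[OF foundation, of x] by simp

lemma elts_induct [case_names step]: "(!!x. (!!y. y:elts x==>P y)==>P x)==>P x"
 by (rule wf_induct_rule[OF foundation, of P]) simp

lemma mem_not_sym: "x:elts y==>y \<notin> elts x"
 using wf_not_sym[OF foundation, of x y] by simp

lemma small_empty [simp]: "small {}"
 by (rule small_subset[OF small_elts]) simp

text \<open>The numerals \<open>s n\<close> inside the set given by infinity are pairwise distinct,
  so every sequence factors through them and its range is a set by replacement.\<close>

lemma small_nat: "small (range (f :: nat => 'v::zfc))"
proof -
 obtain w :: 'v and z where w: "z:elts w" "elts z = {}"
  "!!x. x:elts w==>EX y:elts w. elts y = insert x (elts x)"
 using infinity by metis
 define sc where "sc x = vset (insert x (elts x))" for x :: 'v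
 define s where "s n = (sc ^^ n) z" for n
 have s: "s n:elts w & elts (s n) = s ` {..<n}" for n
 proof (induction n)
 case 0
 thus ?case using w by (simp add: s_def)
 next
 case (Suc n)
 obtain y where y: "y:elts w" "elts y = insert (s n) (elts (s n))"
  using w(3) Suc by blast
 hence "s (Suc n) = y"
  unfolding s_def sc_def using vset_elts[of y] by simp
 thus ?case using y Suc by (auto simp: lessThan_Suc)
 qed
 have "inj s"
 proof (rule linorder_injI)
 fix m n :: nat assume "m < n"
 hence "s m:elts (s n)" using s by auto
 thus "s m ~= s n" by auto
 qed
 hence "range f = (f \<circ> inv_into UNIV s) ` range s"
 by (simp add: image_image inv_f_f)
 moreover have "small (range s)"
 by (rule small_subset[OF small_elts[of w]]) (use s in auto)
 ultimately show ?thesis by (simp add: small_image)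
qed

lemma countable_small: "countable A==>small (A :: 'v::zfc set)"
proof (cases "A = {}")
 case False
 assume "countable A"
 hence "A =< range (from_nat_into A)"
 using subset_range_from_nat_into by blast
 thus ?thesis
 using small_subset small_nat by blast
qed simp

lemma finite_small: "finite A==>small (A :: 'v::zfc set)"
 by (simp add: countable_small countable_finite)

lemma small_insert: "small A==>small (insert x (A :: 'v::zfc set))"
 using small_UN[of "{vset A, vset {x}}" elts] by (auto simp: finite_small elts_vset)

lemma small_Un: "small A==>small B==>small (A Un (B :: 'v::zfc set))"
 using small_UN[of "{vset A, vset B}" elts] by (auto simp: finite_small elts_vset)

lemma elts_vset_finite: "finite A==>elts (vset A) = A"
 by (simp add: elts_vset finite_small)

lemma vpair_inject [simp]: "vpair a b = vpair c d <-> a = c & b = d"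
proof
 assume "vpair a b = vpair c d"
 hence "elts (vpair a b) = elts (vpair c d)" by simp
 hence "{vset {a}, vset {a, b}} = {vset {c}, vset {c, d}}"
 by (simp add: vpair_def elts_vset_finite)
 hence "{{a}, {a, b}} = {{c}, {c, d}}"
 by (auto simp: doubleton_eq_iff vset_inject finite_small)
 thus "a = c & b = d"
 by (auto simp: doubleton_eq_iff)
qed simp

lemma small_image2:
 fixes f :: "'v::zfc => 'v => 'v"
 shows "small A==>small B==>small ((%(x, y). f x y) ` (A \<times> B))"
proof -
 assume "small A" "small B"
 hence "small (\<Union>x\<in>A. f x ` B)"
 by (intro small_UN small_image)
 moreover have "(\<Union>x\<in>A. f x ` B) = (%(x, y). f x y) ` (A \<times> B)"
 by auto
 ultimately show ?thesis by simp
qed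

lemma vord_mem: "vord x==>y:elts x==>vord y"
 unfolding vord_def by blast

lemma vord_trans: "vord x==>y:elts x==>z:elts y==>z:elts x"
 unfolding vord_def by blast

text \<open>Double membership induction: if all three alternatives failed, the induction hypotheses
  and transitivity would make the two ordinals subsets of each other, hence equal.\<close>

lemma vord_linear: "vord x==>vord y==>x:elts y | x = y | y:elts x"
proof (induction x arbitrary: y rule: elts_induct)
 case (step x)
 note outer = step
 from \<open>vord y\<close> show ?case
 proof (induction y rule: elts_induct)
 case (step y)
 show ?case
 proof (rule ccontr)
  assume neg: "~ ?thesis"
  have "elts x =< elts y"
  using outer step.prems neg by (metis subsetI vord_mem vord_trans)
  moreover have "elts y =< elts x"
  using outer step neg by (metis subsetI vord_mem vord_trans)
  ultimately show False
  using neg elts_inject by blast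
 qed
 qed
qed

lemma vord_least:
 assumes "A ~= {}" "!!x. x:A==>vord x"
 obtains m where "m:A" "!!x. x:A==>x = m | m:elts x"
proof -
 obtain m where m: "m:A" "!!y. y:elts m==>y \<notin> A"
 using wfE_min[OF foundation] assms(1) by (metis (no_types, lifting) all_not_in_conv case_prodI mem_Collect_eq)
 thus ?thesis
 using that[of m] vord_linear assms(2) by blast
qed

lemma vord_vset:
 assumes "small A" "!!x. x:A==>vord x" "!!x. x:A==>elts x =< A"
 shows "vord (vset A)"
 unfolding vord_def elts_vset[OF assms(1)] using assms vord_def by blast

text \<open>Burali-Forti: a set of all ordinals would itself be an ordinal and thus its own
  element.\<close>

lemma not_small_vord: "~ small (Collect vord)"
proof
 assume s: "small (Collect (vord :: 'a => bool))"
 have "vord (vset (Collect (vord :: 'a => bool)))"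
 by (rule vord_vset) (use s vord_mem in auto)
 thus False
 using elts_vset[OF s] mem_not_refl by blast
qed

definition vsuc :: "'v::zfc => 'v" where
 "vsuc i = vset (insert i (elts i))"

lemma elts_vsuc [simp]: "elts (vsuc i) = insert i (elts i)"
 by (simp add: vsuc_def elts_vset small_insert)

lemma vsucc_iff: "vsucc i j <-> j = vsuc i"
 by (auto simp: vsucc_def simp flip: elts_inject)

lemma vord_vsuc: "vord i==>vord (vsuc i)"
 by (auto simp: vord_def)

lemma vord_cases:
 assumes "vord i"
 obtains (zero) "elts i = {}" | (succ) j where "vord j" "i = vsuc j" | (limit) "vlimit i"
proof (cases "elts i = {} | vlimit i")
 case False
 then obtain j where j: "j:elts i" "!!k. k:elts i==>j \<notin> elts k"
 using assms unfolding vlimit_def by auto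
 have "elts i = insert j (elts j)"
 proof (intro equalityI subsetI)
 fix k assume "k:elts i"
 thus "k:insert j (elts j)"
  using j vord_linear[of j k] vord_mem[OF assms] by auto
 qed (use j vord_trans[OF assms] in auto)
 hence "i = vsuc j" by (simp flip: elts_inject)
 thus ?thesis using succ j assms vord_mem by blast
qed (use zero limit in auto)

lemma vord_induct [consumes 1, case_names zero succ limit]:
 assumes "vord i"
 and "!!i. vord i==>elts i = {}==>P i"
 and "!!i. vord i==>P i==>P (vsuc i)"
 and "!!i. vlimit i==>(!!j. j:elts i==>P j)==>P i"
 shows "P i"
 using assms(1)
proof (induction i rule: elts_induct)
 case (step i)
 from \<open>vord i\<close> show ?case
 proof (cases rule: vord_cases)
 case zero
 thus ?thesis using assms(2) step by blast
 next
 case (succ j)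
 thus ?thesis using assms(3) step by simp
 next
 case limit
 thus ?thesis using assms(4) step vord_mem by blast
 qed
qed

section \<open>Submodules and subquotients\<close>

text \<open>The locale \<open>lmodule\<close> leaves the record type of the ring open, whereas spans need \<open>'r ring\<close>.\<close>

locale lmod = lmodule R M
 for R :: "'r ring" (structure) and M :: "('r, 'm) module" (structure)
begin

lemma zero_smult:
 assumes x: "x:carrier M"
 shows "0[R] *[M] x = 0[M]"
proof -
 have "0[R] *[M] x +[M] 0[R] *[M] x = 0[R] *[M] x"
 using smult_l_distr[of "0[R]" "0[R]" x] x by simp
 thus ?thesis
 using smult_closed[of "0[R]" x] x by simp
qed

text \<open>Through this identity closure under negatives follows from closure under
  scalars.\<close>

lemma minus_one_smult:
 assumes x: "x:carrier M"
 shows "(\<ominus>\<^bsub>R\<^esub> \<one>\<^bsub>R\<^esub>) *[M] x = \<ominus>\<^bsub>M\<^esub> x"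
proof -
 have "(\<ominus>\<^bsub>R\<^esub> \<one>\<^bsub>R\<^esub>) *[M] x +[M] \<one>\<^bsub>R\<^esub> *[M] x = 0[M]"
 using smult_l_distr[of "\<ominus>\<^bsub>R\<^esub> \<one>\<^bsub>R\<^esub>" "\<one>\<^bsub>R\<^esub>" x] x by (simp add: R.l_neg zero_smult)
 thus ?thesis
 using x smult_closed[of "\<ominus>\<^bsub>R\<^esub> \<one>\<^bsub>R\<^esub>" x] by (simp add: smult_one M.minus_equality)
qed

lemma smult_zero:
 assumes r: "r:carrier R"
 shows "r *[M] 0[M] = 0[M]"
proof -
 have "r *[M] 0[M] +[M] r *[M] 0[M] = r *[M] 0[M]"
 using smult_r_distr[of r "0[M]" "0[M]"] r by simp
 thus ?thesis
 using smult_closed[of r "0[M]"] r by simp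
qed

lemma submodule_iff:
 "submodule U R M <-> U =< carrier M & 0[M]:U & (ALL x:U. ALL y:U. x +[M] y:U) &
  (ALL r:carrier R. ALL x:U. r *[M] x:U)" (is "_ <-> ?r")
proof
 assume "submodule U R M"
 then interpret submodule U R M .
 show ?r using subset one_closed m_closed smult_closed by simp
next
 assume r: ?r
 hence "\<ominus>\<^bsub>M\<^esub> x:U" if "x:U" for x
 using minus_one_smult[of x] that by (metis R.add.inv_closed R.one_closed subsetD)
 thus "submodule U R M"
 using r by unfold_locales (auto simp: a_inv_def)
qed

lemma submoduleD:
 assumes "submodule U R M"
 shows "U =< carrier M" "0[M]:U" "x:U==>y:U==>x +[M] y:U"
 "r:carrier R==>x:U==>r *[M] x:U" "x:U==>\<ominus>\<^bsub>M\<^esub> x:U"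
 "x:U==>y:U==>x \<ominus>\<^bsub>M\<^esub> y:U"
proof -
 have "U =< carrier M & 0[M]:U & (ALL x:U. ALL y:U. x +[M] y:U) &
  (ALL r:carrier R. ALL x:U. r *[M] x:U)"
 using assms unfolding submodule_iff .
 thus *: "U =< carrier M" "0[M]:U" "!!x y. x:U==>y:U==>x +[M] y:U"
 "!!x. r:carrier R==>x:U==>r *[M] x:U"
 by simp_all
 show **: "\<ominus>\<^bsub>M\<^esub> x:U" if "x:U" for x
 using subgroup.m_inv_closed[OF submodule.axioms(1)[OF assms] that] unfolding a_inv_def .
 show "x:U==>y:U==>x \<ominus>\<^bsub>M\<^esub> y:U"
 using * ** by (simp add: a_minus_def)
qed

lemma submodule_carrier: "submodule (carrier M) R M"
 by (simp add: submodule_iff smult_closed)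

lemma submodule_zero: "submodule {0[M]} R M"
 by (simp add: submodule_iff smult_zero)

lemma submodule_Int: "submodule U R M==>submodule V R M==>submodule (U Int V) R M"
 by (auto simp: submodule_iff)

lemma submodule_Union_chain:
 assumes "FF ~= {}" "!!A. A:FF==>submodule A R M" "!!A B. A:FF==>B:FF==>A =< B | B =< A"
 shows "submodule (\<Union>FF) R M"
proof -
 note sub = assms(2)[THEN submoduleD(1)] assms(2)[THEN submoduleD(2)] assms(2)[THEN submoduleD(4)]
 have add: "x +[M] y:\<Union>FF" if "x:A" "y:B" "A:FF" "B:FF" for x y A B
 proof (cases "A =< B")
 case True
 thus ?thesis
  using assms(2)[THEN submoduleD(3), of B x y] that by auto
 next
 case False
 thus ?thesis
  using assms(2)[THEN submoduleD(3), of A x y] assms(3)[of A B] that by auto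
 qed
 show ?thesis
 unfolding submodule_iff
 proof (intro conjI ballI)
 show "0[M]:\<Union>FF" using assms(1) sub(2) by auto
 show "r *[M] x:\<Union>FF" if "r:carrier R" "x:\<Union>FF" for r x
  using that sub(3) by blast
 qed (use sub(1) add in auto)
qed

lemma lmod_submodule:
 assumes "submodule U R M"
 shows "lmod R (submodule_of M U)"
proof -
 note U = submoduleD[OF assms]
 have "abelian_group (submodule_of M U)"
 proof (rule abelian_groupI)
 fix x assume x: "x:carrier (submodule_of M U)"
 thus "EX y:carrier (submodule_of M U). y +[submodule_of M U] x = 0[submodule_of M U]"
  using U(1,5) M.l_neg by (auto intro!: bexI[of _ "\<ominus>\<^bsub>M\<^esub> x"])
 qed (use U in \<open>auto simp: M.a_ac subset_iff\<close>)
 thus ?thesis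
 using U by (auto simp: lmod_def lmodule_def lmodule_axioms_def R.ring_axioms subset_iff
  smult_l_distr smult_r_distr smult_assoc smult_one)
qed

lemma submodule_of_iff:
 assumes "submodule U R M"
 shows "submodule V R (submodule_of M U) <-> submodule V R M & V =< U"
 using lmod.submodule_iff[OF lmod_submodule[OF assms], of V] submoduleD(1)[OF assms]
 by (auto simp: submodule_iff)

definition span :: "'m set => 'm set" where
 "span B = mod_span R M B"

lemma span_superset: "B =< span B"
 by (auto simp: span_def mod_span_def)

lemma span_minimal: "submodule U R M==>B =< U==>span B =< U"
 by (auto simp: span_def mod_span_def)

lemma submodule_span:
 assumes "B =< carrier M"
 shows "submodule (span B) R M"
proof -
 have "span B =< carrier M"
 using assms submodule_carrier span_minimal by blast
 thus ?thesis
 using submoduleD unfolding submodule_iff span_def mod_span_def by (auto; blast)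
qed

lemma span_mono: "A =< B==>B =< carrier M==>span A =< span B"
 by (meson order_trans span_minimal span_superset submodule_span)

lemma span_submodule: "submodule U R M==>span U = U"
 by (simp add: span_minimal span_superset subset_antisym)

lemma span_empty: "span {} = {0[M]}"
 using span_minimal[OF submodule_zero, of "{}"] submoduleD(2)[OF submodule_span, of "{}"] by auto

lemma add_diff_cancel: "x:carrier M==>y:carrier M==>(x +[M] y) \<ominus>\<^bsub>M\<^esub> y = x"
 by (simp add: a_minus_def M.a_assoc M.r_neg)

lemma diff_add_cancel: "x:carrier M==>y:carrier M==>(x \<ominus>\<^bsub>M\<^esub> y) +[M] y = x"
 by (simp add: a_minus_def M.a_assoc M.l_neg)

lemma diff_self: "x:carrier M==>x \<ominus>\<^bsub>M\<^esub> x = 0[M]"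
 by (simp add: a_minus_def M.r_neg)

lemma diff_eq_zero: "x:carrier M==>y:carrier M==>x \<ominus>\<^bsub>M\<^esub> y = 0[M] <-> x = y"
 using diff_add_cancel[of x y] diff_self by force

text \<open>Two representations of one element of \<open>G + E\<close> differ by an element of the
  intersection of \<open>G\<close> and \<open>E\<close>; this makes the map in \<open>sq_sum\<close>
  well defined.\<close>

lemma diff_swap:
 assumes "g:carrier M" "e:carrier M" "g':carrier M" "e':carrier M"
 and "g +[M] e = g' +[M] e'"
 shows "e \<ominus>\<^bsub>M\<^esub> e' = g' \<ominus>\<^bsub>M\<^esub> g"
proof -
 have "(\<ominus>\<^bsub>M\<^esub> g +[M] g') +[M] e' = \<ominus>\<^bsub>M\<^esub> g +[M] (g' +[M] e')"
 by (rule M.a_assoc) (use assms in auto)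
 also have "\<dots> = \<ominus>\<^bsub>M\<^esub> g +[M] (g +[M] e)"
 by (simp only: assms(5))
 also have "\<dots> = e"
 using assms(1-4) by (simp add: M.r_neg1)
 finally have "(\<ominus>\<^bsub>M\<^esub> g +[M] g') +[M] e' = e" .
 hence "e \<ominus>\<^bsub>M\<^esub> e' = \<ominus>\<^bsub>M\<^esub> g +[M] g'"
 using assms(1-4) add_diff_cancel[of "\<ominus>\<^bsub>M\<^esub> g +[M] g'" e'] by simp
 thus ?thesis
 using assms(1-4) by (simp add: a_minus_def M.a_comm)
qed

lemma add_interchange:
 assumes "g:carrier M" "e:carrier M" "g':carrier M" "e':carrier M"
 shows "(g +[M] e) +[M] (g' +[M] e') = (g +[M] g') +[M] (e +[M] e')"
 using assms by (simp add: M.a_ac)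

lemma submodule_sum:
 assumes "submodule U R M" "submodule V R M"
 shows "submodule {u +[M] v |u v. u:U & v:V} R M"
proof -
 note U = submoduleD[OF assms(1)] and V = submoduleD[OF assms(2)]
 have "0[M]:{u +[M] v |u v. u:U & v:V}"
 using U(2) V(2) M.l_zero[of "0[M]"] by (metis (mono_tags, lifting) M.zero_closed mem_Collect_eq)
 moreover have "EX u'' v''. (u +[M] v) +[M] (u' +[M] v') = u'' +[M] v'' & u'':U & v'':V"
 if "u:U" "v:V" "u':U" "v':V" for u v u' v'
 using that add_interchange U V by (meson subsetD)
 moreover have "EX u'' v''. r *[M] (u +[M] v) = u'' +[M] v'' & u'':U & v'':V"
 if "u:U" "v:V" "r:carrier R" for u v r
 using that smult_r_distr U V by (meson subsetD)
 ultimately show ?thesis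
 using U(1) V(1) unfolding submodule_iff by blast
qed

lemma span_Un:
 assumes "A =< carrier M" "B =< carrier M"
 shows "span (A Un B) = {u +[M] v |u v. u:span A & v:span B}"
proof
 note A = submodule_span[OF assms(1)] and B = submodule_span[OF assms(2)]
 have "x:{u +[M] v |u v. u:span A & v:span B}" if "x:A Un B" for x
 proof -
 have "x = x +[M] 0[M]" "x = 0[M] +[M] x"
  using that assms by auto
 thus ?thesis
  using that span_superset submoduleD(2)[OF A] submoduleD(2)[OF B] by blast
 qed
 thus "span (A Un B) =< {u +[M] v |u v. u:span A & v:span B}"
 by (intro span_minimal submodule_sum A B) blast
 have AB: "submodule (span (A Un B)) R M"
 by (rule submodule_span) (use assms in auto)
 show "{u +[M] v |u v. u:span A & v:span B} =< span (A Un B)"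
 using submoduleD(3)[OF AB] span_mono[of A "A Un B"] span_mono[of B "A Un B"] assms by blast
qed

lemma span_Union_chain:
 assumes "FF ~= {}" "!!A. A:FF==>A =< carrier M" "!!A B. A:FF==>B:FF==>A =< B | B =< A"
 shows "span (\<Union>FF) = (\<Union>A\<in>FF. span A)"
proof
 have "submodule (\<Union>(span ` FF)) R M"
 proof (rule submodule_Union_chain)
 fix A B assume "A:span ` FF" "B:span ` FF"
 then obtain A' B' where "A':FF" "B':FF" "A = span A'" "B = span B'" by blast
 thus "A =< B | B =< A"
  using assms(3)[of A' B'] span_mono[of A' B'] span_mono[of B' A'] assms(2) by blast
 qed (use assms submodule_span in auto)
 thus "span (\<Union>FF) =< (\<Union>A\<in>FF. span A)"
 by (rule span_minimal) (use span_superset in auto)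
 have "span A =< span (\<Union>FF)" if "A:FF" for A
 by (rule span_mono) (use assms(2) that in auto)
 thus "(\<Union>A\<in>FF. span A) =< span (\<Union>FF)"
 by auto
qed

end

text \<open>Expresses that \<open>B / A\<close> is isomorphic to \<open>N\<close> by a surjection
  with kernel \<open>A\<close>. A quotient has sets of elements of \<open>M\<close> as its elements
  and so another type; with kernels, all members of a filtration stay submodules of one
  \<open>M\<close>.\<close>

definition sq :: "'r ring => ('r, 'm) module => 'm set => 'm set => ('r, 'n) module => bool" where
 "sq R M A B N <-> (EX h. mod_hom R (submodule_of M B) N h & h ` B = carrier N & {x:B. h x = 0[N]} = A)"

lemma mod_hom_submodule_of:
 "mod_hom R (submodule_of M U) N h <->
  (ALL x:U. h x:carrier N) & (ALL x:U. ALL y:U. h (x +[M] y) = h x +[N] h y) &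
  (ALL r:carrier R. ALL x:U. h (r *[M] x) = r *[N] h x)"
 by (simp add: mod_hom_def)

text \<open>The map is considered on a submodule \<open>U\<close> only, so that inclusions of
  submodules, quotient maps of subquotients and isomorphisms between structures are all
  instances.\<close>

locale lmod_hom =
 M: lmod R M + N: lmod R N
 for R :: "'r ring" (structure) and M :: "('r, 'm) module" and N :: "('r, 'n) module" and U and h +
 assumes U: "submodule U R M" and hom: "mod_hom R (submodule_of M U) N h"
begin

lemma hom_closed: "x:U==>h x:carrier N"
 and hom_add: "x:U==>y:U==>h (x +[M] y) = h x +[N] h y"
 and hom_smult: "r:carrier R==>x:U==>h (r *[M] x) = r *[N] h x"
 using hom by (auto simp: mod_hom_submodule_of)

lemma hom_zero: "h 0[M] = 0[N]"
 using hom_add[of "0[M]" "0[M]"] hom_closed[of "0[M]"] M.submoduleD(2)[OF U] by simp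

lemma hom_minus: "x:U==>h (\<ominus>\<^bsub>M\<^esub> x) = \<ominus>\<^bsub>N\<^esub> h x"
 using hom_smult[of "\<ominus>\<^bsub>R\<^esub> \<one>\<^bsub>R\<^esub>" x] M.minus_one_smult[of x] N.minus_one_smult[of "h x"] hom_closed
 M.submoduleD(1)[OF U] by auto

lemma hom_diff: "x:U==>y:U==>h (x \<ominus>\<^bsub>M\<^esub> y) = h x \<ominus>\<^bsub>N\<^esub> h y"
 using hom_add hom_minus M.submoduleD(5)[OF U] by (simp add: a_minus_def)

lemma submodule_preimage: "submodule V R N==>submodule {x:U. h x:V} R M"
 using M.submoduleD[OF U] N.submoduleD[of V] hom_add hom_smult hom_zero
 by (auto simp: M.submodule_iff)

lemma submodule_image:
 assumes "submodule V R M" "V =< U"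
 shows "submodule (h ` V) R N"
proof -
 have "h ` V =< carrier N" "0[N]:h ` V"
 using M.submoduleD(2)[OF assms(1)] assms(2) hom_closed hom_zero image_eqI[of _ h "0[M]" V] by auto
 moreover have "h x +[N] h y:h ` V" if "x:V" "y:V" for x y
 using that M.submoduleD(3)[OF assms(1)] assms(2) hom_add by (metis imageI subsetD)
 moreover have "r *[N] h x:h ` V" if "x:V" "r:carrier R" for x r
 using that M.submoduleD(4)[OF assms(1)] assms(2) hom_smult by (metis imageI subsetD)
 ultimately show ?thesis by (auto simp: N.submodule_iff)
qed

lemma hom_eq_iff: "x:U==>y:U==>h x = h y <-> h (x \<ominus>\<^bsub>M\<^esub> y) = 0[N]"
 using hom_diff N.diff_eq_zero hom_closed by simp

end

context lmod
begin

text \<open>Second isomorphism theorem: \<open>(G + E) / G\<close> is \<open>E / (G Int E)\<close>.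
  It supplies the factors when a filtration of one span is pushed above another span.\<close>

lemma sq_sum:
 assumes sq: "sq R M Z E N" and E: "submodule E R M" and G: "submodule G R M" and N: "lmod R N"
 and Z: "G Int E = Z" and H: "H = {g +[M] e |g e. g:G & e:E}"
 shows "sq R M G H N"
proof -
 obtain h where h: "mod_hom R (submodule_of M E) N h" "h ` E = carrier N" "{x:E. h x = 0[N]} = Z"
 using sq unfolding sq_def by blast
 interpret h: lmod_hom R M N E h
 by (simp add: E N h(1) lmod_axioms lmod_hom_def lmod_hom_axioms_def)
 \<comment> \<open>The value at \<open>g + e\<close> is \<open>h e\<close>; another representation
   changes \<open>e\<close> by an element of \<open>Z\<close>, where \<open>h\<close>
   vanishes.\<close>
 define k where "k x = h (SOME e. e:E & (EX g:G. x = g +[M] e))" for x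
 note E' = submoduleD[OF E] and G' = submoduleD[OF G]
 have k: "k (g +[M] e) = h e" if "g:G" "e:E" for g e
 proof -
 define e' where "e' = (SOME e'. e':E & (EX g':G. g +[M] e = g' +[M] e'))"
 have "e':E & (EX g':G. g +[M] e = g' +[M] e')"
  unfolding e'_def by (rule someI[of _ e]) (use that in blast)
 then obtain g' where g': "e':E" "g':G" "g +[M] e = g' +[M] e'" by blast
 hence "e \<ominus>\<^bsub>M\<^esub> e' = g' \<ominus>\<^bsub>M\<^esub> g"
  using diff_swap[of g e g' e'] that E'(1) G'(1) by auto
 hence "e \<ominus>\<^bsub>M\<^esub> e':Z"
  using Z E'(6)[of e e'] G'(6)[of g' g] that g' by auto
 hence "h e = h e'"
  using h.hom_eq_iff[of e e'] h(3) that(2) g'(1) by blast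
 thus ?thesis by (simp add: k_def e'_def)
 qed
 have "mod_hom R (submodule_of M H) N k"
 unfolding mod_hom_submodule_of
 proof (intro conjI ballI)
 fix x assume "x:H"
 then obtain g e where x: "g:G" "e:E" "x = g +[M] e" using H by blast
 show "k x:carrier N" using x k h.hom_closed by simp
 have gx: "g:carrier M" "e:carrier M" using x E'(1) G'(1) by auto
 show "k (r *[M] x) = r *[N] k x" if "r:carrier R" for r
 proof -
  have "r *[M] x = r *[M] g +[M] r *[M] e"
  using x(3) gx that smult_r_distr by simp
  thus ?thesis
  using k[of "r *[M] g" "r *[M] e"] k[OF x(1,2)] x h.hom_smult[OF that x(2)] E'(4) G'(4) that by simp
 qed
 fix y assume "y:H"
 then obtain g' e' where y: "g':G" "e':E" "y = g' +[M] e'" using H by blast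
 have gy: "g':carrier M" "e':carrier M" using y E'(1) G'(1) by auto
 have "x +[M] y = (g +[M] g') +[M] (e +[M] e')"
  using x y gx gy add_interchange by simp
 thus "k (x +[M] y) = k x +[N] k y"
  using k[of "g +[M] g'" "e +[M] e'"] k[OF x(1,2)] k[OF y(1,2)] x y h.hom_add[OF x(2) y(2)] E'(3) G'(3) by simp
 qed
 moreover have "k ` H = carrier N"
 proof
 show "k ` H =< carrier N" using H k h.hom_closed by auto
 show "carrier N =< k ` H"
 proof
  fix n assume "n:carrier N"
  then obtain e where "e:E" "n = h e" using h(2) by blast
  hence "n = k (0[M] +[M] e)" "0[M] +[M] e:H"
  using k[of "0[M]" e] G'(2) H by auto
  thus "n:k ` H" by auto
 qed
 qed
 moreover have "{x:H. k x = 0[N]} = G"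
 proof (intro equalityI subsetI)
 fix x assume "x:{x:H. k x = 0[N]}"
 then obtain g e where x: "g:G" "e:E" "x = g +[M] e" "h e = 0[N]" using H k by auto
 thus "x:G" using h(3) Z G'(3) by auto
 next
 fix x assume x: "x:G"
 hence xz: "x = x +[M] 0[M]" using G'(1) by auto
 hence "x:H" using x E'(2) H by auto
 moreover have "k x = 0[N]" using k[OF x E'(2)] xz h.hom_zero by simp
 ultimately show "x:{x:H. k x = 0[N]}" by simp
 qed
 ultimately show ?thesis unfolding sq_def by blast
qed

definition coset :: "'m set => 'm => 'm set" where
 "coset A x = (%a. a +[M] x) ` A"

context
 fixes A B
 assumes A: "submodule A R M" and B: "submodule B R M" and AB: "A =< B"
begin

lemmas A' = submoduleD[OF A] and B' = submoduleD[OF B]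

lemma carrier_quotient: "carrier (quotient_module (submodule_of M B) A) = coset A ` B"
 by (auto simp: quotient_module_def A_RCOSETS_def RCOSETS_def r_coset_def coset_def)

lemma coset_eq_iff:
 assumes that: "x:carrier M" "y:carrier M"
 shows "coset A x = coset A y <-> x \<ominus>\<^bsub>M\<^esub> y:A"
proof
 assume "coset A x = coset A y"
 moreover have "x:coset A x"
 using image_eqI[of x "%a. a +[M] x" "0[M]" A] A'(2) that unfolding coset_def by simp
 ultimately obtain a where a: "a:A" "x = a +[M] y" unfolding coset_def by blast
 thus "x \<ominus>\<^bsub>M\<^esub> y:A" using add_diff_cancel A'(1) that by auto
next
 have *: "coset A x =< coset A y" if "x \<ominus>\<^bsub>M\<^esub> y:A" "x:carrier M" "y:carrier M" for x y
 proof
 fix z assume "z:coset A x"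
 then obtain a where a: "a:A" "z = a +[M] x" unfolding coset_def by blast
 hence "z = (a +[M] (x \<ominus>\<^bsub>M\<^esub> y)) +[M] y"
  using that A'(1) diff_add_cancel[of x y] M.a_assoc[of a "x \<ominus>\<^bsub>M\<^esub> y" y] M.minus_closed by auto
 thus "z:coset A y" using A'(3) a that unfolding coset_def by blast
 qed
 assume xy: "x \<ominus>\<^bsub>M\<^esub> y:A"
 have "y \<ominus>\<^bsub>M\<^esub> x = \<ominus>\<^bsub>M\<^esub> (x \<ominus>\<^bsub>M\<^esub> y)"
 using that by (simp add: a_minus_def M.minus_add M.a_comm)
 thus "coset A x = coset A y" using *[of x y] *[of y x] xy that A'(5) by auto
qed

lemma coset_add:
 assumes that: "x:B" "y:B"
 shows "coset A x +[(quotient_module (submodule_of M B) A)] coset A y = coset A (x +[M] y)"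
proof -
 have x: "x:carrier M" "y:carrier M" using that B' by auto
 have "coset A x +[(quotient_module (submodule_of M B) A)] coset A y = {(a +[M] x) +[M] (b +[M] y) |a b. a:A & b:A}"
 by (auto simp: quotient_module_def set_add_def set_mult_def coset_def)
 also have "\<dots> = {(a +[M] b) +[M] (x +[M] y) |a b. a:A & b:A}"
 proof -
 have "(a +[M] x) +[M] (b +[M] y) = (a +[M] b) +[M] (x +[M] y)" if "a:A" "b:A" for a b
  using add_interchange[of a x b y] x that A'(1) by auto
 thus ?thesis by (metis (no_types, lifting))
 qed
 also have "\<dots> = coset A (x +[M] y)"
 proof (intro equalityI subsetI)
 fix z assume "z:coset A (x +[M] y)"
 then obtain a where "a:A" "z = (a +[M] 0[M]) +[M] (x +[M] y)"
  using A'(1) unfolding coset_def by auto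
 thus "z:{(a +[M] b) +[M] (x +[M] y) |a b. a:A & b:A}" using A'(2) by blast
 qed (use A'(3) in \<open>auto simp: coset_def\<close>)
 finally show ?thesis .
qed

lemma coset_smult:
 assumes that: "x:B" "r:carrier R"
 shows "r *[(quotient_module (submodule_of M B) A)] coset A x = coset A (r *[M] x)"
proof -
 have x: "x:carrier M" using that B' by auto
 have "r *[(quotient_module (submodule_of M B) A)] coset A x = {(r *[M] (a +[M] x)) +[M] b |a b. a:A & b:A}"
 by (auto simp: quotient_module_def set_add_def set_mult_def coset_def)
 also have "\<dots> = {(r *[M] a +[M] b) +[M] (r *[M] x) |a b. a:A & b:A}"
 proof -
 have "(r *[M] (a +[M] x)) +[M] b = (r *[M] a +[M] b) +[M] (r *[M] x)" if "a:A" "b:A" for a b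
 proof -
  have "a:carrier M" "b:carrier M" using that A'(1) by auto
  thus ?thesis
  using x \<open>r:carrier R\<close> smult_closed by (simp add: smult_r_distr M.a_ac)
 qed
 thus ?thesis by (metis (no_types, lifting))
 qed
 also have "\<dots> = coset A (r *[M] x)"
 proof (intro equalityI subsetI)
 fix z assume "z:coset A (r *[M] x)"
 then obtain a where a: "a:A" "z = a +[M] (r *[M] x)"
  unfolding coset_def by auto
 hence "z = (r *[M] 0[M] +[M] a) +[M] (r *[M] x)"
  using A'(1) that(2) by (auto simp: smult_zero)
 thus "z:{(r *[M] a +[M] b) +[M] (r *[M] x) |a b. a:A & b:A}" using A'(2) a(1) by blast
 qed (use A'(3,4) that(2) in \<open>auto simp: coset_def\<close>)
 finally show ?thesis .
qed

text \<open>First isomorphism theorem: compose with the quotient map in one direction, factor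
  through it in the other.\<close>

lemma quotient_iso_iff_sq:
 assumes N: "lmod R N"
 shows "mod_iso R (quotient_module (submodule_of M B) A) N <-> sq R M A B N"
proof -
 interpret N: lmod R N by (rule N)
 let ?Q = "quotient_module (submodule_of M B) A"
 show ?thesis
 proof
 assume "mod_iso R ?Q N"
 then obtain g where g: "mod_hom R ?Q N g" "bij_betw g (carrier ?Q) (carrier N)"
  unfolding mod_iso_def by blast
 have hom: "mod_hom R (submodule_of M B) N (g \<circ> coset A)"
  unfolding mod_hom_submodule_of
 proof (intro conjI ballI)
  fix x assume x: "x:B"
  show "(g \<circ> coset A) x:carrier N" using g(1) x carrier_quotient unfolding mod_hom_def by auto
  show "(g \<circ> coset A) (r *[M] x) = r *[N] (g \<circ> coset A) x" if "r:carrier R" for r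
  using that coset_smult[OF x that, symmetric] g(1) x carrier_quotient unfolding mod_hom_def by simp
  fix y assume y: "y:B"
  show "(g \<circ> coset A) (x +[M] y) = (g \<circ> coset A) x +[N] (g \<circ> coset A) y"
  using coset_add[OF x y, symmetric] g(1) x y carrier_quotient unfolding mod_hom_def by simp
 qed
 then interpret h: lmod_hom R M N B "g \<circ> coset A"
  by (simp add: B N lmod_axioms lmod_hom_def lmod_hom_axioms_def)
 have "(g \<circ> coset A) x = 0[N] <-> x:A" if "x:B" for x
 proof -
  have "(g \<circ> coset A) x = 0[N] <-> g (coset A x) = g (coset A 0[M])" using h.hom_zero by simp
  also have "\<dots> <-> coset A x = coset A 0[M]"
  using inj_on_eq_iff[OF bij_betw_imp_inj_on[OF g(2)], of "coset A x" "coset A 0[M]"] carrier_quotient that B'(2) by simp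
  also have "\<dots> <-> x:A" using coset_eq_iff[of x "0[M]"] add_diff_cancel[of x "0[M]"] that B'(1) by auto
  finally show ?thesis .
 qed
 moreover have "(g \<circ> coset A) ` B = carrier N"
  using g(2) carrier_quotient unfolding bij_betw_def by (simp add: image_comp)
 ultimately show "sq R M A B N"
  unfolding sq_def using hom AB by (intro exI[of _ "g \<circ> coset A"]) blast
 next
 assume "sq R M A B N"
 then obtain h where h: "mod_hom R (submodule_of M B) N h" "h ` B = carrier N" "{x:B. h x = 0[N]} = A"
  unfolding sq_def by blast
 interpret h: lmod_hom R M N B h
  by (simp add: B N h(1) lmod_axioms lmod_hom_def lmod_hom_axioms_def)
 define g where "g X = h (SOME x. x:B & X = coset A x)" for X
 have g_cs: "g (coset A x) = h x" if x: "x:B" for x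
 proof -
  let ?y = "SOME y. y:B & coset A x = coset A y"
  have "?y:B & coset A x = coset A ?y" by (rule someI[of _ x]) (use x in blast)
  thus ?thesis
  using coset_eq_iff[of x ?y] h.hom_eq_iff[of x ?y] h(3) x B'(1) unfolding g_def by auto
 qed
 have cs_inj: "coset A x = coset A y <-> h x = h y" if "x:B" "y:B" for x y
  using that coset_eq_iff[of x y] h.hom_eq_iff[of x y] h(3) B'(1,6) by auto
 have "mod_hom R ?Q N g"
  unfolding mod_hom_def carrier_quotient
  by (auto simp: g_cs coset_add coset_smult h.hom_closed B'(3,4) h.hom_add h.hom_smult)
 moreover have "bij_betw g (carrier ?Q) (carrier N)"
  unfolding bij_betw_def carrier_quotient inj_on_def using h(2) by (auto simp: g_cs cs_inj image_image)
 ultimately show "mod_iso R ?Q N" unfolding mod_iso_def by blast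
 qed
qed

end

end

text \<open>The module axioms pass along a surjection that preserves the operations.
  \<open>N\<close> is only a record at the outset: quotients and first-order structures are
  recognised as modules in this way.\<close>

lemma lmod_surj_image:
 assumes M: "lmod R M" and U: "submodule U R M" and hom: "mod_hom R (submodule_of M U) N h"
 and surj: "h ` U = carrier N" and zero: "h 0[M] = 0[N]"
 shows "lmod R N"
proof -
 interpret M: lmod R M by (rule M)
 note U' = M.submoduleD[OF U]
 have add: "h x +[N] h y = h (x +[M] y)" if "x:U" "y:U" for x y
 using hom that by (simp add: mod_hom_submodule_of)
 have smult: "r *[N] h x = h (r *[M] x)" if "x:U" "r:carrier R" for x r
 using hom that by (simp add: mod_hom_submodule_of)
 have ex: "EX y:U. x = h y" if "x:carrier N" for x
 using that surj by blast
 have in_N: "h x:carrier N" if "x:U" for x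
 using that surj by blast
 have UM: "x:carrier M" if "x:U" for x
 using that U'(1) by blast
 have "abelian_group N"
 proof (rule abelian_groupI)
 show "0[N]:carrier N" using in_N[OF U'(2)] zero by simp
 fix x assume "x:carrier N"
 then obtain x' where x: "x':U" "x = h x'" using ex by blast
 show "0[N] +[N] x = x" using add[OF U'(2) x(1)] x UM zero by simp
 show "EX y:carrier N. y +[N] x = 0[N]"
  using add[OF U'(5)[OF x(1)] x(1)] in_N[OF U'(5)[OF x(1)]] x UM zero by (auto simp: M.M.l_neg)
 fix y assume "y:carrier N"
 then obtain y' where y: "y':U" "y = h y'" using ex by blast
 show "x +[N] y:carrier N" using add in_N U'(3) x y by simp
 show "x +[N] y = y +[N] x" using add x y UM by (simp add: M.M.a_comm)
 fix z assume "z:carrier N"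
 then obtain z' where z: "z':U" "z = h z'" using ex by blast
 show "x +[N] y +[N] z = x +[N] (y +[N] z)"
  using add x y z UM U'(3) by (simp add: M.M.a_assoc)
 qed
 moreover have "\<one>\<^bsub>R\<^esub> *[N] x = x" if xN: "x:carrier N" for x
 proof -
 obtain x' where x: "x':U" "x = h x'" using ex[OF xN] by blast
 thus ?thesis using smult UM by (simp add: M.smult_one)
 qed
 moreover have "a *[N] x:carrier N" if a: "a:carrier R" and xN: "x:carrier N" for a x
 proof -
 obtain x' where x: "x':U" "x = h x'" using ex[OF xN] by blast
 thus ?thesis using smult in_N U'(4) a by simp
 qed
 moreover have "(a +[R] b) *[N] x = a *[N] x +[N] b *[N] x"
 "(a \<otimes>\<^bsub>R\<^esub> b) *[N] x = a *[N] (b *[N] x)"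
 if "a:carrier R" "b:carrier R" and "x:carrier N" for a b x
 proof -
 obtain x' where x: "x':U" "x = h x'" using ex \<open>x:carrier N\<close> by blast
 thus "(a +[R] b) *[N] x = a *[N] x +[N] b *[N] x"
  "(a \<otimes>\<^bsub>R\<^esub> b) *[N] x = a *[N] (b *[N] x)"
  using smult add UM U'(4) that by (simp_all add: M.smult_l_distr M.smult_assoc)
 qed
 moreover have "a *[N] (x +[N] y) = a *[N] x +[N] a *[N] y"
 if a: "a:carrier R" and xy: "x:carrier N" "y:carrier N" for a x y
 proof -
 obtain x' y' where "x':U" "x = h x'" "y':U" "y = h y'" using ex xy by metis
 thus ?thesis
  using smult add UM U'(3,4) a by (simp add: M.smult_r_distr)
 qed
 ultimately show ?thesis
 by (simp add: lmod_def lmodule_def lmodule_axioms_def M.R.ring_axioms)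
qed

section \<open>Filtrations as chains of submodules\<close>

text \<open>
 A filtration is determined by the set of its members, a chain which is well-ordered by inclusion
 and closed under unions. With the top submodule included, concatenation of filtrations becomes
 the union of sets, and no ordinal arithmetic is needed.
\<close>

definition fchain ::
 "'r ring => ('r, 'n) module set => ('r, 'm) module => 'm set => 'm set => 'm set set => bool" where
 "fchain R C M Z Z' FF <->
  Z:FF & Z':FF & (ALL A:FF. submodule A R M & Z =< A & A =< Z') &
  (ALL A:FF. ALL B:FF. A =< B | B =< A) &
  (ALL GG. GG =< FF & GG ~= {} --> \<Union>GG:FF & \<Inter>GG:GG) &
  (ALL A:FF. ALL B:FF. A << B & (ALL D:FF. ~ (A << D & D << B)) --> (EX N:C. sq R M A B N))"

definition subfiltered ::
 "'r ring => ('r, 'n) module set => ('r, 'm) module => 'm set => 'm set => bool" where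
 "subfiltered R C M Z Z' <-> (EX FF. fchain R C M Z Z' FF)"

lemma fchainD:
 assumes "fchain R C M Z Z' FF"
 shows "Z:FF" "Z':FF" "A:FF==>submodule A R M" "A:FF==>Z =< A" "A:FF==>A =< Z'"
 "A:FF==>B:FF==>A =< B | B =< A"
 "GG =< FF==>GG ~= {}==>\<Union>GG:FF" "GG =< FF==>GG ~= {}==>\<Inter>GG:GG"
 "A:FF==>B:FF==>A << B==>(!!D. D:FF==>~ (A << D & D << B))==>EX N:C. sq R M A B N"
 using assms unfolding fchain_def by simp_all

text \<open>Every member either omits \<open>a\<close> or contains it; the union of the former and
  the intersection of the latter are therefore consecutive.\<close>

lemma fchain_step:
 assumes fc: "fchain R C M Z Z' FF" and a: "a:Z'" "a \<notin> Z"
 obtains S B N where "S:FF" "B:FF" "S << B" "a:B" "a \<notin> S" "!!D. D:FF==>D =< S | B =< D"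
 "N:C" "sq R M S B N"
proof -
 note f = fchainD[OF fc]
 define B where "B = \<Inter>{A:FF. a:A}"
 have B: "B:{A:FF. a:A}"
 unfolding B_def by (rule f(8)) (use f(2) a in auto)
 define S where "S = \<Union>{A:FF. a \<notin> A}"
 have S: "S:FF"
 unfolding S_def by (rule f(7)) (use f(1) a in auto)
 have aS: "a \<notin> S" by (auto simp: S_def)
 hence "S << B" using f(6)[of S B] S B by blast
 moreover have D: "D =< S | B =< D" if "D:FF" for D
 using that by (auto simp: S_def B_def)
 ultimately have "EX N:C. sq R M S B N"
 by (intro f(9)) (use S B in blast)+
 thus ?thesis using that[of S B] S B aS \<open>S << B\<close> D by blast
qed

lemma fchain_Un:
 assumes f: "fchain R C M Z Z' FF" and g: "fchain R C M Z' Z'' GG"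
 shows "fchain R C M Z Z'' (FF Un GG)"
 unfolding fchain_def
proof (intro conjI ballI allI impI)
 note f' = fchainD[OF f] and g' = fchainD[OF g]
 show "Z:FF Un GG" "Z'':FF Un GG" using f' g' by auto
 show "submodule A R M" if "A:FF Un GG" for A using that f' g' by auto
 show "Z =< A" "A =< Z''" if "A:FF Un GG" for A using that f'(4,5)[of A] g'(4,5)[of A] f'(4)[OF f'(2)] g'(4)[OF g'(2)] by blast+
 show chain: "A =< B | B =< A" if "A:FF Un GG" "B:FF Un GG" for A B
 using that f'(6)[of A B] g'(6)[of A B] f'(5)[of A] f'(5)[of B] g'(4)[of A] g'(4)[of B] by blast
 fix HH assume HH: "HH =< FF Un GG & HH ~= {}"
 show "\<Union>HH:FF Un GG"
 proof (cases "HH =< FF")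
 case False
 hence ne: "HH Int GG ~= {}" using HH by blast
 \<comment> \<open>Members of \<open>FF\<close> lie below \<open>Z'\<close> and hence below all of
   \<open>GG\<close>, so they contribute nothing once a member of \<open>GG\<close> is
   present.\<close>
 have "\<Union>HH = \<Union>(HH Int GG)"
 proof
  show "\<Union>HH =< \<Union>(HH Int GG)"
  using HH ne f'(5) g'(4) by (intro Union_least) blast
 qed blast
 thus ?thesis using g'(7)[of "HH Int GG"] ne by auto
 qed (use HH f'(7) in auto)
 show "\<Inter>HH:HH"
 proof (cases "HH Int FF = {}")
 case False
 have "\<Inter>(HH Int FF):HH Int FF" using f'(8)[of "HH Int FF"] False by auto
 moreover have "\<Inter>HH = \<Inter>(HH Int FF)"
 proof
  show "\<Inter>(HH Int FF) =< \<Inter>HH"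
  using HH False f'(5) g'(4) by (intro Inter_greatest) blast
 qed blast
 ultimately show ?thesis by auto
 qed (use HH g'(8)[of HH] in auto)
next
 note f' = fchainD[OF f] and g' = fchainD[OF g]
 fix A B assume A: "A:FF Un GG" and B: "B:FF Un GG"
 and AB: "A << B & (ALL D:FF Un GG. ~ (A << D & D << B))"
 show "EX N:C. sq R M A B N"
 proof (cases "B:FF")
 case True
 hence "A:FF" using A AB f'(5)[of B] f'(2) g'(4)[of A] by blast
 thus ?thesis using f'(9)[of A B] True AB by blast
 next
 case False
 hence BG: "B:GG" using B by blast
 have "A:GG"
 proof (rule ccontr)
  assume "A \<notin> GG"
  hence "A:FF" "A ~= Z'" using A g'(1) by auto
  hence "A << Z'" using f'(5) by blast
  moreover have "Z' << B" using g'(4)[OF BG] False f'(2) by blast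
  ultimately show False using AB f'(2) by blast
 qed
 thus ?thesis using g'(9)[of A B] BG AB by blast
 qed
qed

text \<open>Lies between \<open>filtration\<close> and \<open>fchain\<close>. The index class may
  consist of all ordinals and steps may be trivial, as happens when a forced filtration is traced on
  a countable set and most indices bring nothing new.\<close>

definition ordfam ::
 "'r ring => ('r, 'n) module set => ('r, 'm) module => 'm set => 'm set => 'v::zfc set => ('v => 'm set) => bool" where
 "ordfam R C M Z Z' I G <-> I ~= {} & (ALL i:I. vord i & elts i =< I) &
  (ALL i:I. submodule (G i) R M) & (ALL i:I. elts i = {} --> G i = Z) &
  (ALL j:I. ALL i:elts j. G i =< G j) & (ALL j:I. vlimit j --> G j = (\<Union>i\<in>elts j. G i)) &
  Z' = (\<Union>i\<in>I. G i) &
  (ALL i. vsuc i:I --> G i = G (vsuc i) | (EX N:C. sq R M (G i) (G (vsuc i)) N))"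

text \<open>Passing to the set of values removes repetitions; well-ordering and closure under unions
  are inherited from the ordinals by choosing least indices.\<close>

lemma (in lmod) ordfam_fchain:
 assumes "ordfam R C M Z Z' I G"
 shows "fchain R C M Z Z' (insert Z' (G ` I))"
proof -
 have I: "I ~= {}" "!!i. i:I==>vord i" "!!i. i:I==>elts i =< I"
 and sub: "!!i. i:I==>submodule (G i) R M"
 and zero: "!!i. i:I==>elts i = {}==>G i = Z"
 and mono': "!!i j. j:I==>i:elts j==>G i =< G j"
 and lim: "!!j. j:I==>vlimit j==>G j = (\<Union>i\<in>elts j. G i)"
 and top: "Z' = (\<Union>i\<in>I. G i)"
 and suc: "!!i. vsuc i:I==>G i = G (vsuc i) | (EX N:C. sq R M (G i) (G (vsuc i)) N)"
 using assms unfolding ordfam_def by simp_all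
 have lin: "i:elts j | i = j | j:elts i" if "i:I" "j:I" for i j
 using vord_linear I(2) that by blast
 have chain: "G i =< G j | G j =< G i" if "i:I" "j:I" for i j
 using lin[OF that] mono' that by blast
 have subZ': "submodule Z' R M"
 unfolding top by (rule submodule_Union_chain) (use I(1) sub chain in auto)
 obtain z where z: "z:I" "elts z = {}"
 proof -
 obtain z where z: "z:I" "!!x. x:I==>x = z | z:elts x"
  using vord_least[OF I(1,2)] by metis
 have "elts z = {}"
 proof (rule ccontr)
  assume "elts z ~= {}"
  then obtain y where y: "y:elts z" by blast
  hence "y:I" using I(3) z(1) by blast
  thus False using z(2)[of y] y mem_not_sym by (metis mem_not_refl)
 qed
 thus ?thesis using that z(1) by blast
 qed
 have Gz: "Z = G z" using zero z by simp
 have bot: "Z =< G i" if "i:I" for i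
 using lin[OF z(1) that] z mono'[OF that] Gz by auto
 have leZ': "G i =< Z'" if "i:I" for i using top that by blast
 show ?thesis
 unfolding fchain_def
 proof (intro conjI ballI allI impI)
 show "Z:insert Z' (G ` I)" using Gz z(1) by blast
 show "submodule A R M" if "A:insert Z' (G ` I)" for A using that sub subZ' by auto
 show "Z =< A" "A =< Z'" if "A:insert Z' (G ` I)" for A
  using that bot leZ' z(1) by blast+
 show "A =< B | B =< A" if "A:insert Z' (G ` I)" "B:insert Z' (G ` I)" for A B
  using that chain leZ' by blast
 fix GG assume GG: "GG =< insert Z' (G ` I) & GG ~= {}"
 define J where "J = {i:I. G i:GG}"
 show "\<Inter>GG:GG"
 proof (cases "J = {}")
  case True
  hence "GG = {Z'}" using GG by (auto simp: J_def)
  thus ?thesis by simp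
 next
  case False
  obtain m where m: "m:J" "!!x. x:J==>x = m | m:elts x"
  using vord_least[OF False] I(2) J_def by (metis (no_types, lifting) mem_Collect_eq)
  have "G m =< A" if A: "A:GG" for A
  proof (cases "A = Z'")
  case True
  thus ?thesis using leZ' m(1) by (auto simp: J_def)
  next
  case False
  then obtain i where i: "i:I" "A = G i" using GG A by blast
  hence "i:J" using A by (simp add: J_def)
  thus ?thesis using m(2)[of i] mono'[OF i(1), of m] i(2) by auto
  qed
  hence "\<Inter>GG = G m" using m(1) by (auto simp: J_def)
  thus ?thesis using m(1) by (simp add: J_def)
 qed
 show "\<Union>GG:insert Z' (G ` I)"
 proof (cases "Z':GG")
  case True
  hence "\<Union>GG = Z'" using GG leZ' by blast
  thus ?thesis by simp
 next
  case False
  hence GJ: "\<Union>GG = (\<Union>i\<in>J. G i)" and J: "J ~= {}" using GG by (auto simp: J_def)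
  \<comment> \<open>Bounds of \<open>J\<close>. Without a bound, \<open>J\<close> is cofinal in
    \<open>I\<close> and the union is \<open>Z'\<close>. Otherwise the least bound either belongs to
    \<open>J\<close> or is a limit, and then continuity yields the union.\<close>
  define Bd where "Bd = {b:I. ALL j:J. j = b | j:elts b}"
  show ?thesis
  proof (cases "Bd = {}")
  case True
  have "G b =< (\<Union>i\<in>J. G i)" if "b:I" for b
  proof -
   obtain j where "j:J" "j ~= b" "j \<notin> elts b" using True \<open>b:I\<close> by (auto simp: Bd_def)
   thus ?thesis using lin[of b j] that mono'[of j b] by (auto simp: J_def)
  qed
  hence "(\<Union>i\<in>J. G i) = Z'" using top by (auto simp: J_def)
  thus ?thesis using GJ by simp
  next
  case False
  obtain b where b: "b:Bd" "!!x. x:Bd==>x = b | b:elts x"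
   using vord_least[OF False] I(2) Bd_def by (metis (no_types, lifting) mem_Collect_eq)
  have bI: "b:I" and bJ: "!!j. j:J==>j = b | j:elts b" using b(1) by (auto simp: Bd_def)
  have "\<Union>GG = G b"
  proof (cases "b:J")
   case True
   thus ?thesis using GJ bJ mono'[OF bI] by blast
  next
   case bn: False
   have less: "EX j:J. i:elts j" if "i:elts b" for i
   proof (rule ccontr)
   assume "~ ?thesis"
   hence "i:Bd" using lin[of _ i] I(3)[OF bI] that by (auto simp: Bd_def J_def)
   thus False using b(2)[of i] that mem_not_sym by (metis mem_not_refl)
   qed
   have "vlimit b"
   unfolding vlimit_def
   proof (intro conjI ballI)
   show "vord b" using I(2) bI by blast
   show "elts b ~= {}" using J bJ bn by blast
   show "EX k:elts b. j:elts k" if "j:elts b" for j using less[OF that] bJ bn by blast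
   qed
   hence "G b = (\<Union>i\<in>elts b. G i)" using lim bI by blast
   moreover have "(\<Union>i\<in>elts b. G i) = (\<Union>i\<in>J. G i)"
   proof
   show "(\<Union>i\<in>elts b. G i) =< (\<Union>i\<in>J. G i)"
   using less mono' by (fastforce simp: J_def)
   show "(\<Union>i\<in>J. G i) =< (\<Union>i\<in>elts b. G i)" using bJ bn by blast
   qed
   ultimately show ?thesis using GJ by simp
  qed
  thus ?thesis using bI by blast
  qed
 qed
 next
 fix A B assume A: "A:insert Z' (G ` I)" and B: "B:insert Z' (G ` I)"
  and AB: "A << B & (ALL D:insert Z' (G ` I). ~ (A << D & D << B))"
 have "A ~= Z'" using AB B leZ' by blast
 then obtain k where k: "k:I" "A = G k" using A by blast
 \<comment> \<open>The first index at which the family exceeds \<open>A\<close> is neither zero nor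
   a limit. At its predecessor \<open>c\<close> the value is still \<open>A\<close>, and at
   \<open>vsuc c\<close> it has to be \<open>B\<close>.\<close>
 define J where "J = {i:I. A << G i}"
 have "J ~= {}"
 proof
  assume "J = {}"
  hence "G i =< A" if "i:I" for i using that chain[OF k(1) that] k(2) by (auto simp: J_def)
  hence "Z' =< A" using top by blast
  thus False using AB B leZ' by blast
 qed
 then obtain m where m: "m:J" "!!x. x:J==>x = m | m:elts x"
  using vord_least[of J] I(2) J_def by (metis (no_types, lifting) mem_Collect_eq)
 have mI: "m:I" "A << G m" using m(1) by (auto simp: J_def)
 have below: "G i =< A" if "i:elts m" for i
 proof -
  have "i:I" using I(3) mI that by blast
  moreover have "i \<notin> J" using m(2)[of i] that mem_not_sym by (metis mem_not_refl)
  ultimately show ?thesis using chain[OF k(1), of i] k(2) by (auto simp: J_def)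
 qed
 have km: "k:elts m" using lin[OF k(1) mI(1)] mI(2) k(2) mono'[OF k(1), of m] by blast
 obtain c where c: "m = vsuc c"
  using I(2)[OF mI(1)]
 proof (cases rule: vord_cases)
  case limit
  hence "G m =< A" using lim[OF mI(1)] below by blast
  thus ?thesis using mI(2) by blast
 qed (use km in auto)
 have cm: "c:elts m" using c by simp
 have "A = G c"
  using km c k(2) mono'[of c k] below[OF cm] I(3)[OF mI(1)] cm by auto
 moreover have "G m = B"
 proof -
  have "G m =< B"
  proof (cases "B = Z'")
  case False
  then obtain j where j: "j:I" "B = G j" using B by blast
  hence "j:J" using AB by (auto simp: J_def)
  thus ?thesis using m(2)[of j] mono'[OF j(1), of m] j(2) by blast
  qed (use leZ' mI in blast)
  thus ?thesis using AB mI by blast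
 qed
 ultimately show "EX N:C. sq R M A B N" using suc[of c] c mI(1) AB by auto
 qed auto
qed

lemma small_family:
 fixes FF :: "'v::zfc set set"
 assumes "small S" "FF =< Pow S"
 shows "small ((f :: 'v set => 'v) ` FF)"
proof -
 have "f A = (f \<circ> elts) (vset A)" if "A:FF" for A
 proof -
 have "small A" using that assms small_subset by blast
 thus ?thesis by (simp add: elts_vset)
 qed
 hence "f ` FF = (f \<circ> elts) ` (vset ` FF)"
 by (simp only: image_image cong: image_cong)
 moreover have "small (vset ` FF)"
 by (rule small_subset[OF small_Pow[OF assms(1)]]) (use assms(2) in auto)
 ultimately show ?thesis using small_image by metis
qed

definition rk :: "'v::zfc set set => 'v set => 'v" where
 "rk FF = wfrec {(B, A). A:FF & B:FF & B << A} (%f A. vset (f ` {B:FF. B << A}))"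

text \<open>The Mostowski collapse of a chain of submodules.\<close>

context
 fixes R C M Z Z' and FF :: "'v::zfc set set"
 assumes fc: "fchain R C M Z Z' FF" and small: "small (carrier M)" and lmod: "lmod R M"
begin

lemma fchain_wf: "wf {(B, A). A:FF & B:FF & B << A}"
proof (rule wfI_min)
 fix x and Q :: "'v set set" assume x: "x:Q"
 show "EX z:Q. ALL y. (y, z):{(B, A). A:FF & B:FF & B << A} --> y \<notin> Q"
 proof (cases "Q Int FF = {}")
 case False
 hence "\<Inter>(Q Int FF):Q Int FF" using fchainD(8)[OF fc, of "Q Int FF"] by simp
 thus ?thesis by (intro bexI[of _ "\<Inter>(Q Int FF)"]) auto
 qed (use x in auto)
qed

lemma fchain_Pow: "FF =< Pow (carrier M)"
 using fchainD(3)[OF fc] lmod.submoduleD(1)[OF lmod] by blast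

lemma elts_rk: "A:FF==>elts (rk FF A) = rk FF ` {B:FF. B << A}"
proof -
 assume A: "A:FF"
 have "rk FF A = vset (rk FF ` {B:FF. B << A})"
 unfolding rk_def
 by (subst wfrec[OF fchain_wf]) (intro arg_cong[where f = vset] image_cong, auto simp: cut_def A)
 moreover have "small (rk FF ` {B:FF. B << A})"
 by (rule small_family[OF small]) (use fchain_Pow in auto)
 ultimately show ?thesis by (simp add: elts_vset)
qed

lemma elts_rk_mono: "A:FF==>B:FF==>B =< A==>elts (rk FF B) =< elts (rk FF A)"
 unfolding elts_rk by (rule image_mono) auto

lemma rk_mem_iff: "A:FF==>B:FF==>rk FF A:elts (rk FF B) <-> A << B"
proof
 assume A: "A:FF" and B: "B:FF" and r: "rk FF A:elts (rk FF B)"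
 show "A << B"
 proof (rule ccontr)
 assume "~ A << B"
 hence "B =< A" using fchainD(6)[OF fc A B] by blast
 hence "elts (rk FF B) =< elts (rk FF A)" using elts_rk_mono A B by simp
 thus False using r mem_not_refl by blast
 qed
qed (auto simp: elts_rk)

lemma rk_inj: "A:FF==>B:FF==>rk FF A = rk FF B <-> A = B"
 using rk_mem_iff[of A B] rk_mem_iff[of B A] fchainD(6)[OF fc, of A B] by auto

lemma vord_rk:
 assumes "A:FF"
 shows "vord (rk FF A)"
proof -
 have "elts y =< elts (rk FF D)" if y: "y:elts (rk FF D)" "D:FF" for y D
 proof -
 obtain B where "B:FF" "B =< D" "y = rk FF B" using y elts_rk[of D] by auto
 thus ?thesis using elts_rk_mono y by simp
 qed
 moreover have "EX D:FF. y = rk FF D" if "y:elts (rk FF A)" for y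
 using that elts_rk[OF assms] by auto
 ultimately show ?thesis unfolding vord_def using assms by blast
qed

text \<open>Otherwise the union of the members properly below \<open>A\<close> would be the largest
  of them, and the rank of \<open>A\<close> could not be a limit.\<close>

lemma rk_limit:
 assumes A: "A:FF" and lim: "vlimit (rk FF A)"
 shows "A = \<Union>{B:FF. B << A}"
proof -
 let ?D = "\<Union>{B:FF. B << A}"
 have "{B:FF. B << A} ~= {}" using lim elts_rk[OF A] unfolding vlimit_def by auto
 hence D: "?D:FF" using fchainD(7)[OF fc, of "{B:FF. B << A}"] by auto
 show ?thesis
 proof (rule ccontr)
 assume "A ~= ?D"
 hence "?D << A" by blast
 hence "rk FF ?D:elts (rk FF A)" using rk_mem_iff D A by simp
 then obtain k where "k:elts (rk FF A)" "rk FF ?D:elts k"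
  using lim unfolding vlimit_def by blast
 then obtain B where "B:FF" "B << A" "rk FF ?D:elts (rk FF B)" using elts_rk[OF A] by auto
 hence "?D << B" "B =< ?D" using rk_mem_iff D by auto
 thus False by blast
 qed
qed

lemma rk_succ:
 assumes "A:FF" "B:FF" "rk FF B = vsuc (rk FF A)"
 shows "EX N:C. sq R M A B N"
proof (rule fchainD(9)[OF fc assms(1,2)])
 show "A << B" using rk_mem_iff[OF assms(1,2)] assms(3) by simp
 show "~ (A << D & D << B)" if "D:FF" for D
 using rk_mem_iff[OF assms(1) that] rk_mem_iff[OF that assms(2)] assms(3) mem_not_sym[of "rk FF A" "rk FF D"]
 by auto
qed

end

context lmod_hom
begin

context
 fixes Z and C :: "('r, 'c::zfc) module set"
 assumes surj: "h ` U = carrier N" and ker: "{x:U. h x = 0[N]} = Z"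
 and C: "!!K. K:C==>lmodule R K"
begin

text \<open>Third isomorphism theorem: factors between submodules above the kernel \<open>Z\<close>
  are the same in \<open>M\<close> and in the image \<open>N\<close>.\<close>

lemma sq_image_iff:
 assumes A: "submodule A R M" "Z =< A" and B: "submodule B R M" "A =< B" "B =< U"
 shows "sq R N (h ` A) (h ` B) K <-> sq R M A B K"
proof -
 have A_iff: "x:A <-> h x:h ` A" if "x:U" for x
 proof
 assume "h x:h ` A"
 then obtain a where a: "a:A" "h x = h a" by blast
 hence "x \<ominus>\<^bsub>M\<^esub> a:A" using hom_eq_iff[of x a] ker that A(2) B M.submoduleD(6)[OF U, of x a] by blast
 thus "x:A"
  using M.submoduleD(3)[OF A(1), of "x \<ominus>\<^bsub>M\<^esub> a" a] a(1) M.diff_add_cancel[of x a] that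
  M.submoduleD(1)[OF U] M.submoduleD(1)[OF A(1)] by (metis subsetD)
 qed auto
 note B' = M.submoduleD[OF B(1)]
 show ?thesis
 proof
 assume "sq R N (h ` A) (h ` B) K"
 then obtain g where g: "mod_hom R (submodule_of N (h ` B)) K g" "g ` h ` B = carrier K"
  "{y:h ` B. g y = 0[K]} = h ` A"
  unfolding sq_def by blast
 have "mod_hom R (submodule_of M B) K (g \<circ> h)"
  using g(1) B'(3,4) B(3) unfolding mod_hom_submodule_of
  by (auto simp: hom_add hom_smult subset_iff)
 moreover have "{x:B. (g \<circ> h) x = 0[K]} = A"
  using g(3) A_iff B by (auto simp: set_eq_iff)
 ultimately show "sq R M A B K"
  unfolding sq_def using g(2) by (intro exI[of _ "g \<circ> h"]) (simp add: image_comp)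
 next
 assume "sq R M A B K"
 then obtain k where k: "mod_hom R (submodule_of M B) K k" "k ` B = carrier K"
  "{x:B. k x = 0[K]} = A"
  unfolding sq_def by blast
 \<comment> \<open>\<open>K\<close> is an arbitrary record at this point; that its zero is neutral
   on the values of \<open>k\<close> is read off from the additivity of \<open>k\<close>.\<close>
 have "0[K] +[K] k x = k x" "k x:carrier K" if "x:B" for x
 proof -
  have "0[M]:A" by (rule M.submoduleD(2)[OF A(1)])
  hence "k 0[M] = 0[K]" using k(3) by blast
  thus "0[K] +[K] k x = k x"
  using k(1) that B'(1,2) unfolding mod_hom_submodule_of by (metis M.M.l_zero subsetD)
  show "k x:carrier K" using k that by blast
 qed note K0 = this
 have k_eq: "k x = k y" if "x:B" "y:B" "h x = h y" for x y
 proof -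
  have "x \<ominus>\<^bsub>M\<^esub> y:A" using hom_eq_iff[of x y] ker that A(2) B M.submoduleD(6)[OF U, of x y] by blast
  hence "k (x \<ominus>\<^bsub>M\<^esub> y) = 0[K]" "x \<ominus>\<^bsub>M\<^esub> y:B" using k(3) by blast+
  moreover have "x = (x \<ominus>\<^bsub>M\<^esub> y) +[M] y" using M.diff_add_cancel that B'(1) by (metis subsetD)
  ultimately have "k x = 0[K] +[K] k y"
  using k(1) that(2) unfolding mod_hom_submodule_of by metis
  thus ?thesis using K0 that by simp
 qed
 define g where "g y = k (SOME x. x:B & y = h x)" for y
 have g: "g (h x) = k x" if "x:B" for x
 proof -
  let ?y = "SOME y. y:B & h x = h y"
  have "?y:B & h x = h ?y" by (rule someI[of _ x]) (use that in blast)
  thus ?thesis unfolding g_def using k_eq that by metis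
 qed
 have "mod_hom R (submodule_of N (h ` B)) K g"
  using k(1) B(3) B'(3,4) unfolding mod_hom_submodule_of
  by (auto simp: g subset_iff hom_add[symmetric] hom_smult[symmetric])
 moreover have "{y:h ` B. g y = 0[K]} = h ` A"
  using k(3) g B(2) by auto
 ultimately show "sq R N (h ` A) (h ` B) K"
  unfolding sq_def using k(2) g by (intro exI[of _ g]) (simp add: image_image)
 qed
qed

text \<open>Preimages commute with unions and turn the members of a filtration of \<open>N\<close>
  into submodules between the kernel and \<open>U\<close>; the factors agree by
  \<open>sq_image_iff\<close>.\<close>

lemma filtration_ordfam:
 assumes "filtration R C N \<eta> F"
 shows "ordfam R C M Z U (elts \<eta>) (%i. {x:U. h x:F i})"
proof -
 let ?G = "%i. {x:U. h x:F i}"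
 have eta: "vord \<eta>" "elts \<eta> ~= {}"
 and sub: "!!i. i:elts \<eta>==>submodule (F i) R N"
 and zero: "!!i. i:elts \<eta>==>elts i = {}==>F i = {0[N]}"
 and mono': "!!i j. j:elts \<eta>==>i:elts j==>F i =< F j"
 and lim: "!!j. j:elts \<eta>==>vlimit j==>F j = (\<Union>i\<in>elts j. F i)"
 and top: "carrier N = (\<Union>i\<in>elts \<eta>. F i)"
 and suc: "!!i j. i:elts \<eta>==>j:elts \<eta>==>vsucc i j ==>
  EX K:C. mod_iso R (quotient_module (submodule_of N (F j)) (F i)) K"
 using assms unfolding filtration_def by simp_all
 have subG: "submodule (?G i) R M" if "i:elts \<eta>" for i
 using submodule_preimage sub that by blast
 have img: "h ` ?G i = F i" if "i:elts \<eta>" for i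
 using N.submoduleD(1)[OF sub[OF that]] surj by (auto simp: image_iff)
 have ZG: "Z =< ?G i" if "i:elts \<eta>" for i
 using ker N.submoduleD(2)[OF sub[OF that]] by auto
 have "EX K:C. sq R M (?G i) (?G (vsuc i)) K" if s: "vsuc i:elts \<eta>" for i
 proof -
 have i: "i:elts \<eta>" using vord_trans[OF eta(1) s, of i] by simp
 obtain K where K: "K:C" "mod_iso R (quotient_module (submodule_of N (F (vsuc i))) (F i)) K"
  using suc[OF i s] by (auto simp: vsucc_iff)
 have "F i =< F (vsuc i)" using mono'[OF s, of i] by simp
 hence "sq R N (F i) (F (vsuc i)) K"
  using N.quotient_iso_iff_sq[of "F i" "F (vsuc i)" K] sub i s K C by (simp add: lmod_def)
 hence "sq R N (h ` ?G i) (h ` ?G (vsuc i)) K" using img i s by simp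
 thus ?thesis
  using sq_image_iff[OF subG[OF i] ZG[OF i] subG[OF s]] \<open>F i =< F (vsuc i)\<close> K(1) by blast
 qed
 moreover have "U = (\<Union>i\<in>elts \<eta>. ?G i)"
 using top surj by blast
 ultimately show ?thesis
 unfolding ordfam_def
 proof (intro conjI)
 show "ALL i:elts \<eta>. vord i & elts i =< elts \<eta>"
  using vord_mem[OF eta(1)] vord_trans[OF eta(1)] by auto
 show "ALL i:elts \<eta>. elts i = {} --> ?G i = Z" using zero ker by simp
 show "ALL j:elts \<eta>. ALL i:elts j. ?G i =< ?G j" using mono' by blast
 show "ALL j:elts \<eta>. vlimit j --> ?G j = (\<Union>i\<in>elts j. ?G i)" using lim by blast
 qed (use eta subG in simp_all)
qed

end

end

text \<open>The Mostowski ranks of the members form the index ordinal. By \<open>rk_succ\<close> and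
  \<open>rk_limit\<close>, successor ordinals correspond to consecutive members and limit ordinals
  to unions.\<close>

lemma fchain_filtration:
 fixes FF :: "'v::zfc set set" and C :: "('r, 'v) module set"
 assumes hom: "lmod_hom R M N U h"
 and surj: "h ` U = carrier N" and ker: "{x:U. h x = 0[N]} = Z"
 and C: "!!K. K:C==>lmodule R K"
 and fc: "fchain R C M Z U FF" and small: "small (carrier M)"
 shows "EX \<eta> :: 'v. EX F. filtration R C N \<eta> F"
proof -
 interpret lmod_hom R M N U h by (rule hom)
 note f = fchainD[OF fc]
 have ctx: "fchain R C M Z U FF" "small (carrier M)" "lmod R M"
 using fc small M.lmod_axioms by auto
 note mem = rk_mem_iff[OF ctx] and inj = rk_inj[OF ctx] and elt = elts_rk[OF ctx]
 define at where "at i = (THE A. A:FF & rk FF A = i)" for i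
 have at: "at (rk FF A) = A" if "A:FF" for A
 unfolding at_def by (rule the_equality) (use inj that in auto)
 define \<eta> where "\<eta> = vset (rk FF ` FF)"
 have eta: "elts \<eta> = rk FF ` FF"
 unfolding \<eta>_def by (intro elts_vset small_family[OF small]) (use fchain_Pow[OF ctx] in auto)
 have "filtration R C N \<eta> (%i. h ` at i)"
 unfolding filtration_def
 proof (intro conjI ballI impI)
 show "vord \<eta>"
  unfolding vord_def eta using vord_rk[OF ctx] elt by (auto simp: vord_def)
 show "elts \<eta> ~= {}" using eta f(1) by auto
 show "submodule (h ` at i) R N" if i: "i:elts \<eta>" for i
 proof -
  obtain A where A: "A:FF" "i = rk FF A" using i eta by auto
  thus ?thesis using submodule_image[OF f(3)[OF A(1)] f(5)[OF A(1)]] by (simp add: at)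
 qed
 show "h ` at i = {0[N]}" if i: "i:elts \<eta>" "elts i = {}" for i
 proof -
  obtain A where A: "A:FF" "i = rk FF A" using i eta by auto
  hence "A = Z" using i(2) elt[OF A(1)] f(1) f(4)[OF A(1)] by blast
  moreover have "h 0[M]:h ` Z" "!!x. x:Z==>h x = 0[N]"
  using ker hom_zero M.submoduleD(2)[OF U] by auto
  ultimately have "h ` A = {0[N]}" using hom_zero by auto
  thus ?thesis using A by (simp add: at)
 qed
 show "h ` at i =< h ` at j" if ij: "j:elts \<eta>" "i:elts j" for i j
 proof -
  obtain B where B: "B:FF" "j = rk FF B" using ij(1) eta by auto
  then obtain A where A: "A:FF" "A << B" "i = rk FF A" using ij(2) elt by blast
  thus ?thesis using B by (simp add: at image_mono psubset_imp_subset)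
 qed
 show "h ` at j = (\<Union>i\<in>elts j. h ` at i)" if j: "j:elts \<eta>" "vlimit j" for j
 proof -
  obtain A where A: "A:FF" "j = rk FF A" using j eta by auto
  have "h ` A = h ` \<Union>{B:FF. B << A}"
  using rk_limit[OF ctx A(1)] j(2) A(2) by metis
  also have "\<dots> = (\<Union>i\<in>elts j. h ` at i)" using A elt by (auto simp: at)
  finally show ?thesis using A by (simp add: at)
 qed
 show "carrier N = (\<Union>i\<in>elts \<eta>. h ` at i)"
 proof
  show "carrier N =< (\<Union>i\<in>elts \<eta>. h ` at i)" using surj f(2) eta by (auto simp: at)
  show "(\<Union>i\<in>elts \<eta>. h ` at i) =< carrier N" using f(5) hom_closed eta by (auto simp: at)
 qed
 fix i j assume i: "i:elts \<eta>" and j: "j:elts \<eta>" and s: "vsucc i j"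
 obtain A B where A: "A:FF" "i = rk FF A" and B: "B:FF" "j = rk FF B" using i j eta by auto
 then obtain K where K: "K:C" "sq R M A B K"
  using rk_succ[OF ctx A(1) B(1)] s by (auto simp: vsucc_iff)
 have AB: "A =< B" using mem[OF A(1) B(1)] s A B by (auto simp: vsucc_iff)
 have "sq R N (h ` A) (h ` B) K"
  using sq_image_iff[OF surj ker C f(3)[OF A(1)] f(4)[OF A(1)] f(3)[OF B(1)] AB f(5)[OF B(1)]] K by blast
 hence "mod_iso R (quotient_module (submodule_of N (h ` B)) (h ` A)) K"
 proof (rule N.quotient_iso_iff_sq[THEN iffD2, rotated -1])
  show "lmod R K" using C[OF K(1)] by (simp add: lmod_def)
 qed (use submodule_image f(3,5) A(1) B(1) AB in auto)
 thus "EX K:C. mod_iso R (quotient_module (submodule_of N (h ` at j)) (h ` at i)) K"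
  using K(1) A B by (auto simp: at)
 qed
 thus ?thesis by blast
qed

section \<open>Classes of modules closed under submodules of filtered modules\<close>

locale filt_class =
 fixes R :: "'r ring" and C :: "('r, 'v::zfc) module set"
 assumes ring: "ring R" and vmod: "N:C==>vmodule R N"
begin

lemma C_lmodule: "N:C==>lmodule R N"
 using vmod by (simp add: vmodule_def)

lemma C_lmod: "N:C==>lmod R N"
 using C_lmodule by (simp add: lmod_def)

text \<open>\<open>Q\<close> stands for a subquotient of \<open>M\<close>, possibly with elements of
  another type, while the chain on the right is kept inside \<open>M\<close>.\<close>

lemma filtered_iff_subfiltered:
 fixes M :: "('r, 'v) module"
 assumes hom: "lmod_hom R M Q U h" and surj: "h ` U = carrier Q"
 and ker: "{x:U. h x = 0[Q]} = Z" and small: "small (carrier M)"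
 shows "filtered R C Q <-> subfiltered R C M Z U"
proof
 interpret lmod_hom R M Q U h by (rule hom)
 assume "filtered R C Q"
 then obtain \<eta> F where "filtration R C Q \<eta> F" unfolding filtered_def by blast
 hence "ordfam R C M Z U (elts \<eta>) (%i. {x:U. h x:F i})"
 using filtration_ordfam[OF surj ker] C_lmodule by blast
 thus "subfiltered R C M Z U"
 using M.ordfam_fchain unfolding subfiltered_def by blast
next
 assume "subfiltered R C M Z U"
 thus "filtered R C Q"
 using fchain_filtration[OF hom surj ker _ _ small] C_lmodule unfolding subfiltered_def filtered_def by blast
qed

lemma filtered_submodule_iff:
 fixes M :: "('r, 'v) module"
 assumes M: "lmod R M" "small (carrier M)" and Z: "submodule Z R M"
 shows "filtered R C (submodule_of M Z) <-> subfiltered R C M {0[M]} Z"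
proof (rule filtered_iff_subfiltered[where h = "%x. x"])
 interpret M: lmod R M by (rule M)
 show "lmod_hom R M (submodule_of M Z) Z (%x. x)"
 using M Z M.lmod_submodule[OF Z] M.submoduleD[OF Z]
 by (simp add: lmod_hom_def lmod_hom_axioms_def mod_hom_def)
 show "{x:Z. x = 0[submodule_of M Z]} = {0[M]}" using M.submoduleD(2)[OF Z] by auto
qed (use M in simp_all)

lemma filtered_quotient_iff:
 fixes M :: "('r, 'v) module"
 assumes M: "lmod R M" "small (carrier M)"
 and Z: "submodule Z R M" "submodule Z' R M" "Z =< Z'"
 shows "filtered R C (quotient_module (submodule_of M Z') Z) <-> subfiltered R C M Z Z'"
proof -
 interpret M: lmod R M by (rule M)
 let ?Q = "quotient_module (submodule_of M Z') Z"
 note Z' = M.submoduleD[OF Z(2)]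
 have hom: "mod_hom R (submodule_of M Z') ?Q (M.coset Z)"
 unfolding mod_hom_submodule_of
 by (simp add: M.carrier_quotient[OF Z] M.coset_add[OF Z] M.coset_smult[OF Z])
 have surj: "M.coset Z ` Z' = carrier ?Q" by (simp add: M.carrier_quotient[OF Z])
 have zero: "M.coset Z 0[M] = 0[?Q]"
 using M.submoduleD(1)[OF Z(1)] by (force simp: M.coset_def quotient_module_def image_iff)
 have Q: "lmod R ?Q" by (rule lmod_surj_image[OF M(1) Z(2) hom surj zero])
 have "M.coset Z x = 0[?Q] <-> x:Z" if "x:Z'" for x
 using M.coset_eq_iff[OF Z, of x "0[M]"] zero that Z'(1) M.add_diff_cancel[of x "0[M]"] by auto
 hence ker: "{x:Z'. M.coset Z x = 0[?Q]} = Z" using Z(3) by blast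
 show ?thesis
 by (rule filtered_iff_subfiltered[OF _ surj ker M(2)])
  (simp add: lmod_hom_def lmod_hom_axioms_def M Q Z hom)
qed

text \<open>The definition has the large module as the whole module and true quotients as factors;
  for spans of countable sets both have to be read inside one ambient \<open>M\<close>.\<close>

lemma quotient_hereditary_iff:
 "quotient_hereditary R C <-> (ALL (M :: ('r, 'v) module) Z Z' U. lmod R M & small (carrier M) &
  submodule Z R M & submodule Z' R M & Z =< Z' & submodule U R M & U =< Z' &
  subfiltered R C M {0[M]} Z & subfiltered R C M Z Z' -->
  subfiltered R C M {0[M]} (U Int Z) & subfiltered R C M (U Int Z) U)" (is "_ <-> ?r")
proof
 assume qh: "quotient_hereditary R C"
 show ?r
 proof (intro allI impI)
 fix M :: "('r, 'v) module" and Z Z' U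
 assume a: "lmod R M & small (carrier M) &
  submodule Z R M & submodule Z' R M & Z =< Z' & submodule U R M & U =< Z' &
  subfiltered R C M {0[M]} Z & subfiltered R C M Z Z'"
 then interpret lmod R M by simp
 have v: "vmodule R (submodule_of M Z')"
  using lmod_submodule[of Z'] a submoduleD(1)[of Z'] small_subset by (auto simp: vmodule_def lmod_def)
 have "submodule Z R (submodule_of M Z')" "submodule U R (submodule_of M Z')"
  using submodule_of_iff a by auto
 moreover have "filtered R C (submodule_of (submodule_of M Z') Z)"
  "filtered R C (quotient_module (submodule_of M Z') Z)"
  using filtered_submodule_iff[of M Z] filtered_quotient_iff[of M Z Z'] a by auto
 ultimately have "filtered R C (submodule_of (submodule_of M Z') (U Int Z)) &
  filtered R C (quotient_module (submodule_of (submodule_of M Z') U) (U Int Z))"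
  using qh v unfolding quotient_hereditary_def by blast
 thus "subfiltered R C M {0[M]} (U Int Z) & subfiltered R C M (U Int Z) U"
  using filtered_submodule_iff[of M "U Int Z"] filtered_quotient_iff[of M "U Int Z" U]
  submodule_Int[of U Z] a by auto
 qed
next
 assume r: ?r
 show "quotient_hereditary R C"
 unfolding quotient_hereditary_def
 proof (intro allI impI)
 fix M :: "('r, 'v) module" and Z U
 assume a: "vmodule R M & submodule Z R M & filtered R C (submodule_of M Z) &
  filtered R C (quotient_module M Z)" and U: "submodule U R M"
 then interpret lmod R M by (simp add: vmodule_def lmod_def)
 have M: "lmod R M" "small (carrier M)" using a by (auto simp: vmodule_def lmod_def)
 have "subfiltered R C M {0[M]} Z" "subfiltered R C M Z (carrier M)"
  using filtered_submodule_iff[OF M] filtered_quotient_iff[OF M _ submodule_carrier] a submoduleD(1)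
  by auto
 hence "subfiltered R C M {0[M]} (U Int Z) & subfiltered R C M (U Int Z) U"
  using r M a U submodule_carrier submoduleD(1)[of U] submoduleD(1)[of Z] by blast
 thus "filtered R C (submodule_of M (U Int Z)) &
  filtered R C (quotient_module (submodule_of M U) (U Int Z))"
  using filtered_submodule_iff[OF M submodule_Int] filtered_quotient_iff[OF M submodule_Int U] a U
  by auto
 qed
qed

end

locale qh_class = filt_class R C for R :: "'r ring" and C :: "('r, 'v::zfc) module set" +
 assumes qh: "quotient_hereditary R C"
begin

lemma subfiltered_sub:
 fixes M :: "('r, 'v) module"
 assumes "lmod R M" "small (carrier M)" "submodule Z R M" "submodule Z' R M" "Z =< Z'"
 "submodule U R M" "U =< Z'" "subfiltered R C M {0[M]} Z" "subfiltered R C M Z Z'"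
 shows "subfiltered R C M {0[M]} (U Int Z)" "subfiltered R C M (U Int Z) U"
 using qh assms unfolding quotient_hereditary_iff by blast+

end

section \<open>Clubs of countable subsets and good modules\<close>

definition club_family :: "'a set => 'a set set => bool" where
 "club_family X DD <-> (ALL x:DD. countable x & x =< X) &
  (ALL x. countable x & x =< X --> (EX y:DD. x =< y)) &
  (ALL s :: nat => 'a set. (ALL n. s n:DD & s n =< s (Suc n)) --> (\<Union>n. s n):DD)"

definition good_set :: "'r ring => ('r, 'n) module set => ('r, 'm) module => 'm set => bool" where
 "good_set R C M x <-> (ALL y. countable y & x =< y & y =< carrier M -->
  subfiltered R C M {0[M]} (mod_span R M y) & subfiltered R C M (mod_span R M x) (mod_span R M y))"

text \<open>This turns out to be equivalent to being \<open>\<sigma>\<close>-closed potentially filtered.\<close>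

definition good_module :: "'r ring => ('r, 'n) module set => ('r, 'm) module => bool" where
 "good_module R C M <-> (EX DD. club_family (carrier M) DD & (ALL x:DD. good_set R C M x))"

section \<open>Closure under finitary operations\<close>

text \<open>Each \<open>\<phi> n\<close> takes lists of any length, so a single sequence of
  operations covers all arities.\<close>

inductive_set cl :: "(nat => 'a list => 'a) => 'a set => 'a set" for \<phi> A where
 base: "a:A==>a:cl \<phi> A"
| step: "xs:lists (cl \<phi> A)==>\<phi> n xs:cl \<phi> A"
 monos lists_mono

lemma cl_minimal:
 assumes "A =< B" "!!n xs. xs:lists B==>\<phi> n xs:B"
 shows "cl \<phi> A =< B"
proof
 fix x assume "x:cl \<phi> A"
 thus "x:B"
 by induction (use assms in \<open>auto simp: in_lists_conv_set\<close>)
qed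

lemma cl_mono: "A =< B==>cl \<phi> A =< cl \<phi> B"
 by (rule cl_minimal) (auto intro: cl.intros)

text \<open>Closing off ends after omega rounds, since the entries of a list of arguments all appear
  at some finite round.\<close>

lemma countable_cl:
 assumes "countable A"
 shows "countable (cl \<phi> A)"
proof -
 define lev where "lev = rec_nat A (%_ B. B Un (%(n, xs). \<phi> n xs) ` (UNIV \<times> lists B))"
 have lev: "lev 0 = A" "lev (Suc n) = lev n Un (%(n, xs). \<phi> n xs) ` (UNIV \<times> lists (lev n))" for n
 by (simp_all add: lev_def)
 have mono: "mono lev" by (rule mono_iff_le_Suc[THEN iffD2]) (auto simp: lev)
 have "countable (lev n)" for n
 by (induction n) (use assms in \<open>auto simp: lev intro!: countable_image countable_SIGMA countable_lists\<close>)
 moreover have "cl \<phi> A =< (\<Union>n. lev n)"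
 proof (rule cl_minimal)
 show "A =< (\<Union>n. lev n)" using lev(1) by blast
 fix n xs assume "xs:lists (\<Union>n. lev n)"
 hence "EX k. set xs =< lev k"
 proof (induction xs)
  case (Cons x xs)
  then obtain k l where "set xs =< lev k" "x:lev l" by auto
  hence "set (x # xs) =< lev (max k l)"
  using monoD[OF mono, of k "max k l"] monoD[OF mono, of l "max k l"] by auto
  thus ?case by blast
 qed simp
 then obtain k where "xs:lists (lev k)" by (auto simp: in_lists_conv_set)
 hence "\<phi> n xs:lev (Suc k)" unfolding lev by (force simp: image_iff)
 thus "\<phi> n xs:(\<Union>n. lev n)" by blast
 qed
 ultimately show ?thesis by (meson countable_UN countable_subset countableI_type)
qed

text \<open>A list from the union lies in one of the sets because the operations are finitary. For
  this reason the closed countable sets are closed under increasing countable unions and form a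
  club.\<close>

lemma cl_Union_chain:
 fixes s :: "nat => 'a set"
 assumes "!!n. s n =< s (Suc n)"
 shows "cl \<phi> (\<Union>n. s n) = (\<Union>n. cl \<phi> (s n))"
proof
 have mono: "mono s" by (rule mono_iff_le_Suc[THEN iffD2]) (use assms in auto)
 show "cl \<phi> (\<Union>n. s n) =< (\<Union>n. cl \<phi> (s n))"
 proof (rule cl_minimal)
 show "(\<Union>n. s n) =< (\<Union>n. cl \<phi> (s n))" by (auto intro: cl.base)
 fix n xs assume "xs:lists (\<Union>n. cl \<phi> (s n))"
 hence "EX k. xs:lists (cl \<phi> (s k))"
 proof (induction xs)
  case (Cons x xs)
  then obtain k l where "xs:lists (cl \<phi> (s k))" "x:cl \<phi> (s l)" by auto
  hence "x # xs:lists (cl \<phi> (s (max k l)))"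
  using cl_mono[OF monoD[OF mono, of k "max k l"], of \<phi>] cl_mono[OF monoD[OF mono, of l "max k l"], of \<phi>]
  by auto
  thus ?case by blast
 qed simp
 thus "\<phi> n xs:(\<Union>n. cl \<phi> (s n))" by (auto intro: cl.step)
 qed
 show "(\<Union>n. cl \<phi> (s n)) =< cl \<phi> (\<Union>n. s n)" using cl_mono[of "s _" "\<Union>n. s n" \<phi>] by blast
qed

section \<open>Forced filtrations\<close>

text \<open>
 \<open>L a m p\<close> stands for: \<open>p\<close> forces \<open>m\<close> to belong to the \<open>a\<close>-th member of the generic filtration.
 A block at \<open>b\<close> consists of countable ground model sets which witness that the quotient of the
 members number \<open>b + 1\<close> and \<open>b\<close> is a countably presented member of \<open>C\<close>.
\<close>

locale forced_filtration = lmod R M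
 for R :: "'r ring" (structure) and M :: "('r, 'v::zfc) module" (structure) +
 fixes C :: "('r, 'v) module set" and P :: "'p set" and le :: "'p => 'p => bool" (infix "<~" 50)
 and L :: "'v => 'v => 'p => bool"
 assumes small: "small (carrier M)"
 and nonempty: "P ~= {}"
 and refl: "p:P==>p <~ p"
 and trans: "[|p:P; q:P; r:P; p <~ q; q <~ r|]==>p <~ r"
 and sigma_closed: "(!!n :: nat. s n:P & s (Suc n) <~ s n)==>EX q:P. ALL n. q <~ s n"
 and C_lmod: "N:C==>lmod R N"
 and L_antimono: "[|L a m p; p:P; q:P; q <~ p|]==>L a m q"
 and L_submodule: "p:P==>vord a==>submodule {m:carrier M. L a m p} R M"
 and L_mono: "[|L a m p; vord b; a:elts b; p:P|]==>L b m p"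
 and L_zero: "[|L a m p; elts a = {}; p:P; m:carrier M|]==>m = 0[M]"
 and L_limit: "[|L a m p; vlimit a; p:P; m:carrier M|]==>EX q:P. q <~ p & (EX b:elts a. L b m q)"
 and L_total: "[|m:carrier M; p:P|]==>EX q:P. q <~ p & (EX a. vord a & L a m q)"
 and L_block: "[|vord b; m:carrier M; p:P; L (vsuc b) m p; !!q. q:P==>q <~ p==>~ L b m q|] ==>
  EX r:P. r <~ p & (EX E Zs N. countable E & countable Zs & E =< carrier M & Zs =< carrier M & N:C &
  sq R M (span Zs) (span E) N & (ALL e:E. L (vsuc b) e r) & (ALL z:Zs. L b z r) &
  (ALL q:P. ALL m':carrier M. q <~ r & L (vsuc b) m' q -->
   (EX q':P. q' <~ q & (EX a:carrier M. L b a q' & m' \<ominus>\<^bsub>M\<^esub> a:span E))) &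
  (ALL q:P. ALL t:span E. q <~ r & L b t q --> t:span Zs))"
begin

text \<open>The last two clauses are covering and exactness. Covering: \<open>E\<close> generates
  the member number b + 1 over the member number \<open>b\<close>, the summand from the latter being
  found by a stronger condition. Exactness: whatever in the span of \<open>E\<close> can be forced
  into the member number \<open>b\<close> already lies in the span of \<open>Zs\<close>.\<close>

definition block :: "'v => 'v set => 'v set => 'p => bool" where
 "block b E Zs r <-> countable E & countable Zs & E =< carrier M & Zs =< carrier M &
  (EX N:C. sq R M (span Zs) (span E) N) & (ALL e:E. L (vsuc b) e r) & (ALL z:Zs. L b z r) &
  (ALL q:P. ALL m':carrier M. q <~ r & L (vsuc b) m' q -->
  (EX q':P. q' <~ q & (EX a:carrier M. L b a q' & m' \<ominus>\<^bsub>M\<^esub> a:span E))) &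
  (ALL q:P. ALL t:span E. q <~ r & L b t q --> t:span Zs)"

definition has_rank :: "'v => 'v => 'p => bool" where
 "has_rank m b r <-> vord b & L (vsuc b) m r & (ALL q:P. q <~ r --> ~ L b m q)"

lemma block_antimono:
 assumes b: "block b E Zs r" and q: "r:P" "q:P" "q <~ r"
 shows "block b E Zs q"
proof -
 have "q' <~ r" if "q':P" "q' <~ q" for q'
 using trans[OF that(1) q(2,1) that(2) q(3)] .
 moreover have "L a m q" if "L a m r" for a m
 using L_antimono[OF that q] .
 ultimately show ?thesis
 using b unfolding block_def by (elim conjE) (intro conjI; blast)
qed

lemma has_rank_antimono: "has_rank m b r==>r:P==>q:P==>q <~ r==>has_rank m b q"
 unfolding has_rank_def using L_antimono[of _ _ r q] trans[of _ q r] by blast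

lemma L_zero_elt: "p:P==>vord a==>L a 0[M] p"
 using submoduleD(2)[OF L_submodule] by blast

text \<open>Take the least ordinal \<open>a\<close> such that some extension of \<open>p\<close>
  forces \<open>m\<close> into the member number \<open>a\<close>. It is not zero as
  \<open>m\<close> is nonzero, and not a limit, since a stronger condition would find a smaller
  index. So a = b + 1, and by minimality no extension of \<open>p\<close> puts \<open>m\<close> into
  the member number \<open>b\<close>.\<close>

lemma exists_rank_block:
 assumes m: "m:carrier M" "m ~= 0[M]" and p: "p:P"
 shows "EX r:P. r <~ p & (EX b E Zs. has_rank m b r & block b E Zs r)"
proof -
 define A where "A = {a. vord a & (EX q:P. q <~ p & L a m q)}"
 have "A ~= {}" using L_total[OF m(1) p] by (auto simp: A_def)
 then obtain a where a: "a:A" "!!x. x:A==>x = a | a:elts x"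
 using vord_least[of A] A_def by (metis (no_types, lifting) mem_Collect_eq)
 obtain q where q: "q:P" "q <~ p" "L a m q" and va: "vord a" using a(1) by (auto simp: A_def)
 have notA: "b \<notin> A" if "b:elts a" for b
 using a(2)[of b] that mem_not_sym mem_not_refl by metis
 obtain b where b: "vord b" "a = vsuc b"
 using va
 proof (cases rule: vord_cases)
 case zero
 thus ?thesis using L_zero q m by blast
 next
 case limit
 then obtain q' c where "q':P" "q' <~ q" "c:elts a" "L c m q'"
  using L_limit q m(1) by blast
 hence "c:A" using trans[of q' q p] q p va vord_mem by (auto simp: A_def)
 thus ?thesis using notA \<open>c:elts a\<close> by blast
 qed
 have rank: "has_rank m b q"
 unfolding has_rank_def
 proof (intro conjI ballI impI)
 fix q' assume "q':P" "q' <~ q"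
 hence "q' <~ p" using trans[of q' q p] q p by blast
 thus "~ L b m q'" using notA[of b] b \<open>q':P\<close> by (auto simp: A_def)
 qed (use b q in auto)
 have "EX r:P. r <~ q & (EX E Zs. block b E Zs r)"
 using L_block[OF b(1) m(1) q(1)] rank unfolding has_rank_def block_def by blast
 then obtain r E Zs where r: "r:P" "r <~ q" "block b E Zs r" by blast
 thus ?thesis using has_rank_antimono[OF rank q(1) r(1,2)] trans[of r q p] q p by blast
qed

text \<open>The last clause keeps the summand \<open>a\<close> inside \<open>x\<close>. Together
  with the block lying in \<open>x\<close>, it makes the trace of the filtration on the span of
  \<open>x\<close> generated by its trace on \<open>x\<close>.\<close>

definition decides :: "'v set => 'p => bool" where
 "decides x q <-> x =< carrier M & q:P &
  (ALL m:x. m ~= 0[M] --> (EX b E Zs. has_rank m b q & block b E Zs q & E =< x & Zs =< x &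
  (ALL m':x. L (vsuc b) m' q --> (EX a:x. L b a q & m' \<ominus>\<^bsub>M\<^esub> a:span E))))"

definition part :: "'v set => 'p => 'v => 'v set" where
 "part x q a = {m:x. L a m q}"

lemma rank_le:
 assumes r: "has_rank m b q" and a: "vord a" and q: "q':P" "q' <~ q" "q:P" and L: "L a m q'"
 shows "b:elts a"
proof -
 have nb: "~ L b m q'" "vord b" using r q unfolding has_rank_def by auto
 have "a \<notin> elts b" "a ~= b" using nb L L_mono[OF L nb(2)] q by auto
 thus ?thesis using vord_linear[OF nb(2) a] by blast
qed

lemma has_rank_L:
 assumes r: "has_rank m b q" and a: "vord a" "b:elts a" and q: "q:P"
 shows "L a m q"
proof -
 have b: "vord b" "L (vsuc b) m q" using r unfolding has_rank_def by auto
 have "vsuc b = a | vsuc b:elts a"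
 using vord_linear[OF vord_vsuc[OF b(1)] a(1)] a(2) mem_not_sym[of b a] by auto
 thus ?thesis using L_mono[OF b(2) a(1)] b(2) q by blast
qed

text \<open>All ranks of nonzero elements of \<open>x\<close> are already settled at
  \<open>q\<close>, so a stronger condition puts no further element of \<open>x\<close> into a given
  member, and the decompositions found for \<open>q\<close> still suffice.\<close>

lemma decides_antimono:
 assumes d: "decides x q" and q: "q':P" "q' <~ q"
 shows "decides x q'"
 unfolding decides_def
proof (intro conjI ballI impI)
 have q': "q:P" "x =< carrier M" using d by (auto simp: decides_def)
 show "x =< carrier M" "q':P" using q q' by auto
 fix m assume m: "m:x" "m ~= 0[M]"
 then obtain b E Zs where b: "has_rank m b q" "block b E Zs q" "E =< x" "Zs =< x"
 and s: "!!m'. m':x==>L (vsuc b) m' q==>EX a:x. L b a q & m' \<ominus>\<^bsub>M\<^esub> a:span E"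
 using d unfolding decides_def by meson
 have vb: "vord b" using b(1) by (simp add: has_rank_def)
 have "EX a:x. L b a q' & m' \<ominus>\<^bsub>M\<^esub> a:span E" if m': "m':x" "L (vsuc b) m' q'" for m'
 proof -
 have "L (vsuc b) m' q"
 proof (cases "m' = 0[M]")
  case False
  then obtain c where c: "has_rank m' c q" using d m'(1) unfolding decides_def by meson
  have "c:elts (vsuc b)"
  by (rule rank_le[OF c vord_vsuc[OF vb] q q'(1) m'(2)])
  thus ?thesis using has_rank_L[OF c vord_vsuc[OF vb] _ q'(1)] by blast
 qed (use L_zero_elt q'(1) vord_vsuc[OF vb] in simp)
 thus ?thesis using s[OF m'(1)] L_antimono[OF _ q'(1) q] by blast
 qed
 thus "EX b E Zs. has_rank m b q' & block b E Zs q' & E =< x & Zs =< x &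
  (ALL m':x. L (vsuc b) m' q' --> (EX a:x. L b a q' & m' \<ominus>\<^bsub>M\<^esub> a:span E))"
 using has_rank_antimono[OF b(1) q'(1) q] block_antimono[OF b(2) q'(1) q] b(3,4) by blast
qed

context
 fixes x q
 assumes d: "decides x q"
begin

lemma d_car: "x =< carrier M" and d_P: "q:P"
 using d by (auto simp: decides_def)

lemma part_sub: "part x q a =< carrier M"
 using d_car by (auto simp: part_def)

lemma part_mono: "vord b==>a:elts b==>part x q a =< part x q b"
 using L_mono d_P by (auto simp: part_def)

lemma span_part_L: "vord a==>t:span (part x q a)==>L a t q"
 using span_minimal[OF L_submodule[OF d_P], of a "part x q a"] d_car by (auto simp: part_def)

lemma part_limit:
 assumes "vlimit a"
 shows "part x q a = (\<Union>b\<in>elts a. part x q b)"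
proof
 have va: "vord a" using assms by (simp add: vlimit_def)
 show "(\<Union>b\<in>elts a. part x q b) =< part x q a" using part_mono[OF va] by blast
 show "part x q a =< (\<Union>b\<in>elts a. part x q b)"
 proof
 fix m assume "m:part x q a"
 hence m: "m:x" "L a m q" by (auto simp: part_def)
 show "m:(\<Union>b\<in>elts a. part x q b)"
 proof (cases "m = 0[M]")
  case True
  obtain b where "b:elts a" using assms by (auto simp: vlimit_def)
  thus ?thesis using True m L_zero_elt[OF d_P] vord_mem[OF va] by (auto simp: part_def)
 next
  case False
  then obtain c where c: "has_rank m c q" using d m(1) unfolding decides_def by meson
  have "c:elts a" by (rule rank_le[OF c va d_P refl[OF d_P] d_P m(2)])
  then obtain k where k: "k:elts a" "c:elts k" using assms by (auto simp: vlimit_def)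
  hence "L k m q" using has_rank_L[OF c vord_mem[OF va k(1)] k(2) d_P] by blast
  thus ?thesis using k(1) m(1) by (auto simp: part_def)
 qed
 qed
qed

lemma part_zero: "elts a = {}==>part x q a =< {0[M]}"
 using L_zero d_P d_car by (auto simp: part_def)

lemma Union_part: "x = (\<Union>a\<in>Collect vord. part x q a)"
proof
 show "x =< (\<Union>a\<in>Collect vord. part x q a)"
 proof
 fix m assume m: "m:x"
 obtain a where "vord a" "L a m q"
 proof (cases "m = 0[M]")
  case True
  obtain z :: 'v where "vord z" using vord_vset[of "{}"] by auto
  thus ?thesis using that True L_zero_elt d_P by blast
 next
  case False
  then obtain c where c: "has_rank m c q" using d m unfolding decides_def by meson
  thus ?thesis using that[of "vsuc c"] vord_vsuc unfolding has_rank_def by blast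
 qed
 thus "m:(\<Union>a\<in>Collect vord. part x q a)" using m by (auto simp: part_def)
 qed
qed (auto simp: part_def)

lemma part_chain: "vord a==>vord b==>part x q a =< part x q b | part x q b =< part x q a"
 using vord_linear[of a b] part_mono by blast

text \<open>\<open>b\<close> is an index at which \<open>x\<close> grows.\<close>

lemma part_step:
 assumes b: "vord b" and ne: "part x q (vsuc b) ~= part x q b"
 obtains E Zs where "block b E Zs q" "E =< part x q (vsuc b)" "Zs =< part x q b"
 "!!m. m:part x q (vsuc b)==>EX a:part x q b. m \<ominus>\<^bsub>M\<^esub> a:span E"
proof -
 obtain m where m: "m:x" "L (vsuc b) m q" "~ L b m q"
 using ne part_mono[OF vord_vsuc[OF b], of b] by (auto simp: part_def)
 hence "m ~= 0[M]" using L_zero_elt d_P b by blast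
 then obtain c E Zs where c: "has_rank m c q" "block c E Zs q" "E =< x" "Zs =< x"
 and s: "!!m'. m':x==>L (vsuc c) m' q==>EX a:x. L c a q & m' \<ominus>\<^bsub>M\<^esub> a:span E"
 using d m(1) unfolding decides_def by meson
 have "c:elts (vsuc b)"
 by (rule rank_le[OF c(1) vord_vsuc[OF b] d_P refl[OF d_P] d_P m(2)])
 moreover have "c \<notin> elts b" using has_rank_L[OF c(1) b _ d_P] m(3) by blast
 ultimately have "c = b" by simp
 thus ?thesis
 using that[of E Zs] c s unfolding block_def by (auto simp: part_def) blast
qed

lemma span_part_step:
 assumes b: "vord b" and E: "E =< part x q (vsuc b)"
 and s: "!!m. m:part x q (vsuc b)==>EX a:part x q b. m \<ominus>\<^bsub>M\<^esub> a:span E"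
 shows "span (part x q (vsuc b)) = {g +[M] e |g e. g:span (part x q b) & e:span E}"
proof
 have EM: "E =< carrier M" using E part_sub by blast
 have "span (part x q b Un E) = {g +[M] e |g e. g:span (part x q b) & e:span E}"
 by (rule span_Un[OF part_sub EM])
 moreover have "part x q b Un E =< part x q (vsuc b)"
 using E part_mono[OF vord_vsuc[OF b], of b] by auto
 ultimately show "{g +[M] e |g e. g:span (part x q b) & e:span E} =< span (part x q (vsuc b))"
 using span_mono[of "part x q b Un E" "part x q (vsuc b)"] part_sub by simp
 show "span (part x q (vsuc b)) =< {g +[M] e |g e. g:span (part x q b) & e:span E}"
 proof (rule span_minimal[OF submodule_sum[OF submodule_span[OF part_sub] submodule_span[OF EM]]])
 show "part x q (vsuc b) =< {g +[M] e |g e. g:span (part x q b) & e:span E}"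
 proof
  fix m assume m: "m:part x q (vsuc b)"
  then obtain a where a: "a:part x q b" "m \<ominus>\<^bsub>M\<^esub> a:span E" using s by blast
  have "m:carrier M" "a:carrier M" using a m part_sub by blast+
  hence "m = a +[M] (m \<ominus>\<^bsub>M\<^esub> a)"
  using diff_add_cancel[of m a] by (simp add: M.a_comm)
  thus "m:{g +[M] e |g e. g:span (part x q b) & e:span E}"
  using a span_superset by blast
 qed
 qed
qed

text \<open>Elements of \<open>span x\<close> are not decided by construction, as \<open>R\<close> may be uncountable: this is where
 the relations \<open>Zs\<close> of the blocks are needed.\<close>

lemma span_part_decided:
 assumes a: "vord a" and q': "q':P" "q' <~ q" and m: "m:span x" "L a m q'"
 shows "m:span (part x q a)"
proof -
 \<comment> \<open>Induction on an index \<open>c\<close> at which \<open>m\<close> is known to be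
   in the span. If \<open>x\<close> grows at \<open>c\<close> and \<open>a\<close> is at most
   \<open>c\<close>, subtract from \<open>m\<close> its part \<open>g\<close> in the span at
   \<open>c\<close>: the rest \<open>e\<close> lies in the span of \<open>E\<close> and is forced
   into the member number \<open>c\<close>, so exactness puts it into the span of \<open>Zs\<close>,
   and \<open>m\<close> was already in the span at \<open>c\<close>.\<close>
 have *: "ALL m:span (part x q c). L a m q' --> m:span (part x q a)" if "vord c" for c
 using that
 proof (induction c rule: vord_induct)
 case (zero c)
 hence "part x q c =< part x q a"
  using part_zero[of c] L_zero_elt[OF d_P a] by (auto simp: part_def)
 thus ?case using span_mono part_sub by blast
 next
 case (succ c)
 show ?case
 proof (cases "vsuc c:elts a | vsuc c = a | part x q (vsuc c) = part x q c")
  case True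
  thus ?thesis using succ span_mono[OF part_mono[OF a] part_sub] by fastforce
 next
  case False
  hence ac: "a = c | a:elts c"
  using vord_linear[OF a vord_vsuc[OF succ(1)]] by auto
  obtain E Zs where E: "block c E Zs q" "E =< part x q (vsuc c)" "Zs =< part x q c"
  and s: "!!m. m:part x q (vsuc c)==>EX a:part x q c. m \<ominus>\<^bsub>M\<^esub> a:span E"
  using part_step[OF succ(1)] False by metis
  show ?thesis
  proof (intro ballI impI)
  fix m assume m: "m:span (part x q (vsuc c))" "L a m q'"
  then obtain g e where g: "g:span (part x q c)" "e:span E" "m = g +[M] e"
   using span_part_step[OF succ(1) E(2) s] by blast
  have gM: "g:carrier M" "e:carrier M"
   using g submoduleD(1)[OF submodule_span] part_sub E(2) by blast+
  have sub: "submodule {m:carrier M. L c m q'} R M" by (rule L_submodule[OF q'(1) succ(1)])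
  have "L c m q'" using ac m(2) L_mono[OF m(2) succ(1) _ q'(1)] by blast
  moreover have "L c g q'" using L_antimono[OF span_part_L[OF succ(1) g(1)] d_P q'] .
  ultimately have "m \<ominus>\<^bsub>M\<^esub> g:{m:carrier M. L c m q'}"
   using submoduleD(6)[OF sub, of m g] g gM by simp
  moreover have "m \<ominus>\<^bsub>M\<^esub> g = e"
   using g gM add_diff_cancel[of e g] by (simp add: M.a_comm)
  ultimately have "e:span Zs" using E(1) g(2) q' unfolding block_def by blast
  hence "e:span (part x q c)" using span_mono[OF E(3) part_sub] by blast
  hence "m:span (part x q c)"
   using submoduleD(3)[OF submodule_span[OF part_sub]] g by blast
  thus "m:span (part x q a)" using succ(2) m(2) by blast
  qed
 qed
 next
 case (limit c)
 have vc: "vord c" using limit(1) by (simp add: vlimit_def)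
 have "span (part x q c) = (\<Union>A\<in>part x q ` elts c. span A)"
  unfolding part_limit[OF limit(1)]
 proof (rule span_Union_chain)
  fix A B assume "A:part x q ` elts c" "B:part x q ` elts c"
  thus "A =< B | B =< A" using part_chain vord_mem[OF vc] by blast
 qed (use limit(1) part_sub in \<open>auto simp: vlimit_def\<close>)
 thus ?case using limit(2) by auto
 qed
 have "span x = span (\<Union>(part x q ` Collect vord))" using Union_part by simp
 also have "\<dots> = (\<Union>A\<in>part x q ` Collect vord. span A)"
 proof (rule span_Union_chain)
 fix A B assume "A:part x q ` Collect vord" "B:part x q ` Collect vord"
 thus "A =< B | B =< A" using part_chain by blast
 qed (use part_sub a in auto)
 finally obtain c where "vord c" "m:span (part x q c)" using m(1) by auto
 thus ?thesis using * m(2) by blast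
qed

end

text \<open>The filtration of \<open>span y\<close> over \<open>span x\<close> has the members
  \<open>span x + span (part y q a)\<close>. At an index where \<open>x\<close> grows, the block of
  \<open>x\<close> covers \<open>y\<close> as well and the step collapses; where only
  \<open>y\<close> grows, the block of \<open>y\<close> yields the factor by
  \<open>sq_sum\<close>.\<close>

lemma decides_subfiltered:
 assumes dx: "decides x q" and dy: "decides y q" and xy: "x =< y"
 shows "subfiltered R C M (span x) (span y)"
proof -
 note P = d_P[OF dy] and xM = d_car[OF dx] and yM = d_car[OF dy]
 define G where "G a = span (x Un part y q a)" for a
 have sub: "x Un part y q a =< carrier M" for a using xM part_sub[OF dy] by blast
 have G_sum: "G a = {u +[M] v |u v. u:span x & v:span (part y q a)}" for a
 unfolding G_def by (rule span_Un[OF xM part_sub[OF dy]])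
 have "ordfam R C M (span x) (span y) (Collect vord) G"
 unfolding ordfam_def
 proof (intro conjI ballI allI impI)
 obtain z :: 'v where "vord z" using vord_vset[of "{}"] by auto
 thus "Collect vord ~= ({} :: 'v set)" by blast
 show "elts i =< Collect vord" if "i:Collect vord" for i :: 'v using that vord_mem by auto
 show "submodule (G i) R M" for i unfolding G_def by (rule submodule_span[OF sub])
 show "G i = span x" if "elts i = {}" for i
 proof
  have "x Un part y q i =< span x"
  using part_zero[OF dy that] span_superset submoduleD(2)[OF submodule_span[OF xM]] by blast
  thus "G i =< span x" unfolding G_def by (rule span_minimal[OF submodule_span[OF xM]])
  show "span x =< G i" unfolding G_def by (rule span_mono) (use sub in auto)
 qed
 show "G i =< G j" if "j:Collect vord" "i:elts j" for i j
  unfolding G_def by (rule span_mono) (use that part_mono[OF dy, of j i] sub in auto)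
 show "G j = (\<Union>i\<in>elts j. G i)" if j: "vlimit j" for j
 proof -
  have vj: "vord j" "elts j ~= {}" using j by (auto simp: vlimit_def)
  have "x Un part y q j = \<Union>((%i. x Un part y q i) ` elts j)"
  using vj(2) by (auto simp: part_limit[OF dy j])
  hence "G j = (\<Union>A\<in>(%i. x Un part y q i) ` elts j. span A)"
  unfolding G_def
  proof (subst span_Union_chain[symmetric])
  fix A B assume "A:(%i. x Un part y q i) ` elts j" "B:(%i. x Un part y q i) ` elts j"
  thus "A =< B | B =< A" using part_chain[OF dy] vord_mem[OF vj(1)] by blast
  qed (use vj sub in auto)
  thus ?thesis by (simp add: G_def)
 qed
 have "y = \<Union>((%i. x Un part y q i) ` Collect vord)"
  using Union_part[OF dy] xy \<open>vord z\<close> by blast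
 thus "span y = (\<Union>i\<in>Collect vord. G i)"
  unfolding G_def
 proof -
  assume y: "y = \<Union>((%i. x Un part y q i) ` Collect vord)"
  have "span (\<Union>((%i. x Un part y q i) ` Collect vord)) = (\<Union>A\<in>(%i. x Un part y q i) ` Collect vord. span A)"
  proof (rule span_Union_chain)
  fix A B assume "A:(%i. x Un part y q i) ` Collect vord" "B:(%i. x Un part y q i) ` Collect vord"
  thus "A =< B | B =< A" using part_chain[OF dy] by blast
  qed (use sub \<open>vord z\<close> in auto)
  thus "span y = (\<Union>i\<in>Collect vord. span (x Un part y q i))" using y by simp
 qed
 fix b :: 'v assume "vsuc b:Collect vord"
 hence b: "vord b" using vord_mem[of "vsuc b" b] by simp
 show "G b = G (vsuc b) | (EX N:C. sq R M (G b) (G (vsuc b)) N)"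
 proof (cases "part y q (vsuc b) = part y q b")
  case True
  thus ?thesis by (simp add: G_def)
 next
  case ny: False
  have mono: "G b =< G (vsuc b)"
  unfolding G_def by (rule span_mono) (use part_mono[OF dy vord_vsuc[OF b], of b] sub in auto)
  show ?thesis
  proof (cases "part x q (vsuc b) = part x q b")
  \<comment> \<open>Here \<open>x\<close> grows and \<open>E\<close> lies in \<open>x\<close>. A new
    element of \<open>y\<close> is, modulo \<open>span x\<close>, an element \<open>a\<close> of the
    member number \<open>b\<close>; as \<open>a\<close> belongs to \<open>span y\<close>, it lies in
    the span of \<open>part y q b\<close>.\<close>
  case False
  obtain E Zs where E: "block b E Zs q" "E =< part x q (vsuc b)"
   using part_step[OF dx b False] by metis
  have EM: "E =< carrier M" "span E =< span x"
   using E(2) part_sub[OF dx] span_mono[OF _ xM, of E] by (auto simp: part_def)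
  have "part y q (vsuc b) =< G b"
  proof
   fix m assume "m:part y q (vsuc b)"
   hence m: "m:y" "L (vsuc b) m q" by (auto simp: part_def)
   then obtain q' a where a: "q':P" "q' <~ q" "a:carrier M" "L b a q'" "m \<ominus>\<^bsub>M\<^esub> a:span E"
   using E(1) P refl[OF P] yM unfolding block_def by blast
   have mM: "m:carrier M" using m yM by blast
   have "m \<ominus>\<^bsub>M\<^esub> a:span y" using a(5) EM(2) span_mono[OF xy yM] by blast
   moreover have "m \<ominus>\<^bsub>M\<^esub> (m \<ominus>\<^bsub>M\<^esub> a) = a"
   using mM a(3) add_diff_cancel[of a "m \<ominus>\<^bsub>M\<^esub> a"] diff_add_cancel[of m a] by (simp add: M.a_comm)
   ultimately have "a:span y"
   using submoduleD(6)[OF submodule_span[OF yM], of m "m \<ominus>\<^bsub>M\<^esub> a"] m(1) span_superset by auto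
   hence "a:span (part y q b)" by (rule span_part_decided[OF dy b a(1,2) _ a(4)])
   moreover have "m = (m \<ominus>\<^bsub>M\<^esub> a) +[M] a" using diff_add_cancel mM a(3) by simp
   ultimately show "m:G b" unfolding G_sum using a(5) EM(2) by blast
  qed
  moreover have "x =< G b" unfolding G_def using span_superset by blast
  ultimately have "G (vsuc b) =< G b"
   unfolding G_def[of "vsuc b"] by (intro span_minimal) (auto simp: G_def submodule_span[OF sub])
  thus ?thesis using mono by blast
  next
  \<comment> \<open>Here \<open>x\<close> does not grow, and \<open>sq_sum\<close> applies once the
    intersection of \<open>G b\<close> with the span of \<open>E\<close> is known to be the span of
    \<open>Zs\<close>.\<close>
  case True
  obtain E Zs where E: "block b E Zs q" "E =< part y q (vsuc b)" "Zs =< part y q b"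
   and s: "!!m. m:part y q (vsuc b)==>EX a:part y q b. m \<ominus>\<^bsub>M\<^esub> a:span E"
   using part_step[OF dy b ny] by metis
  obtain N where N: "N:C" "sq R M (span Zs) (span E) N" using E(1) unfolding block_def by blast
  have EM: "E =< carrier M" "Zs =< carrier M" using E(1) by (auto simp: block_def)
  note subE = submodule_span[OF EM(1)]
  have subG: "submodule (G i) R M" for i unfolding G_def by (rule submodule_span[OF sub])
  have "G b Int span E = span Zs"
  proof
   have "span Zs =< G b" unfolding G_def by (rule span_mono) (use E(3) sub in auto)
   moreover have "span Zs =< span E" using N(2) unfolding sq_def by blast
   ultimately show "span Zs =< G b Int span E" by blast
   \<comment> \<open>Write \<open>t = u + v\<close> with \<open>u\<close> in \<open>span x\<close>.
     Then \<open>u = t - v\<close> is forced into the member number b + 1, hence, as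
     \<open>x\<close> does not grow there, into the member number \<open>b\<close>. So is
     \<open>t\<close>, and exactness applies.\<close>
   show "G b Int span E =< span Zs"
   proof
   fix t assume t: "t:G b Int span E"
   then obtain u v where uv: "u:span x" "v:span (part y q b)" "t = u +[M] v"
   unfolding G_sum by blast
   have uM: "u:carrier M" "v:carrier M"
   using uv submoduleD(1)[OF submodule_span] xM part_sub[OF dy] by blast+
   have Lv: "L b v q" by (rule span_part_L[OF dy b uv(2)])
   have "span E =< {m:carrier M. L (vsuc b) m q}"
   using E(1) EM(1) by (intro span_minimal L_submodule[OF P vord_vsuc[OF b]]) (auto simp: block_def)
   hence "L (vsuc b) t q" using t by blast
   moreover have "L (vsuc b) v q" using L_mono[OF Lv vord_vsuc[OF b] _ P] by simp
   ultimately have "t \<ominus>\<^bsub>M\<^esub> v:{m:carrier M. L (vsuc b) m q}"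
   using submoduleD(6)[OF L_submodule[OF P vord_vsuc[OF b]], of t v] uv uM by simp
   hence "L (vsuc b) u q" using uv uM add_diff_cancel by simp
   hence "u:span (part x q b)"
   using span_part_decided[OF dx vord_vsuc[OF b] P refl[OF P] uv(1)] True by simp
   hence "L b u q" by (rule span_part_L[OF dx b])
   hence "L b t q" using submoduleD(3)[OF L_submodule[OF P b], of u v] Lv uv uM by simp
   thus "t:span Zs" using E(1) t P refl[OF P] unfolding block_def by blast
   qed
  qed
  moreover have "G (vsuc b) = {g +[M] e |g e. g:G b & e:span E}"
  proof
   have "part y q (vsuc b) =< {g +[M] e |g e. g:G b & e:span E}"
   using span_part_step[OF dy b E(2) s] span_superset[of "part y q (vsuc b)"]
   span_mono[of "part y q b" "x Un part y q b"] sub unfolding G_def by blast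
   moreover have "x =< {g +[M] e |g e. g:G b & e:span E}"
   proof
   fix u assume "u:x"
   hence "u:G b" "u = u +[M] 0[M]"
   unfolding G_def using span_superset[of "x Un part y q b"] xM by auto
   thus "u:{g +[M] e |g e. g:G b & e:span E}" using submoduleD(2)[OF subE] by blast
   qed
   ultimately show "G (vsuc b) =< {g +[M] e |g e. g:G b & e:span E}"
   unfolding G_def[of "vsuc b"] by (intro span_minimal submodule_sum subG subE) blast
   have "span E =< G (vsuc b)" unfolding G_def by (rule span_mono) (use E(2) sub in auto)
   thus "{g +[M] e |g e. g:G b & e:span E} =< G (vsuc b)"
   using mono submoduleD(3)[OF subG] by blast
  qed
  ultimately have "sq R M (G b) (G (vsuc b)) N"
   using sq_sum[OF N(2) subE subG C_lmod[OF N(1)]] by blast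
  thus ?thesis using N(1) by blast
  qed
 qed
 qed auto
 thus ?thesis using ordfam_fchain unfolding subfiltered_def by blast
qed

text \<open>
 Given a condition \<open>p\<close> and an element \<open>m\<close>, \<open>next p m\<close> decides the rank of \<open>m\<close> and a block for it;
 \<open>look p m q m'\<close> then decides how \<open>m'\<close> is related to that block. A set closed under these
 operations is decided by a single condition, a lower bound of a descending sequence.
\<close>

lemma exists_next:
 assumes "m:carrier M" "p:P"
 shows "EX r b E Zs. r:P & r <~ p & countable E & countable Zs & E =< carrier M & Zs =< carrier M &
 (m ~= 0[M] --> has_rank m b r & block b E Zs r)"
proof (cases "m = 0[M]")
 case True
 thus ?thesis using assms(2) refl by (intro exI[of _ p] exI[of _ undefined] exI[of _ "{}"]) auto
next
 case False
 thus ?thesis using exists_rank_block[OF assms(1) False assms(2)] unfolding block_def by blast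
qed

text \<open>Either some extension of \<open>q\<close> puts \<open>m'\<close> into the member number
  b + 1, and covering supplies a summand \<open>a\<close> for a still stronger condition, or none
  does; then the conclusion is vacuous and \<open>a\<close> may be zero.\<close>

lemma exists_look:
 assumes "block b E Zs r" "r:P" "q:P" "q <~ r" "m':carrier M"
 shows "EX q' a. q':P & q' <~ q & a:carrier M &
 (ALL q'':P. q'' <~ q' & L (vsuc b) m' q'' --> L b a q'' & m' \<ominus>\<^bsub>M\<^esub> a:span E)"
proof (cases "EX q'':P. q'' <~ q & L (vsuc b) m' q''")
 case True
 then obtain q1 where q1: "q1:P" "q1 <~ q" "L (vsuc b) m' q1" by blast
 have "q1 <~ r" using trans[OF q1(1) assms(3,2) q1(2) assms(4)] .
 then obtain q' a where a: "q':P" "q' <~ q1" "a:carrier M" "L b a q'" "m' \<ominus>\<^bsub>M\<^esub> a:span E"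
 using assms(1,5) q1(1,3) unfolding block_def by blast
 moreover have "q' <~ q" using trans[OF a(1) q1(1) assms(3) a(2) q1(2)] .
 moreover have "L b a q''" if "q'':P" "q'' <~ q'" for q''
 using L_antimono[OF a(4,1) that] .
 ultimately show ?thesis by blast
next
 case False
 thus ?thesis using refl[OF assms(3)] assms(3) M.zero_closed by blast
qed

context
 fixes q0 assumes q0: "q0:P"
begin

definition nxt :: "'p => 'v => 'p \<times> 'v \<times> 'v set \<times> 'v set" where
 "nxt p m = (SOME (r, b, E, Zs). r:P & r <~ p & countable E & countable Zs & E =< carrier M &
  Zs =< carrier M & (m ~= 0[M] --> has_rank m b r & block b E Zs r))"

definition "nP p m = fst (nxt p m)"
definition "nb p m = fst (snd (nxt p m))"
definition "nE p m = fst (snd (snd (nxt p m)))"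
definition "nZ p m = snd (snd (snd (nxt p m)))"

lemma nxt:
 assumes "p:P" "m:carrier M"
 shows "nP p m:P" "nP p m <~ p" "countable (nE p m)" "countable (nZ p m)" "nE p m =< carrier M"
 "nZ p m =< carrier M" "m ~= 0[M]==>has_rank m (nb p m) (nP p m)"
 "m ~= 0[M]==>block (nb p m) (nE p m) (nZ p m) (nP p m)"
proof -
 have "case nxt p m of (r, b, E, Zs) => r:P & r <~ p & countable E & countable Zs & E =< carrier M &
  Zs =< carrier M & (m ~= 0[M] --> has_rank m b r & block b E Zs r)"
 unfolding nxt_def by (rule someI_ex) (use exists_next[OF assms(2,1)] in auto)
 thus "nP p m:P" "nP p m <~ p" "countable (nE p m)" "countable (nZ p m)" "nE p m =< carrier M"
 "nZ p m =< carrier M" "m ~= 0[M]==>has_rank m (nb p m) (nP p m)"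
 "m ~= 0[M]==>block (nb p m) (nE p m) (nZ p m) (nP p m)"
 by (auto simp: nP_def nb_def nE_def nZ_def split: prod.splits)
qed

definition look :: "'p => 'v => 'p => 'v => 'p \<times> 'v" where
 "look p m q m' = (if m ~= 0[M] & q <~ nP p m then (SOME (q', a). q':P & q' <~ q & a:carrier M &
 (ALL q'':P. q'' <~ q' & L (vsuc (nb p m)) m' q'' --> L (nb p m) a q'' & m' \<ominus>\<^bsub>M\<^esub> a:span (nE p m)))
 else (q, 0[M]))"

lemma look:
 assumes "p:P" "m:carrier M" "q:P" "m':carrier M"
 shows "fst (look p m q m'):P" "fst (look p m q m') <~ q" "snd (look p m q m'):carrier M"
 "[|m ~= 0[M]; q <~ nP p m; q'':P; q'' <~ fst (look p m q m'); L (vsuc (nb p m)) m' q''|] ==>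
  L (nb p m) (snd (look p m q m')) q'' & m' \<ominus>\<^bsub>M\<^esub> snd (look p m q m'):span (nE p m)"
proof -
 have *: "case look p m q m' of (q', a) => q':P & q' <~ q & a:carrier M &
 (ALL q'':P. q'' <~ q' & L (vsuc (nb p m)) m' q'' --> L (nb p m) a q'' & m' \<ominus>\<^bsub>M\<^esub> a:span (nE p m))"
 if c: "m ~= 0[M] & q <~ nP p m"
 unfolding look_def if_P[OF c]
 by (rule someI_ex) (use exists_look[OF nxt(8)[OF assms(1,2)] nxt(1)[OF assms(1,2)] assms(3) _ assms(4)] c in auto)
 show "fst (look p m q m'):P" "fst (look p m q m') <~ q" "snd (look p m q m'):carrier M"
 using * assms(3) refl by (cases "m ~= 0[M] & q <~ nP p m"; force simp: look_def split: prod.splits)+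
 show "[|m ~= 0[M]; q <~ nP p m; q'':P; q'' <~ fst (look p m q m'); L (vsuc (nb p m)) m' q''|] ==>
  L (nb p m) (snd (look p m q m')) q'' & m' \<ominus>\<^bsub>M\<^esub> snd (look p m q m'):span (nE p m)"
 using * by (auto split: prod.splits)
qed

text \<open>Conditions and elements are closed off together in the sum type, because the conditions
  reached determine which elements have to be added. Index 0 returns a condition and a positive
  index an element. Zero is inserted so that the enumerated set is nonempty; lists of any other
  shape give the default \<open>q0\<close>.\<close>

definition op :: "nat => ('p + 'v) list => 'p + 'v" where
 "op n xs = (case xs of
  [Inl p, Inr m] => if n = 0 then Inl (nP p m)
  else Inr (from_nat_into (insert 0[M] (nE p m Un nZ p m)) (n - 1))
 | [Inl p, Inr m, Inl q, Inr m'] => if n = 0 then Inl (fst (look p m q m')) else Inr (snd (look p m q m'))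
 | _ => Inl q0)"

definition "hull x = cl op (insert (Inl q0) (Inr ` x))"

lemma hull_sub: "x =< carrier M==>hull x =< Inl ` P Un Inr ` carrier M"
 unfolding hull_def
proof (rule cl_minimal)
 fix n xs assume xs: "xs:lists (Inl ` P Un Inr ` carrier M)"
 have "from_nat_into (insert 0[M] (nE p m Un nZ p m)) k:carrier M" if "p:P" "m:carrier M" for p m k
 using from_nat_into[of "insert 0[M] (nE p m Un nZ p m)" k] nxt(5,6)[OF that] by auto
 thus "op n xs:Inl ` P Un Inr ` carrier M"
 using xs q0 nxt(1) look(1,3) unfolding op_def by (auto split: list.splits sum.splits)
qed (use q0 in auto)

lemma hull_closed:
 assumes "Inl p:hull x" "Inr m:hull x" "x =< carrier M"
 shows "Inl (nP p m):hull x" "e:nE p m Un nZ p m==>Inr e:hull x"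
 "[|Inl q:hull x; Inr m':hull x|]==>Inl (fst (look p m q m')):hull x"
 "[|Inl q:hull x; Inr m':hull x|]==>Inr (snd (look p m q m')):hull x"
proof -
 have s: "op n xs:hull x" if "set xs =< hull x" for n xs
 using that cl.step[of xs op] unfolding hull_def by (auto simp: in_lists_conv_set)
 show "Inl (nP p m):hull x" using s[of "[Inl p, Inr m]" 0] assms by (simp add: op_def)
 show "Inl (fst (look p m q m')):hull x" "Inr (snd (look p m q m')):hull x"
 if "Inl q:hull x" "Inr m':hull x"
 using s[of "[Inl p, Inr m, Inl q, Inr m']" 0] s[of "[Inl p, Inr m, Inl q, Inr m']" 1] assms that
 by (simp_all add: op_def)
 have pm: "p:P" "m:carrier M" using hull_sub[OF assms(3)] assms(1,2) by auto
 let ?S = "insert 0[M] (nE p m Un nZ p m)"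
 assume "e:nE p m Un nZ p m"
 moreover have "countable ?S" using nxt(3,4)[OF pm] by simp
 ultimately obtain k where "e = from_nat_into ?S k"
 using from_nat_into_surj[of ?S e] by auto
 thus "Inr e:hull x" using s[of "[Inl p, Inr m]" "Suc k"] assms by (simp add: op_def)
qed

text \<open>A step with task \<open>(p', m, m')\<close> first decides a rank and a block for
  \<open>m\<close> below the current condition, and then looks at \<open>m'\<close> relative to the
  block chosen earlier at \<open>p'\<close>.\<close>

definition step :: "'p => 'p \<times> 'v \<times> 'v => 'p" where
 "step p t = (case t of (p', m, m') => fst (look p' m (nP p m) m'))"

text \<open>Bookkeeping over the countably many tasks formed from the conditions in the hull and the
  elements of \<open>x\<close>. The descending sequence never leaves the hull, so all generators,
  relations and summands chosen along it belong to \<open>x\<close>, and a lower bound decides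
  \<open>x\<close>.\<close>

lemma closed_decided:
 assumes x: "countable x" "x =< carrier M" and closed: "!!m. Inr m:hull x==>m:x"
 shows "EX q:P. q <~ q0 & decides x q"
proof (cases "x = {}")
 case True
 thus ?thesis using q0 refl by (auto simp: decides_def)
next
 case False
 have hull_x: "Inr m:hull x" if "m:x" for m
 unfolding hull_def by (rule cl.base) (use that in auto)
 have hull0: "Inl q0:hull x" unfolding hull_def by (rule cl.base) auto
 have hullP: "p:P" if "Inl p:hull x" for p using hull_sub[OF x(2)] that by auto
 define T where "T = {p. Inl p:hull x} \<times> x \<times> x"
 have "countable (hull x)" unfolding hull_def using x(1) by (intro countable_cl) auto
 hence "countable {p. Inl p:hull x}"
 by (rule countable_image_inj_on[of Inl, OF countable_subset[rotated]]) auto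
 hence T: "countable T" "T ~= {}" unfolding T_def using x(1) False hull0 by auto
 \<comment> \<open>Only the first component of the decoded pair counts, so that every task recurs
   arbitrarily late.\<close>
 define task where "task n = from_nat_into T (fst (prod_decode n))" for n
 have taskT: "task n:T" for n unfolding task_def by (rule from_nat_into[OF T(2)])
 have task: "EX n>k. task n = t" if t: "t:T" for t k
 proof -
 obtain i where i: "from_nat_into T i = t" using from_nat_into_surj[OF T(1) t] by blast
 have "k < prod_encode (i, Suc k)" using le_prod_encode_2[of "Suc k" i] by simp
 thus ?thesis using i by (intro exI[of _ "prod_encode (i, Suc k)"]) (simp add: task_def)
 qed
 define s where "s = rec_nat q0 (%n p. step p (task n))"
 have s: "s 0 = q0" "s (Suc n) = step (s n) (task n)" for n by (simp_all add: s_def)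
 have step: "Inl (step p t):hull x & step p t <~ nP p (fst (snd t)) & step p t <~ p"
 if p: "Inl p:hull x" and t: "t:T" for p t
 proof -
 obtain p' m m' where t': "t = (p', m, m')" "Inl p':hull x" "m:x" "m':x"
  using t by (auto simp: T_def)
 have c: "p:P" "p':P" "m:carrier M" "m':carrier M" using hullP p t' x by auto
 note n = nxt(1,2)[OF c(1,3)] and l = look(1,2)[OF c(2,3) nxt(1)[OF c(1,3)] c(4)]
 have "fst (look p' m (nP p m) m') <~ p" using trans[OF l(1) n(1) c(1) l(2) n(2)] .
 thus ?thesis
  using t' l hull_closed(3)[OF t'(2) hull_x[OF t'(3)] x(2) hull_closed(1)[OF p hull_x[OF t'(3)] x(2)] hull_x[OF t'(4)]]
  by (simp add: step_def)
 qed
 have sh: "Inl (s n):hull x" for n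
 by (induction n) (use hull0 step taskT in \<open>auto simp: s\<close>)
 have sP: "s n:P" for n using hullP sh by blast
 have sdec: "s (Suc n) <~ s n" for n using step[OF sh taskT] by (simp add: s)
 have smono: "s k <~ s n" if "n <= k" for n k
 using that by (induction k rule: dec_induct) (use refl sP sdec trans in \<open>blast\<close>)+
 obtain q where q: "q:P" "!!n. q <~ s n" using sigma_closed[of s] sP sdec by blast
 have "decides x q"
 unfolding decides_def
 proof (intro conjI ballI impI)
 fix m assume m: "m:x" "m ~= 0[M]"
 \<comment> \<open>This task only serves to have \<open>m\<close> treated at stage \<open>n\<close>;
   the block used below is the one chosen for the pair \<open>s n\<close>, \<open>m\<close>.\<close>
 obtain n where n: "task n = (q0, m, m)" using task[of "(q0, m, m)" 0] hull0 m by (auto simp: T_def)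
 have mM: "m:carrier M" using m x by blast
 let ?p = "s n" and ?r = "nP (s n) m"
 note N = nxt[OF sP mM, of n]
 have sr: "s (Suc n) <~ ?r" using step[OF sh[of n] taskT[of n]] n by (simp add: s)
 have qr: "q <~ ?r" using trans[OF q(1) sP N(1) q(2) sr] .
 have EZ: "nE ?p m Un nZ ?p m =< x" using hull_closed(2)[OF sh hull_x[OF m(1)] x(2)] closed by blast
 have "EX a:x. L (nb ?p m) a q & m' \<ominus>\<^bsub>M\<^esub> a:span (nE ?p m)" if m': "m':x" "L (vsuc (nb ?p m)) m' q" for m'
 proof -
  \<comment> \<open>A later stage compares \<open>m'\<close> with that same block. Being later
    matters: \<open>look\<close> acts only below the condition at which the block was fixed.\<close>
  obtain k where k: "k > n" "task k = (?p, m, m')" using task[of "(?p, m, m')" n] sh m m' by (auto simp: T_def)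
  let ?u = "nP (s k) m"
  note K = nxt[OF sP mM, of k]
  have "s k <~ ?r" using trans[OF sP sP N(1) smono[of "Suc n" k] sr] k(1) by simp
  hence u: "?u <~ ?r" using trans[OF K(1) sP N(1) K(2)] by blast
  have sk: "s (Suc k) = fst (look ?p m ?u m')" by (simp add: s k(2) step_def)
  have "m':carrier M" using m' x by blast
  from look(4)[OF sP mM K(1) this m(2) u q(1) _ m'(2)] q(2)[of "Suc k"] sk
  have "L (nb ?p m) (snd (look ?p m ?u m')) q & m' \<ominus>\<^bsub>M\<^esub> snd (look ?p m ?u m'):span (nE ?p m)" by simp
  moreover have "snd (look ?p m ?u m'):x"
  using hull_closed(4)[OF sh hull_x[OF m(1)] x(2) hull_closed(1)[OF sh hull_x[OF m(1)] x(2)] hull_x[OF m'(1)]] closed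
  by blast
  ultimately show ?thesis by blast
 qed
 moreover have "has_rank m (nb ?p m) q" "block (nb ?p m) (nE ?p m) (nZ ?p m) q"
  using has_rank_antimono[OF N(7)[OF m(2)] N(1) q(1) qr] block_antimono[OF N(8)[OF m(2)] N(1) q(1) qr] by auto
 ultimately show "EX b E Zs. has_rank m b q & block b E Zs q & E =< x & Zs =< x &
  (ALL m':x. L (vsuc b) m' q --> (EX a:x. L b a q & m' \<ominus>\<^bsub>M\<^esub> a:span E))"
  using EZ by blast
 qed (use x q in auto)
 thus ?thesis using q s by metis
qed

lemma club_hull: "club_family (carrier M) {x. countable x & x =< carrier M & (ALL m. Inr m:hull x --> m:x)}"
 unfolding club_family_def
proof (intro conjI allI impI)
 fix x assume x: "countable x & x =< carrier M"
 define y where "y = {m. Inr m:hull x}"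
 have "countable (hull x)" unfolding hull_def using x by (intro countable_cl) auto
 hence "countable y" unfolding y_def
 by (rule countable_image_inj_on[of Inr, OF countable_subset[rotated]]) auto
 moreover have "x =< y" unfolding y_def hull_def by (auto intro: cl.base)
 moreover have "y =< carrier M" using hull_sub[of x] x by (auto simp: y_def)
 moreover have "hull y =< hull x"
 unfolding hull_def[of y]
 by (rule cl_minimal) (auto simp: y_def hull_def intro: cl.intros)
 ultimately show "EX y:{x. countable x & x =< carrier M & (ALL m. Inr m:hull x --> m:x)}. x =< y"
 by (intro bexI[of _ y]) (auto simp: y_def)
next
 fix s :: "nat => 'v set"
 assume s: "ALL n. s n:{x. countable x & x =< carrier M & (ALL m. Inr m:hull x --> m:x)} & s n =< s (Suc n)"
 have "insert (Inl q0) (Inr ` (\<Union>n. s n)) = (\<Union>n. insert (Inl q0) (Inr ` s n))" by blast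
 moreover have "cl op (\<Union>n. insert (Inl q0) (Inr ` s n)) = (\<Union>n. cl op (insert (Inl q0) (Inr ` s n)))"
 by (rule cl_Union_chain) (use s in blast)
 ultimately have "hull (\<Union>n. s n) = (\<Union>n. hull (s n))"
 unfolding hull_def by simp
 thus "(\<Union>n. s n):{x. countable x & x =< carrier M & (ALL m. Inr m:hull x --> m:x)}"
 using s by auto
qed auto

end

text \<open>The club consists of the sets closed under the hull of one condition. The larger set
  \<open>y\<close> is arbitrary; it is enlarged to a closed \<open>y'\<close> decided by a stronger
  condition, and quotient-heredity brings the filtrations down from \<open>span y'\<close> to
  \<open>span y\<close>.\<close>

theorem good_module_forced:
 assumes qh: "qh_class R C"
 shows "good_module R C M"
proof -
 interpret qh_class R C by (rule qh)
 obtain p0 where p0: "p0:P" using nonempty by blast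
 have ext: "EX y' q'. y =< y' & q':P & q' <~ q & decides y' q'"
 if q: "q:P" and y: "countable y" "y =< carrier M" for y q
 proof -
 have "EX y':{x. countable x & x =< carrier M & (ALL m. Inr m:hull q x --> m:x)}. y =< y'"
  using conjunct1[OF conjunct2[OF club_hull[OF q, unfolded club_family_def]]] y by simp
 then obtain y' where y': "countable y'" "y' =< carrier M" "!!m. Inr m:hull q y'==>m:y'" "y =< y'"
  by auto
 show ?thesis using closed_decided[OF q y'(1-3)] y'(4) by blast
 qed
 have "good_set R C M x" if x: "countable x" "x =< carrier M" "!!m. Inr m:hull p0 x==>m:x" for x
 unfolding good_set_def
 proof (intro allI impI)
 fix y assume y: "countable y & x =< y & y =< carrier M"
 obtain q where q: "q:P" "decides x q" using closed_decided[OF p0 x] by blast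
 obtain y' q' where y': "y =< y'" "q':P" "q' <~ q" "decides y' q'" using ext[OF q(1), of y] y by auto
 have dx: "decides x q'" by (rule decides_antimono[OF q(2) y'(2,3)])
 have y'M: "y' =< carrier M" using y'(4) by (simp add: decides_def)
 \<comment> \<open>The empty set spans zero, so filtrations over it are filtrations of the spans
   themselves.\<close>
 have e: "decides {} q'" using y'(2) by (simp add: decides_def)
 have sub: "submodule (span x) R M" "submodule (span y) R M" "submodule (span y') R M"
  using submodule_span x(2) y y'M by auto
 have inc: "span x =< span y" "span y =< span y'" using span_mono y y'(1) y'M by auto
 have f: "subfiltered R C M {0[M]} (span x)" "subfiltered R C M {0[M]} (span y')"
  using decides_subfiltered[OF e dx] decides_subfiltered[OF e y'(4)] by (simp_all add: span_empty)
 have xy': "subfiltered R C M (span x) (span y')"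
  using decides_subfiltered[OF dx y'(4)] y y'(1) by blast
 \<comment> \<open>The trivial chain allows heredity to be applied with \<open>span y'\<close> in
   the role of both modules, which filters its submodule \<open>span y\<close>.\<close>
 have full: "fchain R C M (span y') (span y') {span y'}"
  using sub(3) by (auto simp: fchain_def subset_singleton_iff)
 have "subfiltered R C M (span y Int span x) (span y)" "subfiltered R C M {0[M]} (span y Int span y')"
  using subfiltered_sub(2)[OF lmod_axioms small sub(1) sub(3) _ sub(2) inc(2) f(1) xy']
  subfiltered_sub(1)[OF lmod_axioms small sub(3) sub(3) _ sub(2) inc(2) f(2)] full inc
  by (auto simp: subfiltered_def)
 thus "subfiltered R C M {0[M]} (mod_span R M y) & subfiltered R C M (mod_span R M x) (mod_span R M y)"
  using inc by (simp add: Int_absorb2 Int_absorb1 flip: span_def)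
 qed
 thus ?thesis
 unfolding good_module_def using club_hull[OF p0]
 by (intro exI[of _ "{x. countable x & x =< carrier M & (ALL m. Inr m:hull p0 x --> m:x)}"]) blast
qed

end

section \<open>The forcing calculus\<close>

text \<open>Induction on names: the first components of the pairs in \<open>x\<close> lie in its
  transitive closure.\<close>

lemma dom_induct [case_names step]:
 fixes x :: "'v::zfc"
 assumes "!!x. (!!s u. vpair s u:elts x==>\<Phi> s)==>\<Phi> x"
 shows "\<Phi> x"
proof -
 let ?E = "{(x, y :: 'v). x:elts y}"
 have "(s, x):?E\<^sup>+" if "vpair s u:elts x" for s u x
 proof -
 have "(s, vset {s}):?E" "(vset {s}, vpair s u):?E" "(vpair s u, x):?E"
  using that by (simp_all add: vpair_def elts_vset_finite)
 thus ?thesis by (meson trancl.simps)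
 qed
 thus ?thesis
 using wf_induct_rule[OF wf_trancl[OF foundation], of \<Phi> x] assms by blast
qed

context forcing_poset
begin

notation fMem (infix ".:" 50) and fEq (infix ".=" 50) and fNot (".~ _" [40] 40) and fAnd (infixr ".&" 35)
 and fOr (infixr ".|" 30) and fImp (infixr ".->" 25) and fIff (infixr ".<->" 25) and fSub (infix ".<=" 50)
 and le (infix "<~" 50)

abbreviation (input) "ck == check P"

text \<open>Regular predicates are the truth values of the forcing language: they persist to
  stronger conditions, and to have one at \<open>p\<close> it suffices to have it on a dense set
  below \<open>p\<close>.\<close>

definition reg :: "('v => bool) => bool" where
 "reg \<phi> <-> (ALL p:P. ALL q:P. q <~ p --> \<phi> p --> \<phi> q) & (ALL p:P. dense_below \<phi> p --> \<phi> p)"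

lemma regD: "reg \<phi>==>\<phi> p==>p:P==>q:P==>q <~ p==>\<phi> q"
 by (auto simp: reg_def)

lemma reg_dense: "reg \<phi>==>p:P==>(!!q. q:P==>q <~ p==>EX r:P. r <~ q & \<phi> r)==>\<phi> p"
 by (auto simp: reg_def dense_below_def)

lemma dense_belowI: "(!!q. q:P==>q <~ p==>EX r:P. r <~ q & \<phi> r)==>dense_below \<phi> p"
 by (auto simp: dense_below_def)

lemma dense_belowD: "dense_below \<phi> p==>q:P==>q <~ p==>EX r:P. r <~ q & \<phi> r"
 by (auto simp: dense_below_def)

lemma dense_below_mono:
 assumes "dense_below \<phi> p" "p:P" "q:P" "q <~ p"
 shows "dense_below \<phi> q"
proof (rule dense_belowI)
 fix r assume r: "r:P" "r <~ q"
 show "EX r':P. r' <~ r & \<phi> r'"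
 by (rule dense_belowD[OF assms(1) r(1) P_trans[OF r(1) assms(3,2) r(2) assms(4)]])
qed

lemma dense_below_weaken:
 "dense_below \<phi> p==>p:P==>(!!r. r:P==>r <~ p==>\<phi> r==>EX r':P. r' <~ r & \<psi> r')==>dense_below \<psi> p"
 unfolding dense_below_def using P_trans by meson

lemma dense_below_idem:
 "(!!q. q:P==>q <~ p==>EX r:P. r <~ q & dense_below \<phi> r)==>p:P==>dense_below \<phi> p"
 unfolding dense_below_def using P_trans P_refl by meson

lemma reg_dense_below [simp, intro]: "reg (dense_below \<phi>)"
proof -
 have "dense_below \<phi> q" if "dense_below \<phi> p" "p:P" "q:P" "q <~ p" for p q
 by (rule dense_below_mono[OF that])
 moreover have "dense_below \<phi> p" if "dense_below (dense_below \<phi>) p" "p:P" for p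
 using that dense_below_idem unfolding dense_below_def[of "dense_below \<phi>"] by blast
 ultimately show ?thesis unfolding reg_def by blast
qed

lemma dense_below_here: "p:P==>(!!q. q:P==>q <~ p==>\<phi> q)==>dense_below \<phi> p"
 unfolding dense_below_def using P_refl by blast

lemma reg_fNot [simp, intro]: "reg \<phi>==>reg (.~ \<phi>)"
 unfolding reg_def fNot_def dense_below_def by (meson P_trans P_refl)

lemma reg_fAnd [simp, intro]: "reg \<phi>==>reg \<psi>==>reg (\<phi> .& \<psi>)"
 unfolding reg_def fAnd_def dense_below_def by meson

lemma reg_fAll [simp, intro]: "(!!x. x:A==>reg (\<Phi> x))==>reg (fAll A \<Phi>)"
 unfolding reg_def fAll_def dense_below_def by meson

lemma reg_fMem [simp, intro]: "reg (x .: y)"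
 by (simp add: fMem_def)

lemma reg_Gr [simp, intro]: "reg (Gr Q xs)"
 by (simp add: Gr_def)

lemma fImp_iff: "(\<phi> .-> \<psi>) p <-> (ALL q:P. q <~ p & \<phi> q --> (EX r:P. r <~ q & \<psi> r))"
 by (auto simp: fNot_def fAnd_def)

lemma fImpI: "(!!q. q:P==>q <~ p==>\<phi> q==>\<psi> q)==>(\<phi> .-> \<psi>) p"
 unfolding fImp_iff using P_refl by blast

text \<open>An implication built from negation and conjunction yields its conclusion only on a dense
  set; regularity of \<open>\<psi>\<close> then gives it at \<open>q\<close>.\<close>

lemma fImpD:
 assumes "(\<phi> .-> \<psi>) p" "reg \<phi>" "reg \<psi>" "p:P" "q:P" "q <~ p" "\<phi> q"
 shows "\<psi> q"
proof (rule reg_dense[OF assms(3,5)])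
 fix r assume r: "r:P" "r <~ q"
 have "r <~ p" using P_trans[OF r(1) assms(5,4) r(2) assms(6)] .
 moreover have "\<phi> r" using regD[OF assms(2,7,5) r] .
 ultimately show "EX r':P. r' <~ r & \<psi> r'" using assms(1) r unfolding fImp_iff by blast
qed

lemma fOr_iff: "(\<phi> .| \<psi>) p <-> dense_below (%r. \<phi> r | \<psi> r) p"
 by (auto simp: fNot_def fAnd_def dense_below_def)

lemma fEx_iff: "fEx A \<Phi> p <-> dense_below (%r. EX x:A. \<Phi> x r) p"
 unfolding fNot_def fAll_def dense_below_def by blast

lemma fAndI: "\<phi> p==>\<psi> p==>(\<phi> .& \<psi>) p"
 by (simp add: fAnd_def)

lemma fIffI: "(!!q. q:P==>q <~ p==>\<phi> q <-> \<psi> q)==>(\<phi> .<-> \<psi>) p"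
 by (intro fAndI fImpI; blast)

lemma fIffD:
 assumes "(\<phi> .<-> \<psi>) p" "reg \<phi>" "reg \<psi>" "p:P" "q:P" "q <~ p"
 shows "\<phi> q <-> \<psi> q"
proof -
 have "(\<phi> .-> \<psi>) p" "(\<psi> .-> \<phi>) p" using assms(1) unfolding fAnd_def[of "_ .-> _"] by blast+
 thus ?thesis
 using fImpD[of \<phi> \<psi> p q] fImpD[of \<psi> \<phi> p q] assms(2-6) by blast
qed

lemma fEx_cases:
 assumes "fEx A \<Phi> p" "p:P"
 obtains r x where "r:P" "r <~ p" "x:A" "\<Phi> x r"
 using assms P_refl unfolding fEx_iff dense_below_def by blast

lemma reg_conj_ex_here:
 "p:P==>x:A==>reg (\<Phi> x)==>\<Phi> x p==>fEx A \<Phi> p"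
 unfolding fEx_iff by (rule dense_below_here) (use regD in blast)+

subsection \<open>Equality and membership of names\<close>

lemma fEq_sym: "(x .= y) p==>(y .= x) p"
proof (induction rule: fEq.induct)
 case (1 x p y)
 show ?case
 by (rule fEq.intros) (use 1 in meson)+
qed

lemma name_parts: "x:Nm==>vpair s u:elts x==>s:Nm & u:P"
proof -
 assume "x:Nm" and su: "vpair s u:elts x"
 hence "is_name x" by (simp add: Nm_def)
 hence "EX y p. vpair s u = vpair y p & p:P & is_name y"
 by cases (use su in blast)
 thus ?thesis by (auto simp: Nm_def)
qed

lemma nameI: "(!!z. z:elts x==>EX s:Nm. EX u:P. z = vpair s u)==>x:Nm"
 unfolding Nm_def mem_Collect_eq by (rule is_name.intros) blast

text \<open>The inner existential clause of the inductive definition is folded into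
  \<open>fMem\<close>; from here on equality of names is mutual inclusion.\<close>

lemma fEq_iff:
 assumes p: "p:P" and names: "x:Nm" "y:Nm"
 shows "(x .= y) p <->
 (ALL s u. vpair s u:elts x --> (ALL q:P. q <~ p & q <~ u --> (s .: y) q)) &
 (ALL t w. vpair t w:elts y --> (ALL q:P. q <~ p & q <~ w --> (t .: x) q))" (is "_ <-> ?r")
proof -
 let ?c = "%x y. ALL s u. vpair s u:elts x --> (ALL q:P. q <~ p & q <~ u -->
  (EX r:P. r <~ q & (EX t w. vpair t w:elts y & r <~ w & (s .= t) r)))"
 have *: "?c x y <-> (ALL s u. vpair s u:elts x --> (ALL q:P. q <~ p & q <~ u --> (s .: y) q))"
 if PU: "!!s u. vpair s u:elts x==>u:P" for x y
 proof
 assume c: "?c x y"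
 show "ALL s u. vpair s u:elts x --> (ALL q:P. q <~ p & q <~ u --> (s .: y) q)"
 proof (intro allI impI ballI)
  fix s u q assume su: "vpair s u:elts x" and q: "q:P" "q <~ p & q <~ u"
  show "(s .: y) q"
  unfolding fMem_def
  proof (rule dense_belowI)
  fix q' assume q': "q':P" "q' <~ q"
  have "q' <~ p" "q' <~ u"
   using P_trans[OF q'(1) q(1) p q'(2)] P_trans[OF q'(1) q(1) PU[OF su] q'(2)] q(2) by auto
  thus "EX r:P. r <~ q' & (EX t w. vpair t w:elts y & r <~ w & (s .= t) r)"
   using c su q'(1) by blast
  qed
 qed
 next
 assume "ALL s u. vpair s u:elts x --> (ALL q:P. q <~ p & q <~ u --> (s .: y) q)"
 thus "?c x y" unfolding fMem_def dense_below_def using P_refl by blast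
 qed
 have "(x .= y) p <-> ?c x y & ?c y x"
 proof
 assume "(x .= y) p"
 thus "?c x y & ?c y x"
  by cases (use fEq_sym in meson)
 next
 assume "?c x y & ?c y x"
 thus "(x .= y) p"
  by (intro fEq.intros) (use fEq_sym in meson)+
 qed
 thus ?thesis
 using *[of x y] *[of y x] name_parts[OF names(1)] name_parts[OF names(2)] by auto
qed

lemma fMemI: "vpair s u:elts y==>p:P==>y:Nm==>p <~ u==>(!!q. q:P==>q <~ p==>(x .= s) q)==>(x .: y) p"
 unfolding fMem_def by (rule dense_below_here) (use name_parts P_trans in blast)+

lemma fMemE:
 assumes "(x .: y) p" "p:P"
 obtains r s u where "r:P" "r <~ p" "vpair s u:elts y" "r <~ u" "(x .= s) r"
 using assms P_refl unfolding fMem_def dense_below_def by blast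

lemma fEq_refl: "p:P==>x:Nm==>(x .= x) p"
proof (induction x arbitrary: p rule: dom_induct)
 case (step x)
 have "(s .: x) q" if s: "vpair s u:elts x" "q:P" "q <~ u" for s u q
 by (rule fMemI[OF s(1,2) step(3) s(3)]) (use step(1)[OF s(1)] name_parts[OF step(3) s(1)] in blast)
 thus ?case by (simp add: fEq_iff[OF step(2,3,3)])
qed

lemma reg_fEq:
 assumes "x:Nm" "y:Nm"
 shows "reg (x .= y)"
 unfolding reg_def
proof (intro conjI ballI impI)
 fix p q assume pq: "p:P" "q:P" "q <~ p" "(x .= y) p"
 have "q' <~ p" if "q':P" "q' <~ q" for q' using P_trans[OF that(1) pq(2,1) that(2) pq(3)] .
 thus "(x .= y) q" using pq(4) by (simp add: fEq_iff[OF pq(1) assms] fEq_iff[OF pq(2) assms])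
next
 fix p assume p: "p:P" and d: "dense_below (x .= y) p"
 have *: "(s .: z) q" if q: "q:P" "q <~ p" "q <~ u" and u: "u:P"
 and sz: "!!r. r:P==>r <~ u==>(x .= y) r==>(s .: z) r" for s z u q
 proof (rule reg_dense[OF reg_fMem q(1)])
 fix q' assume q': "q':P" "q' <~ q"
 have "q' <~ p" using P_trans[OF q'(1) q(1) p q'(2) q(2)] .
 then obtain r where r: "r:P" "r <~ q'" "(x .= y) r" using dense_belowD[OF d q'(1)] by blast
 have "r <~ u" using P_trans[OF r(1) q'(1) u r(2) P_trans[OF q'(1) q(1) u q'(2) q(3)]] .
 thus "EX r:P. r <~ q' & (s .: z) r" using sz r by blast
 qed
 show "(x .= y) p"
 unfolding fEq_iff[OF p assms]
 proof (intro conjI allI impI ballI)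
 fix s u q assume su: "vpair s u:elts x" and q: "q:P" "q <~ p & q <~ u"
 show "(s .: y) q"
 proof (rule *[OF q(1)])
  fix r assume r: "r:P" "r <~ u" "(x .= y) r"
  thus "(s .: y) r" using su P_refl unfolding fEq_iff[OF r(1) assms] by blast
 qed (use q name_parts[OF assms(1) su] in auto)
 next
 fix s u q assume su: "vpair s u:elts y" and q: "q:P" "q <~ p & q <~ u"
 show "(s .: x) q"
 proof (rule *[OF q(1)])
  fix r assume r: "r:P" "r <~ u" "(x .= y) r"
  thus "(s .: x) r" using su P_refl unfolding fEq_iff[OF r(1) assms] by blast
 qed (use q name_parts[OF assms(2) su] in auto)
 qed
qed

text \<open>Both inclusions have the same shape, isolated in \<open>via\<close>. In one the element
  of \<open>x\<close> stands first among the three names, in the other last; there the induction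
  hypothesis is used with all equalities reversed.\<close>

lemma fEq_trans:
 "[|p:P; x:Nm; y:Nm; z:Nm; (x .= y) p; (y .= z) p|]==>(x .= z) p"
proof (induction x arbitrary: p y z rule: dom_induct)
 case (step x)
 note p = step(2) and N = step(3-5)
 have via: "(s .: z') q"
 if q: "q:P" "q <~ p" and s: "(s .: y') q" and N': "s:Nm" "y':Nm" "z':Nm"
  and yz: "!!t w r. vpair t w:elts y'==>r:P==>r <~ p==>r <~ w==>(t .: z') r"
  and tr: "!!t t' r. r:P==>t:Nm==>t':dom z'==>(s .= t) r==>(t .= t') r==>(s .= t') r"
  and dom: "dom z' = {t'. EX w. vpair t' w:elts z'}" for s q y' z' and dom :: "'v => 'v set"
 unfolding fMem_def
 proof (rule dense_belowI)
 fix q' assume q': "q':P" "q' <~ q"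
 obtain r t w where r: "r:P" "r <~ q'" "vpair t w:elts y'" "r <~ w" "(s .= t) r"
  using fMemE[OF regD[OF reg_fMem s q(1) q'] q'(1)] by blast
 have t: "t:Nm" using name_parts[OF N'(2) r(3)] by simp
 have rp: "r <~ p" using P_trans[OF r(1) q'(1) p r(2) P_trans[OF q'(1) q(1) p q'(2) q(2)]] .
 obtain r' t' w' where r': "r':P" "r' <~ r" "vpair t' w':elts z'" "r' <~ w'" "(t .= t') r'"
  using fMemE[OF yz[OF r(3,1) rp r(4)] r(1)] by blast
 have "(s .= t) r'" using regD[OF reg_fEq[OF N'(1) t] r(5,1) r'(1,2)] .
 hence "(s .= t') r'" using tr[OF r'(1) t _ _ r'(5)] r'(3) dom by blast
 moreover have "r' <~ q'" using P_trans[OF r'(1) r(1) q'(1) r'(2) r(2)] .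
 ultimately show "EX r:P. r <~ q' & (EX s' u. vpair s' u:elts z' & r <~ u & (s .= s') r)"
  using r' by blast
 qed
 define dom where "dom z' = {t'. EX w. vpair t' w:elts z'}" for z' :: 'v
 show ?case
 unfolding fEq_iff[OF p N(1,3)]
 proof (intro conjI allI impI ballI)
 fix s u q assume su: "vpair s u:elts x" and q: "q:P" "q <~ p & q <~ u"
 have s: "s:Nm" using name_parts[OF N(1) su] by simp
 show "(s .: z) q"
 proof (rule via[of q s y z dom])
  show "(s .: y) q" using step(6) su q unfolding fEq_iff[OF p N(1,2)] by blast
  show "(t .: z) r" if "vpair t w:elts y" "r:P" "r <~ p" "r <~ w" for t w r
  using step(7) that unfolding fEq_iff[OF p N(2,3)] by blast
  show "(s .= t') r" if "r:P" "t:Nm" "t':dom z" "(s .= t) r" "(t .= t') r" for t t' r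
  using step(1)[OF su that(1) s that(2) _ that(4,5)] that(3) name_parts[OF N(3)] by (auto simp: dom_def)
 qed (use q s N in \<open>auto simp: dom_def\<close>)
 next
 fix s u q assume su: "vpair s u:elts z" and q: "q:P" "q <~ p & q <~ u"
 have s: "s:Nm" using name_parts[OF N(3) su] by simp
 show "(s .: x) q"
 proof (rule via[of q s y x dom])
  show "(s .: y) q" using step(7) su q unfolding fEq_iff[OF p N(2,3)] by blast
  show "(t .: x) r" if "vpair t w:elts y" "r:P" "r <~ p" "r <~ w" for t w r
  using step(6) that unfolding fEq_iff[OF p N(1,2)] by blast
  show "(s .= t') r" if h: "r:P" "t:Nm" "t':dom x" "(s .= t) r" "(t .= t') r" for t t' r
  proof -
  obtain w where w: "vpair t' w:elts x" using h(3) by (auto simp: dom_def)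
  have "(t' .= s) r"
   using step(1)[OF w h(1) _ h(2) s fEq_sym[OF h(5)] fEq_sym[OF h(4)]] name_parts[OF N(1) w] by blast
  thus ?thesis by (rule fEq_sym)
  qed
 qed (use q s N in \<open>auto simp: dom_def\<close>)
 qed
qed

lemma fMem_eq_left:
 assumes "p:P" "x:Nm" "x':Nm" "y:Nm" "(x .= x') p" "(x .: y) p"
 shows "(x' .: y) p"
 unfolding fMem_def
proof (rule dense_belowI)
 fix q assume q: "q:P" "q <~ p"
 obtain r s u where r: "r:P" "r <~ q" "vpair s u:elts y" "r <~ u" "(x .= s) r"
 using fMemE[OF regD[OF reg_fMem assms(6,1) q] q(1)] by blast
 have "r <~ p" using P_trans[OF r(1) q(1) assms(1) r(2) q(2)] .
 hence "(x' .= x) r" using regD[OF reg_fEq[OF assms(2,3)] assms(5,1) r(1)] fEq_sym by blast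
 hence "(x' .= s) r" using fEq_trans[OF r(1) assms(3,2)] name_parts[OF assms(4) r(3)] r(5) by blast
 thus "EX r:P. r <~ q & (EX s u. vpair s u:elts y & r <~ u & (x' .= s) r)" using r by blast
qed

lemma fMem_eq_right:
 assumes "p:P" "x:Nm" "y:Nm" "y':Nm" "(y .= y') p" "(x .: y) p"
 shows "(x .: y') p"
proof (rule reg_dense[OF reg_fMem assms(1)])
 fix q assume q: "q:P" "q <~ p"
 obtain r s u where r: "r:P" "r <~ q" "vpair s u:elts y" "r <~ u" "(x .= s) r"
 using fMemE[OF regD[OF reg_fMem assms(6,1) q] q(1)] by blast
 have "r <~ p" using P_trans[OF r(1) q(1) assms(1) r(2) q(2)] .
 hence "(s .: y') r" using assms(5) r unfolding fEq_iff[OF assms(1,3,4)] by blast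
 hence "(x .: y') r"
 using fMem_eq_left[OF r(1) _ assms(2,4) fEq_sym[OF r(5)]] name_parts[OF assms(3) r(3)] by blast
 thus "EX r:P. r <~ q & (x .: y') r" using r by blast
qed

lemma fEq_extI:
 assumes "p:P" "x:Nm" "y:Nm"
 and "!!z q. z:Nm==>q:P==>q <~ p==>(z .: x) q==>(z .: y) q"
 and "!!z q. z:Nm==>q:P==>q <~ p==>(z .: y) q==>(z .: x) q"
 shows "(x .= y) p"
proof -
 have "(s .: z) q" if "z:Nm" "vpair s u:elts z" "q:P" "q <~ u" for s z u q
 by (rule fMemI[OF that(2,3,1,4)]) (use fEq_refl name_parts[OF that(1,2)] in blast)
 thus ?thesis
 unfolding fEq_iff[OF assms(1-3)] using assms(2-5) name_parts by blast
qed

lemma fEq_mem_iff: "p:P==>x:Nm==>y:Nm==>z:Nm==>(x .= y) p==>(z .: x) p <-> (z .: y) p"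
 using fMem_eq_right fEq_sym by blast

subsection \<open>Names of ground model sets and of generic unions\<close>

text \<open>A name for the union of the ground model sets \<open>Y p\<close> over the conditions
  \<open>p\<close> in the generic filter; check names are the constant case.\<close>

definition nm :: "('v => 'v set) => 'v" where
 "nm Y = vset (\<Union>p\<in>P. (%z. vpair (ck z) p) ` Y p)"

lemma elts_nm: "(!!p. p:P==>small (Y p))==>elts (nm Y) = (\<Union>p\<in>P. (%z. vpair (ck z) p) ` Y p)"
 unfolding nm_def by (intro elts_vset small_UN small_image P_small)

lemma check_nm: "ck x = nm (%_. elts x)"
 unfolding nm_def check.simps[of P x] by (rule arg_cong[where f = vset]) auto

lemma check_name [simp]: "ck x:Nm"
proof (induction x rule: elts_induct)
 case (step x)
 thus ?case
 unfolding check_nm[of x] by (intro nameI) (auto simp: elts_nm)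
qed

lemma nm_name: "(!!p. p:P==>small (Y p))==>nm Y:Nm"
 by (intro nameI) (auto simp: elts_nm)

lemma mem_nm_iff:
 assumes small: "!!p. p:P==>small (Y p)"
 and mono: "!!p q. p:P==>q:P==>q <~ p==>Y p =< Y q"
 shows "(x .: nm Y) p <-> dense_below (%r. EX z:Y r. (x .= ck z) r) p"
proof -
 have "(EX s u. vpair s u:elts (nm Y) & r <~ u & (x .= s) r) <-> (EX z:Y r. (x .= ck z) r)"
 if "r:P" for r
 proof
 assume "EX z:Y r. (x .= ck z) r"
 then obtain z where z: "z:Y r" "(x .= ck z) r" by blast
 hence "vpair (ck z) r:elts (nm Y)" using that by (auto simp: elts_nm small)
 thus "EX s u. vpair s u:elts (nm Y) & r <~ u & (x .= s) r" using z P_refl[OF that] by blast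
 next
 assume "EX s u. vpair s u:elts (nm Y) & r <~ u & (x .= s) r"
 then obtain u z where "u:P" "z:Y u" "r <~ u" "(x .= ck z) r"
  by (auto simp: elts_nm small)
 thus "EX z:Y r. (x .= ck z) r" using mono[of u r] that by blast
 qed
 thus ?thesis unfolding fMem_def dense_below_def by blast
qed

lemma mem_check_iff: "(x .: ck b) p <-> dense_below (%r. EX a:elts b. (x .= ck a) r) p"
 unfolding check_nm[of b] by (rule mem_nm_iff) auto

text \<open>Membership induction: a name forced into \<open>ck b\<close> equals, below some stronger
  condition, the check name of an element of \<open>b\<close>.\<close>

lemma check_eq_iff: "p:P==>(ck a .= ck b) p <-> a = b"
proof (induction a arbitrary: b p rule: elts_induct)
 case (step a)
 have mem: "c:elts y" if "(ck c .: ck y) q" "q:P"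
  "!!d r. r:P==>d:elts y==>(ck c .= ck d) r==>c = d" for c y q
 using that P_refl unfolding mem_check_iff dense_below_def by blast
 show ?case
 proof
 assume eq: "(ck a .= ck b) p"
 have here: "(ck c .: ck y) p" if "c:elts y" for c y
  unfolding mem_check_iff by (rule dense_below_here) (use that step(2) fEq_refl in \<open>auto intro!: bexI[of _ c]\<close>)
 have "c:elts b" if "c:elts a" for c
  using mem[OF fMem_eq_right[OF step(2) _ _ _ eq here[OF that]] step(2)] step(1)[OF that] by auto
 moreover have "c:elts a" if "c:elts b" for c
  using mem[OF fMem_eq_right[OF step(2) _ _ _ fEq_sym[OF eq] here[OF that]] step(2)] step(1) fEq_sym
  by (metis check_name)
 ultimately show "a = b" using elts_inject by blast
 qed (use step(2) fEq_refl in simp)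
qed

lemma check_mem_iff: "p:P==>(ck a .: ck b) p <-> a:elts b"
 unfolding mem_check_iff using P_refl by (auto simp: check_eq_iff dense_below_def)

subsection \<open>Pairs\<close>

text \<open>Canonical names of unordered pairs and, in \<open>op\<close>, of Kuratowski pairs; they
  turn the formula \<open>fPair\<close> into an equality of names.\<close>

definition up :: "'v => 'v => 'v" where
 "up x y = vset ((%p. vpair x p) ` P Un (%p. vpair y p) ` P)"

definition op :: "'v => 'v => 'v" where
 "op x y = up (up x x) (up x y)"

lemma elts_up: "elts (up x y) = (%p. vpair x p) ` P Un (%p. vpair y p) ` P"
 unfolding up_def by (intro elts_vset small_Un small_image P_small)

lemma up_name [simp]: "x:Nm==>y:Nm==>up x y:Nm"
 by (rule nameI) (auto simp: elts_up)

lemma op_name [simp]: "x:Nm==>y:Nm==>op x y:Nm"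
 by (simp add: op_def)

lemma mem_up_iff: "(w .: up x y) p <-> dense_below (%r. (w .= x) r | (w .= y) r) p"
proof -
 have "(EX s u. vpair s u:elts (up x y) & r <~ u & (w .= s) r) <-> (w .= x) r | (w .= y) r" if "r:P" for r
 using that P_refl by (auto simp: elts_up)
 thus ?thesis unfolding fMem_def dense_below_def by blast
qed

lemma check_pair: "ck (vpair a b) = op (ck a) (ck b)"
proof -
 have "ck (vset {x, y}) = up (ck x) (ck y)" for x y :: 'v
 unfolding check.simps[of P "vset {x, y}"] up_def
 by (rule arg_cong[where f = vset]) (auto simp: elts_vset_finite)
 from this[of a a] this[of a b] this[of "vset {a}" "vset {a, b}"] show ?thesis
 by (simp add: vpair_def op_def)
qed

end

context forcing_poset
begin

lemma reg_elim: "reg \<chi>==>dense_below \<phi> p==>p:P==>(!!r. r:P==>r <~ p==>\<phi> r==>\<chi> r)==>\<chi> p"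
 by (rule reg_dense) (use dense_belowD P_trans in meson)+

lemma dense_below_cong: "(!!r. r:P==>\<phi> r <-> \<psi> r)==>dense_below \<phi> p <-> dense_below \<psi> p"
 by (simp add: dense_below_def cong: bex_cong)

lemma dense_here: "dense_below \<phi> p==>p:P==>EX r:P. r <~ p & \<phi> r"
 using P_refl by (simp add: dense_below_def)

lemma fEq_antimono: "(x .= y) p==>x:Nm==>y:Nm==>p:P==>r:P==>r <~ p==>(x .= y) r"
 using regD[OF reg_fEq] by blast

lemma fMem_antimono: "(x .: y) p==>p:P==>r:P==>r <~ p==>(x .: y) r"
 using regD[OF reg_fMem] by blast

lemma mem_up: "p:P==>x:Nm==>y:Nm==>(x .: up x y) p & (y .: up x y) p"
 unfolding mem_up_iff by (auto intro!: dense_below_here fEq_refl)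

lemma up_cong:
 assumes p: "p:P" and N: "x:Nm" "x':Nm" "y:Nm" "y':Nm" and e: "(x .= x') p" "(y .= y') p"
 shows "(up x y .= up x' y') p"
proof -
 have *: "(z .: up x' y') q" if N: "x:Nm" "x':Nm" "y:Nm" "y':Nm" and e: "(x .= x') p" "(y .= y') p"
 and z: "z:Nm" "q:P" "q <~ p" "(z .: up x y) q" for x x' y y' z q
 using z(4) unfolding mem_up_iff
 proof (rule dense_below_weaken[OF _ z(2)])
 fix r assume r: "r:P" "r <~ q" "(z .= x) r | (z .= y) r"
 have "r <~ p" using P_trans[OF r(1) z(2) p r(2) z(3)] .
 hence "(x .= x') r" "(y .= y') r" using fEq_antimono e N p r(1) by blast+
 hence "(z .= x') r | (z .= y') r" using r fEq_trans[OF r(1) z(1)] N by blast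
 thus "EX r':P. r' <~ r & ((z .= x') r' | (z .= y') r')" using r(1) P_refl by blast
 qed
 show ?thesis
 by (rule fEq_extI[OF p]) (use *[OF N e] *[OF N(2,1,4,3) fEq_sym[OF e(1)] fEq_sym[OF e(2)]] N in auto)
qed

lemma op_cong:
 "p:P==>x:Nm==>x':Nm==>y:Nm==>y':Nm==>(x .= x') p==>(y .= y') p==>(op x y .= op x' y') p"
 unfolding op_def by (intro up_cong up_name) auto

lemma up_sing:
 assumes p: "p:P" and N: "x:Nm" "y:Nm" "z:Nm" and e: "(up x x .= up y z) p"
 shows "(y .= x) p" "(z .= x) p"
proof -
 have "(w .= x) p" if "w:Nm" "(w .: up y z) p" for w
 proof (rule reg_elim[OF reg_fEq[OF that(1) N(1)] _ p])
 have "(w .: up x x) p" using fMem_eq_right[OF p that(1) _ _ fEq_sym[OF e] that(2)] N by simp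
 thus "dense_below (%r. (w .= x) r | (w .= x) r) p" unfolding mem_up_iff .
 qed auto
 thus "(y .= x) p" "(z .= x) p" using mem_up[OF p N(2,3)] N by auto
qed

lemma up_cancel:
 assumes p: "p:P" and N: "x:Nm" "y:Nm" "y':Nm" and e: "(up x y .= up x y') p"
 shows "(y .= y') p"
proof (rule reg_elim[OF reg_fEq[OF N(2,3)] _ p])
 have "(y .: up x y') p" using fMem_eq_right[OF p N(2) _ _ e] mem_up[OF p N(1,2)] N by simp
 thus "dense_below (%r. (y .= x) r | (y .= y') r) p" unfolding mem_up_iff .
 have y': "(y' .: up x y) p" using fMem_eq_right[OF p N(3) _ _ fEq_sym[OF e]] mem_up[OF p N(1,3)] N by simp
 fix r assume r: "r:P" "r <~ p" "(y .= x) r | (y .= y') r"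
 show "(y .= y') r"
 proof (cases "(y .= y') r")
 case False
 hence yx: "(y .= x) r" using r by blast
 have "(y' .: up x y) r" using fMem_antimono[OF y' p r(1,2)] .
 thus ?thesis
  unfolding mem_up_iff
 proof (rule reg_elim[OF reg_fEq[OF N(2,3)] _ r(1)])
  fix q assume q: "q:P" "q <~ r" "(y' .= x) q | (y' .= y) q"
  have "(x .= y) q" using fEq_sym[OF fEq_antimono[OF yx N(2,1) r(1) q(1,2)]] .
  thus "(y .= y') q" using q fEq_trans[OF q(1) N(3,1,2)] fEq_sym by blast
 qed
 qed
qed

text \<open>The usual argument for Kuratowski pairs, carried out below conditions: the case
  distinctions about members of a pair are settled only on dense sets, and regularity of equality
  collects the cases.\<close>

lemma op_inject:
 assumes p: "p:P" and N: "x:Nm" "x':Nm" "y:Nm" "y':Nm" and e: "(op x y .= op x' y') p"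
 shows "(x .= x') p" "(y .= y') p"
proof -
 have N': "up x x:Nm" "up x y:Nm" "up x' x':Nm" "up x' y':Nm" using N by auto
 have "(up x x .: op x' y') p" "(up x y .: op x' y') p"
 using fMem_eq_right[OF p _ _ _ e] mem_up[OF p N'(1,2)] N by (auto simp: op_def)
 hence d: "dense_below (%r. (up x x .= up x' x') r | (up x x .= up x' y') r) p"
 "dense_below (%r. (up x y .= up x' x') r | (up x y .= up x' y') r) p"
 unfolding op_def mem_up_iff by auto
 show xx: "(x .= x') p"
 by (rule reg_elim[OF reg_fEq[OF N(1,2)] d(1) p]) (use up_sing N fEq_sym in blast)
 have cross: "(y' .= y) r" if r: "r:P" "r <~ p" and u: "(up x y .= up x' x') r" for r
 proof -
 have yx: "(y .= x) r"
 proof -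
  have "(y .= x') r" using up_sing(2)[OF r(1) N(2,1,3) fEq_sym[OF u]] .
  thus ?thesis using fEq_trans[OF r(1) N(3,2,1)] fEq_sym[OF fEq_antimono[OF xx N(1,2) p r]] by blast
 qed
 have "(up x' y' .: op x y) r"
  using fMem_eq_right[OF r(1) _ _ _ fEq_sym[OF fEq_antimono[OF e _ _ p r]]] mem_up[OF r(1) N'(3,4)] N
  by (simp add: op_def)
 thus ?thesis
  unfolding op_def mem_up_iff
 proof (rule reg_elim[OF reg_fEq[OF N(4,3)] _ r(1)])
  fix q assume q: "q:P" "q <~ r" "(up x' y' .= up x x) q | (up x' y' .= up x y) q"
  have yxq: "(x .= y) q" using fEq_sym[OF fEq_antimono[OF yx N(3,1) r(1) q(1,2)]] .
  have "(up x x .= up x y) q" using up_cong[OF q(1) N(1,1,1,3) fEq_refl[OF q(1) N(1)] yxq] .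
  hence "(up x x .= up x' y') q"
  using q(3) fEq_trans[OF q(1) N'(1,2,4)] fEq_sym by blast
  hence "(y' .= x) q" using up_sing(2)[OF q(1) N(1,2,4)] by blast
  thus "(y' .= y) q" using fEq_trans[OF q(1) N(4,1,3) _ yxq] by blast
 qed
 qed
 show "(y .= y') p"
 proof (rule reg_elim[OF reg_fEq[OF N(3,4)] d(2) p])
 fix r assume r: "r:P" "r <~ p" "(up x y .= up x' x') r | (up x y .= up x' y') r"
 show "(y .= y') r"
 proof (cases "(up x y .= up x' x') r")
  case False
  hence u: "(up x y .= up x' y') r" using r(3) by blast
  have "(x' .= x) r" using fEq_sym[OF fEq_antimono[OF xx N(1,2) p r(1,2)]] .
  hence "(up x' y' .= up x y') r" using up_cong[OF r(1) N(2,1,4,4)] fEq_refl[OF r(1) N(4)] by blast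
  hence "(up x y .= up x y') r" using fEq_trans[OF r(1) N'(2,4) _ u] N by simp
  thus ?thesis using up_cancel[OF r(1) N(1,3,4)] by blast
 qed (use cross[OF r(1,2)] fEq_sym in blast)
 qed
qed

text \<open>Pairs and cosets are described by formulas of this form. Once a name \<open>v\<close>
  with the prescribed members is at hand, the formula says no more than
  \<open>w .= v\<close>.\<close>

lemma fComprehension_iff:
 assumes p: "p:P" and N: "w:Nm" "v:Nm" and reg: "!!u. u:Nm==>reg (\<Phi> u)"
 and \<Phi>: "!!u r. u:Nm==>r:P==>r <~ p==>\<Phi> u r <-> (u .: v) r"
 shows "(\<^bold>\<forall>u. u .: w .<-> \<Phi> u) p <-> (w .= v) p"
proof
 assume a: "(\<^bold>\<forall>u. u .: w .<-> \<Phi> u) p"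
 have "(u .: w) q <-> \<Phi> u q" if "u:Nm" "q:P" "q <~ p" for u q
 by (rule fIffD[OF _ reg_fMem reg[OF that(1)] p that(2,3)]) (use a that in \<open>simp add: fAll_def\<close>)
 thus "(w .= v) p" using \<Phi> by (intro fEq_extI[OF p N]) blast+
next
 assume e: "(w .= v) p"
 show "(\<^bold>\<forall>u. u .: w .<-> \<Phi> u) p"
 unfolding fAll_def
 proof (intro ballI fIffI)
 fix u q assume "u:Nm" "q:P" "q <~ p"
 thus "(u .: w) q <-> \<Phi> u q"
  using \<Phi> fEq_mem_iff[OF _ N _ fEq_antimono[OF e N p]] by blast
 qed
qed

lemma fPair_iff:
 assumes p: "p:P" and N: "z:Nm" "x:Nm" "y:Nm"
 shows "fPair z x y p <-> (z .= op x y) p"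
proof -
 have A: "(\<^bold>\<forall>u. u .: w .<-> u .= x) q <-> (w .= up x x) q"
 and B: "(\<^bold>\<forall>u. u .: w .<-> (u .= x .| u .= y)) q <-> (w .= up x y) q" if w: "w:Nm" "q:P" for w q
 proof -
 show "(\<^bold>\<forall>u. u .: w .<-> u .= x) q <-> (w .= up x x) q"
 proof (rule fComprehension_iff[OF w(2,1)])
  show "(u .= x) r <-> (u .: up x x) r" if "u:Nm" "r:P" for u r
  using reg_elim[OF reg_fEq[OF that(1) N(2)], of "u .= x" r] fEq_antimono[OF _ that(1) N(2)] that
  unfolding mem_up_iff by (auto intro: dense_below_here)
 qed (use N reg_fEq in auto)
 show "(\<^bold>\<forall>u. u .: w .<-> (u .= x .| u .= y)) q <-> (w .= up x y) q"
  by (rule fComprehension_iff[OF w(2,1)]) (use N reg_fEq in \<open>auto simp: fOr_iff mem_up_iff\<close>)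
 qed
 show ?thesis
 unfolding fPair_def
 proof (rule fComprehension_iff[OF p N(1)])
 fix w r assume w: "w:Nm" "r:P"
 show "((\<^bold>\<forall>u. u .: w .<-> u .= x) .| (\<^bold>\<forall>u. u .: w .<-> (u .= x .| u .= y))) r <-> (w .: op x y) r"
  unfolding op_def mem_up_iff by (subst fOr_iff, rule dense_below_cong) (simp only: A[OF w(1)] B[OF w(1)])
 qed (use N reg_fEq in auto)
qed

lemma fMaps_iff:
 assumes p: "p:P" and N: "f:Nm" "x:Nm" "y:Nm"
 shows "fMaps f x y p <-> (op x y .: f) p"
proof
 assume "fMaps f x y p"
 hence d: "dense_below (%r. EX z:Nm. (fPair z x y .& z .: f) r) p" unfolding fMaps_def fEx_iff .
 show "(op x y .: f) p"
 proof (rule reg_elim[OF reg_fMem d p])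
 fix r assume r: "r:P" "r <~ p" "EX z:Nm. (fPair z x y .& z .: f) r"
 then obtain z where z: "z:Nm" "fPair z x y r" "(z .: f) r" by (auto simp: fAnd_def)
 thus "(op x y .: f) r"
  using fMem_eq_left[OF r(1) z(1) _ N(1) _ z(3)] fPair_iff[OF r(1) z(1) N(2,3)] N by simp
 qed
next
 assume "(op x y .: f) p"
 thus "fMaps f x y p"
 unfolding fMaps_def fEx_iff
 by (intro dense_below_here[OF p] bexI[of _ "op x y"] fAndI)
  (use fPair_iff N fEq_refl fMem_antimono p in auto)
qed

subsection \<open>Ordinals\<close>

lemma fSub_iff: "p:P==>(x .<= y) p <-> (ALL z:Nm. ALL q:P. q <~ p --> (z .: x) q --> (z .: y) q)"
 unfolding fSub_def fAll_def using fImpD[OF _ reg_fMem reg_fMem] fImpI[of p] by (metis (no_types, lifting))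

lemma reg_fSub [simp, intro]: "reg (x .<= y)"
 by (simp add: fSub_def)

lemma fEmpty_iff: "fEmpty x p <-> (ALL z:Nm. ALL q:P. q <~ p --> ~ (z .: x) q)"
 by (simp add: fEmpty_def fAll_def fNot_def)

lemma fOrd_iff:
 assumes p: "p:P"
 shows "fOrd x p <-> (ALL y:Nm. ALL q:P. q <~ p --> (y .: x) q -->
 (y .<= x) q & (ALL z:Nm. ALL r:P. r <~ q --> (z .: y) r --> (z .<= y) r))"
proof -
 have A: "(\<^bold>\<forall>y. y .: x .-> \<Psi> y) p <-> (ALL y:Nm. ALL q:P. q <~ p --> (y .: x) q --> \<Psi> y q)"
 if "!!y. y:Nm==>reg (\<Psi> y)" "p:P" for \<Psi> x p
 unfolding fAll_def using fImpD[OF _ reg_fMem that(1) that(2)] fImpI[of p] by (metis (no_types, lifting))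
 have B: "(\<^bold>\<forall>z. z .: y .-> z .<= y) q <-> (ALL z:Nm. ALL r:P. r <~ q --> (z .: y) r --> (z .<= y) r)"
 if "q:P" for y q by (rule A) (use that in auto)
 have "fOrd x p <-> (\<^bold>\<forall>y. y .: x .-> y .<= x) p & (\<^bold>\<forall>y. y .: x .-> (\<^bold>\<forall>z. z .: y .-> z .<= y)) p"
 by (simp add: fOrd_def fAnd_def)
 also have "\<dots> <-> (ALL y:Nm. ALL q:P. q <~ p --> (y .: x) q --> (y .<= x) q) &
  (ALL y:Nm. ALL q:P. q <~ p --> (y .: x) q --> (\<^bold>\<forall>z. z .: y .-> z .<= y) q)"
 using A[OF _ p, of "%y. y .<= x" x] A[OF _ p, of "%y. \<^bold>\<forall>z. z .: y .-> z .<= y" x] by simp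
 finally show ?thesis using B by auto
qed

lemma reg_fOrd [simp, intro]: "reg (fOrd x)"
 by (simp add: fOrd_def)

lemma fOrd_trans:
 assumes o: "fOrd x p" and q: "p:P" "q:P" "q <~ p" and N: "y:Nm" "z:Nm"
 and m: "(y .: x) q" "(z .: y) q"
 shows "(z .: x) q"
proof -
 have "(y .<= x) q"
 using o[unfolded fOrd_iff[OF q(1)], rule_format, OF N(1) q(2,3) m(1)] by (rule conjunct1)
 thus ?thesis using N(2) q(2) m(2) P_refl[OF q(2)] unfolding fSub_iff[OF q(2)] by blast
qed

lemma fOrd_mem:
 assumes o: "fOrd x p" and p: "p:P" and N: "y:Nm" and m: "(y .: x) p"
 shows "fOrd y p"
 unfolding fOrd_iff[OF p]
proof (intro ballI impI conjI)
 fix z q assume z: "z:Nm" "q:P" "q <~ p" "(z .: y) q"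
 have y: "(y .: x) q" using fMem_antimono[OF m p z(2,3)] .
 show "(z .<= y) q"
 using conjunct2[OF o[unfolded fOrd_iff[OF p], rule_format, OF N p P_refl[OF p] m]] z by blast
 have zx: "(z .: x) q" by (rule fOrd_trans[OF o p z(2,3) N z(1) y z(4)])
 fix w r assume "w:Nm" "r:P" "r <~ q" "(w .: z) r"
 thus "(w .<= z) r"
 using conjunct2[OF o[unfolded fOrd_iff[OF p], rule_format, OF z(1-3) zx]] by blast
qed

text \<open>The argument of \<open>vord_linear\<close> inside the forcing language; which of the
  three cases holds is decided only on a dense set.\<close>

lemma fOrd_linear:
 assumes "x:Nm" "y:Nm" "p:P" "fOrd x p" "fOrd y p"
 shows "dense_below (%r. (x .: y) r | (x .= y) r | (y .: x) r) p"
 using assms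
proof (induction x arbitrary: y p rule: dom_induct)
 case (step x)
 note outer = step
 from outer(3-6) show ?case
 proof (induction y arbitrary: p rule: dom_induct)
 case (step y)
 note p = step(3) and N = outer(2) step(2) and oo = step(4,5)
 show ?case
 proof (rule dense_belowI, rule ccontr)
  fix q assume q: "q:P" "q <~ p" and no: "~ (EX r:P. r <~ q & ((x .: y) r | (x .= y) r | (y .: x) r))"
  have no': False if "r:P" "r <~ q" "(x .: y) r | (x .= y) r | (y .: x) r" for r
  using no that by blast
  have oq: "fOrd x r" "fOrd y r" if "r:P" "r <~ q" for r
  using regD[OF reg_fOrd oo(1) p that(1)] regD[OF reg_fOrd oo(2) p that(1)] P_trans[OF that(1) q(1) p that(2) q(2)]
  by auto
  have "(x .= y) q"
  proof (rule fEq_extI[OF q(1) N])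
  fix z q' assume z: "z:Nm" "q':P" "q' <~ q" "(z .: x) q'"
  show "(z .: y) q'"
  proof (rule reg_dense[OF reg_fMem z(2)])
   fix q1 assume q1: "q1:P" "q1 <~ q'"
   obtain r s u where r: "r:P" "r <~ q1" "vpair s u:elts x" "r <~ u" "(z .= s) r"
   using fMemE[OF fMem_antimono[OF z(4,2) q1] q1(1)] by blast
   have rq: "r <~ q" using P_trans[OF r(1) q1(1) q(1) r(2) P_trans[OF q1(1) z(2) q(1) q1(2) z(3)]] .
   have s: "s:Nm" using name_parts[OF N(1) r(3)] by simp
   have sx: "(s .: x) r" by (rule fMemI[OF r(3,1) N(1) r(4)]) (use fEq_refl s in blast)
   have os: "fOrd s r" by (rule fOrd_mem[OF oq(1)[OF r(1) rq] r(1) s sx])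
   obtain r' where r': "r':P" "r' <~ r" "(s .: y) r' | (s .= y) r' | (y .: s) r'"
   using dense_here[OF outer(1)[OF r(3) s N(2) r(1) os oq(2)[OF r(1) rq]] r(1)] by blast
   have r'q: "r' <~ q" using P_trans[OF r'(1) r(1) q(1) r'(2) rq] .
   have sx': "(s .: x) r'" using fMem_antimono[OF sx r(1) r'(1,2)] .
   have "~ (s .= y) r'" using no'[OF r'(1) r'q] fMem_eq_left[OF r'(1) s N(2,1) _ sx'] by blast
   moreover have "~ (y .: s) r'"
   using no'[OF r'(1) r'q] fOrd_trans[OF oq(1)[OF r(1) rq] r(1) r'(1,2) s N(2) sx'] by blast
   ultimately have "(s .: y) r'" using r'(3) by blast
   hence "(z .: y) r'"
   using fMem_eq_left[OF r'(1) s z(1) N(2) fEq_sym[OF fEq_antimono[OF r(5) z(1) s r(1) r'(1,2)]]] by blast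
   thus "EX r:P. r <~ q1 & (z .: y) r" using r'(1) P_trans[OF r'(1) r(1) q1(1) r'(2) r(2)] by blast
  qed
  next
  fix z q' assume z: "z:Nm" "q':P" "q' <~ q" "(z .: y) q'"
  show "(z .: x) q'"
  proof (rule reg_dense[OF reg_fMem z(2)])
   fix q1 assume q1: "q1:P" "q1 <~ q'"
   obtain r s u where r: "r:P" "r <~ q1" "vpair s u:elts y" "r <~ u" "(z .= s) r"
   using fMemE[OF fMem_antimono[OF z(4,2) q1] q1(1)] by blast
   have rq: "r <~ q" using P_trans[OF r(1) q1(1) q(1) r(2) P_trans[OF q1(1) z(2) q(1) q1(2) z(3)]] .
   have s: "s:Nm" using name_parts[OF N(2) r(3)] by simp
   have sx: "(s .: y) r" by (rule fMemI[OF r(3,1) N(2) r(4)]) (use fEq_refl s in blast)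
   have os: "fOrd s r" by (rule fOrd_mem[OF oq(2)[OF r(1) rq] r(1) s sx])
   obtain r' where r': "r':P" "r' <~ r" "(x .: s) r' | (x .= s) r' | (s .: x) r'"
   using dense_here[OF step(1)[OF r(3) s r(1) oq(1)[OF r(1) rq] os] r(1)] by blast
   have r'q: "r' <~ q" using P_trans[OF r'(1) r(1) q(1) r'(2) rq] .
   have sx': "(s .: y) r'" using fMem_antimono[OF sx r(1) r'(1,2)] .
   have "~ (x .= s) r'" using no'[OF r'(1) r'q] fMem_eq_left[OF r'(1) s N(1,2) fEq_sym sx'] by blast
   moreover have "~ (x .: s) r'"
   using no'[OF r'(1) r'q] fOrd_trans[OF oq(2)[OF r(1) rq] r(1) r'(1,2) s N(1) sx'] by blast
   ultimately have "(s .: x) r'" using r'(3) by blast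
   hence "(z .: x) r'"
   using fMem_eq_left[OF r'(1) s z(1) N(1) fEq_sym[OF fEq_antimono[OF r(5) z(1) s r(1) r'(1,2)]]] by blast
   thus "EX r:P. r <~ q1 & (z .: x) r" using r'(1) P_trans[OF r'(1) r(1) q1(1) r'(2) r(2)] by blast
  qed
  qed
  thus False using no'[OF q(1) P_refl[OF q(1)]] by blast
 qed
 qed
qed

lemma mem_check_elim:
 "reg \<chi>==>(x .: ck b) p==>p:P ==>
 (!!r a. r:P==>r <~ p==>a:elts b==>(x .= ck a) r==>\<chi> r)==>\<chi> p"
 unfolding mem_check_iff by (erule (2) reg_elim) blast

lemma check_sub: "p:P==>elts a =< elts b==>(ck a .<= ck b) p"
 unfolding fSub_iff mem_check_iff dense_below_def by blast

lemma fSub_cong_left: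
 assumes "p:P" "x:Nm" "x':Nm" "(x .= x') p" "(x' .<= y) p"
 shows "(x .<= y) p"
 unfolding fSub_iff[OF assms(1)]
 using assms(5) fEq_mem_iff[OF _ assms(2,3)] fEq_antimono[OF assms(4,2,3,1)] unfolding fSub_iff[OF assms(1)] by blast

lemma fOrd_check:
 assumes p: "p:P" and a: "vord a"
 shows "fOrd (ck a) p"
 unfolding fOrd_iff[OF p]
proof (intro ballI impI)
 fix y q assume y: "y:Nm" "q:P" "q <~ p" "(y .: ck a) q"
 have sub: "(y .<= ck b) q" if y: "y:Nm" "q:P" "(y .: ck b) q" and b: "vord b" for y q b
 proof (rule mem_check_elim[OF reg_fSub y(3,2)])
 fix r c assume r: "r:P" "c:elts b" "(y .= ck c) r"
 thus "(y .<= ck b) r"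
  using check_sub[of r c b] vord_trans[OF b r(2)] by (intro fSub_cong_left[OF r(1) y(1) _ r(3)]) auto
 qed
 have "(z .<= y) r" if z: "z:Nm" "r:P" "r <~ q" "(z .: y) r" for z r
 proof (rule mem_check_elim[OF reg_fSub fMem_antimono[OF y(4,2) z(2,3)] z(2)])
 fix s c assume s: "s:P" "s <~ r" "c:elts a" "(y .= ck c) s"
 have "(z .: ck c) s"
  using fMem_eq_right[OF s(1) z(1) y(1) _ s(4)] fMem_antimono[OF z(4,2) s(1,2)] by simp
 hence "(z .<= ck c) s" using sub z(1) s vord_mem[OF a] by blast
 thus "(z .<= y) s"
  unfolding fSub_iff[OF s(1)] using fEq_mem_iff[OF _ y(1) check_name] fEq_antimono[OF s(4) y(1) check_name s(1)] by blast
 qed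
 thus "(y .<= ck a) q & (ALL z:Nm. ALL r:P. r <~ q --> (z .: y) r --> (z .<= y) r)"
 using sub[OF y(1,2,4) a] by blast
qed

text \<open>Forcing adds no ordinals. Otherwise, by linearity, some \<open>q\<close> would force the
  check names of all ordinals into \<open>x\<close>, and the ordinals could be listed by pairs in
  \<open>x\<close> and conditions, against Burali-Forti.\<close>

lemma fOrd_is_check:
 assumes x: "x:Nm" and p: "p:P" and o: "fOrd x p"
 shows "dense_below (%r. EX a. vord a & (x .= ck a) r) p"
proof (rule dense_belowI, rule ccontr)
 fix q assume q: "q:P" "q <~ p" and "~ (EX r:P. r <~ q & (EX a. vord a & (x .= ck a) r))"
 hence no: "~ (x .= ck a) r" if "r:P" "r <~ q" "vord a" for r a using that by blast
 have oq: "fOrd x q" using regD[OF reg_fOrd o p q] .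
 have mem: "(ck a .: x) q" if a: "vord a" for a
 proof (rule reg_elim[OF reg_fMem fOrd_linear[OF x check_name q(1) oq fOrd_check[OF q(1) a]] q(1)])
 fix r assume r: "r:P" "r <~ q" "(x .: ck a) r | (x .= ck a) r | (ck a .: x) r"
 have "~ (x .: ck a) r"
 proof
  assume "(x .: ck a) r"
  then obtain r' b where "r':P" "r' <~ r" "b:elts a" "(x .= ck b) r'"
  using dense_here[OF _ r(1)] unfolding mem_check_iff by blast
  thus False using no[of r' b] P_trans[OF _ r(1) q(1) _ r(2)] vord_mem[OF a] by blast
 qed
 thus "(ck a .: x) r" using r no a by blast
 qed
 \<comment> \<open>Recovers \<open>a\<close> from a pair and a condition: below one condition a name
   can equal the check name of at most one ordinal.\<close>
 define f where "f = (%(z, r). SOME a. EX s u. z = vpair s u & (ck a .= s) r)"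
 have "Collect vord =< (%(z, r). f (z, r)) ` (elts x \<times> P)"
 proof
 fix a :: 'v assume "a:Collect vord"
 then obtain r s u where r: "r:P" "vpair s u:elts x" "(ck a .= s) r"
  using fMemE[OF mem q(1)] by (metis mem_Collect_eq)
 have s: "s:Nm" using name_parts[OF x r(2)] by simp
 have "(ck (f (vpair s u, r)) .= s) r"
 proof -
  have "EX s' u'. vpair s u = vpair s' u' & (ck (f (vpair s u, r)) .= s') r"
  unfolding f_def prod.case by (rule someI[of _ a]) (use r in blast)
  thus ?thesis by auto
 qed
 hence "(ck a .= ck (f (vpair s u, r))) r"
  using fEq_trans[OF r(1) check_name s check_name r(3)] fEq_sym by blast
 hence "a = f (vpair s u, r)" using check_eq_iff[OF r(1)] by blast
 thus "a:(%(z, r). f (z, r)) ` (elts x \<times> P)" using r by auto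
 qed
 moreover have "small ((%(z, r). f (z, r)) ` (elts x \<times> P))"
 by (rule small_image2) (use P_small in auto)
 ultimately show False using not_small_vord small_subset by blast
qed

end

section \<open>Countable presentations\<close>

definition unit_vec :: "'r ring => 'i => 'i => 'r" where
 "unit_vec R k = (%i. if i = k then \<one>\<^bsub>R\<^esub> else 0[R])"

lemma free_module_carrier:
 "d:carrier (free_module R I) <->
 (ALL i. d i:carrier R) & (ALL i. i \<notin> I --> d i = 0[R]) & finite {i. d i ~= 0[R]}"
 by (simp add: free_module_def)

lemma lmod_free_module:
 assumes "ring R"
 shows "lmod R (free_module R I)"
proof -
 interpret ring R by (rule assms)
 let ?F = "free_module R I"
 have add: "c +[?F] d = (%i. c i +[R] d i)" "r *[?F] c = (%i. r \<otimes>\<^bsub>R\<^esub> c i)" "0[?F] = (%i. 0[R])" for r c d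
 by (simp_all add: free_module_def)
 have fin: "finite {i. c i +[R] d i ~= 0[R]}" if "finite {i. c i ~= 0[R]}" "finite {i. d i ~= 0[R]}" for c d
 by (rule finite_subset[of _ "{i. c i ~= 0[R]} Un {i. d i ~= 0[R]}"]) (use that in auto)
 have fin': "finite {i. r \<otimes>\<^bsub>R\<^esub> d i ~= 0[R]}" if "finite {i. d i ~= 0[R]}" "r:carrier R" for r d
 by (rule finite_subset[OF _ that(1)]) (use that in auto)
 have "abelian_group ?F"
 proof (rule abelian_groupI)
 fix c assume c: "c:carrier ?F"
 have "(%i. \<ominus>\<^bsub>R\<^esub> c i):carrier ?F"
  using c finite_subset[of "{i. \<ominus>\<^bsub>R\<^esub> c i ~= 0[R]}" "{i. c i ~= 0[R]}"] unfolding free_module_carrier by auto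
 thus "EX d:carrier ?F. d +[?F] c = 0[?F]"
  using c by (intro bexI[of _ "%i. \<ominus>\<^bsub>R\<^esub> c i"]) (auto simp: add free_module_carrier l_neg)
 qed (auto simp: add free_module_carrier fin a_ac)
 thus ?thesis
 by (auto simp: lmod_def lmodule_def lmodule_axioms_def assms add free_module_carrier fin fin'
  l_distr r_distr m_assoc)
qed

lemma unit_vec_free: "ring R==>k:I==>unit_vec R k:carrier (free_module R I)"
proof -
 assume "ring R" "k:I"
 then interpret ring R by simp
 show ?thesis
 using \<open>k:I\<close> finite_subset[of "{i. unit_vec R k i ~= 0[R]}" "{k}"]
 by (auto simp: free_module_carrier unit_vec_def)
qed

text \<open>Induction on a finite set containing the support: clear one coordinate and add a
  multiple of a unit vector.\<close>

lemma free_module_generated: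
 assumes ring: "ring R" and U: "submodule U R (free_module R I)" and e: "!!k. k:I==>unit_vec R k:U"
 shows "carrier (free_module R I) =< U"
proof -
 interpret ring R by (rule ring)
 interpret F: lmod R "free_module R I" by (rule lmod_free_module[OF ring])
 note U' = F.submoduleD[OF U]
 have *: "d:U" if "finite S" "d:carrier (free_module R I)" "{i. d i ~= 0[R]} =< S" for S d
 using that
 proof (induction S arbitrary: d rule: finite_induct)
 case empty
 hence "d = 0[free_module R I]" by (auto simp: free_module_def)
 thus ?case using U'(2) by simp
 next
 case (insert k S)
 show ?case
 proof (cases "k:I")
  case False
  hence "d k = 0[R]" using insert.prems by (simp add: free_module_carrier)
  thus ?thesis using insert.prems by (intro insert.IH) auto
 next
  case True
  let ?d = "d(k := 0[R])"
  have d: "!!i. d i:carrier R" using insert.prems by (simp add: free_module_carrier)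
  have "finite {i. ?d i ~= 0[R]}"
  by (rule finite_subset[of _ "{i. d i ~= 0[R]}"]) (use insert.prems in \<open>auto simp: free_module_carrier\<close>)
  hence "?d:carrier (free_module R I)"
  using insert.prems unfolding free_module_carrier by simp
  hence "?d:U" by (rule insert.IH) (use insert.prems in auto)
  moreover have "d = ?d +[free_module R I] d k *[free_module R I] unit_vec R k"
  using d by (auto simp: free_module_def unit_vec_def fun_eq_iff)
  ultimately show ?thesis using U'(3,4) e[OF True] d by metis
 qed
 qed
 show ?thesis using * by (auto simp: free_module_carrier)
qed

lemma (in lmod_hom) span_image:
 assumes "B =< U"
 shows "N.span (h ` B) = h ` M.span B"
proof
 have BM: "B =< carrier M" using assms M.submoduleD(1)[OF U] by blast
 have sp: "M.span B =< U" by (rule M.span_minimal[OF U assms])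
 show "N.span (h ` B) =< h ` M.span B"
 using N.span_minimal[OF submodule_image[OF M.submodule_span[OF BM] sp]] M.span_superset by (simp add: image_mono)
 have "h ` B =< carrier N" using hom_closed assms by blast
 hence "M.span B =< {x:U. h x:N.span (h ` B)}"
 using N.span_superset[of "h ` B"] assms by (intro M.span_minimal submodule_preimage N.submodule_span) auto
 thus "h ` M.span B =< N.span (h ` B)" by blast
qed

context lmod
begin

definition lincomb :: "('i => 'm) => ('i => 'r) => 'm" where
 "lincomb u d = finsum M (%k. d k *[M] u k) {k. d k ~= 0[R]}"

context
 fixes u :: "'i => 'm"
 assumes u: "!!k. u k:carrier M"
begin

lemma lincomb_superset:
 assumes "finite S" "{k. d k ~= 0[R]} =< S" "!!k. d k:carrier R"
 shows "lincomb u d = finsum M (%k. d k *[M] u k) S"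
 unfolding lincomb_def
 by (rule M.add.finprod_mono_neutral_cong_left) (use assms u in \<open>auto simp: zero_smult smult_closed\<close>)

lemma smult_finsum:
 assumes "finite S" "f:S \<rightarrow> carrier M" "r:carrier R"
 shows "r *[M] finsum M f S = finsum M (%k. r *[M] f k) S"
 using assms(1,2)
proof (induction S rule: finite_induct)
 case (insert k S)
 hence f: "f:S \<rightarrow> carrier M" "f k:carrier M" by auto
 thus ?case
 using insert assms(3) smult_closed by (simp add: M.finsum_insert smult_r_distr Pi_iff)
qed (simp add: smult_zero assms(3))

lemma lincomb_hom: "lmod_hom R (free_module R I) M (carrier (free_module R I)) (lincomb u)"
proof -
 let ?F = "free_module R I"
 interpret F: lmod R ?F by (rule lmod_free_module[OF R.ring_axioms])
 have "mod_hom R (submodule_of ?F (carrier ?F)) M (lincomb u)"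
 unfolding mod_hom_submodule_of
 proof (intro conjI ballI)
 fix c assume c: "c:carrier ?F"
 hence c': "!!k. c k:carrier R" "finite {k. c k ~= 0[R]}" by (auto simp: free_module_carrier)
 show "lincomb u c:carrier M"
  unfolding lincomb_def by (rule M.finsum_closed) (use c' u smult_closed in auto)
 show "lincomb u (r *[?F] c) = r *[M] lincomb u c" if r: "r:carrier R" for r
 proof -
  have "lincomb u (r *[?F] c) = finsum M (%k. (r \<otimes>\<^bsub>R\<^esub> c k) *[M] u k) {k. c k ~= 0[R]}"
  by (subst lincomb_superset[OF c'(2)]) (use c' r in \<open>auto simp: free_module_def\<close>)
  also have "\<dots> = finsum M (%k. r *[M] (c k *[M] u k)) {k. c k ~= 0[R]}"
  by (rule M.finsum_cong') (use c' r u smult_closed smult_assoc in auto)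
  also have "\<dots> = r *[M] lincomb u c"
  unfolding lincomb_def by (rule smult_finsum[symmetric]) (use c' r u smult_closed in auto)
  finally show ?thesis .
 qed
 fix d assume d: "d:carrier ?F"
 hence d': "!!k. d k:carrier R" "finite {k. d k ~= 0[R]}" by (auto simp: free_module_carrier)
 let ?S = "{k. c k ~= 0[R]} Un {k. d k ~= 0[R]}"
 have "lincomb u (c +[?F] d) = finsum M (%k. (c k +[R] d k) *[M] u k) ?S"
  by (subst lincomb_superset[of ?S]) (use c' d' in \<open>auto simp: free_module_def\<close>)
 also have "\<dots> = finsum M (%k. c k *[M] u k +[M] d k *[M] u k) ?S"
  by (rule M.finsum_cong') (use c' d' u smult_closed smult_l_distr in auto)
 also have "\<dots> = finsum M (%k. c k *[M] u k) ?S +[M] finsum M (%k. d k *[M] u k) ?S"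
  by (rule M.finsum_addf) (use c' d' u smult_closed in auto)
 also have "\<dots> = lincomb u c +[M] lincomb u d"
  using lincomb_superset[of ?S c] lincomb_superset[of ?S d] c' d' by simp
 finally show "lincomb u (c +[?F] d) = lincomb u c +[M] lincomb u d" .
 qed
 thus ?thesis
 by (simp add: lmod_hom_def lmod_hom_axioms_def lmod_axioms F.lmod_axioms F.submodule_carrier)
qed

lemma lincomb_unit_vec: "lincomb u (unit_vec R k) = u k"
proof -
 have "lincomb u (unit_vec R k) = finsum M (%i. unit_vec R k i *[M] u i) {k}"
 by (rule lincomb_superset) (auto simp: unit_vec_def)
 thus ?thesis using u by (simp add: M.finsum_insert unit_vec_def smult_one)
qed

end

text \<open>
 The submodule \<open>D\<close> of \<open>M \<times> N\<close> generated by the pairs \<open>(u k, e k)\<close>, for generators \<open>e k\<close> of \<open>N\<close>; the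
 elements \<open>Zs\<close> are the values in \<open>M\<close> of the relations between them.
\<close>

definition pres_graph ::
 "('r, 'n) module => nat set => (nat => 'n) => (nat => 'm) => ('m \<times> 'n) set => 'm set => bool" where
 "pres_graph N I e u D Zs <-> countable Zs & Zs =< carrier M & D =< carrier M \<times> carrier N &
  fst ` D = span (u ` I) & snd ` D = carrier N & (ALL t. (t, 0[N]):D <-> t:span Zs) &
  (ALL a b c d. (a, b):D & (c, d):D --> (a +[M] c, b +[N] d):D) &
  (ALL r a b. r:carrier R & (a, b):D --> (r *[M] a, r *[N] b):D) &
  (ALL G. (0[M], 0[N]):G & (ALL a b c d. (a, b):G & (c, d):G --> (a +[M] c, b +[N] d):G) &
   (ALL r a b. r:carrier R & (a, b):G --> (r *[M] a, r *[N] b):G) &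
   (ALL k:I. (u k, e k):G) --> D =< G)"

text \<open>\<open>I\<close> and \<open>e\<close> are obtained before \<open>u\<close> is given,
  because the elements \<open>u k\<close> of \<open>M\<close> are found only later, along a
  descending sequence that runs through the generators \<open>e k\<close>.\<close>

lemma presentation_graph:
 assumes N: "lmod R N" and cp: "countably_presented R N"
 obtains I :: "nat set" and e where "!!k. k:I==>e k:carrier N"
 "!!u. (!!k. u k:carrier M)==>EX D Zs. pres_graph N I e u D Zs"
proof -
 obtain I :: "nat set" and h B where h: "mod_hom R (free_module R I) N h" "h ` carrier (free_module R I) = carrier N"
 "countable B" "B =< carrier (free_module R I)"
 "{c:carrier (free_module R I). h c = 0[N]} = mod_span R (free_module R I) B"
 using cp unfolding countably_presented_def Let_def by blast
 let ?F = "free_module R I"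
 interpret F: lmod R ?F by (rule lmod_free_module[OF R.ring_axioms])
 interpret h: lmod_hom R ?F N "carrier ?F" h
 using h(1) by (simp add: lmod_hom_def lmod_hom_axioms_def N F.lmod_axioms F.submodule_carrier mod_hom_def)
 have uv: "unit_vec R k:carrier ?F" if "k:I" for k by (rule unit_vec_free[OF R.ring_axioms that])
 show ?thesis
 proof (rule that[of I "%k. h (unit_vec R k)"])
 show "h (unit_vec R k):carrier N" if "k:I" for k using h.hom_closed uv that by blast
 fix u :: "nat => 'm" assume u: "!!k. u k:carrier M"
 interpret l: lmod_hom R ?F M "carrier ?F" "lincomb u" by (rule lincomb_hom[OF u])
 \<comment> \<open>The image of the free module under the linear combinations of the
   \<open>u k\<close> paired with the presentation \<open>h\<close>. The relations \<open>B\<close>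
   generate the kernel of \<open>h\<close>, so their values in \<open>M\<close> generate the
   elements paired with zero.\<close>
 define D where "D = (%d. (lincomb u d, h d)) ` carrier ?F"
 define Zs where "Zs = lincomb u ` B"
 have "countable Zs" "Zs =< carrier M" "D =< carrier M \<times> carrier N"
  using h(3,4) l.hom_closed h.hom_closed by (auto simp: Zs_def D_def)
 moreover have "snd ` D = carrier N" using h(2) by (simp add: D_def image_image)
 moreover have "fst ` D = span (u ` I)"
 proof -
  have "carrier ?F = F.span (unit_vec R ` I)"
  using free_module_generated[OF R.ring_axioms F.submodule_span[of "unit_vec R ` I"]] F.span_superset[of "unit_vec R ` I"]
   F.span_minimal[OF F.submodule_carrier] uv by blast
  hence "fst ` D = lincomb u ` F.span (unit_vec R ` I)" by (simp add: D_def image_image)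
  also have "\<dots> = span (lincomb u ` unit_vec R ` I)" using l.span_image[of "unit_vec R ` I"] uv by auto
  also have "lincomb u ` unit_vec R ` I = u ` I" using lincomb_unit_vec[of u] u by (simp add: image_image)
  finally show ?thesis .
 qed
 moreover have "(t, 0[N]):D <-> t:span Zs" for t
 proof -
  have "(t, 0[N]):D <-> t:lincomb u ` {c:carrier ?F. h c = 0[N]}" by (auto simp: D_def)
  also have "{c:carrier ?F. h c = 0[N]} = F.span B" using h(5) by (simp add: F.span_def)
  also have "lincomb u ` F.span B = span Zs" unfolding Zs_def by (rule l.span_image[OF h(4), symmetric])
  finally show ?thesis .
 qed
 moreover have "(a +[M] c, b +[N] d):D" if ab: "(a, b):D" "(c, d):D" for a b c d
 proof -
  obtain x y where x: "x:carrier ?F" "(a, b) = (lincomb u x, h x)"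
  and y: "y:carrier ?F" "(c, d) = (lincomb u y, h y)"
  using ab by (auto simp: D_def)
  thus ?thesis
  unfolding D_def using l.hom_add[of x y] h.hom_add[of x y]
  by (intro image_eqI[of _ _ "x +[?F] y"]) auto
 qed
 moreover have "(r *[M] a, r *[N] b):D" if ab: "r:carrier R" "(a, b):D" for r a b
 proof -
  obtain x where x: "x:carrier ?F" "(a, b) = (lincomb u x, h x)"
  using ab by (auto simp: D_def)
  thus ?thesis
  unfolding D_def using l.hom_smult[of r x] h.hom_smult[of r x] ab(1) F.smult_closed[of r x]
  by (intro image_eqI[of _ _ "r *[?F] x"]) auto
 qed
 moreover have "D =< G"
  if G: "(0[M], 0[N]):G" "!!a b c d. (a, b):G & (c, d):G --> (a +[M] c, b +[N] d):G"
  "!!r a b. r:carrier R & (a, b):G --> (r *[M] a, r *[N] b):G"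
  "!!k. k:I==>(u k, h (unit_vec R k)):G" for G
 proof -
  have "submodule {d:carrier ?F. (lincomb u d, h d):G} R ?F"
  unfolding F.submodule_iff using G(1-3) l.hom_zero h.hom_zero l.hom_add h.hom_add l.hom_smult h.hom_smult F.smult_closed
  by auto
  hence "carrier ?F =< {d:carrier ?F. (lincomb u d, h d):G}"
  by (rule free_module_generated[OF R.ring_axioms]) (use uv G(4) lincomb_unit_vec[of u] u in auto)
  thus ?thesis by (auto simp: D_def)
 qed
 ultimately have "pres_graph N I (%k. h (unit_vec R k)) u D Zs"
  unfolding pres_graph_def by - (intro conjI allI impI; (simp; fail | blast))
 thus "EX D Zs. pres_graph N I (%k. h (unit_vec R k)) u D Zs" by blast
 qed
qed

text \<open>\<open>H m n p\<close> is to be read: \<open>p\<close> forces a surjection of the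
  submodule \<open>HB\<close> onto \<open>N\<close>, with kernel \<open>HA\<close>, to map
  \<open>m\<close> to \<open>n\<close>. It suffices to decide preimages of countably many generators
  of \<open>N\<close>; the countably many relations between these generators then give
  \<open>Zs\<close>.\<close>

lemma forced_block:
 fixes P :: "'p set" and le :: "'p => 'p => bool" (infix "<~" 50)
 and HA HB :: "'m => 'p => bool" and H :: "'m => 'n => 'p => bool"
 assumes N: "lmod R N" "countably_presented R N" and p: "p:P"
 and refl: "!!p. p:P==>p <~ p"
 and trans: "!!p q r. [|p:P; q:P; r:P; p <~ q; q <~ r|]==>p <~ r"
 and sigma: "!!s. (!!n :: nat. s n:P & s (Suc n) <~ s n)==>EX q:P. ALL n. q <~ s n"
 and H_mono: "!!m n p q. [|H m n p; p:P; q:P; q <~ p|]==>H m n q"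
 and H_carrier: "!!m n p. [|H m n p; p:P|]==>m:carrier M & n:carrier N & HB m p"
 and H_total: "!!m p. [|m:carrier M; HB m p; p:P|]==>EX q:P. q <~ p & (EX n. H m n q)"
 and H_surj: "!!n p. [|n:carrier N; p:P|]==>EX q:P. q <~ p & (EX m. H m n q)"
 and H_zero: "!!p. p:P==>H 0[M] 0[N] p"
 and H_add: "!!m n m' n' p. [|H m n p; H m' n' p; p:P|]==>H (m +[M] m') (n +[N] n') p"
 and H_smult: "!!r m n p. [|r:carrier R; H m n p; p:P|]==>H (r *[M] m) (r *[N] n) p"
 and H_fun: "!!m n n' p. [|H m n p; H m n' p; p:P|]==>n = n'"
 and H_ker: "!!m p. [|m:carrier M; p:P|]==>H m 0[N] p <-> HA m p"
 shows "EX r:P. r <~ p & (EX E Zs. countable E & countable Zs & E =< carrier M & Zs =< carrier M &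
  sq R M (span Zs) (span E) N & (ALL e:E. HB e r) & (ALL z:Zs. HA z r) &
  (ALL q:P. ALL m':carrier M. q <~ r & HB m' q -->
   (EX q':P. q' <~ q & (EX a:carrier M. HA a q' & m' \<ominus>\<^bsub>M\<^esub> a:span E))) &
  (ALL q:P. ALL t:span E. q <~ r & HA t q --> t:span Zs))"
proof -
 interpret N: lmod R N by (rule N(1))
 obtain I :: "nat set" and e where e: "!!k. k:I==>e k:carrier N"
 and graph: "!!u. (!!k. u k:carrier M)==>EX D Zs. pres_graph N I e u D Zs"
 using presentation_graph[OF N] by metis
 have "EX q m. q:P & q <~ p & m:carrier M & (k:I --> H m (e k) q)" if "p:P" for p k
 using H_surj[OF e that] H_carrier refl[OF that] that M.zero_closed by (cases "k:I") blast+
 then obtain f g where fg: "!!p k. p:P==>f p k:P & f p k <~ p & g p k:carrier M & (k:I --> H (g p k) (e k) (f p k))"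
 by metis
 \<comment> \<open>At stage \<open>k\<close> the condition is strengthened so that it decides a
   preimage of the generator number \<open>k\<close>.\<close>
 define s where "s = rec_nat p (%k p. f p k)"
 have s: "s 0 = p" "s (Suc k) = f (s k) k" for k by (simp_all add: s_def)
 have sP: "s k:P" for k by (induction k) (use p fg s in auto)
 then obtain r where r: "r:P" "!!k. r <~ s k" using sigma[of s] fg s by metis
 define u where "u k = g (s k) k" for k
 have u: "u k:carrier M" for k using fg sP by (simp add: u_def)
 have Hu: "H (u k) (e k) r" if "k:I" for k
 using H_mono[OF _ sP r(1) r(2)[of "Suc k"]] fg[OF sP] that by (simp add: u_def s)
 obtain D Zs where graph_D: "pres_graph N I e u D Zs" using graph[of u, OF u] by blast
 have D: "countable Zs" "Zs =< carrier M" "D =< carrier M \<times> carrier N" "fst ` D = span (u ` I)"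
  "snd ` D = carrier N" "!!t. (t, 0[N]):D <-> t:span Zs"
 and Dadd: "!!a b c d. (a, b):D==>(c, d):D==>(a +[M] c, b +[N] d):D"
 and Dsmult: "!!r a b. r:carrier R==>(a, b):D==>(r *[M] a, r *[N] b):D"
 and Dmin: "!!G. (0[M], 0[N]):G & (ALL a b c d. (a, b):G & (c, d):G --> (a +[M] c, b +[N] d):G) &
   (ALL r a b. r:carrier R & (a, b):G --> (r *[M] a, r *[N] b):G) &
   (ALL k:I. (u k, e k):G)==>D =< G"
 using graph_D unfolding pres_graph_def by simp_all
 have DH: "H t n r" if "(t, n):D" for t n
 proof -
 have "D =< {(t, n). H t n r}"
  by (rule Dmin) (use H_zero H_add H_smult Hu r(1) in auto)
 thus ?thesis using that by blast
 qed
 let ?E = "u ` I"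
 have EM: "?E =< carrier M" using u by auto
 \<comment> \<open>The graph is that of a function, because the forced relation \<open>H\<close> is
   functional and contains it at \<open>r\<close>.\<close>
 define k where "k t = (THE n. (t, n):D)" for t
 have k: "k t = n" if "(t, n):D" for t n
 unfolding k_def using that H_fun[OF DH DH r(1)] by blast
 have k_D: "(t, k t):D" if "t:span ?E" for t
 using that k unfolding D(4)[symmetric] by auto
 have kN: "k t:carrier N" if "t:span ?E" for t
 using k_D[OF that] D(3) by blast
 have sq: "sq R M (span Zs) (span ?E) N"
 unfolding sq_def
 proof (intro exI conjI)
 show "mod_hom R (submodule_of M (span ?E)) N k"
  unfolding mod_hom_submodule_of
  using k[OF Dadd[OF k_D k_D]] k[OF Dsmult[OF _ k_D]] kN by auto
 show "k ` span ?E = carrier N"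
 proof
  show "k ` span ?E =< carrier N" using kN by auto
  show "carrier N =< k ` span ?E"
  proof
  fix n assume "n:carrier N"
  then obtain t where t: "(t, n):D" using D(5) by force
  hence "t:span ?E" using D(4) by force
  thus "n:k ` span ?E" using k[OF t] by blast
  qed
 qed
 show "{x:span ?E. k x = 0[N]} = span Zs"
 proof (intro equalityI subsetI)
  fix x assume x: "x:span Zs"
  hence "(x, 0[N]):D" using D(6) by blast
  moreover from this have "x:span ?E" using D(4) by force
  ultimately show "x:{x:span ?E. k x = 0[N]}" using k by blast
 next
  fix x assume "x:{x:span ?E. k x = 0[N]}"
  thus "x:span Zs" using k_D[of x] D(6) by auto
 qed
 qed
 have HB: "HB e' r" if "e':?E" for e' using that Hu H_carrier r(1) by blast
 have HA: "HA z r" if "z:Zs" for z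
 using DH D(6) span_superset[of Zs] H_ker[OF _ r(1)] D(2) that by blast
 have cover: "EX q':P. q' <~ q & (EX a:carrier M. HA a q' & m' \<ominus>\<^bsub>M\<^esub> a:span ?E)"
 if q: "q:P" "m':carrier M" "q <~ r" "HB m' q" for q m'
 proof -
 obtain q' n where q': "q':P" "q' <~ q" "H m' n q'" using H_total[OF q(2,4,1)] by blast
 have n: "n:carrier N" using H_carrier q' by blast
 then obtain t where t: "(t, n):D" using D(5) by force
 have tE: "t:span ?E" "t:carrier M" using t D(3,4) by force+
 have "q' <~ r" using trans[OF q'(1) q(1) r(1) q'(2) q(3)] .
 hence "H t n q'" using H_mono[OF DH[OF t] r(1) q'(1)] by blast
 \<comment> \<open>\<open>t\<close> is an element of the span with the same image as
   \<open>m'\<close>; the difference is mapped to zero and so is forced into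
   \<open>HA\<close>.\<close>
 hence "H ((\<ominus>\<^bsub>R\<^esub> \<one>\<^bsub>R\<^esub>) *[M] t) ((\<ominus>\<^bsub>R\<^esub> \<one>\<^bsub>R\<^esub>) *[N] n) q'" by (intro H_smult q'(1)) auto
 hence "H (m' \<ominus>\<^bsub>M\<^esub> t) (n \<ominus>\<^bsub>N\<^esub> n) q'"
  using H_add[OF q'(3) _ q'(1)] minus_one_smult[OF tE(2)] N.minus_one_smult[OF n] by (simp add: a_minus_def)
 hence "HA (m' \<ominus>\<^bsub>M\<^esub> t) q'" using N.diff_self[OF n] H_ker[of "m' \<ominus>\<^bsub>M\<^esub> t"] q(2) tE q'(1) by simp
 moreover have "m' \<ominus>\<^bsub>M\<^esub> (m' \<ominus>\<^bsub>M\<^esub> t) = t"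
  using add_diff_cancel[of t "m' \<ominus>\<^bsub>M\<^esub> t"] diff_add_cancel[of m' t] q(2) tE(2) by (simp add: M.a_comm)
 ultimately show ?thesis using q' tE q(2) by (intro bexI[of _ q'] conjI bexI[of _ "m' \<ominus>\<^bsub>M\<^esub> t"]) auto
 qed
 have "t:span Zs" if q: "q:P" "t:span ?E" "q <~ r" "HA t q" for q t
 proof -
 have "t:carrier M" using k_D[OF q(2)] D(3) by blast
 hence "H t 0[N] q" using H_ker[OF _ q(1)] q(4) by blast
 moreover have "H t (k t) q" using H_mono[OF DH[OF k_D[OF q(2)]] r(1) q(1,3)] .
 ultimately have "k t = 0[N]" using H_fun q(1) by blast
 thus ?thesis using k_D[OF q(2)] D(6) by simp
 qed
 thus ?thesis
 using r(1) r(2)[of 0] s(1) sq HB HA cover D(1,2) EM by (intro bexI[of _ r] conjI exI[of _ ?E] exI[of _ Zs]) auto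
qed

end

section \<open>Filtrations in the generic extension\<close>

context forcing_poset
begin

lemma fAllD: "fAll A \<Phi> p==>x:A==>\<Phi> x p"
 by (simp add: fAll_def)

lemma fAndD1: "(\<phi> .& \<psi>) p==>\<phi> p" and fAndD2: "(\<phi> .& \<psi>) p==>\<psi> p"
 by (simp_all add: fAnd_def)

lemma Gr_check:
 assumes p: "p:P"
 shows "Gr Q (map (check P) vs) p <-> vs:Q"
proof -
 have "list_all2 (%x v. (x .= ck v) r) (map (check P) vs) ws <-> ws = vs" if "r:P" for r ws
 using that by (auto simp: list_all2_conv_all_nth check_eq_iff intro: nth_equalityI)
 hence "Gr Q (map (check P) vs) p <-> dense_below (%r. vs:Q) p"
 unfolding Gr_def by (intro dense_below_cong) auto
 thus ?thesis using p P_refl by (auto simp: dense_below_def)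
qed

lemma fCarrier_check: "p:P==>fCarrier M (ck a) p <-> a:carrier M"
 and fZero_check: "p:P==>fZero M (ck a) p <-> a = 0[M]"
 and fAdd_check: "p:P==>fAdd M (ck a) (ck b) (ck c) p <-> a:carrier M & b:carrier M & c = a +[M] b"
 and fMinus_check: "p:P==>fMinus M (ck a) (ck b) p <-> a:carrier M & b = \<ominus>\<^bsub>M\<^esub> a"
 and fSmult_check: "p:P==>fSmult M r (ck a) (ck b) p <-> a:carrier M & b = r *[M] a"
 using Gr_check[of p "{[a] |a. a:carrier M}" "[a]"] Gr_check[of p "{[0[M]]}" "[a]"]
 Gr_check[of p "{[a, b, a +[M] b] |a b. a:carrier M & b:carrier M}" "[a, b, c]"]
 Gr_check[of p "{[a, \<ominus>\<^bsub>M\<^esub> a] |a. a:carrier M}" "[a, b]"]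
 Gr_check[of p "{[a, r *[M] a] |a. a:carrier M}" "[a, b]"]
 by (auto simp: fCarrier_def fZero_def fAdd_def fMinus_def fSmult_def)

lemma fCarrier_iff: "fCarrier M x p <-> dense_below (%r. EX a:carrier M. (x .= ck a) r) p"
 unfolding fCarrier_def Gr_def by (rule dense_below_cong) auto

lemma fZero_iff: "fZero M x p <-> dense_below (%r. (x .= ck 0[M]) r) p"
 unfolding fZero_def Gr_def by (rule dense_below_cong) auto

lemma fAdd_iff: "fAdd M x y z p <-> dense_below (%r. EX a:carrier M. EX b:carrier M.
 (x .= ck a) r & (y .= ck b) r & (z .= ck (a +[M] b)) r) p"
 unfolding fAdd_def Gr_def by (rule dense_below_cong) fastforce

lemma fMinus_iff: "fMinus M x y p <-> dense_below (%r. EX a:carrier M.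
 (x .= ck a) r & (y .= ck (\<ominus>\<^bsub>M\<^esub> a)) r) p"
 unfolding fMinus_def Gr_def by (rule dense_below_cong) fastforce

lemma fSmult_iff: "fSmult M s x y p <-> dense_below (%r. EX a:carrier M.
 (x .= ck a) r & (y .= ck (s *[M] a)) r) p"
 unfolding fSmult_def Gr_def by (rule dense_below_cong) fastforce

lemma reg_ground [simp, intro]:
 "reg (fCarrier M x)" "reg (fZero M x)" "reg (fAdd M x y z)" "reg (fMinus M x y)" "reg (fSmult M s x y)"
 by (simp_all add: fCarrier_def fZero_def fAdd_def fMinus_def fSmult_def)

lemma reg_fEmpty [simp, intro]: "reg (fEmpty x)"
 by (simp add: fEmpty_def)

lemma reg_fPair [simp]: "x:Nm==>y:Nm==>reg (fPair z x y)"
 by (simp add: fPair_def reg_fEq)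

lemma reg_fMaps [simp]: "x:Nm==>y:Nm==>reg (fMaps f x y)"
 by (simp add: fMaps_def)

lemma reg_fSubmodule [simp, intro]: "reg (fSubmodule R M A)"
 by (simp add: fSubmodule_def)

lemma reg_fCoset [simp]: "reg (fCoset M A x X)"
 by (simp add: fCoset_def)

lemma reg_fSucc [simp]: "i:Nm==>reg (fSucc i j)"
 by (simp add: fSucc_def reg_fEq)

lemma reg_fLimit [simp]: "reg (fLimit i)"
 by (simp add: fLimit_def)

text \<open>The instance of a forced implication under universal quantifiers.\<close>

lemma fSubmodule_ground:
 assumes M: "lmod R M" and q: "q:P" and A: "A:Nm" and s: "fSubmodule R M A q"
 shows "submodule {m:carrier M. (ck m .: A) q} R M"
 and "!!x r. x:Nm==>r:P==>r <~ q==>(x .: A) r==>fCarrier M x r"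
proof -
 interpret lmod R M by (rule M)
 from s have c: "(\<^bold>\<forall>x. x .: A .-> fCarrier M x) q"
 and z: "(\<^bold>\<forall>x. fZero M x .-> x .: A) q"
 and a: "(\<^bold>\<forall>x. \<^bold>\<forall>y. \<^bold>\<forall>z. (x .: A .& y .: A .& fAdd M x y z) .-> z .: A) q"
 and sm: "fAll (carrier R) (%r. \<^bold>\<forall>x. \<^bold>\<forall>y. (x .: A .& fSmult M r x y) .-> y .: A) q"
 unfolding fSubmodule_def by (blast dest: fAndD1 fAndD2)+
 note hr = P_refl[OF q]
 show "fCarrier M x r" if "x:Nm" "r:P" "r <~ q" "(x .: A) r" for x r
 by (rule fImpD[OF fAllD[OF c that(1)] _ _ q that(2,3,4)]) auto
 have "(ck 0[M] .: A) q"
 by (rule fImpD[OF fAllD[OF z] _ _ q q hr]) (auto simp: fZero_check q)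
 moreover have "(ck (x +[M] y) .: A) q"
 if "x:carrier M" "y:carrier M" "(ck x .: A) q" "(ck y .: A) q" for x y
 by (rule fImpD[OF fAllD[OF fAllD[OF fAllD[OF a]]] _ _ q q hr, of "ck x" "ck y"])
  (use that in \<open>auto simp: fAnd_def fAdd_check q\<close>)
 moreover have "(ck (r *[M] x) .: A) q"
 if "r:carrier R" "x:carrier M" "(ck x .: A) q" for x r
 by (rule fImpD[OF fAllD[OF fAllD[OF fAllD[OF sm that(1)]]] _ _ q q hr, of "ck x"])
  (use that in \<open>auto simp: fAnd_def fSmult_check q\<close>)
 ultimately show "submodule {m:carrier M. (ck m .: A) q} R M"
 by (auto simp: submodule_iff smult_closed)
qed

lemma fFunD:
 assumes f: "fFun D f p" and N: "f:Nm" and p: "p:P" and D: "!!x. x:Nm==>reg (D x)"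
 shows "!!x y q. x:Nm==>y:Nm==>q:P==>q <~ p==>(op x y .: f) q ==>
  EX r:P. r <~ q & (EX x':Nm. D x' r & (x .= x') r)"
 and "!!x q. x:Nm==>q:P==>q <~ p==>D x q==>EX r:P. r <~ q & (EX y:Nm. (op x y .: f) r)"
 and "!!x y y' q. x:Nm==>y:Nm==>y':Nm==>q:P==>q <~ p==>(op x y .: f) q ==>
  (op x y' .: f) q==>(y .= y') q"
proof -
 from f have a: "(\<^bold>\<forall>z. z .: f .-> (\<^bold>\<exists>x. D x .& (\<^bold>\<exists>y. fPair z x y))) p"
 and b: "(\<^bold>\<forall>x. D x .-> (\<^bold>\<exists>y. fMaps f x y)) p"
 and c: "(\<^bold>\<forall>x. \<^bold>\<forall>y. \<^bold>\<forall>y'. (fMaps f x y .& fMaps f x y') .-> y .= y') p"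
 unfolding fFun_def by (blast dest: fAndD1 fAndD2)+
 show "EX r:P. r <~ q & (EX x':Nm. D x' r & (x .= x') r)"
 if h: "x:Nm" "y:Nm" "q:P" "q <~ p" "(op x y .: f) q" for x y q
 proof -
 obtain r where r: "r:P" "r <~ q" "(\<^bold>\<exists>x'. D x' .& (\<^bold>\<exists>y'. fPair (op x y) x' y')) r"
  using fAllD[OF a op_name[OF h(1,2)]] h(3-5) unfolding fImp_iff by blast
 obtain r' x' where r': "r':P" "r' <~ r" "x':Nm" "(D x' .& (\<^bold>\<exists>y'. fPair (op x y) x' y')) r'"
  by (rule fEx_cases[OF r(3,1)])
 obtain s y' where s: "s:P" "s <~ r'" "y':Nm" "fPair (op x y) x' y' s"
  by (rule fEx_cases[OF fAndD2[OF r'(4)] r'(1)])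
 have "(x .= x') s"
  using op_inject(1)[OF s(1) h(1) r'(3) h(2) s(3)] s(4) fPair_iff[OF s(1) op_name[OF h(1,2)] r'(3) s(3)] by blast
 moreover have "D x' s" using regD[OF D[OF r'(3)] fAndD1[OF r'(4)] r'(1) s(1,2)] .
 moreover have "s <~ q" using P_trans[OF s(1) r'(1) h(3) s(2) P_trans[OF r'(1) r(1) h(3) r'(2) r(2)]] .
 ultimately show ?thesis using s(1) r'(3) by blast
 qed
 show "EX r:P. r <~ q & (EX y:Nm. (op x y .: f) r)" if h: "x:Nm" "q:P" "q <~ p" "D x q" for x q
 proof -
 obtain r where r: "r:P" "r <~ q" "(\<^bold>\<exists>y. fMaps f x y) r"
  using fAllD[OF b h(1)] h(2-4) unfolding fImp_iff by blast
 obtain s y where s: "s:P" "s <~ r" "y:Nm" "fMaps f x y s" by (rule fEx_cases[OF r(3,1)])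
 thus ?thesis
  using fMaps_iff[OF s(1) N h(1) s(3)] P_trans[OF s(1) r(1) h(2) s(2) r(2)] by blast
 qed
 show "(y .= y') q" if h: "x:Nm" "y:Nm" "y':Nm" "q:P" "q <~ p" "(op x y .: f) q" "(op x y' .: f) q" for x y y' q
 by (rule fImpD[OF fAllD[OF fAllD[OF fAllD[OF c h(1)] h(2)] h(3)] _ _ p h(4,5)])
  (use h fMaps_iff N reg_fEq in \<open>auto simp: fAnd_def\<close>)
qed

lemma op_mem_cong:
 "p:P==>f:Nm==>x:Nm==>x':Nm==>y:Nm==>y':Nm==>(x .= x') p==>(y .= y') p ==>
 (op x y .: f) p==>(op x' y' .: f) p"
 using fMem_eq_left[OF _ op_name op_name _ op_cong] by blast

subsection \<open>Cosets\<close>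

text \<open>A condition contributes the sums \<open>a + m\<close> for those \<open>a\<close> which
  it forces into \<open>A\<close>; stronger conditions contribute more, as required of a family for
  \<open>nm\<close>.\<close>

definition coset_name :: "('r, 'v) module => 'v => 'v => 'v" where
 "coset_name M A m = nm (%q. {a +[M] m |a. a:carrier M & (ck a .: A) q})"

context
 fixes M :: "('r, 'v) module" and A :: 'v
 assumes small_M: "small (carrier M)" and A: "A:Nm"
begin

lemma coset_small: "small {a +[M] m |a. a:carrier M & (ck a .: A) q}"
 by (rule small_subset[OF small_image[OF small_M, of "%a. a +[M] m"]]) auto

lemma coset_name [simp]: "coset_name M A m:Nm"
 unfolding coset_name_def by (rule nm_name) (rule coset_small)

lemma mem_coset_iff:
 "(z .: coset_name M A m) p <->
 dense_below (%r. EX a:carrier M. (ck a .: A) r & (z .= ck (a +[M] m)) r) p"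
 unfolding coset_name_def
proof (subst mem_nm_iff[OF coset_small])
 show "{a +[M] m |a. a:carrier M & (ck a .: A) p} =< {a +[M] m |a. a:carrier M & (ck a .: A) q}"
 if "p:P" "q:P" "q <~ p" for p q
 using fMem_antimono[OF _ that] by blast
qed (rule dense_below_cong, blast)

lemma fCoset_iff:
 assumes p: "p:P" and N: "x:Nm" "X:Nm" and m: "m:carrier M" "(x .= ck m) p"
 shows "fCoset M A x X p <-> (X .= coset_name M A m) p"
 unfolding fCoset_def
proof (rule fComprehension_iff[OF p N(2) coset_name])
 fix z r assume z: "z:Nm" and r: "r:P" "r <~ p"
 show "(\<^bold>\<exists>a. a .: A .& fAdd M a x z) r <-> (z .: coset_name M A m) r"
 proof
 assume "(\<^bold>\<exists>a. a .: A .& fAdd M a x z) r"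
 hence d: "dense_below (%r. EX a:Nm. (a .: A .& fAdd M a x z) r) r" unfolding fEx_iff .
 show "(z .: coset_name M A m) r"
  unfolding mem_coset_iff
 proof (rule dense_below_weaken[OF d r(1)])
  fix q assume q: "q:P" "q <~ r" "EX a:Nm. (a .: A .& fAdd M a x z) q"
  then obtain a where a: "a:Nm" "(a .: A) q" "fAdd M a x z q" by (auto simp: fAnd_def)
  obtain s b c where s: "s:P" "s <~ q" "b:carrier M" "c:carrier M"
  "(a .= ck b) s" "(x .= ck c) s" "(z .= ck (b +[M] c)) s"
  using dense_here[OF a(3)[unfolded fAdd_iff] q(1)] by blast
  have sp: "s <~ p" using P_trans[OF s(1) q(1) p s(2) P_trans[OF q(1) r(1) p q(2) r(2)]] .
  have "(ck c .= ck m) s"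
  using fEq_trans[OF s(1) check_name N(1) check_name fEq_sym[OF s(6)]] fEq_antimono[OF m(2) N(1) check_name p s(1) sp] by blast
  hence "c = m" using check_eq_iff s(1) by blast
  moreover have "(ck b .: A) s"
  using fMem_eq_left[OF s(1) a(1) check_name A s(5)] fMem_antimono[OF a(2) q(1) s(1,2)] by blast
  ultimately show "EX r':P. r' <~ q & (EX a:carrier M. (ck a .: A) r' & (z .= ck (a +[M] m)) r')"
  using s by blast
 qed
 next
 assume d: "(z .: coset_name M A m) r"
 show "(\<^bold>\<exists>a. a .: A .& fAdd M a x z) r"
  unfolding fEx_iff
 proof (rule dense_below_weaken[OF d[unfolded mem_coset_iff] r(1)])
  fix q assume q: "q:P" "q <~ r" "EX a:carrier M. (ck a .: A) q & (z .= ck (a +[M] m)) q"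
  then obtain a where a: "a:carrier M" "(ck a .: A) q" "(z .= ck (a +[M] m)) q" by blast
  have "fAdd M (ck a) x z q"
  unfolding fAdd_iff
  proof (rule dense_below_here[OF q(1)])
  fix s assume s: "s:P" "s <~ q"
  have "s <~ p" using P_trans[OF s(1) q(1) p s(2) P_trans[OF q(1) r(1) p q(2) r(2)]] .
  hence "(x .= ck m) s" using fEq_antimono[OF m(2) N(1) check_name p s(1)] by blast
  moreover have "(z .= ck (a +[M] m)) s" using fEq_antimono[OF a(3) z check_name q(1) s] .
  ultimately show "EX a':carrier M. EX b:carrier M. (ck a .= ck a') s & (x .= ck b) s &
   (z .= ck (a' +[M] b)) s"
   using a(1) m(1) fEq_refl[OF s(1) check_name] by blast
  qed
  thus "EX r':P. r' <~ q & (EX a:Nm. (a .: A .& fAdd M a x z) r')"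
  using q(1) P_refl a(2) by (intro bexI[of _ q] conjI bexI[of _ "ck a"] fAndI) auto
 qed
 qed
qed auto

lemma coset_name_eq:
 assumes M: "lmod R M" and q: "q:P" and sub: "!!r. r:P==>r <~ q==>submodule {m:carrier M. (ck m .: A) r} R M"
 and m: "m:carrier M"
 shows "(coset_name M A m .= coset_name M A 0[M]) q <-> (ck m .: A) q"
proof
 interpret lmod R M by (rule M)
 assume e: "(coset_name M A m .= coset_name M A 0[M]) q"
 have "(ck m .: coset_name M A m) q"
 unfolding mem_coset_iff
 proof (rule dense_below_here[OF q])
 fix r assume r: "r:P" "r <~ q"
 show "EX a:carrier M. (ck a .: A) r & (ck m .= ck (a +[M] m)) r"
  using submoduleD(2)[OF sub[OF r]] m fEq_refl[OF r(1) check_name] by (intro bexI[of _ "0[M]"]) auto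
 qed
 hence "(ck m .: coset_name M A 0[M]) q"
 using fMem_eq_right[OF q check_name coset_name coset_name e] by blast
 hence d: "dense_below (%r. EX a:carrier M. (ck a .: A) r & (ck m .= ck (a +[M] 0[M])) r) q"
 unfolding mem_coset_iff .
 show "(ck m .: A) q"
 by (rule reg_elim[OF reg_fMem d q]) (auto simp: check_eq_iff)
next
 interpret lmod R M by (rule M)
 assume mA: "(ck m .: A) q"
 have *: "(ck m .: A) r" if "r:P" "r <~ q" for r using fMem_antimono[OF mA q that] .
 show "(coset_name M A m .= coset_name M A 0[M]) q"
 proof (rule fEq_extI[OF q coset_name coset_name])
 fix z r assume z: "z:Nm" "r:P" "r <~ q" "(z .: coset_name M A m) r"
 show "(z .: coset_name M A 0[M]) r"
  unfolding mem_coset_iff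
 proof (rule dense_below_weaken[OF z(4)[unfolded mem_coset_iff] z(2)])
  fix s assume s: "s:P" "s <~ r" "EX a:carrier M. (ck a .: A) s & (z .= ck (a +[M] m)) s"
  then obtain a where a: "a:carrier M" "(ck a .: A) s" "(z .= ck (a +[M] m)) s" by blast
  have sq: "s <~ q" using P_trans[OF s(1) z(2) q s(2) z(3)] .
  have "(ck (a +[M] m) .: A) s"
  using submoduleD(3)[OF sub[OF s(1) sq], of a m] a *[OF s(1) sq] m by auto
  thus "EX r':P. r' <~ s & (EX a:carrier M. (ck a .: A) r' & (z .= ck (a +[M] 0[M])) r')"
  using a m s(1) P_refl by (intro bexI[of _ s] conjI bexI[of _ "a +[M] m"]) auto
 qed
 next
 fix z r assume z: "z:Nm" "r:P" "r <~ q" "(z .: coset_name M A 0[M]) r"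
 show "(z .: coset_name M A m) r"
  unfolding mem_coset_iff
 proof (rule dense_below_weaken[OF z(4)[unfolded mem_coset_iff] z(2)])
  fix s assume s: "s:P" "s <~ r" "EX a:carrier M. (ck a .: A) s & (z .= ck (a +[M] 0[M])) s"
  then obtain a where a: "a:carrier M" "(ck a .: A) s" "(z .= ck a) s" by auto
  have sq: "s <~ q" using P_trans[OF s(1) z(2) q s(2) z(3)] .
  have "(ck (a \<ominus>\<^bsub>M\<^esub> m) .: A) s"
  using submoduleD(6)[OF sub[OF s(1) sq], of a m] a *[OF s(1) sq] m by auto
  thus "EX r':P. r' <~ s & (EX a:carrier M. (ck a .: A) r' & (z .= ck (a +[M] m)) r')"
  using a m s(1) P_refl diff_add_cancel by (intro bexI[of _ s] conjI bexI[of _ "a \<ominus>\<^bsub>M\<^esub> m"]) auto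
 qed
 qed
qed

end

end

section \<open>From a forced filtration to goodness\<close>

context forcing_poset
begin

text \<open>\<open>forced_block\<close> is applied with \<open>H m n\<close> meaning that the forced
  isomorphism sends the coset of \<open>m\<close> to \<open>n\<close>. What is to be shown about
  ground model elements has to be extracted from clauses about arbitrary names.\<close>

lemma fQuotientIso_block:
 fixes M N :: "('r, 'v) module"
 assumes sc: sigma_closed and M: "lmod R M" "small (carrier M)" and N: "lmod R N" "countably_presented R N"
 and r: "r:P" and AB: "A:Nm" "B:Nm"
 and sA: "fSubmodule R M A r" and sB: "fSubmodule R M B r"
 and le: "!!m q. q:P==>q <~ r==>(ck m .: A) q==>(ck m .: B) q" and iso: "fQuotientIso R M B A N r"
 shows "EX r':P. r' <~ r & (EX E Zs. countable E & countable Zs & E =< carrier M & Zs =< carrier M &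
  sq R M (lmod.span R M Zs) (lmod.span R M E) N &
  (ALL e:E. (ck e .: B) r') & (ALL z:Zs. (ck z .: A) r') &
  (ALL q:P. ALL m':carrier M. q <~ r' & (ck m' .: B) q -->
   (EX q':P. q' <~ q & (EX a:carrier M. (ck a .: A) q' & m' \<ominus>\<^bsub>M\<^esub> a:lmod.span R M E))) &
  (ALL q:P. ALL t:lmod.span R M E. q <~ r' & (ck t .: A) q --> t:lmod.span R M Zs))"
proof -
 interpret M: lmod R M by (rule M)
 interpret N: lmod R N by (rule N)
 obtain p h where p: "p:P" "p <~ r" and h: "h:Nm" and hh:
  "(fFun (%X. \<^bold>\<exists>x. x .: B .& fCoset M A x X) h .&
  (\<^bold>\<forall>X. \<^bold>\<forall>u. fMaps h X u .-> fCarrier N u) .&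
  (\<^bold>\<forall>X. \<^bold>\<forall>X'. \<^bold>\<forall>u. (fMaps h X u .& fMaps h X' u) .-> X .= X') .&
  (\<^bold>\<forall>u. fCarrier N u .-> (\<^bold>\<exists>X. fMaps h X u)) .&
  (\<^bold>\<forall>x. \<^bold>\<forall>y. \<^bold>\<forall>z. \<^bold>\<forall>X. \<^bold>\<forall>Y. \<^bold>\<forall>Z. \<^bold>\<forall>u. \<^bold>\<forall>v. \<^bold>\<forall>w.
  (x .: B .& y .: B .& fAdd M x y z .&
   fCoset M A x X .& fCoset M A y Y .& fCoset M A z Z .&
   fMaps h X u .& fMaps h Y v .& fMaps h Z w) .-> fAdd N u v w) .&
  fAll (carrier R) (%r. \<^bold>\<forall>x. \<^bold>\<forall>y. \<^bold>\<forall>X. \<^bold>\<forall>Y. \<^bold>\<forall>u. \<^bold>\<forall>v.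
  (x .: B .& fSmult M r x y .& fCoset M A x X .& fCoset M A y Y .&
   fMaps h X u .& fMaps h Y v) .-> fSmult N r u v)) p"
 by (rule fEx_cases[OF iso[unfolded fQuotientIso_def] r])
 from hh have ff: "fFun (%X. \<^bold>\<exists>x. x .: B .& fCoset M A x X) h p"
 and hN: "(\<^bold>\<forall>X. \<^bold>\<forall>u. fMaps h X u .-> fCarrier N u) p"
 and hinj: "(\<^bold>\<forall>X. \<^bold>\<forall>X'. \<^bold>\<forall>u. (fMaps h X u .& fMaps h X' u) .-> X .= X') p"
 and hsurj: "(\<^bold>\<forall>u. fCarrier N u .-> (\<^bold>\<exists>X. fMaps h X u)) p"
 and hadd: "(\<^bold>\<forall>x. \<^bold>\<forall>y. \<^bold>\<forall>z. \<^bold>\<forall>X. \<^bold>\<forall>Y. \<^bold>\<forall>Z. \<^bold>\<forall>u. \<^bold>\<forall>v. \<^bold>\<forall>w.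
  (x .: B .& y .: B .& fAdd M x y z .&
   fCoset M A x X .& fCoset M A y Y .& fCoset M A z Z .&
   fMaps h X u .& fMaps h Y v .& fMaps h Z w) .-> fAdd N u v w) p"
 and hsm: "fAll (carrier R) (%r. \<^bold>\<forall>x. \<^bold>\<forall>y. \<^bold>\<forall>X. \<^bold>\<forall>Y. \<^bold>\<forall>u. \<^bold>\<forall>v.
  (x .: B .& fSmult M r x y .& fCoset M A x X .& fCoset M A y Y .&
   fMaps h X u .& fMaps h Y v) .-> fSmult N r u v) p"
 by (blast dest: fAndD1 fAndD2)+
 \<comment> \<open>Below \<open>p\<close> one fixed name \<open>h\<close> is forced to be the
   isomorphism, so only these conditions are considered.\<close>
 define Q where "Q = {q:P. q <~ p}"
 have Q: "q:P" "q <~ p" "q <~ r" if "q:Q" for q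
 using that P_trans[of q p r] p r by (auto simp: Q_def)
 have QI: "q':Q" if "q:Q" "q':P" "q' <~ q" for q q'
 using that P_trans[of q' q p] p by (auto simp: Q_def)
 note ground = fSubmodule_ground[OF M(1)]
 have subA: "submodule {m:carrier M. (ck m .: A) q} R M" if "q:Q" for q
 by (rule ground(1)[OF Q(1)[OF that] AB(1) regD[OF reg_fSubmodule sA r Q(1,3)[OF that]]])
 have subB: "submodule {m:carrier M. (ck m .: B) q} R M" if "q:Q" for q
 by (rule ground(1)[OF Q(1)[OF that] AB(2) regD[OF reg_fSubmodule sB r Q(1,3)[OF that]]])
 define cs where "cs m = coset_name M A m" for m
 have cs [simp]: "cs m:Nm" for m unfolding cs_def by (rule coset_name[OF M(2) AB(1)])
 have csC: "fCoset M A (ck m) (cs m) q" if "q:P" "m:carrier M" for m q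
 using fCoset_iff[OF M(2) AB(1) that(1) check_name cs that(2) fEq_refl[OF that(1) check_name]]
  fEq_refl[OF that(1) cs] unfolding cs_def by blast
 define H where "H m n q <-> m:carrier M & n:carrier N & (ck m .: B) q & (op (cs m) (ck n) .: h) q" for m n q
 have D: "reg (\<^bold>\<exists>x. x .: B .& fCoset M A x X)" for X by simp
 note hfun = fFunD[OF ff h p(1) D]
 have inN: "EX r:Q. r <~ q & (EX n:carrier N. (u .= ck n) r)" if q: "q:Q" and N': "X:Nm" "u:Nm" and m: "(op X u .: h) q" for q X u
 proof -
 have "fCarrier N u q"
  by (rule fImpD[OF fAllD[OF fAllD[OF hN N'(1)] N'(2)] _ _ p(1) Q(1,2)[OF q]])
  (use m fMaps_iff[OF Q(1)[OF q] h N'] N' in auto)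
 then obtain s where "s:P" "s <~ q" "EX n:carrier N. (u .= ck n) s"
  using dense_here Q(1)[OF q] unfolding fCarrier_iff by blast
 thus ?thesis using QI[OF q] by blast
 qed
 have H_mono: "H m n q" if "H m n p'" "p':Q" "q:Q" "q <~ p'" for m n p' q
 using that fMem_antimono[OF _ Q(1)[OF that(2)] Q(1)[OF that(3)] that(4)] by (auto simp: H_def)
 have H_total: "EX q:Q. q <~ p' & (EX n. H m n q)" if m: "m:carrier M" "(ck m .: B) p'" and p': "p':Q" for m p'
 proof -
 have "(\<^bold>\<exists>x. x .: B .& fCoset M A x (cs m)) p'"
  unfolding fEx_iff
  by (rule dense_below_here[OF Q(1)[OF p']], intro bexI[of _ "ck m"] fAndI)
  (use m csC fMem_antimono[OF m(2) Q(1)[OF p']] in auto)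
 then obtain s y where s: "s:P" "s <~ p'" "y:Nm" "(op (cs m) y .: h) s"
  using hfun(2)[OF cs Q(1,2)[OF p']] by blast
 obtain t n where t: "t:Q" "t <~ s" "n:carrier N" "(y .= ck n) t"
  using inN[OF QI[OF p' s(1,2)] cs s(3,4)] by blast
 have "(op (cs m) (ck n) .: h) t"
  using op_mem_cong[OF Q(1)[OF t(1)] h cs cs s(3) check_name fEq_refl[OF Q(1)[OF t(1)] cs] t(4)]
  fMem_antimono[OF s(4,1) Q(1)[OF t(1)] t(2)] by blast
 moreover have tp: "t <~ p'" using P_trans[OF Q(1)[OF t(1)] s(1) Q(1)[OF p'] t(2) s(2)] .
 moreover have "(ck m .: B) t" using fMem_antimono[OF m(2) Q(1)[OF p'] Q(1)[OF t(1)] tp] .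
 ultimately show ?thesis using t m unfolding H_def by blast
 qed
 have H_fun: "n = n'" if "H m n q" "H m n' q" "q:Q" for m n n' q
 using hfun(3)[OF cs check_name check_name Q(1,2)[OF that(3)]] that check_eq_iff[OF Q(1)[OF that(3)]]
 unfolding H_def by blast
 have B_add: "(ck (m +[M] m') .: B) q" if "m:carrier M" "m':carrier M" "(ck m .: B) q" "(ck m' .: B) q" "q:Q" for m m' q
 using M.submoduleD(3)[OF subB[OF that(5)], of m m'] that by simp
 have B_smult: "(ck (s *[M] m) .: B) q" if "s:carrier R" "m:carrier M" "(ck m .: B) q" "q:Q" for m s q
 using M.submoduleD(4)[OF subB[OF that(4)] that(1), of m] that by simp
 \<comment> \<open>\<open>H\<close> is regular in the condition, so a value may be computed at a
   stronger condition where all needed values of \<open>h\<close> are decided.\<close>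
 have Hreg: "H m n q" if "q:Q" "!!q'. q':Q==>q' <~ q==>EX s:Q. s <~ q' & H m n s" for m n q
 proof -
 have q: "q:P" "q <~ q" using Q(1) P_refl that(1) by auto
 have "EX s:P. s <~ q' & H m n s" if "q':P" "q' <~ q" for q'
  using \<open>!!q'. q':Q==>q' <~ q==>EX s:Q. s <~ q' & H m n s\<close>[OF QI[OF \<open>q:Q\<close> that] that(2)] Q(1) by blast
 thus ?thesis
  unfolding H_def using reg_dense[OF reg_fMem q(1)] q by meson
 qed
 have H_add: "H (m +[M] m') (n +[N] n') q" if Hs: "H m n q" "H m' n' q" and q: "q:Q" for m n m' n' q
 proof (rule Hreg[OF q])
 fix q' assume q': "q':Q" "q' <~ q"
 have H': "H m n q'" "H m' n' q'" using H_mono Hs q q' by blast+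
 have c: "m:carrier M" "m':carrier M" "n:carrier N" "n':carrier N" using Hs by (auto simp: H_def)
 have "(ck (m +[M] m') .: B) q'" using B_add c H' q'(1) by (auto simp: H_def)
 then obtain s w where s: "s:Q" "s <~ q'" "H (m +[M] m') w s" using H_total[of "m +[M] m'" q'] c q'(1) by auto
 have Hs': "H m n s" "H m' n' s" using H_mono H' q'(1) s(1,2) by blast+
 note sP = Q(1)[OF s(1)]
 have "fAdd N (ck n) (ck n') (ck w) s"
  by (rule fImpD[OF fAllD[OF fAllD[OF fAllD[OF fAllD[OF fAllD[OF fAllD[OF fAllD[OF fAllD[OF fAllD[OF hadd
   check_name[of m]] check_name[of m']] check_name[of "m +[M] m'"]] cs[of m]] cs[of m']] cs[of "m +[M] m'"]]
   check_name[of n]] check_name[of n']] check_name[of w]] _ _ p(1) sP Q(2)[OF s(1)]])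
  (use Hs' s(3) c csC[OF sP] fMaps_iff[OF sP h] in \<open>auto simp: fAnd_def H_def fAdd_check[OF sP]\<close>)
 hence "w = n +[N] n'" using fAdd_check[OF sP] by blast
 thus "EX s:Q. s <~ q' & H (m +[M] m') (n +[N] n') s" using s by blast
 qed
 have H_smult: "H (c *[M] m) (c *[N] n) q" if c: "c:carrier R" and Hs: "H m n q" and q: "q:Q" for c m n q
 proof (rule Hreg[OF q])
 fix q' assume q': "q':Q" "q' <~ q"
 have H': "H m n q'" using H_mono Hs q q' by blast
 have cc: "m:carrier M" "n:carrier N" using Hs by (auto simp: H_def)
 have "(ck (c *[M] m) .: B) q'" using B_smult[OF c] cc H' q'(1) by (auto simp: H_def)
 then obtain s w where s: "s:Q" "s <~ q'" "H (c *[M] m) w s"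
  using H_total[of "c *[M] m" q'] cc c q'(1) M.smult_closed by auto
 have Hs': "H m n s" using H_mono H' q'(1) s(1,2) by blast
 note sP = Q(1)[OF s(1)]
 have "fSmult N c (ck n) (ck w) s"
  by (rule fImpD[OF fAllD[OF fAllD[OF fAllD[OF fAllD[OF fAllD[OF fAllD[OF fAllD[OF hsm c]
   check_name[of m]] check_name[of "c *[M] m"]] cs[of m]] cs[of "c *[M] m"]]
   check_name[of n]] check_name[of w]] _ _ p(1) sP Q(2)[OF s(1)]])
  (use Hs' s(3) cc c M.smult_closed csC[OF sP] fMaps_iff[OF sP h] in \<open>auto simp: fAnd_def H_def fSmult_check[OF sP]\<close>)
 hence "w = c *[N] n" by (simp add: fSmult_check[OF sP])
 thus "EX s:Q. s <~ q' & H (c *[M] m) (c *[N] n) s" using s by blast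
 qed
 have H_zero: "H 0[M] 0[N] q" if q: "q:Q" for q
 proof (rule Hreg[OF q])
 fix q' assume q': "q':Q" "q' <~ q"
 have "(ck 0[M] .: B) q'" using M.submoduleD(2)[OF subB[OF q'(1)]] by simp
 \<comment> \<open>Let \<open>n\<close> be the value at zero. Additivity gives
   \<open>n + n = n\<close>, hence \<open>n\<close> is zero.\<close>
 then obtain s n where s: "s:Q" "s <~ q'" "H 0[M] n s" using H_total q'(1) by blast
 have nN: "n:carrier N" using s(3) by (simp add: H_def)
 have "H 0[M] (n +[N] n) s" using H_add[OF s(3,3,1)] by simp
 hence "n +[N] n = n" using H_fun s by blast
 hence "n = 0[N]" using nN by simp
 thus "EX s:Q. s <~ q' & H 0[M] 0[N] s" using s by auto
 qed
 have ceq: "(cs m .= cs 0[M]) q <-> (ck m .: A) q" if "m:carrier M" "q:Q" for m q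
 unfolding cs_def
 by (rule coset_name_eq[OF M(2) AB(1) M(1) Q(1)[OF that(2)] subA[OF QI[OF that(2)]] that(1)])
 have "EX r':Q. r' <~ p & (EX E Zs. countable E & countable Zs & E =< carrier M & Zs =< carrier M &
  sq R M (M.span Zs) (M.span E) N & (ALL e:E. (ck e .: B) r') & (ALL z:Zs. (ck z .: A) r') &
  (ALL q:Q. ALL m':carrier M. q <~ r' & (ck m' .: B) q -->
   (EX q':Q. q' <~ q & (EX a:carrier M. (ck a .: A) q' & m' \<ominus>\<^bsub>M\<^esub> a:M.span E))) &
  (ALL q:Q. ALL t:M.span E. q <~ r' & (ck t .: A) q --> t:M.span Zs))"
 proof (rule M.forced_block[OF N, where H = H])
 show "p:Q" using p P_refl by (simp add: Q_def)
 show "q <~ q" if "q:Q" for q using Q(1) P_refl that by blast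
 show "q <~ s" if "q:Q" "t:Q" "s:Q" "q <~ t" "t <~ s" for q t s
  using P_trans[OF Q(1)[OF that(1)] Q(1)[OF that(2)] Q(1)[OF that(3)] that(4,5)] .
 show "EX q:Q. ALL n. q <~ s n" if s: "!!n :: nat. s n:Q & s (Suc n) <~ s n" for s
 proof -
  obtain q where q: "q:P" "!!n. q <~ s n"
  using sc s Q(1) unfolding sigma_closed_def by (metis (no_types, lifting))
  thus ?thesis using QI[of "s 0" q] s by blast
 qed
 show "EX q:Q. q <~ p' & (EX m. H m n q)" if n: "n:carrier N" and p': "p':Q" for n p'
 proof -
  have "fCarrier N (ck n) p'" using n fCarrier_check[OF Q(1)[OF p']] by blast
  then obtain s where s: "s:P" "s <~ p'" "(\<^bold>\<exists>X. fMaps h X (ck n)) s"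
  using fAllD[OF hsurj check_name] Q[OF p'] unfolding fImp_iff by blast
  obtain t X where t: "t:P" "t <~ s" "X:Nm" "fMaps h X (ck n) t" by (rule fEx_cases[OF s(3,1)])
  have tQ: "t:Q" using QI[OF QI[OF p' s(1,2)] t(1,2)] .
  have m: "(op X (ck n) .: h) t" using fMaps_iff[OF t(1) h t(3) check_name] t(4) by blast
  \<comment> \<open>The preimage \<open>X\<close> of \<open>n\<close> is forced to be a coset of
    some name in \<open>B\<close>; a stronger condition identifies that name with a ground model
    element \<open>b\<close>.\<close>
  obtain v X' where v: "v:P" "v <~ t" "X':Nm" "(\<^bold>\<exists>x. x .: B .& fCoset M A x X') v" "(X .= X') v"
  using hfun(1)[OF t(3) check_name t(1) Q(2)[OF tQ] m] by blast
  obtain w x where w: "w:P" "w <~ v" "x:Nm" "(x .: B .& fCoset M A x X') w" by (rule fEx_cases[OF v(4,1)])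
  have wQ: "w:Q" using QI[OF QI[OF tQ v(1,2)] w(1,2)] .
  have "fCarrier M x w"
  using ground(2)[OF Q(1)[OF wQ] AB(2) regD[OF reg_fSubmodule sB r Q(1,3)[OF wQ]] w(3,1) P_refl[OF w(1)] fAndD1[OF w(4)]] .
  then obtain y b where y: "y:P" "y <~ w" "b:carrier M" "(x .= ck b) y"
  using dense_here[OF _ w(1)] unfolding fCarrier_iff by blast
  have yQ: "y:Q" using QI[OF wQ y(1,2)] .
  have yv: "y <~ v" using P_trans[OF y(1) w(1) v(1) y(2) w(2)] .
  have yt: "y <~ t" using P_trans[OF y(1) v(1) t(1) yv v(2)] .
  have "fCoset M A x X' y" using regD[OF reg_fCoset fAndD2[OF w(4)] w(1) y(1,2)] .
  hence "(X' .= cs b) y" using fCoset_iff[OF M(2) AB(1) y(1) w(3) v(3) y(3,4)] by (simp add: cs_def)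
  moreover have "(X .= X') y" using fEq_antimono[OF v(5) t(3) v(3) v(1) y(1) yv] .
  ultimately have "(X .= cs b) y" using fEq_trans[OF y(1) t(3) v(3) cs] by blast
  hence "(op (cs b) (ck n) .: h) y"
  using op_mem_cong[OF y(1) h t(3) cs check_name check_name _ fEq_refl[OF y(1) check_name] fMem_antimono[OF m t(1) y(1) yt]]
  by blast
  moreover have "(ck b .: B) y"
  using fMem_eq_left[OF y(1) w(3) check_name AB(2) y(4)] fMem_antimono[OF fAndD1[OF w(4)] w(1) y(1,2)] by blast
  moreover have "y <~ p'"
  using P_trans[OF y(1) t(1) Q(1)[OF p'] yt P_trans[OF t(1) s(1) Q(1)[OF p'] t(2) s(2)]] .
  ultimately show ?thesis using yQ y(3) n unfolding H_def by blast
 qed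
 show "H m 0[N] q <-> (ck m .: A) q" if m: "m:carrier M" and q: "q:Q" for m q
 proof
  assume Hm: "H m 0[N] q"
  have "(cs m .= cs 0[M]) q"
  by (rule fImpD[OF fAllD[OF fAllD[OF fAllD[OF hinj cs] cs] check_name] _ _ p(1) Q(1,2)[OF q]])
   (use Hm H_zero[OF q] fMaps_iff[OF Q(1)[OF q] h] reg_fEq in \<open>auto simp: fAnd_def H_def\<close>)
  thus "(ck m .: A) q" using ceq[OF m q] Hm by (simp add: H_def)
 next
  assume a: "(ck m .: A) q"
  hence "(cs 0[M] .= cs m) q" using ceq[OF m q] fEq_sym by blast
  hence "(op (cs m) (ck 0[N]) .: h) q"
  using op_mem_cong[OF Q(1)[OF q] h cs cs check_name check_name _ fEq_refl[OF Q(1)[OF q] check_name]] H_zero[OF q]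
  unfolding H_def by blast
  thus "H m 0[N] q" using m le[OF Q(1,3)[OF q] a] by (simp add: H_def)
 qed
 show "m:carrier M & n:carrier N & (ck m .: B) q" if "H m n q" for m n q
  using that by (simp add: H_def)
 show "H m n q" if "H m n p'" "p':Q" "q:Q" "q <~ p'" for m n p' q by (rule H_mono[OF that])
 show "EX q:Q. q <~ p' & (EX n. H m n q)" if "m:carrier M" "(ck m .: B) p'" "p':Q" for m p'
  by (rule H_total[OF that])
 show "H 0[M] 0[N] q" if "q:Q" for q by (rule H_zero[OF that])
 show "H (m +[M] m') (n +[N] n') q" if "H m n q" "H m' n' q" "q:Q" for m n m' n' q by (rule H_add[OF that])
 show "H (c *[M] m) (c *[N] n) q" if "c:carrier R" "H m n q" "q:Q" for c m n q by (rule H_smult[OF that])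
 show "n = n'" if "H m n q" "H m n' q" "q:Q" for m n n' q by (rule H_fun[OF that])
 qed
 thus ?thesis
 proof (elim bexE exE conjE)
 fix r' E Zs
 assume r': "r':Q" and EZ: "countable E" "countable Zs" "E =< carrier M" "Zs =< carrier M"
  "sq R M (M.span Zs) (M.span E) N" "ALL e:E. (ck e .: B) r'" "ALL z:Zs. (ck z .: A) r'"
  and cover: "ALL q:Q. ALL m':carrier M. q <~ r' & (ck m' .: B) q -->
   (EX q':Q. q' <~ q & (EX a:carrier M. (ck a .: A) q' & m' \<ominus>\<^bsub>M\<^esub> a:M.span E))"
  and rel: "ALL q:Q. ALL t:M.span E. q <~ r' & (ck t .: A) q --> t:M.span Zs"
 have "EX q':P. q' <~ q & (EX a:carrier M. (ck a .: A) q' & m' \<ominus>\<^bsub>M\<^esub> a:M.span E)"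
  if "q:P" "m':carrier M" "q <~ r' & (ck m' .: B) q" for q m'
  using cover QI[OF r' that(1)] that(2,3) Q(1) by blast
 moreover have "t:M.span Zs" if "q:P" "t:M.span E" "q <~ r' & (ck t .: A) q" for q t
  using rel QI[OF r' that(1)] that(2,3) by blast
 ultimately show ?thesis
  using Q(1,3)[OF r'] EZ by (intro bexI[of _ r'] conjI exI[of _ E] exI[of _ Zs]) auto
 qed
qed

lemma fSucc_check:
 assumes p: "p:P"
 shows "fSucc (ck b) (ck (vsuc b)) p"
 unfolding fSucc_def fAll_def
proof (intro ballI fIffI)
 fix k q assume k: "k:Nm" "q:P" "q <~ p"
 show "(k .: ck (vsuc b)) q <-> (k .= ck b .| k .: ck b) q"
 unfolding fOr_iff
 proof
 assume "(k .: ck (vsuc b)) q"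
 thus "dense_below (%r. (k .= ck b) r | (k .: ck b) r) q"
 proof (rule mem_check_elim[OF reg_dense_below _ k(2)])
  fix r a assume r: "r:P" "r <~ q" "a:elts (vsuc b)" "(k .= ck a) r"
  show "dense_below (%r. (k .= ck b) r | (k .: ck b) r) r"
  proof (rule dense_below_here[OF r(1)])
  fix s assume s: "s:P" "s <~ r"
  have e: "(k .= ck a) s" using fEq_antimono[OF r(4) k(1) check_name r(1) s] .
  show "(k .= ck b) s | (k .: ck b) s"
  proof (cases "a = b")
   case False
   hence "(ck a .: ck b) s" using r(3) check_mem_iff[OF s(1)] by simp
   thus ?thesis using fMem_eq_left[OF s(1) check_name k(1) check_name fEq_sym[OF e]] by blast
  qed (use e in simp)
  qed
 qed
 next
 assume d: "dense_below (%r. (k .= ck b) r | (k .: ck b) r) q"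
 show "(k .: ck (vsuc b)) q"
 proof (rule reg_elim[OF reg_fMem d k(2)])
  fix r assume r: "r:P" "r <~ q" "(k .= ck b) r | (k .: ck b) r"
  have "(ck b .: ck (vsuc b)) r" using check_mem_iff[OF r(1)] by simp
  moreover have "(ck b .<= ck (vsuc b)) r" by (rule check_sub[OF r(1)]) auto
  ultimately show "(k .: ck (vsuc b)) r"
  using r fMem_eq_left[OF r(1) check_name k(1) check_name fEq_sym] k(1) P_refl[OF r(1)]
  unfolding fSub_iff[OF r(1)] by blast
 qed
 qed
qed

lemma fEmpty_check: "p:P==>fEmpty (ck a) p <-> elts a = {}"
 unfolding fEmpty_iff
proof
 assume p: "p:P" and e: "ALL z:Nm. ALL q:P. q <~ p --> ~ (z .: ck a) q"
 thus "elts a = {}" using check_mem_iff[OF p] P_refl[OF p] check_name by (metis equals0I)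
next
 assume "p:P" "elts a = {}"
 thus "ALL z:Nm. ALL q:P. q <~ p --> ~ (z .: ck a) q"
 unfolding mem_check_iff dense_below_def using P_refl by blast
qed

lemma fLimit_check:
 assumes p: "p:P" and a: "vlimit a"
 shows "fLimit (ck a) p"
 unfolding fLimit_def
proof (intro fAndI)
 show "fOrd (ck a) p" using fOrd_check[OF p] a by (simp add: vlimit_def)
 show "(.~ fEmpty (ck a)) p"
 unfolding fNot_def using fEmpty_check a by (auto simp: vlimit_def)
 show "(\<^bold>\<forall>j. j .: ck a .-> (\<^bold>\<exists>k. k .: ck a .& j .: k)) p"
 unfolding fAll_def[of Nm "%j. j .: ck a .-> (\<^bold>\<exists>k. k .: ck a .& j .: k)"]
 proof (intro ballI fImpI)
 fix j q assume j: "j:Nm" "q:P" "q <~ p" "(j .: ck a) q"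
 show "(\<^bold>\<exists>k. k .: ck a .& j .: k) q"
 proof (rule mem_check_elim[OF _ j(4,2)])
  fix r b assume r: "r:P" "r <~ q" "b:elts a" "(j .= ck b) r"
  obtain k where k: "k:elts a" "b:elts k" using a r(3) by (auto simp: vlimit_def)
  have "(ck k .: ck a) r" "(ck b .: ck k) r" using k check_mem_iff[OF r(1)] by auto
  moreover from this(2) have "(j .: ck k) r"
  using fMem_eq_left[OF r(1) check_name j(1) check_name fEq_sym[OF r(4)]] by blast
  ultimately show "(\<^bold>\<exists>k. k .: ck a .& j .: k) r"
  by (intro reg_conj_ex_here[OF r(1) check_name[of k]] fAndI) auto
 qed simp
 qed
qed

text \<open>Below \<open>p0\<close> the names \<open>\<eta>\<close> and \<open>F\<close> are fixed.
  Since no new ordinals appear, every index is below some condition a check name, and the forced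
  filtration becomes an instance of \<open>forced_filtration\<close>.\<close>

lemma fFiltration_good:
 fixes M :: "('r, 'v) module"
 assumes sc: sigma_closed and M: "lmod R M" "small (carrier M)"
 and C: "!!N. N:C==>lmod R N & countably_presented R N" and qh: "qh_class R C"
 and p0: "p0:P" and N: "\<eta>:Nm" "F:Nm" and f: "fFiltration R C M \<eta> F p0"
 shows "good_module R C M"
proof -
 interpret M: lmod R M by (rule M)
 from f have o: "fOrd \<eta> p0" and ff: "fFun (%i. i .: \<eta>) F p0"
 and c1: "(\<^bold>\<forall>i. \<^bold>\<forall>A. fMaps F i A .-> fSubmodule R M A) p0"
 and c2: "(\<^bold>\<forall>i. \<^bold>\<forall>A. (fMaps F i A .& fEmpty i) .-> (\<^bold>\<forall>x. x .: A .<-> fZero M x)) p0"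
 and c3: "(\<^bold>\<forall>i. \<^bold>\<forall>j. \<^bold>\<forall>A. \<^bold>\<forall>B. (i .: j .& fMaps F i A .& fMaps F j B) .-> A .<= B) p0"
 and c4: "(\<^bold>\<forall>j. \<^bold>\<forall>B. (fMaps F j B .& fLimit j) .->
   (\<^bold>\<forall>x. x .: B .<-> (\<^bold>\<exists>i. \<^bold>\<exists>A. i .: j .& fMaps F i A .& x .: A))) p0"
 and c5: "(\<^bold>\<forall>x. fCarrier M x .<-> (\<^bold>\<exists>i. \<^bold>\<exists>A. fMaps F i A .& x .: A)) p0"
 and c6: "(\<^bold>\<forall>i. \<^bold>\<forall>j. \<^bold>\<forall>A. \<^bold>\<forall>B. (fSucc i j .& fMaps F i A .& fMaps F j B) .->
   fEx C (%N. fQuotientIso R M B A N)) p0"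
 unfolding fFiltration_def by (blast dest: fAndD1 fAndD2)+
 define Q where "Q = {q:P. q <~ p0}"
 have Q: "q:P" "q <~ p0" if "q:Q" for q using that by (auto simp: Q_def)
 have QI: "q':Q" if "q:Q" "q':P" "q' <~ q" for q q'
 using that P_trans[of q' q p0] p0 by (auto simp: Q_def)
 note hfun = fFunD[OF ff N(2) p0 reg_fMem]
 have maps: "fMaps F i A q <-> (op i A .: F) q" if "q:P" "i:Nm" "A:Nm" for i A q
 by (rule fMaps_iff[OF that(1) N(2) that(2,3)])
 have F_eta: "(i .: \<eta>) q" if i: "i:Nm" "A:Nm" "q:Q" "(op i A .: F) q" for i A q
 proof (rule reg_dense[OF reg_fMem Q(1)[OF i(3)]])
 fix q' assume q': "q':P" "q' <~ q"
 have q'Q: "q':Q" by (rule QI[OF i(3) q'])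
 obtain r x' where r: "r:P" "r <~ q'" "x':Nm" "(x' .: \<eta>) r" "(i .= x') r"
  using hfun(1)[OF i(1,2) q'(1) Q(2)[OF q'Q] fMem_antimono[OF i(4) Q(1)[OF i(3)] q']] by blast
 have "(i .: \<eta>) r" using fMem_eq_left[OF r(1,3) i(1) N(1) fEq_sym[OF r(5)] r(4)] .
 thus "EX r:P. r <~ q' & (i .: \<eta>) r" using r by blast
 qed
 have F_sub: "fSubmodule R M A q" if "i:Nm" "A:Nm" "q:Q" "(op i A .: F) q" for i A q
 by (rule fImpD[OF fAllD[OF fAllD[OF c1 that(1)] that(2)] _ _ p0 Q[OF that(3)]])
  (use that maps[OF Q(1)[OF that(3)]] in auto)
 note F_ground = fSubmodule_ground(1)[OF M(1) Q(1) _ F_sub]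
 have F_zero: "m = 0[M]"
 if "elts z = {}" "A:Nm" "q:Q" "(op (ck z) A .: F) q" "(ck m .: A) q" for z A q m
 proof -
 note qP = Q(1)[OF that(3)]
 have "(\<^bold>\<forall>x. x .: A .<-> fZero M x) q"
  by (rule fImpD[OF fAllD[OF fAllD[OF c2 check_name[of z]] that(2)] _ _ p0 Q[OF that(3)]])
  (use that maps[OF qP] fEmpty_check[OF qP] in \<open>auto simp: fAnd_def\<close>)
 from fAllD[OF this check_name[of m]] have "fZero M (ck m) q"
  using fIffD[of "ck m .: A" "fZero M (ck m)" q q] qP P_refl[OF qP] that(5) by simp
 thus ?thesis using fZero_check[OF qP] by blast
 qed
 have F_mono: "(A .<= B) q" if "a:elts b" "A:Nm" "B:Nm" "q:Q"
 "(op (ck a) A .: F) q" "(op (ck b) B .: F) q" for a b A B q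
 by (rule fImpD[OF fAllD[OF fAllD[OF fAllD[OF fAllD[OF c3 check_name[of a]] check_name[of b]] that(2)] that(3)]
   _ _ p0 Q[OF that(4)]])
  (use that maps[OF Q(1)[OF that(4)]] check_mem_iff[OF Q(1)[OF that(4)]] in \<open>auto simp: fAnd_def\<close>)
 have F_mono': "(ck m .: B) q" if "a:elts b" "A:Nm" "B:Nm" "q:Q"
 "(op (ck a) A .: F) q" "(op (ck b) B .: F) q" "(ck m .: A) q" for a b A B q m
 using F_mono[OF that(1-6)] that(7) P_refl[OF Q(1)[OF that(4)]] Q(1)[OF that(4)] check_name
 unfolding fSub_iff[OF Q(1)[OF that(4)]] by blast
 have F_lim: "EX r:Q. r <~ q & (EX b:elts a. EX B:Nm. (op (ck b) B .: F) r & (ck m .: B) r)"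
 if a: "vlimit a" and A: "A:Nm" "q:Q" "(op (ck a) A .: F) q" "(ck m .: A) q" for a A q m
 proof -
 note qP = Q(1)[OF A(2)]
 have "(\<^bold>\<forall>x. x .: A .<-> (\<^bold>\<exists>i. \<^bold>\<exists>A. i .: ck a .& fMaps F i A .& x .: A)) q"
  by (rule fImpD[OF fAllD[OF fAllD[OF c4 check_name[of a]] A(1)] _ _ p0 Q[OF A(2)]])
  (use A maps[OF qP] fLimit_check[OF qP a] in \<open>auto simp: fAnd_def\<close>)
 from fAllD[OF this check_name[of m]] have ex: "(\<^bold>\<exists>i. \<^bold>\<exists>A. i .: ck a .& fMaps F i A .& ck m .: A) q"
  by (rule fIffD[THEN iffD1, OF _ _ _ qP qP P_refl[OF qP]]) (use A(4) in simp_all)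
 obtain r i where r: "r:P" "r <~ q" "i:Nm" "(\<^bold>\<exists>A. i .: ck a .& fMaps F i A .& ck m .: A) r"
  by (rule fEx_cases[OF ex qP])
 obtain s B where s: "s:P" "s <~ r" "B:Nm" "(i .: ck a .& fMaps F i B .& ck m .: B) s"
  by (rule fEx_cases[OF r(4,1)])
 have sm: "(i .: ck a) s" "(op i B .: F) s" "(ck m .: B) s"
  using s(4) maps[OF s(1) r(3) s(3)] by (auto simp: fAnd_def)
 obtain t b where t: "t:P" "t <~ s" "b:elts a" "(i .= ck b) t"
  using dense_here[OF sm(1)[unfolded mem_check_iff] s(1)] by blast
 have "(op (ck b) B .: F) t"
  using op_mem_cong[OF t(1) N(2) r(3) check_name s(3,3) t(4) fEq_refl[OF t(1) s(3)] fMem_antimono[OF sm(2) s(1) t(1,2)]] .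
 moreover have "(ck m .: B) t" using fMem_antimono[OF sm(3) s(1) t(1,2)] .
 moreover have "t <~ q" using P_trans[OF t(1) s(1) qP t(2) P_trans[OF s(1) r(1) qP s(2) r(2)]] .
 ultimately show ?thesis using QI[OF A(2) t(1)] t(3) s(3) by blast
 qed
 have F_all: "EX r:Q. r <~ q & (EX a. vord a & (EX A:Nm. (op (ck a) A .: F) r & (ck m .: A) r))"
 if m: "m:carrier M" and q: "q:Q" for m q
 proof -
 note qP = Q(1)[OF q]
 have "fCarrier M (ck m) q" using m fCarrier_check[OF qP] by blast
 hence ex: "(\<^bold>\<exists>i. \<^bold>\<exists>A. fMaps F i A .& ck m .: A) q"
  by (rule fIffD[THEN iffD1, OF fAllD[OF c5 check_name[of m]] _ _ p0 Q[OF q], rotated -1]) simp_all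
 obtain r i where r: "r:P" "r <~ q" "i:Nm" "(\<^bold>\<exists>A. fMaps F i A .& ck m .: A) r"
  by (rule fEx_cases[OF ex qP])
 obtain s B where s: "s:P" "s <~ r" "B:Nm" "(fMaps F i B .& ck m .: B) s"
  by (rule fEx_cases[OF r(4,1)])
 have sm: "(op i B .: F) s" "(ck m .: B) s"
  using s(4) maps[OF s(1) r(3) s(3)] by (auto simp: fAnd_def)
 have sQ: "s:Q" using QI[OF QI[OF q r(1,2)] s(1,2)] .
 have "fOrd i s"
  using fOrd_mem[OF regD[OF reg_fOrd o p0 s(1) Q(2)[OF sQ]] s(1) r(3) F_eta[OF r(3) s(3) sQ sm(1)]] .
 then obtain t a where t: "t:P" "t <~ s" "vord a" "(i .= ck a) t"
  using dense_here[OF fOrd_is_check[OF r(3) s(1)] s(1)] by blast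
 have "(op (ck a) B .: F) t"
  using op_mem_cong[OF t(1) N(2) r(3) check_name s(3,3) t(4) fEq_refl[OF t(1) s(3)] fMem_antimono[OF sm(1) s(1) t(1,2)]] .
 moreover have "(ck m .: B) t" using fMem_antimono[OF sm(2) s(1) t(1,2)] .
 moreover have "t <~ q" using P_trans[OF t(1) s(1) qP t(2) P_trans[OF s(1) r(1) qP s(2) r(2)]] .
 ultimately show ?thesis using QI[OF q t(1)] t(3) s(3) by blast
 qed
 \<comment> \<open>\<open>F\<close> may have no member at an index beyond its length, so the member
   number \<open>a\<close> is replaced by the union of the members with index at most
   \<open>a\<close>. The alternative \<open>m = 0[M]\<close> in \<open>L\<close> puts zero in from
   the start, before any member has been found.\<close>
 define wit where "wit a m r <-> (EX c A. (c = a | c:elts a) & A:Nm & (op (ck c) A .: F) r & (ck m .: A) r)" for a m r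
 define L where "L a m q <-> dense_below (%r. m = 0[M] | wit a m r) q" for a m q
 have wit_mono: "wit a m q" if "wit a m r" "r:P" "q:P" "q <~ r" for a m r q
 using that(1) fMem_antimono[OF _ that(2-4)] unfolding wit_def by blast
 have L_here: "L a m q" if "wit a m q" "q:P" for a m q
 unfolding L_def by (rule dense_below_here[OF that(2)]) (use wit_mono that in blast)
 \<comment> \<open>At an index where \<open>F\<close> does have a member \<open>A\<close>, nothing
   has changed: \<open>L\<close> agrees with membership in \<open>A\<close>.\<close>
 have L_E: "L a m q <-> (ck m .: A) q" if "A:Nm" "q:Q" "m:carrier M" "(op (ck a) A .: F) q" for a m q A
 proof
 assume "L a m q"
 show "(ck m .: A) q"
 proof (rule reg_elim[OF reg_fMem \<open>L a m q\<close>[unfolded L_def] Q(1)[OF that(2)]])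
  fix r assume r: "r:P" "r <~ q" "m = 0[M] | wit a m r"
  have rQ: "r:Q" using QI[OF that(2) r(1,2)] .
  have E: "(op (ck a) A .: F) r" using fMem_antimono[OF that(4) Q(1)[OF that(2)] r(1,2)] .
  show "(ck m .: A) r"
  proof (cases "m = 0[M]")
  case True
  thus ?thesis using M.submoduleD(2)[OF F_ground[OF rQ that(1) check_name that(1) rQ E]] by simp
  next
  case False
  then obtain c B where B: "c = a | c:elts a" "B:Nm" "(op (ck c) B .: F) r" "(ck m .: B) r"
   using r(3) unfolding wit_def by blast
  show ?thesis
  proof (cases "c = a")
   case True
   hence "(B .= A) r" using hfun(3)[OF check_name B(2) that(1) r(1) Q(2)[OF rQ] B(3)] E by simp
   thus ?thesis using fMem_eq_right[OF r(1) check_name B(2) that(1) _ B(4)] by blast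
  next
   case False
   thus ?thesis using F_mono'[OF _ B(2) that(1) rQ B(3) E B(4)] B(1) by blast
  qed
  qed
 qed
 next
 assume "(ck m .: A) q"
 thus "L a m q" by (intro L_here) (use that Q in \<open>auto simp: wit_def\<close>)
 qed
 have L_mono_r: "L a m q" if "L a m p" "p:P" "q:P" "q <~ p" for a m p q
 using dense_below_mono[OF that(1)[unfolded L_def] that(2-4)] unfolding L_def .
 have "forced_filtration R M C Q (<~) L"
 proof (intro forced_filtration.intro forced_filtration_axioms.intro M(1))
 show "small (carrier M)" by (rule M(2))
 show "Q ~= {}" using p0 P_refl by (auto simp: Q_def)
 show "p <~ p" if "p:Q" for p using Q(1) P_refl that by blast
 show "p <~ r" if "p:Q" "q:Q" "r:Q" "p <~ q" "q <~ r" for p q r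
  using P_trans[OF Q(1)[OF that(1)] Q(1)[OF that(2)] Q(1)[OF that(3)] that(4,5)] .
 show "EX q:Q. ALL n. q <~ s n" if s: "!!n :: nat. s n:Q & s (Suc n) <~ s n" for s
 proof -
  have "ALL n. s n:P & s (Suc n) <~ s n" using s Q(1) by blast
  then obtain q where q: "q:P" "!!n. q <~ s n" using sc unfolding sigma_closed_def by blast
  thus ?thesis using QI[of "s 0" q] s by blast
 qed
 show "lmod R K" if "K:C" for K using C that by blast
 show "L a m q" if "L a m p" "p:Q" "q:Q" "q <~ p" for a m p q
  using L_mono_r[OF that(1) Q(1)[OF that(2)] Q(1)[OF that(3)] that(4)] .
 show "L b m p" if "L a m p" "vord b" "a:elts b" "p:Q" for a b m p
  using that(1) unfolding L_def
 proof (rule dense_below_weaken[OF _ Q(1)[OF that(4)]])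
  fix r assume "r:P" "m = 0[M] | wit a m r"
  moreover have "wit b m r" if "wit a m r"
  using that vord_trans[OF \<open>vord b\<close> \<open>a:elts b\<close>] \<open>a:elts b\<close> unfolding wit_def by blast
  ultimately show "EX r':P. r' <~ r & (m = 0[M] | wit b m r')" using P_refl by blast
 qed
 show "m = 0[M]" if L: "L a m p" "elts a = {}" "p:Q" for a m p
 proof -
  obtain r where r: "r:P" "r <~ p" "m = 0[M] | wit a m r"
  using dense_here[OF L(1)[unfolded L_def] Q(1)[OF L(3)]] by blast
  thus ?thesis using F_zero[OF L(2) _ QI[OF L(3) r(1,2)]] L(2) unfolding wit_def by blast
 qed
 show "EX q:Q. q <~ p & (EX b:elts a. L b m q)" if L: "L a m p" "vlimit a" "p:Q" for a m p
 proof -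
  obtain r where r: "r:P" "r <~ p" "m = 0[M] | wit a m r"
  using dense_here[OF L(1)[unfolded L_def] Q(1)[OF L(3)]] by blast
  have rQ: "r:Q" using QI[OF L(3) r(1,2)] .
  consider "m = 0[M]" | c A where "c:elts a" "A:Nm" "(op (ck c) A .: F) r" "(ck m .: A) r"
  | A where "A:Nm" "(op (ck a) A .: F) r" "(ck m .: A) r"
  using r(3) unfolding wit_def by blast
  thus ?thesis
  proof cases
  case 1
  obtain b where "b:elts a" using L(2) by (auto simp: vlimit_def)
  moreover have "L b m r" unfolding L_def by (rule dense_below_here[OF r(1)]) (simp add: 1)
  ultimately show ?thesis using rQ r(2) by blast
  next
  case 2
  hence "L c m r" by (intro L_here r(1)) (auto simp: wit_def)
  thus ?thesis using rQ r(2) 2(1) by blast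
  next
  case 3
  obtain t b B where t: "t:Q" "t <~ r" "b:elts a" "B:Nm" "(op (ck b) B .: F) t" "(ck m .: B) t"
   using F_lim[OF L(2) 3(1) rQ 3(2,3)] by blast
  have "L b m t" by (rule L_here) (use t Q in \<open>auto simp: wit_def\<close>)
  moreover have "t <~ p" using P_trans[OF Q(1)[OF t(1)] r(1) Q(1)[OF L(3)] t(2) r(2)] .
  ultimately show ?thesis using t by blast
  qed
 qed
 show "EX q:Q. q <~ p & (EX a. vord a & L a m q)" if m: "m:carrier M" "p:Q" for m p
 proof -
  obtain r a A where r: "r:Q" "r <~ p" "vord a" "A:Nm" "(op (ck a) A .: F) r" "(ck m .: A) r"
  using F_all[OF m] by blast
  hence "L a m r" by (intro L_here Q(1)) (auto simp: wit_def)
  thus ?thesis using r by blast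
 qed
 show "submodule {m:carrier M. L a m p} R M" if p: "p:Q" "vord a" for p a
 proof -
  note pP = Q(1)[OF p(1)]
  have "L a 0[M] p" unfolding L_def by (rule dense_below_here[OF pP]) simp
  moreover have "L a (m +[M] m') p" if m: "m:carrier M" "m':carrier M" "L a m p" "L a m' p" for m m'
  unfolding L_def
  proof (rule dense_below_weaken[OF m(3)[unfolded L_def] pP])
  fix r assume r: "r:P" "r <~ p" "m = 0[M] | wit a m r"
  obtain s where s: "s:P" "s <~ r" "m' = 0[M] | wit a m' s"
   using dense_here[OF L_mono_r[OF m(4) pP r(1,2), unfolded L_def] r(1)] by blast
  have sQ: "s:Q" using QI[OF QI[OF p(1) r(1,2)] s(1,2)] .
  have w: "m = 0[M] | wit a m s" using r(3) wit_mono[OF _ r(1) s(1,2)] by blast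
  have "m +[M] m' = 0[M] | wit a (m +[M] m') s"
  proof (cases "m = 0[M] | m' = 0[M]")
   case True
   thus ?thesis using s(3) w m(1,2) by auto
  next
   case False
   obtain c A where A: "c = a | c:elts a" "A:Nm" "(op (ck c) A .: F) s" "(ck m .: A) s"
   using False w unfolding wit_def by blast
   obtain d B where B: "d = a | d:elts a" "B:Nm" "(op (ck d) B .: F) s" "(ck m' .: B) s"
   using False s(3) unfolding wit_def by blast
   have "vord c" "vord d" using A(1) B(1) p(2) vord_mem by blast+
   then consider "c:elts d" | "c = d" | "d:elts c" using vord_linear by blast
   hence "EX e E. (e = a | e:elts a) & E:Nm & (op (ck e) E .: F) s &
   (ck m .: E) s & (ck m' .: E) s"
   proof cases
   case 1
   thus ?thesis using F_mono'[OF 1 A(2) B(2) sQ A(3) B(3) A(4)] B by blast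
   next
   case 2
   hence "(A .= B) s" using hfun(3)[OF check_name A(2) B(2) s(1) Q(2)[OF sQ] A(3)] B(3) by simp
   thus ?thesis using fMem_eq_right[OF s(1) check_name A(2) B(2) _ A(4)] B by blast
   next
   case 3
   thus ?thesis using F_mono'[OF 3 B(2) A(2) sQ B(3) A(3) B(4)] A by blast
   qed
   then obtain e E where E: "e = a | e:elts a" "E:Nm" "(op (ck e) E .: F) s"
   "(ck m .: E) s" "(ck m' .: E) s" by blast
   have "(ck (m +[M] m') .: E) s"
   using M.submoduleD(3)[OF F_ground[OF sQ E(2) check_name E(2) sQ E(3)], of m m'] E m by simp
   thus ?thesis using E unfolding wit_def by blast
  qed
  thus "EX r':P. r' <~ r & (m +[M] m' = 0[M] | wit a (m +[M] m') r')" using s by blast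
  qed
  moreover have "L a (x *[M] m) p" if m: "m:carrier M" "x:carrier R" "L a m p" for x m
  unfolding L_def
  proof (rule dense_below_weaken[OF m(3)[unfolded L_def] pP])
  fix r assume r: "r:P" "r <~ p" "m = 0[M] | wit a m r"
  have rQ: "r:Q" using QI[OF p(1) r(1,2)] .
  have "x *[M] m = 0[M] | wit a (x *[M] m) r"
  proof (cases "m = 0[M]")
   case False
   then obtain c A where A: "c = a | c:elts a" "A:Nm" "(op (ck c) A .: F) r" "(ck m .: A) r"
   using r(3) unfolding wit_def by blast
   have "(ck (x *[M] m) .: A) r"
   using M.submoduleD(4)[OF F_ground[OF rQ A(2) check_name A(2) rQ A(3)] m(2), of m] A m by simp
   thus ?thesis using A unfolding wit_def by blast
  qed (use M.smult_zero m in simp)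
  thus "EX r':P. r' <~ r & (x *[M] m = 0[M] | wit a (x *[M] m) r')" using r(1) P_refl by blast
  qed
  ultimately show ?thesis by (auto simp: M.submodule_iff M.smult_closed)
 qed
 fix b m p assume b: "vord b" and m: "m:carrier M" and p: "p:Q" and Lm: "L (vsuc b) m p"
  and nL: "!!q. q:Q==>q <~ p==>~ L b m q"
 note pP = Q(1)[OF p]
 obtain r where r: "r:P" "r <~ p" "m = 0[M] | wit (vsuc b) m r"
  using dense_here[OF Lm[unfolded L_def] pP] by blast
 have rQ: "r:Q" using QI[OF p r(1,2)] .
 have m0: "m ~= 0[M]"
 proof
  assume "m = 0[M]"
  hence "L b m p" unfolding L_def by (intro dense_below_here[OF pP]) simp
  thus False using nL[OF p P_refl[OF pP]] by simp
 qed
 then obtain c B where c: "c = vsuc b | c:elts (vsuc b)" and B: "B:Nm" "(op (ck c) B .: F) r" "(ck m .: B) r"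
  using r(3) unfolding wit_def by blast
 \<comment> \<open>The member containing \<open>m\<close> must be the one with the index b + 1
   itself; a smaller index would put \<open>m\<close> into the member number
   \<open>b\<close>.\<close>
 have "c = vsuc b"
 proof (rule ccontr)
  assume "c ~= vsuc b"
  hence "c = b | c:elts b" using c by simp
  hence "L b m r" by (intro L_here r(1)) (use B in \<open>auto simp: wit_def\<close>)
  thus False using nL[OF rQ r(2)] by blast
 qed
 hence EB: "(op (ck (vsuc b)) B .: F) r" using B(2) by simp
 have or: "fOrd \<eta> r" using regD[OF reg_fOrd o p0 r(1) Q(2)[OF rQ]] .
 have "(ck b .: ck (vsuc b)) r" using check_mem_iff[OF r(1)] by simp
 hence "(ck b .: \<eta>) r"
  using fOrd_trans[OF or r(1) r(1) P_refl[OF r(1)] check_name check_name F_eta[OF check_name B(1) rQ EB]] by blast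
 then obtain s A where s: "s:P" "s <~ r" "A:Nm" "(op (ck b) A .: F) s"
  using hfun(2)[OF check_name r(1) Q(2)[OF rQ]] by blast
 have sQ: "s:Q" using QI[OF rQ s(1,2)] .
 have EBs: "(op (ck (vsuc b)) B .: F) s" using fMem_antimono[OF EB r(1) s(1,2)] .
 have imp: "((fSucc (ck b) (ck (vsuc b)) .& fMaps F (ck b) A .& fMaps F (ck (vsuc b)) B) .->
   fEx C (%N. fQuotientIso R M B A N)) p0"
  using fAllD[OF fAllD[OF fAllD[OF fAllD[OF c6 check_name[of b]] check_name[of "vsuc b"]] s(3)] B(1)] .
 have "(fSucc (ck b) (ck (vsuc b)) .& fMaps F (ck b) A .& fMaps F (ck (vsuc b)) B) s"
  using fSucc_check[OF s(1)] maps[OF s(1)] s(3,4) B(1) EBs by (simp add: fAnd_def)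
 then obtain t where t: "t:P" "t <~ s" "fEx C (%N. fQuotientIso R M B A N) t"
  using imp s(1) Q(2)[OF sQ] unfolding fImp_iff by blast
 obtain u K where u: "u:P" "u <~ t" "K:C" "fQuotientIso R M B A K u" by (rule fEx_cases[OF t(3,1)])
 have us: "u <~ s" using P_trans[OF u(1) t(1) s(1) u(2) t(2)] .
 have uQ: "u:Q" using QI[OF sQ u(1) us] .
 have Eu: "(op (ck b) A .: F) u" "(op (ck (vsuc b)) B .: F) u"
  using fMem_antimono[OF s(4,1) u(1) us] fMem_antimono[OF EBs s(1) u(1) us] by auto
 have Eq: "(op (ck b) A .: F) q" "(op (ck (vsuc b)) B .: F) q" if "q:P" "q <~ u" for q
  using fMem_antimono[OF Eu(1) u(1) that] fMem_antimono[OF Eu(2) u(1) that] by auto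
 have le: "(ck x .: B) q" if "q:P" "q <~ u" "(ck x .: A) q" for x q
  by (rule F_mono'[OF _ s(3) B(1) QI[OF uQ that(1,2)] Eq[OF that(1,2)] that(3)]) simp
 have "EX r':P. r' <~ u & (EX E Zs. countable E & countable Zs & E =< carrier M & Zs =< carrier M &
  sq R M (M.span Zs) (M.span E) K &
  (ALL e:E. (ck e .: B) r') & (ALL z:Zs. (ck z .: A) r') &
  (ALL q:P. ALL m':carrier M. q <~ r' & (ck m' .: B) q -->
   (EX q':P. q' <~ q & (EX a:carrier M. (ck a .: A) q' & m' \<ominus>\<^bsub>M\<^esub> a:M.span E))) &
  (ALL q:P. ALL t:M.span E. q <~ r' & (ck t .: A) q --> t:M.span Zs))"
  by (rule fQuotientIso_block[OF sc M _ _ u(1) s(3) B(1) F_sub[OF check_name s(3) uQ Eu(1)]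
   F_sub[OF check_name B(1) uQ Eu(2)] le u(4)]) (use C[OF u(3)] in auto)
 then obtain r' E Zs where r': "r':P" "r' <~ u" and EZ: "countable E" "countable Zs" "E =< carrier M" "Zs =< carrier M"
  "sq R M (M.span Zs) (M.span E) K" "ALL e:E. (ck e .: B) r'" "ALL z:Zs. (ck z .: A) r'"
  and cover': "ALL q:P. ALL m':carrier M. q <~ r' & (ck m' .: B) q -->
   (EX q':P. q' <~ q & (EX a:carrier M. (ck a .: A) q' & m' \<ominus>\<^bsub>M\<^esub> a:M.span E))"
  and rel': "ALL q:P. ALL t:M.span E. q <~ r' & (ck t .: A) q --> t:M.span Zs"
  by (elim bexE exE conjE) (rule that)
 have cover: "EX q':P. q' <~ q & (EX a:carrier M. (ck a .: A) q' & m' \<ominus>\<^bsub>M\<^esub> a:M.span E)"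
  if "q:P" "m':carrier M" "q <~ r'" "(ck m' .: B) q" for q m' using cover' that by simp
 have rel: "t:M.span Zs" if "q:P" "t:M.span E" "q <~ r'" "(ck t .: A) q" for q t using rel' that by blast
 have r'Q: "r':Q" using QI[OF uQ r'] .
 have LA: "L b x q <-> (ck x .: A) q" and LB: "L (vsuc b) x q <-> (ck x .: B) q"
  if "q:Q" "q <~ r'" "x:carrier M" for x q
  using L_E[OF s(3) that(1,3)] L_E[OF B(1) that(1,3)] Eq[OF Q(1)[OF that(1)] P_trans[OF Q(1)[OF that(1)] r'(1) u(1) that(2) r'(2)]]
  by auto
 have r'r: "r' <~ r'" using P_refl[OF r'(1)] .
 have spE: "M.span E =< carrier M" using M.submoduleD(1)[OF M.submodule_span[OF EZ(3)]] .
 have "EX q':Q. q' <~ q & (EX a:carrier M. L b a q' & m' \<ominus>\<^bsub>M\<^esub> a:M.span E)"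
  if q: "q:Q" "m':carrier M" "q <~ r'" "L (vsuc b) m' q" for q m'
 proof -
  obtain q' a where q': "q':P" "q' <~ q" "a:carrier M" "(ck a .: A) q'" "m' \<ominus>\<^bsub>M\<^esub> a:M.span E"
  using cover[OF Q(1)[OF q(1)] q(2,3)] LB[OF q(1,3,2)] q(4) by blast
  have "q':Q" "q' <~ r'" using QI[OF q(1) q'(1,2)] P_trans[OF q'(1) Q(1)[OF q(1)] r'(1) q'(2) q(3)] by auto
  thus ?thesis using LA q' by blast
 qed
 moreover have "t:M.span Zs" if "q:Q" "t:M.span E" "q <~ r'" "L b t q" for q t
  using rel[OF Q(1)[OF that(1)] that(2,3)] LA[OF that(1,3)] that(2,4) spE by blast
 moreover have "ALL e:E. L (vsuc b) e r'" "ALL z:Zs. L b z r'"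
  using LA[OF r'Q r'r] LB[OF r'Q r'r] EZ(3,4,6,7) by (auto simp: subset_iff)
 moreover have "r' <~ p"
  using P_trans[OF r'(1) s(1) pP P_trans[OF r'(1) u(1) s(1) r'(2) us] P_trans[OF s(1) r(1) pP s(2) r(2)]] .
 ultimately show "EX r:Q. r <~ p & (EX E Zs N. countable E & countable Zs & E =< carrier M & Zs =< carrier M & N:C &
  sq R M (M.span Zs) (M.span E) N & (ALL e:E. L (vsuc b) e r) & (ALL z:Zs. L b z r) &
  (ALL q:Q. ALL m':carrier M. q <~ r & L (vsuc b) m' q -->
   (EX q':Q. q' <~ q & (EX a:carrier M. L b a q' & m' \<ominus>\<^bsub>M\<^esub> a:M.span E))) &
  (ALL q:Q. ALL t:M.span E. q <~ r & L b t q --> t:M.span Zs))"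
  using EZ(1-5) u(3) r'Q
  by (intro bexI[of _ r'] conjI exI[of _ E] exI[of _ Zs] exI[of _ K]) auto
 qed
 thus ?thesis by (rule forced_filtration.good_module_forced[OF _ qh])
qed

lemma forces_filtered_good:
 fixes M :: "('r, 'v) module"
 assumes sigma_closed and M: "lmod R M" "small (carrier M)"
 and C: "!!N. N:C==>lmod R N & countably_presented R N" and qh: "qh_class R C"
 and f: "forces_filtered R C M"
 shows "good_module R C M"
proof -
 obtain p where p: "p:P" using P_nonempty by blast
 hence "(\<^bold>\<exists>\<eta>. \<^bold>\<exists>F. fFiltration R C M \<eta> F) p" using f unfolding forces_filtered_def by blast
 then obtain q \<eta> where q: "q:P" "\<eta>:Nm" "(\<^bold>\<exists>F. fFiltration R C M \<eta> F) q"
 using fEx_cases[OF _ p] by metis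
 then obtain r F where "r:P" "F:Nm" "fFiltration R C M \<eta> F r"
 using fEx_cases[OF q(3,1)] by metis
 thus ?thesis using fFiltration_good assms q(2) by blast
qed

end

theorem potentially_filtered_good:
 fixes M :: "('r, 'v::zfc) module"
 assumes M: "vmodule R M" and C: "!!N. N:C==>vmodule R N & countably_presented R N"
 and qh: "quotient_hereditary R C" and pf: "potentially_filtered R C M"
 shows "good_module R C M"
proof -
 obtain P le where P: "forcing_poset P le" "forcing_poset.sigma_closed P le" "forcing_poset.forces_filtered P le R C M"
 using pf unfolding potentially_filtered_def by blast
 have "ring R" using M unfolding vmodule_def lmodule_def by blast
 hence "qh_class R C"
 using C qh by (simp add: qh_class_def filt_class_def qh_class_axioms_def)
 thus ?thesis
 using forcing_poset.forces_filtered_good[OF P(1,2) _ _ _ _ P(3)] M C by (simp add: vmodule_def lmod_def)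
qed

section \<open>Substitution of equal names and evaluation at check names\<close>

context forcing_poset
begin

text \<open>Names in the extension are only equal to check names, and only below some conditions.
  This property permits replacing them by check names before a formula is evaluated in the ground
  model.\<close>

definition resp :: "('v => 'v => bool) => bool" where
 "resp \<Phi> <-> (ALL x:Nm. ALL y:Nm. ALL p:P. (x .= y) p --> \<Phi> x p --> \<Phi> y p)"

lemma respD: "resp \<Phi>==>x:Nm==>y:Nm==>p:P==>(x .= y) p==>\<Phi> y p==>\<Phi> x p"
 unfolding resp_def using fEq_sym by blast

lemma resp_fNot: "resp \<Phi>==>resp (%x. .~ (\<Phi> x))"
 unfolding resp_def fNot_def by (meson fEq_antimono fEq_sym)

lemma resp_fAnd: "resp \<Phi>==>resp \<Psi>==>resp (%x. \<Phi> x .& \<Psi> x)"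
 unfolding resp_def fAnd_def by blast

lemma resp_fAll: "(!!z. z:A==>resp (%x. \<Phi> x z))==>resp (%x. fAll A (\<Phi> x))"
 unfolding resp_def fAll_def by blast

lemma resp_const: "resp (%x. \<phi>)"
 unfolding resp_def by blast

lemma resp_fMem: "y:Nm==>resp (%x. x .: y)" "y:Nm==>resp (%x. y .: x)"
 unfolding resp_def using fMem_eq_left fMem_eq_right by blast+

lemma resp_fEq: "y:Nm==>resp (%x. x .= y)" "y:Nm==>resp (%x. y .= x)"
 unfolding resp_def using fEq_trans fEq_sym by blast+

lemma Gr_cong:
 assumes p: "p:P" and e: "list_all2 (%x y. x:Nm & y:Nm & (x .= y) p) xs ys" and g: "Gr Q xs p"
 shows "Gr Q ys p"
 unfolding Gr_def
proof (rule dense_below_weaken[OF g[unfolded Gr_def] p])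
 fix r assume r: "r:P" "r <~ p" "EX vs:Q. list_all2 (%x v. (x .= ck v) r) xs vs"
 then obtain vs where vs: "vs:Q" "list_all2 (%x v. (x .= ck v) r) xs vs" by blast
 have "(y .= ck v) r" if "x:Nm & y:Nm & (x .= y) p" "(x .= ck v) r" for x y v
 using that fEq_trans[OF r(1), of y x "ck v"] fEq_sym fEq_antimono[OF _ _ _ p r(1,2)] by auto
 hence "list_all2 (%x v. (x .= ck v) r) ys vs"
 using e vs(2) unfolding list_all2_conv_all_nth by metis
 thus "EX r':P. r' <~ r & (EX vs:Q. list_all2 (%x v. (x .= ck v) r') ys vs)"
 using r(1) P_refl vs(1) by blast
qed

lemma resp_ground:
 "resp (%x. fCarrier M x)" "resp (%x. fZero M x)"
 "y:Nm==>z:Nm==>resp (%x. fAdd M x y z)" "y:Nm==>z:Nm==>resp (%x. fAdd M y x z)"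
 "y:Nm==>z:Nm==>resp (%x. fAdd M y z x)"
 "y:Nm==>resp (%x. fMinus M x y)" "y:Nm==>resp (%x. fMinus M y x)"
 "y:Nm==>resp (%x. fSmult M r x y)" "y:Nm==>resp (%x. fSmult M r y x)"
 unfolding resp_def fCarrier_def fZero_def fAdd_def fMinus_def fSmult_def
 by (auto elim!: Gr_cong[rotated 2] simp: fEq_refl)

lemmas resp_intros = resp_const resp_fNot resp_fAnd resp_fAll resp_fMem resp_fEq resp_ground

lemma resp_defined:
 "B:Nm==>resp (%A. A .<= B)" "B:Nm==>resp (%A. B .<= A)" "resp (fSubmodule R M)"
 "resp (%A. fQuotientIso R M B A N)" "A:Nm==>resp (%B. fQuotientIso R M B A N)"
 "y:Nm==>resp (%x. fSucc x y)" "y:Nm==>resp (fSucc y)" "resp fEmpty" "resp fLimit"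
 "x:Nm==>X:Nm==>resp (%A. fCoset M A x X)" "A:Nm==>X:Nm==>resp (%x. fCoset M A x X)"
 unfolding fSub_def fSubmodule_def fQuotientIso_def fCoset_def fSucc_def fEmpty_def fLimit_def fOrd_def fFun_def
 fMaps_def fPair_def
 by (intro resp_intros | assumption)+

text \<open>Equality to a check name turns a formula into an absolute statement about the ground model.\<close>

lemma fMaps_nm:
 assumes small: "ALL p:P. small (Y p)" and mono: "ALL p:P. ALL q:P. q <~ p --> Y p =< Y q"
 and pair: "ALL p:P. ALL z:Y p. EX a b. z = vpair a b" and p: "p:P" and N: "i:Nm" "A:Nm"
 shows "fMaps (nm Y) i A p <->
 dense_below (%r. EX a b. vpair a b:Y r & (i .= ck a) r & (A .= ck b) r) p"
proof -
 have "fMaps (nm Y) i A p <-> (op i A .: nm Y) p" using fMaps_iff[OF p nm_name N] small by blast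
 also have "\<dots> <-> dense_below (%r. EX z:Y r. (op i A .= ck z) r) p" by (rule mem_nm_iff) (use small mono in blast)+
 also have "\<dots> <-> dense_below (%r. EX a b. vpair a b:Y r & (i .= ck a) r & (A .= ck b) r) p"
 proof (rule dense_below_cong)
 fix r assume r: "r:P"
 have "(op i A .= ck (vpair a b)) r <-> (i .= ck a) r & (A .= ck b) r" for a b
 unfolding check_pair using op_cong[OF r N(1) check_name N(2) check_name] op_inject[OF r N(1) check_name N(2) check_name] by metis
 thus "(EX z:Y r. (op i A .= ck z) r) <-> (EX a b. vpair a b:Y r & (i .= ck a) r & (A .= ck b) r)"
 using pair r by metis
 qed
 finally show ?thesis .
qed

lemma fMaps_check:
 assumes "ALL z:elts g. EX a b. z = vpair a b" "p:P" "i:Nm" "A:Nm"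
 shows "fMaps (ck g) i A p <->
 dense_below (%r. EX a b. vpair a b:elts g & (i .= ck a) r & (A .= ck b) r) p"
 unfolding check_nm[of g] by (rule fMaps_nm) (use assms in auto)

lemma fCoset_check:
 assumes M: "lmod R M" "small (carrier M)" and p: "p:P" and A: "A =< carrier M" and m: "m:carrier M"
 and N: "x:Nm" "X:Nm" and e: "(x .= ck m) p"
 shows "fCoset M (ck (vset A)) x X p <-> (X .= ck (vset (lmod.coset M A m))) p"
proof -
 have sA: "elts (vset A) = A" using elts_vset small_subset[OF M(2) A] by blast
 have eq: "coset_name M (ck (vset A)) m = ck (vset (lmod.coset M A m))"
 proof -
 have "{a +[M] m |a. a:carrier M & (ck a .: ck (vset A)) q} = elts (vset (lmod.coset M A m))"
  if "q:P" for q
  using A check_mem_iff[OF that] small_image[OF small_subset[OF M(2) A]]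
  by (auto simp: lmod.coset_def[OF M(1)] elts_vset sA)
 thus ?thesis unfolding coset_name_def check_nm[of "vset (lmod.coset M A m)"] nm_def
  by (metis (no_types, lifting) SUP_cong)
 qed
 show ?thesis unfolding eq[symmetric] by (rule fCoset_iff[OF M(2) _ p N m e]) simp
qed

lemma fSubmodule_check:
 assumes M: "lmod R M" "small (carrier M)" and A: "submodule A R M" and p: "p:P"
 shows "fSubmodule R M (ck (vset A)) p"
proof -
 note A' = lmod.submoduleD[OF M(1) A]
 have sA: "elts (vset A) = A" using elts_vset small_subset[OF M(2) A'(1)] by blast
 note mem = mem_check_elim[where b = "vset A", unfolded sA]
 show ?thesis unfolding fSubmodule_def
 proof (intro fAndI)
 show "(\<^bold>\<forall>x. x .: ck (vset A) .-> fCarrier M x) p" unfolding fAll_def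
 proof (intro ballI fImpI)
  fix x q assume x: "x:Nm" and q: "q:P" "(x .: ck (vset A)) q"
  show "fCarrier M x q"
  by (rule mem[OF reg_ground(1) q(2,1)], rule respD[OF resp_ground(1) x check_name])
   (use A'(1) in \<open>auto simp: fCarrier_check\<close>)
 qed
 show "(\<^bold>\<forall>x. fZero M x .-> x .: ck (vset A)) p" unfolding fAll_def
 proof (intro ballI fImpI)
  fix x q assume x: "x:Nm" and q: "q:P" "fZero M x q"
  show "(x .: ck (vset A)) q"
  by (rule reg_elim[OF reg_fMem q(2)[unfolded fZero_iff] q(1)], rule respD[OF resp_fMem(1) x check_name])
   (use A'(2) in \<open>auto simp: check_mem_iff sA\<close>)
 qed
 show "(\<^bold>\<forall>x. \<^bold>\<forall>y. \<^bold>\<forall>z. (x .: ck (vset A) .& y .: ck (vset A) .& fAdd M x y z) .-> z .: ck (vset A)) p"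
  unfolding fAll_def
 proof (intro ballI fImpI)
  fix x y z q assume N: "x:Nm" "y:Nm" "z:Nm" and q: "q:P"
  and h: "(x .: ck (vset A) .& y .: ck (vset A) .& fAdd M x y z) q"
  hence h: "(x .: ck (vset A)) q" "(y .: ck (vset A)) q" "fAdd M x y z q" by (auto simp: fAnd_def)
  show "(z .: ck (vset A)) q"
  proof (rule reg_elim[OF reg_fMem h(3)[unfolded fAdd_iff] q])
  fix r assume r: "r:P" "r <~ q"
   "EX a:carrier M. EX b:carrier M. (x .= ck a) r & (y .= ck b) r & (z .= ck (a +[M] b)) r"
  then obtain a b where ab: "(x .= ck a) r" "(y .= ck b) r" "(z .= ck (a +[M] b)) r" by blast
  have "a:A" "b:A"
   using fMem_eq_left[OF r(1) _ check_name check_name _ fMem_antimono[OF _ q r(1,2)]] h(1,2) ab(1,2) N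
   check_mem_iff[OF r(1)] sA by auto
  thus "(z .: ck (vset A)) r"
   using respD[OF resp_fMem(1) N(3) check_name r(1) ab(3)] A'(3) check_mem_iff[OF r(1)] sA by simp
  qed
 qed
 show "(\<^bold>\<forall>x. \<^bold>\<forall>y. (x .: ck (vset A) .& fMinus M x y) .-> y .: ck (vset A)) p"
  unfolding fAll_def
 proof (intro ballI fImpI)
  fix x y q assume N: "x:Nm" "y:Nm" and q: "q:P" and h: "(x .: ck (vset A) .& fMinus M x y) q"
  hence h: "(x .: ck (vset A)) q" "fMinus M x y q" by (auto simp: fAnd_def)
  show "(y .: ck (vset A)) q"
  proof (rule reg_elim[OF reg_fMem h(2)[unfolded fMinus_iff] q])
  fix r assume r: "r:P" "r <~ q" "EX a:carrier M. (x .= ck a) r & (y .= ck (\<ominus>\<^bsub>M\<^esub> a)) r"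
  then obtain a where ab: "(x .= ck a) r" "(y .= ck (\<ominus>\<^bsub>M\<^esub> a)) r" by blast
  have "a:A"
   using fMem_eq_left[OF r(1) N(1) check_name check_name ab(1) fMem_antimono[OF h(1) q r(1,2)]] check_mem_iff[OF r(1)] sA by auto
  thus "(y .: ck (vset A)) r"
   using respD[OF resp_fMem(1) N(2) check_name r(1) ab(2)] A'(5) check_mem_iff[OF r(1)] sA by simp
  qed
 qed
 show "fAll (carrier R) (%s. \<^bold>\<forall>x. \<^bold>\<forall>y. (x .: ck (vset A) .& fSmult M s x y) .-> y .: ck (vset A)) p"
  unfolding fAll_def
 proof (intro ballI fImpI)
  fix s x y q assume s: "s:carrier R" and N: "x:Nm" "y:Nm" and q: "q:P"
  and h: "(x .: ck (vset A) .& fSmult M s x y) q"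
  hence h: "(x .: ck (vset A)) q" "fSmult M s x y q" by (auto simp: fAnd_def)
  show "(y .: ck (vset A)) q"
  proof (rule reg_elim[OF reg_fMem h(2)[unfolded fSmult_iff] q])
  fix r assume r: "r:P" "r <~ q" "EX a:carrier M. (x .= ck a) r & (y .= ck (s *[M] a)) r"
  then obtain a where ab: "(x .= ck a) r" "(y .= ck (s *[M] a)) r" by blast
  have "a:A"
   using fMem_eq_left[OF r(1) N(1) check_name check_name ab(1) fMem_antimono[OF h(1) q r(1,2)]] check_mem_iff[OF r(1)] sA by auto
  thus "(y .: ck (vset A)) r"
   using respD[OF resp_fMem(1) N(2) check_name r(1) ab(2)] A'(4)[OF s] check_mem_iff[OF r(1)] sA by simp
  qed
 qed
 qed
qed

lemmas reg_intros = reg_fNot reg_fAnd reg_fAll reg_fMem reg_fEq reg_ground reg_fCoset reg_fPair reg_fMaps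

text \<open>A ground model isomorphism remains one in the extension: forcing adds no elements to
  \<open>B\<close>, to \<open>K\<close> or to a coset, so all names involved are densely check names
  and the clauses reduce to properties of \<open>g\<close>.\<close>

lemma fQuotientIso_check:
 assumes M: "lmod R M" "small (carrier M)" and K: "lmod R K" "small (carrier K)"
 and A: "submodule A R M" and B: "submodule B R M" "A =< B" and sq: "sq R M A B K" and p: "p:P"
 shows "fQuotientIso R M (ck (vset B)) (ck (vset A)) K p"
proof -
 obtain g where g: "mod_hom R (submodule_of M B) K g" "g ` B = carrier K" "{x:B. g x = 0[K]} = A"
 using sq unfolding sq_def by blast
 interpret g: lmod_hom R M K B g using M(1) K(1) B(1) g(1) by (intro lmod_hom.intro lmod_hom_axioms.intro)
 note B' = g.M.submoduleD[OF B(1)]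
 have sA: "A =< carrier M" and sB: "elts (vset B) = B"
 using B(2) B'(1) elts_vset small_subset[OF M(2) B'(1)] by auto
 define cs where "cs b = vset (g.M.coset A b)" for b
 have gcs: "g b = g c" if "cs b = cs c" "b:B" "c:B" for b c
 proof -
 have "small (g.M.coset A b)" for b
  unfolding g.M.coset_def by (rule small_image[OF small_subset[OF M(2) sA]])
 hence "b \<ominus>\<^bsub>M\<^esub> c:A" using that g.M.coset_eq_iff[OF A B(1,2), of b c] B'(1) by (auto simp: cs_def vset_inject)
 thus ?thesis using g.hom_eq_iff[OF that(2,3)] g.hom_zero g(3) by auto
 qed
 have csg: "cs b = cs c" if "g b = g c" "b:B" "c:B" for b c
 proof -
 have "b \<ominus>\<^bsub>M\<^esub> c:B" "g (b \<ominus>\<^bsub>M\<^esub> c) = 0[K]"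
  using that B'(6) g.hom_diff[OF that(2,3)] g.N.diff_self[OF g.hom_closed[OF that(3)]] by auto
 hence "b \<ominus>\<^bsub>M\<^esub> c:A" using g(3) by blast
 thus ?thesis using that g.M.coset_eq_iff[OF A B(1,2), of b c] B'(1) by (auto simp: cs_def subset_iff)
 qed
 \<comment> \<open>The graph of the map induced by \<open>g\<close> on coset codes; its check name
   witnesses the existential quantifier of \<open>fQuotientIso\<close>.\<close>
 define G where "G = vset ((%b. vpair (cs b) (g b)) ` B)"
 have eG: "elts G = (%b. vpair (cs b) (g b)) ` B"
 unfolding G_def by (intro elts_vset small_image small_subset[OF M(2) B'(1)])
 have pG: "ALL z:elts G. EX a b. z = vpair a b" using eG by auto
 have maps: "dense_below (%r. EX b:B. (X .= ck (cs b)) r & (u .= ck (g b)) r) q"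
 if "fMaps (ck G) X u q" "q:P" "X:Nm" "u:Nm" for X u q
 proof (rule dense_below_weaken[OF that(1)[unfolded fMaps_check[OF pG that(2-4)]] that(2)])
 fix r assume r: "r:P" and "EX a b. vpair a b:elts G & (X .= ck a) r & (u .= ck b) r"
 thus "EX r':P. r' <~ r & (EX b:B. (X .= ck (cs b)) r' & (u .= ck (g b)) r')"
  using P_refl[OF r] unfolding eG by (intro bexI[OF _ r]) auto
 qed
 have maps_val: "(u .= ck (g a)) q"
 if "fMaps (ck G) X u q" "q:P" "X:Nm" "u:Nm" "(X .= ck (cs a)) q" "a:B" for X u q a
 proof (rule reg_elim[OF reg_fEq[OF that(4) check_name] maps[OF that(1-4)] that(2)])
 fix r assume r: "r:P" "r <~ q" "EX b:B. (X .= ck (cs b)) r & (u .= ck (g b)) r"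
 then obtain b where b: "b:B" "(X .= ck (cs b)) r" "(u .= ck (g b)) r" by blast
 have "(ck (cs a) .= ck (cs b)) r"
  using fEq_trans[OF r(1) check_name that(3) check_name fEq_sym[OF fEq_antimono[OF that(5,3) check_name that(2) r(1,2)]] b(2)] .
 thus "(u .= ck (g a)) r" using check_eq_iff[OF r(1)] gcs[of a b] b that(6) by simp
 qed
 note cos = fCoset_check[OF M _ sA _ _ _ _, folded cs_def]
 have coset_val: "(X .= ck (cs a)) q"
 if "fCoset M (ck (vset A)) x X q" "q:P" "(x .= ck a) q" "a:B" "x:Nm" "X:Nm" for x X q a
 using cos[OF that(2) _ that(5,6,3)] that(1,4) B'(1) by blast
 have mem_val: "a:B" if "(x .: ck (vset B)) q" "q:P" "(x .= ck a) r" "r:P" "r <~ q" "x:Nm" for x q r a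
 using fMem_eq_left[OF that(4,6) check_name check_name that(3) fMem_antimono[OF that(1,2,4,5)]] check_mem_iff[OF that(4)] sB by simp
 let ?B = "ck (vset B)" and ?A = "ck (vset A)"
 define D where "D X = (\<^bold>\<exists>x. x .: ?B .& fCoset M ?A x X)" for X
 have reg_D: "reg (D X)" if "X:Nm" for X unfolding D_def by (intro reg_intros)
 have D_here: "D (ck (cs b)) q" if "b:B" "q:P" for b q
 unfolding D_def
 proof (rule reg_conj_ex_here[OF that(2) check_name[of b]])
 show "(ck b .: ?B .& fCoset M ?A (ck b) (ck (cs b))) q"
  using that cos[OF that(2) _ check_name check_name fEq_refl[OF that(2) check_name]] fEq_refl[OF that(2) check_name]
  check_mem_iff[OF that(2)] sB B'(1) by (auto simp: fAnd_def)
 qed (intro reg_intros)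
 have main: "(fFun D (ck G) .&
  (\<^bold>\<forall>X. \<^bold>\<forall>u. fMaps (ck G) X u .-> fCarrier K u) .&
  (\<^bold>\<forall>X. \<^bold>\<forall>X'. \<^bold>\<forall>u. (fMaps (ck G) X u .& fMaps (ck G) X' u) .-> X .= X') .&
  (\<^bold>\<forall>u. fCarrier K u .-> (\<^bold>\<exists>X. fMaps (ck G) X u)) .&
  (\<^bold>\<forall>x. \<^bold>\<forall>y. \<^bold>\<forall>z. \<^bold>\<forall>X. \<^bold>\<forall>Y. \<^bold>\<forall>Z. \<^bold>\<forall>u. \<^bold>\<forall>v. \<^bold>\<forall>w. (x .: ?B .& y .: ?B .& fAdd M x y z .&
  fCoset M ?A x X .& fCoset M ?A y Y .& fCoset M ?A z Z .&
  fMaps (ck G) X u .& fMaps (ck G) Y v .& fMaps (ck G) Z w) .-> fAdd K u v w) .&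
  fAll (carrier R) (%s. \<^bold>\<forall>x. \<^bold>\<forall>y. \<^bold>\<forall>X. \<^bold>\<forall>Y. \<^bold>\<forall>u. \<^bold>\<forall>v.
  (x .: ?B .& fSmult M s x y .& fCoset M ?A x X .& fCoset M ?A y Y .&
  fMaps (ck G) X u .& fMaps (ck G) Y v) .-> fSmult K s u v)) p" for p
 proof -
 have "fFun D (ck G) p"
 unfolding fFun_def
 proof (intro fAndI)
 show "(\<^bold>\<forall>z. z .: ck G .-> (\<^bold>\<exists>x. D x .& (\<^bold>\<exists>y. fPair z x y))) p"
  unfolding fAll_def[of Nm "%z. z .: ck G .-> (\<^bold>\<exists>x. D x .& (\<^bold>\<exists>y. fPair z x y))"]
 proof (intro ballI fImpI)
  fix z q assume z: "z:Nm" and q: "q:P" "(z .: ck G) q"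
  have reg1: "reg (\<^bold>\<exists>y. fPair z x y)" if "x:Nm" for x using that by (intro reg_intros)
  have reg2: "reg (D x .& (\<^bold>\<exists>y. fPair z x y))" if "x:Nm" for x using reg_D[OF that] reg1[OF that] by (intro reg_fAnd)
  show "(\<^bold>\<exists>x. D x .& (\<^bold>\<exists>y. fPair z x y)) q"
  proof (rule mem_check_elim[OF _ q(2,1)])
  fix r w assume r: "r:P" "r <~ q" and w: "w:elts G" "(z .= ck w) r"
  then obtain b where b: "b:B" "w = vpair (cs b) (g b)" using eG by blast
  have "fPair z (ck (cs b)) (ck (g b)) r"
   using fPair_iff[OF r(1) z check_name check_name] w(2) b(2) by (simp add: check_pair)
  hence "(\<^bold>\<exists>y. fPair z (ck (cs b)) y) r" by (intro reg_conj_ex_here[where \<Phi> = "fPair z (ck (cs b))" and x = "ck (g b)"] r(1) check_name reg_fPair)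
  thus "(\<^bold>\<exists>x. D x .& (\<^bold>\<exists>y. fPair z x y)) r"
   by (intro reg_conj_ex_here[where \<Phi> = "%x. D x .& (\<^bold>\<exists>y. fPair z x y)" and x = "ck (cs b)"]
   reg2 check_name fAndI D_here b(1) r(1))
  qed (intro reg_fNot reg_fAll reg2)
 qed
 show "(\<^bold>\<forall>x. D x .-> (\<^bold>\<exists>y. fMaps (ck G) x y)) p"
  unfolding fAll_def[of Nm "%x. D x .-> (\<^bold>\<exists>y. fMaps (ck G) x y)"]
 proof (intro ballI fImpI)
  fix X q assume X: "X:Nm" and q: "q:P" and D: "D X q"
  show "(\<^bold>\<exists>y. fMaps (ck G) X y) q"
  proof (rule reg_elim[OF _ D[unfolded D_def fEx_iff] q])
  show "reg (\<^bold>\<exists>y. fMaps (ck G) X y)" using X by (intro reg_intros)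
  fix r assume r: "r:P" "r <~ q" "EX x:Nm. (x .: ?B .& fCoset M ?A x X) r"
  then obtain x where x: "x:Nm" "(x .: ?B) r" "fCoset M ?A x X r" by (auto simp: fAnd_def)
  show "(\<^bold>\<exists>y. fMaps (ck G) X y) r"
  proof (rule mem_check_elim[OF _ x(2) r(1)])
   show "reg (\<^bold>\<exists>y. fMaps (ck G) X y)" using X by (intro reg_intros)
   fix s b assume s: "s:P" "s <~ r" and b: "b:elts (vset B)" "(x .= ck b) s"
   have bB: "b:B" using b sB by simp
   have e: "(X .= ck (cs b)) s"
   by (rule coset_val[OF regD[OF reg_fCoset x(3) r(1) s] s(1) b(2) bB x(1) X])
   have "fMaps (ck G) X (ck (g b)) s"
   unfolding fMaps_check[OF pG s(1) X check_name]
   by (rule dense_below_here[OF s(1)]) (use fEq_antimono[OF e X check_name s(1)] fEq_refl[OF _ check_name] bB eG in blast)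
   thus "(\<^bold>\<exists>y. fMaps (ck G) X y) s" by (intro reg_conj_ex_here[where \<Phi> = "fMaps (ck G) X" and x = "ck (g b)"] s(1) X check_name reg_fMaps)
  qed
  qed
 qed
 show "(\<^bold>\<forall>x. \<^bold>\<forall>y. \<^bold>\<forall>y'. (fMaps (ck G) x y .& fMaps (ck G) x y') .-> y .= y') p"
  unfolding fAll_def
 proof (intro ballI fImpI)
  fix X u v q assume N: "X:Nm" "u:Nm" "v:Nm" and q: "q:P" and h: "(fMaps (ck G) X u .& fMaps (ck G) X v) q"
  hence h: "fMaps (ck G) X u q" "fMaps (ck G) X v q" by (auto simp: fAnd_def)
  show "(u .= v) q"
  proof (rule reg_elim[OF reg_fEq[OF N(2,3)] maps[OF h(1) q N(1,2)] q])
  fix r assume r: "r:P" "r <~ q" "EX b:B. (X .= ck (cs b)) r & (u .= ck (g b)) r"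
  then obtain b where b: "b:B" "(X .= ck (cs b)) r" "(u .= ck (g b)) r" by blast
  show "(u .= v) r"
   using maps_val[OF regD[OF reg_fMaps[OF N(1,3)] h(2) q r(1,2)] r(1) N(1,3) b(2,1)] b(3)
   fEq_trans[OF r(1) N(2) check_name N(3)] fEq_sym by blast
  qed
 qed
 qed
 moreover have "(\<^bold>\<forall>X. \<^bold>\<forall>u. fMaps (ck G) X u .-> fCarrier K u) p"
 unfolding fAll_def
 proof (intro ballI fImpI)
 fix X u q assume N: "X:Nm" "u:Nm" and q: "q:P" and h: "fMaps (ck G) X u q"
 show "fCarrier K u q"
  by (rule reg_elim[OF reg_ground(1) maps[OF h q N] q])
  (use respD[OF resp_ground(1) N(2) check_name] fCarrier_check g.hom_closed in blast)
 qed
 moreover have "(\<^bold>\<forall>X. \<^bold>\<forall>X'. \<^bold>\<forall>u. (fMaps (ck G) X u .& fMaps (ck G) X' u) .-> X .= X') p"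
 unfolding fAll_def
 proof (intro ballI fImpI)
 fix X X' u q assume N: "X:Nm" "X':Nm" "u:Nm" and q: "q:P" and h: "(fMaps (ck G) X u .& fMaps (ck G) X' u) q"
 hence h: "fMaps (ck G) X u q" "fMaps (ck G) X' u q" by (auto simp: fAnd_def)
 show "(X .= X') q"
 proof (rule reg_elim[OF reg_fEq[OF N(1,2)] maps[OF h(1) q N(1,3)] q])
  fix r assume r: "r:P" "r <~ q" "EX b:B. (X .= ck (cs b)) r & (u .= ck (g b)) r"
  then obtain b where b: "b:B" "(X .= ck (cs b)) r" "(u .= ck (g b)) r" by blast
  show "(X .= X') r"
  proof (rule reg_elim[OF reg_fEq[OF N(1,2)] maps[OF regD[OF reg_fMaps[OF N(2,3)] h(2) q r(1,2)] r(1) N(2,3)] r(1)])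
  fix s assume s: "s:P" "s <~ r" "EX b:B. (X' .= ck (cs b)) s & (u .= ck (g b)) s"
  then obtain c where c: "c:B" "(X' .= ck (cs c)) s" "(u .= ck (g c)) s" by blast
  have "(ck (g b) .= ck (g c)) s"
   using fEq_trans[OF s(1) check_name N(3) check_name fEq_sym[OF fEq_antimono[OF b(3) N(3) check_name r(1) s(1,2)]] c(3)] .
  hence "cs b = cs c" using check_eq_iff[OF s(1)] csg[of b c] b c by simp
  thus "(X .= X') s"
   using fEq_trans[OF s(1) N(1) check_name N(2) fEq_antimono[OF b(2) N(1) check_name r(1) s(1,2)]] fEq_sym[OF c(2)] by simp
  qed
 qed
 qed
 moreover have "(\<^bold>\<forall>u. fCarrier K u .-> (\<^bold>\<exists>X. fMaps (ck G) X u)) p"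
 unfolding fAll_def[of Nm "%u. fCarrier K u .-> (\<^bold>\<exists>X. fMaps (ck G) X u)"]
 proof (intro ballI fImpI)
 fix u q assume u: "u:Nm" and q: "q:P" and h: "fCarrier K u q"
 show "(\<^bold>\<exists>X. fMaps (ck G) X u) q"
 proof (rule reg_elim[OF _ h[unfolded fCarrier_iff] q])
  show "reg (\<^bold>\<exists>X. fMaps (ck G) X u)" using u by (intro reg_intros)
  fix r assume r: "r:P" "r <~ q" "EX a:carrier K. (u .= ck a) r"
  then obtain a where a: "a:g ` B" "(u .= ck a) r" using g(2) by auto
  then obtain b where b: "b:B" "(u .= ck (g b)) r" by auto
  have "fMaps (ck G) (ck (cs b)) u r"
  unfolding fMaps_check[OF pG r(1) check_name u]
  by (rule dense_below_here[OF r(1)]) (use fEq_antimono[OF b(2) u check_name r(1)] fEq_refl[OF _ check_name] b(1) eG in blast)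
  thus "(\<^bold>\<exists>X. fMaps (ck G) X u) r" by (intro reg_conj_ex_here[where \<Phi> = "%X. fMaps (ck G) X u" and x = "ck (cs b)"] r(1) u check_name reg_fMaps)
 qed
 qed
 moreover have "(\<^bold>\<forall>x. \<^bold>\<forall>y. \<^bold>\<forall>z. \<^bold>\<forall>X. \<^bold>\<forall>Y. \<^bold>\<forall>Z. \<^bold>\<forall>u. \<^bold>\<forall>v. \<^bold>\<forall>w. (x .: ?B .& y .: ?B .& fAdd M x y z .&
  fCoset M ?A x X .& fCoset M ?A y Y .& fCoset M ?A z Z .&
  fMaps (ck G) X u .& fMaps (ck G) Y v .& fMaps (ck G) Z w) .-> fAdd K u v w) p"
 unfolding fAll_def
 proof (intro ballI fImpI)
 fix x y z X Y Z u v w q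
 assume N: "x:Nm" "y:Nm" "z:Nm" "X:Nm" "Y:Nm" "Z:Nm" "u:Nm" "v:Nm" "w:Nm" and q: "q:P"
  and h: "(x .: ?B .& y .: ?B .& fAdd M x y z .& fCoset M ?A x X .& fCoset M ?A y Y .& fCoset M ?A z Z .&
  fMaps (ck G) X u .& fMaps (ck G) Y v .& fMaps (ck G) Z w) q"
 hence h: "(x .: ?B) q" "(y .: ?B) q" "fAdd M x y z q" "fCoset M ?A x X q" "fCoset M ?A y Y q" "fCoset M ?A z Z q"
  "fMaps (ck G) X u q" "fMaps (ck G) Y v q" "fMaps (ck G) Z w q" by (auto simp: fAnd_def)
 show "fAdd K u v w q"
 proof (rule reg_elim[OF reg_ground(3) h(3)[unfolded fAdd_iff] q])
  fix r assume r: "r:P" "r <~ q"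
  "EX a:carrier M. EX b:carrier M. (x .= ck a) r & (y .= ck b) r & (z .= ck (a +[M] b)) r"
  then obtain a b where ab: "(x .= ck a) r" "(y .= ck b) r" "(z .= ck (a +[M] b)) r" by blast
  have aB: "a:B" "b:B" using mem_val[OF h(1) q ab(1) r(1,2) N(1)] mem_val[OF h(2) q ab(2) r(1,2) N(2)] .
  have val: "(u' .= ck (g c)) r" if "(x' .= ck c) r" "c:B" "x':Nm" "X':Nm" "u':Nm"
   "fCoset M ?A x' X' q" "fMaps (ck G) X' u' q" for x' X' u' c
  using maps_val[OF regD[OF reg_fMaps[OF that(4,5)] that(7) q r(1,2)] r(1) that(4,5)
   coset_val[OF regD[OF reg_fCoset that(6) q r(1,2)] r(1) that(1,2,3,4)] that(2)] .
  have "fAdd K (ck (g a)) (ck (g b)) (ck (g (a +[M] b))) r"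
  using fAdd_check[OF r(1), of K] g.hom_add[OF aB] g.hom_closed aB by simp
  hence "fAdd K u (ck (g b)) (ck (g (a +[M] b))) r"
  by (rule respD[OF resp_ground(3)[OF check_name check_name] N(7) check_name r(1) val[OF ab(1) aB(1) N(1,4,7) h(4,7)]])
  hence "fAdd K u v (ck (g (a +[M] b))) r"
  by (rule respD[OF resp_ground(4)[OF N(7) check_name] N(8) check_name r(1) val[OF ab(2) aB(2) N(2,5,8) h(5,8)]])
  thus "fAdd K u v w r"
  by (rule respD[OF resp_ground(5)[OF N(7,8)] N(9) check_name r(1) val[OF ab(3) B'(3)[OF aB] N(3,6,9) h(6,9)]])
 qed
 qed
 moreover have "fAll (carrier R) (%s. \<^bold>\<forall>x. \<^bold>\<forall>y. \<^bold>\<forall>X. \<^bold>\<forall>Y. \<^bold>\<forall>u. \<^bold>\<forall>v.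
  (x .: ?B .& fSmult M s x y .& fCoset M ?A x X .& fCoset M ?A y Y .&
  fMaps (ck G) X u .& fMaps (ck G) Y v) .-> fSmult K s u v) p"
 unfolding fAll_def
 proof (intro ballI fImpI)
 fix s x y X Y u v q
 assume s: "s:carrier R" and N: "x:Nm" "y:Nm" "X:Nm" "Y:Nm" "u:Nm" "v:Nm" and q: "q:P"
  and h: "(x .: ?B .& fSmult M s x y .& fCoset M ?A x X .& fCoset M ?A y Y .&
  fMaps (ck G) X u .& fMaps (ck G) Y v) q"
 hence h: "(x .: ?B) q" "fSmult M s x y q" "fCoset M ?A x X q" "fCoset M ?A y Y q"
  "fMaps (ck G) X u q" "fMaps (ck G) Y v q" by (auto simp: fAnd_def)
 show "fSmult K s u v q"
 proof (rule reg_elim[OF reg_ground(5) h(2)[unfolded fSmult_iff] q])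
  fix r assume r: "r:P" "r <~ q" "EX a:carrier M. (x .= ck a) r & (y .= ck (s *[M] a)) r"
  then obtain a where ab: "(x .= ck a) r" "(y .= ck (s *[M] a)) r" by blast
  have aB: "a:B" using mem_val[OF h(1) q ab(1) r(1,2) N(1)] .
  have val: "(u' .= ck (g c)) r" if "(x' .= ck c) r" "c:B" "x':Nm" "X':Nm" "u':Nm"
   "fCoset M ?A x' X' q" "fMaps (ck G) X' u' q" for x' X' u' c
  using maps_val[OF regD[OF reg_fMaps[OF that(4,5)] that(7) q r(1,2)] r(1) that(4,5)
   coset_val[OF regD[OF reg_fCoset that(6) q r(1,2)] r(1) that(1,2,3,4)] that(2)] .
  have "fSmult K s (ck (g a)) (ck (g (s *[M] a))) r"
  using fSmult_check[OF r(1), of K] g.hom_smult[OF s aB] g.hom_closed aB by simp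
  hence "fSmult K s u (ck (g (s *[M] a))) r"
  by (rule respD[OF resp_ground(8)[OF check_name] N(5) check_name r(1) val[OF ab(1) aB N(1,3,5) h(3,5)]])
  thus "fSmult K s u v r"
  by (rule respD[OF resp_ground(9)[OF N(5)] N(6) check_name r(1) val[OF ab(2) B'(4)[OF s aB] N(2,4,6) h(4,6)]])
 qed
 qed
 ultimately show ?thesis by (simp add: fAnd_def)
 qed
 show ?thesis
 unfolding fQuotientIso_def
 proof (subst fEx_iff, rule dense_below_here[OF p], rule bexI[where x = "ck G"])
 qed (use main in \<open>simp_all only: D_def[abs_def] check_name\<close>)
qed

lemma fSucc_check_iff: "p:P==>fSucc (ck a) (ck b) p <-> b = vsuc a"
proof
 assume p: "p:P" and h: "fSucc (ck a) (ck b) p"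
 have "c:elts b <-> c = a | c:elts a" for c
 proof -
 have "(ck c .: ck b .<-> (ck c .= ck a .| ck c .: ck a)) p"
  using fAllD[OF h[unfolded fSucc_def] check_name] .
 hence "(ck c .: ck b) p <-> (ck c .= ck a .| ck c .: ck a) p"
  by (rule fIffD) (auto intro!: reg_intros P_refl p)
 moreover have "(ck c .= ck a .| ck c .: ck a) p <-> c = a | c:elts a"
 proof
  assume "(ck c .= ck a .| ck c .: ck a) p"
  from dense_here[OF this[unfolded fOr_iff] p] show "c = a | c:elts a" by (auto simp: check_mem_iff check_eq_iff)
 next
  assume "c = a | c:elts a"
  thus "(ck c .= ck a .| ck c .: ck a) p"
  unfolding fOr_iff by (intro dense_below_here[OF p]) (auto simp: check_mem_iff check_eq_iff)
 qed
 ultimately show ?thesis using check_mem_iff[OF p] by simp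
 qed
 thus "b = vsuc a" by (auto simp flip: elts_inject)
qed (simp add: fSucc_check)

lemma fLimit_checkD:
 assumes p: "p:P" and h: "fLimit (ck a) p" and a: "vord a"
 shows "vlimit a"
proof -
 have h: "(.~ fEmpty (ck a)) p" "(\<^bold>\<forall>j. j .: ck a .-> (\<^bold>\<exists>k. k .: ck a .& j .: k)) p"
 using h by (auto simp: fLimit_def fAnd_def)
 have "elts a ~= {}" using h(1) fEmpty_check[OF p] P_refl[OF p] p by (auto simp: fNot_def)
 moreover have "EX k:elts a. j:elts k" if j: "j:elts a" for j
 proof -
 have "(\<^bold>\<exists>k. k .: ck a .& ck j .: k) p"
  by (rule fImpD[OF fAllD[OF h(2) check_name[of j]] _ _ p p P_refl[OF p]])
  (use j check_mem_iff[OF p] in \<open>auto intro!: reg_intros\<close>)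
 then obtain r k where r: "r:P" "r <~ p" "k:Nm" "(k .: ck a .& ck j .: k) r"
  by (rule fEx_cases[OF _ p])
 note r = r(1,3) r(4)[THEN fAndD1] r(4)[THEN fAndD2]
 obtain s b where s: "s:P" "s <~ r" "b:elts a" "(k .= ck b) s"
  using dense_here[OF r(3)[unfolded mem_check_iff] r(1)] by blast
 have "(ck j .: ck b) s"
  using fMem_eq_right[OF s(1) check_name r(2) check_name s(4) fMem_antimono[OF r(4,1) s(1,2)]] .
 thus ?thesis using check_mem_iff[OF s(1)] s(3) by blast
 qed
 ultimately show ?thesis using a by (simp add: vlimit_def)
qed

end

section \<open>The generic union of a coherent system of chains\<close>

context forcing_poset
begin

lemma fAllI: "(!!x. x:A==>\<Phi> x p)==>fAll A \<Phi> p"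
 by (simp add: fAll_def)

lemma resp_fOrd: "resp fOrd"
 unfolding fOrd_def fSub_def by (intro resp_intros | assumption)+

lemma resp_fMaps: "f:Nm==>y:Nm==>resp (%x. fMaps f x y)"
 unfolding fMaps_def fPair_def by (intro resp_intros | assumption)+

text \<open>New members lie above the old top, so the Mostowski ranks of old members are final. The
  maps from ranks to members thus cohere, their union along the generic filter is a filtration, and
  density makes it exhaust \<open>M\<close>.\<close>

lemma forces_filtered_generic:
 assumes M: "lmod R M" "small (carrier M)" and C: "!!K. K:C==>lmod R K & small (carrier K)"
 and fc: "!!p. p:P==>fchain R C M {0[M]} (T p) (FF p)"
 and ext: "!!p q. p:P==>q:P==>q <~ p==>FF p =< FF q & (ALL A:FF q - FF p. T p =< A)"
 and dense: "!!p m. p:P==>m:carrier M==>EX q:P. q <~ p & m:T q"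
 shows "forces_filtered R C M"
proof -
 note fD = fchainD[OF fc]
 define \<rho> where "\<rho> p = rk (FF p)" for p
 have sub: "A =< carrier M" "small A" if "p:P" "A:FF p" for p A
 using lmod.submoduleD(1)[OF M(1) fD(3)[OF that]] small_subset[OF M(2)] by auto
 \<comment> \<open>Below an old member no new ones appear, so the recursions defining the two ranks
   run over the same members.\<close>
 have agree: "\<rho> q A = \<rho> p A" if pq: "p:P" "q:P" "q <~ p" and A: "A:FF p" for p q A
 using fchain_wf[OF fc[OF pq(1)] M(2,1)] A
 proof (induction A rule: wf_induct_rule)
 case (less A)
 have "{B:FF q. B << A} = {B:FF p. B << A}"
  using ext[OF pq] fD(5)[OF pq(1) less.prems] by blast
 moreover have "\<rho> q ` {B:FF p. B << A} = \<rho> p ` {B:FF p. B << A}"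
  by (rule image_cong[OF refl]) (use less in auto)
 moreover have "A:FF q" using ext[OF pq] less.prems by blast
 ultimately have "elts (\<rho> q A) = elts (\<rho> p A)"
  using elts_rk[OF fc[OF pq(1)] M(2,1) less.prems] elts_rk[OF fc[OF pq(2)] M(2,1), of A] by (simp add: \<rho>_def)
 thus ?case by (simp add: elts_inject)
 qed
 \<comment> \<open>Each condition contributes the ranks of its members to the length, and the pairs
   of rank and member to the filtration; coherence makes both families increase along the
   filter.\<close>
 define Y where "Y p = \<rho> p ` FF p" for p
 define G where "G p = (%A. vpair (\<rho> p A) (vset A)) ` FF p" for p
 have Pow: "FF p =< Pow (carrier M)" if "p:P" for p using sub that by blast
 have sY: "ALL p:P. small (Y p)" and sG: "ALL p:P. small (G p)"
 unfolding Y_def G_def using small_family[OF M(2) Pow] by blast+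
 have mY: "ALL p:P. ALL q:P. q <~ p --> Y p =< Y q" and mG: "ALL p:P. ALL q:P. q <~ p --> G p =< G q"
 proof -
 have "Y p =< Y q & G p =< G q" if "p:P" "q:P" "q <~ p" for p q
 proof -
  have "\<rho> p A = \<rho> q A & A:FF q" if "A:FF p" for A
  using ext[OF \<open>p:P\<close> \<open>q:P\<close> \<open>q <~ p\<close>] agree[OF \<open>p:P\<close> \<open>q:P\<close> \<open>q <~ p\<close> that] that by auto
  thus ?thesis unfolding Y_def G_def by auto
 qed
 thus "ALL p:P. ALL q:P. q <~ p --> Y p =< Y q" "ALL p:P. ALL q:P. q <~ p --> G p =< G q" by blast+
 qed
 define \<eta> F where "\<eta> = nm Y" and "F = nm G"
 have N [simp]: "\<eta>:Nm" "F:Nm" unfolding \<eta>_def F_def using nm_name sY sG by auto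
 have \<eta>_iff: "(x .: \<eta>) p <-> dense_below (%r. EX D:FF r. (x .= ck (\<rho> r D)) r) p" for x p
 using mem_nm_iff[of Y x p] sY mY unfolding \<eta>_def by (simp add: Y_def)
 have F_iff: "fMaps F i A p <->
  dense_below (%r. EX D:FF r. (i .= ck (\<rho> r D)) r & (A .= ck (vset D)) r) p"
 if "p:P" "i:Nm" "A:Nm" for i A p
 proof -
 have "fMaps F i A p <->
  dense_below (%r. EX a b. vpair a b:G r & (i .= ck a) r & (A .= ck b) r) p"
  unfolding F_def by (rule fMaps_nm[OF sG mG _ that]) (auto simp: G_def)
 also have "\<dots> <-> dense_below (%r. EX D:FF r. (i .= ck (\<rho> r D)) r & (A .= ck (vset D)) r) p"
  by (rule dense_below_cong) (auto simp: G_def image_iff)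
 finally show ?thesis .
 qed
 have \<eta>_here: "(ck (\<rho> p D) .: \<eta>) p"
 and F_here: "fMaps F (ck (\<rho> p D)) (ck (vset D)) p" if p: "p:P" "D:FF p" for p D
 proof -
 have "D:FF q & (ck (\<rho> p D) .= ck (\<rho> q D)) q & (ck (vset D) .= ck (vset D)) q"
  if "q:P" "q <~ p" for q
  using ext[OF p(1) that] agree[OF p(1) that p(2)] p(2) fEq_refl[OF that(1) check_name] by auto
 thus "(ck (\<rho> p D) .: \<eta>) p" "fMaps F (ck (\<rho> p D)) (ck (vset D)) p"
  unfolding \<eta>_iff F_iff[OF p(1) check_name check_name] by (auto intro!: dense_below_here[OF p(1)])
 qed
 have F_cases: "\<chi> q" if \<chi>: "reg \<chi>" and m: "fMaps F i A q" "q:P" "i:Nm" "A:Nm"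
 and "!!r D. r:P==>r <~ q==>D:FF r==>(i .= ck (\<rho> r D)) r==>(A .= ck (vset D)) r==>\<chi> r" for \<chi> q i A
 by (rule reg_elim[OF \<chi> F_iff[OF m(2-4), THEN iffD1, OF m(1)] m(2)]) (use that(6) in blast)
 have F_cases2: "\<chi> q" if \<chi>: "reg \<chi>" and q: "q:P" and m: "fMaps F i A q" "i:Nm" "A:Nm" and m': "fMaps F j B q" "j:Nm" "B:Nm"
 and *: "!!r D E. r:P==>r <~ q==>D:FF r==>E:FF r==>(i .= ck (\<rho> r D)) r==>(A .= ck (vset D)) r ==>
  (j .= ck (\<rho> r E)) r==>(B .= ck (vset E)) r==>\<chi> r" for \<chi> q i A j B
 proof (rule F_cases[OF \<chi> m(1) q m(2,3)])
 fix r D assume r: "r:P" "r <~ q" "D:FF r" "(i .= ck (\<rho> r D)) r" "(A .= ck (vset D)) r"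
 show "\<chi> r"
 proof (rule F_cases[OF \<chi> regD[OF reg_fMaps[OF m'(2,3)] m'(1) q r(1,2)] r(1) m'(2,3)])
  fix s E assume s: "s:P" "s <~ r" "E:FF s" "(j .= ck (\<rho> s E)) s" "(B .= ck (vset E)) s"
  have "D:FF s" "\<rho> s D = \<rho> r D" using ext[OF r(1) s(1,2)] agree[OF r(1) s(1,2) r(3)] r(3) by auto
  thus "\<chi> s"
  using *[OF s(1) P_trans[OF s(1) r(1) q s(2) r(2)], of D E] fEq_antimono[OF r(4) m(2) check_name r(1) s(1,2)]
   fEq_antimono[OF r(5) m(3) check_name r(1) s(1,2)] s(3-5) by simp
 qed
 qed
 have sv: "elts (vset D) = D" if "D:FF r" "r:P" for D r using elts_vset sub(2) that by blast
 have vo: "vord (\<rho> r D)" if "D:FF r" "r:P" for D r unfolding \<rho>_def by (rule vord_rk[OF fc[OF that(2)] M(2,1) that(1)])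
 have rmem: "\<rho> r D:elts (\<rho> r E) <-> D << E" if "D:FF r" "E:FF r" "r:P" for D E r
 unfolding \<rho>_def by (rule rk_mem_iff[OF fc[OF that(3)] M(2,1) that(1,2)])
 have relts: "EX E:FF r. a = \<rho> r E & E << D" if "a:elts (\<rho> r D)" "D:FF r" "r:P" for a D r
 using that(1) unfolding \<rho>_def elts_rk[OF fc[OF that(3)] M(2,1) that(2)] by auto
 have \<eta>_elim: "\<chi> q" if "reg \<chi>" "(x .: \<eta>) q" "q:P"
 "!!r D. r:P==>r <~ q==>D:FF r==>(x .= ck (\<rho> r D)) r==>\<chi> r" for \<chi> x q
 by (rule reg_elim[OF that(1) that(2)[unfolded \<eta>_iff] that(3)]) (use that(4) in blast)
 have memv: "(x .: ck (vset D)) r" if "(x .= ck m) r" "x:Nm" "m:D" "D:FF r" "r:P" for x m D r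
 using respD[OF resp_fMem(1) that(2) check_name that(5,1)] check_mem_iff[OF that(5), of m "vset D"] sv[OF that(4,5)] that(3) by simp
 \<comment> \<open>The facts 1 to 9 are the clauses of \<open>fFiltration\<close> in their
   order.\<close>
 have 1: "fOrd \<eta> p" if p: "p:P" for p
 unfolding fOrd_iff[OF p]
 proof (intro ballI impI conjI)
 fix y q assume y: "y:Nm" and q: "q:P" "q <~ p" "(y .: \<eta>) q"
 show "(y .<= \<eta>) q"
 proof (rule \<eta>_elim[OF reg_fSub q(3,1)])
  fix r D assume r: "r:P" "r <~ q" "D:FF r" "(y .= ck (\<rho> r D)) r"
  have "(ck (\<rho> r D) .<= \<eta>) r"
  unfolding fSub_iff[OF r(1)]
  proof (intro ballI impI)
  fix z s assume z: "z:Nm" and s: "s:P" "s <~ r" "(z .: ck (\<rho> r D)) s"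
  show "(z .: \<eta>) s"
  proof (rule mem_check_elim[OF reg_fMem s(3,1)])
   fix t a assume t: "t:P" "t <~ s" "a:elts (\<rho> r D)" "(z .= ck a) t"
   have tr: "t <~ r" using P_trans[OF t(1) s(1) r(1) t(2) s(2)] .
   obtain E where "E:FF r" "a = \<rho> r E" using relts[OF t(3) r(3,1)] by blast
   hence "(ck a .: \<eta>) t" using \<eta>_here[OF t(1), of E] ext[OF r(1) t(1) tr] agree[OF r(1) t(1) tr, of E] by auto
   thus "(z .: \<eta>) t" by (rule respD[OF resp_fMem(1)[OF N(1)] z check_name t(1,4)])
  qed
  qed
  thus "(y .<= \<eta>) r" by (rule respD[OF resp_defined(1)[OF N(1)] y check_name r(1,4)])
 qed
 next
 fix y q z r assume y: "y:Nm" and q: "q:P" "q <~ p" "(y .: \<eta>) q" and z: "z:Nm" and r: "r:P" "r <~ q" "(z .: y) r"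
 show "(z .<= y) r"
 proof (rule \<eta>_elim[OF reg_fSub fMem_antimono[OF q(3,1) r(1,2)] r(1)])
  fix s D assume s: "s:P" "s <~ r" "D:FF s" "(y .= ck (\<rho> s D)) s"
  have "fOrd y s" by (rule respD[OF resp_fOrd y check_name s(1,4) fOrd_check[OF s(1) vo[OF s(3,1)]]])
  thus "(z .<= y) s"
  using fOrd_iff[OF s(1)] fMem_antimono[OF r(3,1) s(1,2)] P_refl[OF s(1)] s(1) z by blast
 qed
 qed
 have 2: "(.~ fEmpty \<eta>) p" if p: "p:P" for p
 unfolding fNot_def fEmpty_iff
 using \<eta>_here fD(1) check_name P_refl by blast
 have 3: "fFun (%i. i .: \<eta>) F p" for p
 unfolding fFun_def
 proof (intro fAndI)
 show "(\<^bold>\<forall>z. z .: F .-> (\<^bold>\<exists>x. x .: \<eta> .& (\<^bold>\<exists>y. fPair z x y))) p"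
 proof (rule fAllI, rule fImpI)
  fix z q assume z: "z:Nm" and q: "q:P" "(z .: F) q"
  have "dense_below (%r. EX w:G r. (z .= ck w) r) q"
  using q(2) mem_nm_iff[of G z q] sG mG unfolding F_def by simp
  thus "(\<^bold>\<exists>x. x .: \<eta> .& (\<^bold>\<exists>y. fPair z x y)) q"
  proof (rule reg_elim[rotated])
  show "reg (\<^bold>\<exists>x. x .: \<eta> .& (\<^bold>\<exists>y. fPair z x y))" by (intro reg_intros)
  fix r assume r: "r:P" "r <~ q" "EX w:G r. (z .= ck w) r"
  then obtain D where D: "D:FF r" "(z .= op (ck (\<rho> r D)) (ck (vset D))) r"
   by (auto simp: G_def check_pair)
  have "fPair z (ck (\<rho> r D)) (ck (vset D)) r"
   using fPair_iff[OF r(1) z check_name check_name] D(2) by simp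
  hence "(\<^bold>\<exists>y. fPair z (ck (\<rho> r D)) y) r"
   by (intro reg_conj_ex_here[where \<Phi> = "fPair z (ck (\<rho> r D))" and x = "ck (vset D)"] r(1) check_name reg_fPair)
  thus "(\<^bold>\<exists>x. x .: \<eta> .& (\<^bold>\<exists>y. fPair z x y)) r"
   by (intro reg_conj_ex_here[where \<Phi> = "%x. x .: \<eta> .& (\<^bold>\<exists>y. fPair z x y)" and x = "ck (\<rho> r D)"]
   fAndI \<eta>_here D(1) r(1) reg_intros check_name)
  qed (rule q)
 qed
 show "(\<^bold>\<forall>x. x .: \<eta> .-> (\<^bold>\<exists>y. fMaps F x y)) p"
 proof (rule fAllI, rule fImpI)
  fix i q assume i: "i:Nm" and q: "q:P" "(i .: \<eta>) q"
  show "(\<^bold>\<exists>y. fMaps F i y) q"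
  proof (rule \<eta>_elim[OF _ q(2,1)])
  show "reg (\<^bold>\<exists>y. fMaps F i y)" using i by (intro reg_intros)
  fix r D assume r: "r:P" "r <~ q" "D:FF r" "(i .= ck (\<rho> r D)) r"
  have "fMaps F i (ck (vset D)) r"
   by (rule respD[OF resp_fMaps i check_name r(1,4) F_here[OF r(1,3)]]) simp_all
  thus "(\<^bold>\<exists>y. fMaps F i y) r"
   by (intro reg_conj_ex_here[where \<Phi> = "fMaps F i" and x = "ck (vset D)"] r(1) i check_name reg_fMaps)
  qed
 qed
 show "(\<^bold>\<forall>x. \<^bold>\<forall>y. \<^bold>\<forall>y'. (fMaps F x y .& fMaps F x y') .-> y .= y') p"
 proof (intro fAllI fImpI)
  fix i A B q assume i: "i:Nm" "A:Nm" "B:Nm" and q: "q:P" and "(fMaps F i A .& fMaps F i B) q"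
  hence h: "fMaps F i A q" "fMaps F i B q" by (auto simp: fAnd_def)
  show "(A .= B) q"
  proof (rule F_cases2[OF reg_fEq[OF i(2,3)] q h(1) i(1,2) h(2) i(1,3)])
  fix r D E assume r: "r:P" "D:FF r" "E:FF r" "(i .= ck (\<rho> r D)) r" "(A .= ck (vset D)) r"
   "(i .= ck (\<rho> r E)) r" "(B .= ck (vset E)) r"
  have "\<rho> r D = \<rho> r E"
   using fEq_trans[OF r(1) check_name i(1) check_name fEq_sym[OF r(4)] r(6)] check_eq_iff[OF r(1)] by simp
  hence "D = E" using rk_inj[OF fc[OF r(1)] M(2,1) r(2,3)] by (simp add: \<rho>_def)
  thus "(A .= B) r" using fEq_trans[OF r(1) i(2) check_name i(3) r(5) fEq_sym] r(7) by simp
  qed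
 qed
 qed
 have 4: "(\<^bold>\<forall>i. \<^bold>\<forall>A. fMaps F i A .-> fSubmodule R M A) p" for p
 proof (intro fAllI fImpI)
 fix i A q assume i: "i:Nm" "A:Nm" and q: "q:P" and h: "fMaps F i A q"
 show "fSubmodule R M A q"
  by (rule F_cases[OF reg_fSubmodule h q i], rule respD[OF resp_defined(3) i(2) check_name])
  (use fSubmodule_check[OF M fD(3)] in blast)+
 qed
 have 5: "(\<^bold>\<forall>i. \<^bold>\<forall>A. (fMaps F i A .& fEmpty i) .-> (\<^bold>\<forall>x. x .: A .<-> fZero M x)) p" for p
 proof (rule fAllI, rule fAllI, rule fImpI)
 fix i A q assume i: "i:Nm" "A:Nm" and q: "q:P" and "(fMaps F i A .& fEmpty i) q"
 hence h: "fMaps F i A q" "fEmpty i q" by (auto simp: fAnd_def)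
 show "(\<^bold>\<forall>x. x .: A .<-> fZero M x) q"
 proof (rule F_cases[OF _ h(1) q i])
  show "reg (\<^bold>\<forall>x. x .: A .<-> fZero M x)" by (intro reg_intros)
  fix r D assume r: "r:P" "r <~ q" "D:FF r" "(i .= ck (\<rho> r D)) r" "(A .= ck (vset D)) r"
  have "fEmpty (ck (\<rho> r D)) r"
  using respD[OF resp_defined(8) check_name i(1) r(1) fEq_sym[OF r(4)]] regD[OF reg_fEmpty h(2) q r(1,2)] by blast
  hence "~ {0[M]} << D" using fEmpty_check[OF r(1)] rmem[OF fD(1)[OF r(1)] r(3,1)] by auto
  hence D: "D = {0[M]}" using fD(4)[OF r(1,3)] by blast
  show "(\<^bold>\<forall>x. x .: A .<-> fZero M x) r"
  proof (rule respD[OF _ i(2) check_name r(1,5)])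
  show "resp (%A. \<^bold>\<forall>x. x .: A .<-> fZero M x)" by (intro resp_intros | assumption)+
  show "(\<^bold>\<forall>x. x .: ck (vset D) .<-> fZero M x) r"
   unfolding fAll_def using sv[OF r(3,1)] by (auto intro!: fIffI simp: mem_check_iff D fZero_iff)
  qed
 qed
 qed
 have 6: "(\<^bold>\<forall>i. \<^bold>\<forall>j. \<^bold>\<forall>A. \<^bold>\<forall>B. (i .: j .& fMaps F i A .& fMaps F j B) .-> A .<= B) p" for p
 proof (intro fAllI fImpI)
 fix i j A B q assume N': "i:Nm" "j:Nm" "A:Nm" "B:Nm" and q: "q:P" and "(i .: j .& fMaps F i A .& fMaps F j B) q"
 hence h: "(i .: j) q" "fMaps F i A q" "fMaps F j B q" by (auto simp: fAnd_def)
 show "(A .<= B) q"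
 proof (rule F_cases2[OF reg_fSub q h(2) N'(1,3) h(3) N'(2,4)])
  fix r D E assume r: "r:P" "r <~ q" "D:FF r" "E:FF r" "(i .= ck (\<rho> r D)) r" "(A .= ck (vset D)) r"
  "(j .= ck (\<rho> r E)) r" "(B .= ck (vset E)) r"
  have "(ck (\<rho> r D) .: ck (\<rho> r E)) r"
  using fMem_eq_right[OF r(1) check_name N'(2) check_name r(7) fMem_eq_left[OF r(1) N'(1) check_name N'(2) r(5)
   fMem_antimono[OF h(1) q r(1,2)]]] .
  hence "(ck (vset D) .<= ck (vset E)) r"
  using check_mem_iff[OF r(1)] rmem[OF r(3,4,1)] sv r(1,3,4) by (intro check_sub) auto
  hence "(ck (vset D) .<= B) r" by (rule respD[OF resp_defined(2)[OF check_name] N'(4) check_name r(1,8)])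
  thus "(A .<= B) r" by (rule respD[OF resp_defined(1)[OF N'(4)] N'(3) check_name r(1,6)])
 qed
 qed
 \<comment> \<open>Both the limit clause and the union clause ask for an index and a member
   containing \<open>x\<close>, once with a restriction on the index and once without. The common
   proof uses a parameter \<open>\<chi>\<close> for the restriction.\<close>
 have ex2: "(\<^bold>\<exists>i. \<^bold>\<exists>A. i .: j .& fMaps F i A .& x .: A) q <->
  dense_below (%r. EX D:FF r. (ck (\<rho> r D) .: j) r & (x .: ck (vset D)) r) q" (is ?A)
 and ex2': "(\<^bold>\<exists>i. \<^bold>\<exists>A. fMaps F i A .& x .: A) q <-> dense_below (%r. EX D:FF r. (x .: ck (vset D)) r) q" (is ?B)
 if q: "q:P" and x: "x:Nm" and j: "j:Nm" for j x q
 proof -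
 have "(\<^bold>\<exists>i. \<^bold>\<exists>A. \<chi> i .& fMaps F i A .& x .: A) q <->
  dense_below (%r. EX D:FF r. \<chi> (ck (\<rho> r D)) r & (x .: ck (vset D)) r) q" (is "?l <-> ?r")
  if \<chi>: "resp \<chi>" "!!i. i:Nm==>reg (\<chi> i)" for \<chi>
 proof
  assume ?l
  thus ?r unfolding fEx_iff[of Nm]
  proof (rule reg_elim[OF reg_dense_below _ q])
  fix r assume r: "r:P" "r <~ q" "EX i:Nm. dense_below (%r. EX A:Nm. (\<chi> i .& fMaps F i A .& x .: A) r) r"
  then obtain i where i: "i:Nm" and d: "dense_below (%r. EX A:Nm. (\<chi> i .& fMaps F i A .& x .: A) r) r" by blast
  show "dense_below (%r. EX D:FF r. \<chi> (ck (\<rho> r D)) r & (x .: ck (vset D)) r) r"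
  proof (rule reg_elim[OF reg_dense_below d r(1)])
   fix s assume s: "s:P" "s <~ r" "EX A:Nm. (\<chi> i .& fMaps F i A .& x .: A) s"
   then obtain A where A: "A:Nm" "\<chi> i s" "fMaps F i A s" "(x .: A) s" by (auto simp: fAnd_def)
   show "dense_below (%r. EX D:FF r. \<chi> (ck (\<rho> r D)) r & (x .: ck (vset D)) r) s"
   proof (rule dense_below_weaken[OF A(3)[unfolded F_iff[OF s(1) i A(1)]] s(1)])
   fix t assume t: "t:P" "t <~ s" "EX D:FF t. (i .= ck (\<rho> t D)) t & (A .= ck (vset D)) t"
   then obtain D where D: "D:FF t" "(i .= ck (\<rho> t D)) t" "(A .= ck (vset D)) t" by blast
   have "\<chi> (ck (\<rho> t D)) t"
   by (rule respD[OF \<chi>(1) check_name i t(1) fEq_sym[OF D(2)] regD[OF \<chi>(2)[OF i] A(2) s(1) t(1,2)]])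
   moreover have "(x .: ck (vset D)) t"
   by (rule fMem_eq_right[OF t(1) x A(1) check_name D(3) fMem_antimono[OF A(4) s(1) t(1,2)]])
   ultimately show "EX r':P. r' <~ t & (EX D:FF r'. \<chi> (ck (\<rho> r' D)) r' & (x .: ck (vset D)) r')"
   using t(1) P_refl D(1) by blast
   qed
  qed
  qed
 next
  assume ?r
  thus ?l unfolding fEx_iff[of Nm]
  proof (rule dense_below_weaken[OF _ q])
  fix r assume r: "r:P" "r <~ q" "EX D:FF r. \<chi> (ck (\<rho> r D)) r & (x .: ck (vset D)) r"
  then obtain D where D: "D:FF r" "\<chi> (ck (\<rho> r D)) r" "(x .: ck (vset D)) r" by blast
  have "(\<chi> (ck (\<rho> r D)) .& fMaps F (ck (\<rho> r D)) (ck (vset D)) .& x .: ck (vset D)) s"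
   if "s:P" "s <~ r" for s
   using regD[OF \<chi>(2)[OF check_name] D(2) r(1) that] fMem_antimono[OF D(3) r(1) that]
   regD[OF reg_fMaps[OF check_name check_name] F_here[OF r(1) D(1)] r(1) that] by (simp add: fAnd_def)
  hence "dense_below (%s. EX A:Nm. (\<chi> (ck (\<rho> r D)) .& fMaps F (ck (\<rho> r D)) A .& x .: A) s) r"
   by (intro dense_below_here[OF r(1)] bexI[OF _ check_name[of "vset D"]])
  thus "EX r':P. r' <~ r & (EX i:Nm. dense_below (%r. EX A:Nm. (\<chi> i .& fMaps F i A .& x .: A) r) r')"
   using r(1) P_refl check_name by blast
  qed
 qed
 note gen = this
 have T: "((%p. True) .& \<phi>) = \<phi>" for \<phi> :: "'v => bool" by (rule HOL.ext) (simp add: fAnd_def)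
 show ?A by (rule gen[OF resp_fMem(1)[OF j] reg_fMem])
 show ?B using gen[of "%i p. True"] by (simp add: T resp_def reg_def)
 qed
 have 7: "(\<^bold>\<forall>j. \<^bold>\<forall>B. (fMaps F j B .& fLimit j) .->
  (\<^bold>\<forall>x. x .: B .<-> (\<^bold>\<exists>i. \<^bold>\<exists>A. i .: j .& fMaps F i A .& x .: A))) p" for p
 proof (rule fAllI, rule fAllI, rule fImpI)
 fix j B q assume N': "j:Nm" "B:Nm" and q: "q:P" and "(fMaps F j B .& fLimit j) q"
 hence h: "fMaps F j B q" "fLimit j q" by (auto simp: fAnd_def)
 let ?\<Psi> = "%j B. \<^bold>\<forall>x. x .: B .<-> (\<^bold>\<exists>i. \<^bold>\<exists>A. i .: j .& fMaps F i A .& x .: A)"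
 show "?\<Psi> j B q"
 proof (rule F_cases[OF _ h(1) q N'])
  show "reg (?\<Psi> j B)" using N' by (intro reg_intros)
  fix r E assume r: "r:P" "r <~ q" "E:FF r" "(j .= ck (\<rho> r E)) r" "(B .= ck (vset E)) r"
  have "fLimit (ck (\<rho> r E)) r"
  by (rule respD[OF resp_defined(9) check_name N'(1) r(1) fEq_sym[OF r(4)] regD[OF reg_fLimit h(2) q r(1,2)]])
  \<comment> \<open>An index forced to be a limit is a limit already in the ground model, where the
    chain of \<open>r\<close> is continuous.\<close>
  hence "E = \<Union>{D:FF r. D << E}"
  using rk_limit[OF fc[OF r(1)] M(2,1) r(3)] fLimit_checkD[OF r(1) _ vo[OF r(3,1)]] by (simp add: \<rho>_def)
  hence lim: "EX D:FF r. D << E & a:D" if "a:E" for a using that by blast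
  have "?\<Psi> (ck (\<rho> r E)) (ck (vset E)) r"
  proof (rule fAllI, rule fIffI)
  fix x s assume x: "x:Nm" and s: "s:P" "s <~ r"
  note ag = agree[OF r(1) s] and es = ext[OF r(1) s]
  show "(x .: ck (vset E)) s <-> (\<^bold>\<exists>i. \<^bold>\<exists>A. i .: ck (\<rho> r E) .& fMaps F i A .& x .: A) s"
   unfolding ex2[OF s(1) x check_name]
  proof
   assume "(x .: ck (vset E)) s"
   thus "dense_below (%t. EX D:FF t. (ck (\<rho> t D) .: ck (\<rho> r E)) t & (x .: ck (vset D)) t) s"
   unfolding mem_check_iff[of x "vset E"] sv[OF r(3,1)]
   proof (rule dense_below_weaken[OF _ s(1)])
   fix t assume t: "t:P" "t <~ s" "EX a:E. (x .= ck a) t"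
   then obtain a D where a: "(x .= ck a) t" "D:FF r" "D << E" "a:D" using lim by blast
   have tr: "t <~ r" using P_trans[OF t(1) s(1) r(1) t(2) s(2)] .
   have D: "D:FF t" using ext[OF r(1) t(1) tr] a(2) by blast
   have "(ck (\<rho> t D) .: ck (\<rho> r E)) t"
   using check_mem_iff[OF t(1)] rmem[OF a(2) r(3,1)] agree[OF r(1) t(1) tr a(2)] a(3) by simp
   thus "EX r':P. r' <~ t & (EX D:FF r'. (ck (\<rho> r' D) .: ck (\<rho> r E)) r' & (x .: ck (vset D)) r')"
   using memv[OF a(1) x a(4) D t(1)] D t(1) P_refl by blast
   qed
  next
   assume "dense_below (%t. EX D:FF t. (ck (\<rho> t D) .: ck (\<rho> r E)) t & (x .: ck (vset D)) t) s"
   thus "(x .: ck (vset E)) s"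
   proof (rule reg_elim[OF reg_fMem _ s(1)])
   fix t assume t: "t:P" "t <~ s" "EX D:FF t. (ck (\<rho> t D) .: ck (\<rho> r E)) t & (x .: ck (vset D)) t"
   then obtain D where D: "D:FF t" "(ck (\<rho> t D) .: ck (\<rho> r E)) t" "(x .: ck (vset D)) t" by blast
   have tr: "t <~ r" using P_trans[OF t(1) s(1) r(1) t(2) s(2)] .
   have E: "E:FF t" using ext[OF r(1) t(1) tr] r(3) by blast
   have "D << E"
   using D(2) check_mem_iff[OF t(1)] rmem[OF D(1) E t(1)] agree[OF r(1) t(1) tr r(3)] by simp
   hence "(ck (vset D) .<= ck (vset E)) t"
   using sv D(1) E t(1) by (intro check_sub) auto
   thus "(x .: ck (vset E)) t" using fSub_iff[OF t(1)] D(3) x t(1) P_refl[OF t(1)] by blast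
   qed
  qed
  qed
  moreover have "resp (%j. ?\<Psi> j B)" if "B:Nm" for B using that by (intro resp_intros | assumption)+
  moreover have "resp (?\<Psi> j)" by (intro resp_intros | assumption)+
  ultimately show "?\<Psi> j B r" using respD[OF _ N'(1) check_name r(1,4)] respD[OF _ N'(2) check_name r(1,5)] check_name by blast
 qed
 qed
 have 8: "(\<^bold>\<forall>x. fCarrier M x .<-> (\<^bold>\<exists>i. \<^bold>\<exists>A. fMaps F i A .& x .: A)) p" for p
 proof (rule fAllI, rule fIffI)
 fix x q assume x: "x:Nm" and q: "q:P"
 show "fCarrier M x q <-> (\<^bold>\<exists>i. \<^bold>\<exists>A. fMaps F i A .& x .: A) q"
  unfolding ex2'[OF q x check_name]
 proof
  assume "fCarrier M x q"
  thus "dense_below (%r. EX D:FF r. (x .: ck (vset D)) r) q"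
  unfolding fCarrier_iff
  proof (rule dense_below_weaken[OF _ q])
  fix r assume r: "r:P" "r <~ q" "EX a:carrier M. (x .= ck a) r"
  then obtain a where a: "a:carrier M" "(x .= ck a) r" by blast
  obtain s where s: "s:P" "s <~ r" "a:T s" using dense[OF r(1) a(1)] by blast
  thus "EX r':P. r' <~ r & (EX D:FF r'. (x .: ck (vset D)) r')"
   using memv[OF fEq_antimono[OF a(2) x check_name r(1) s(1,2)] x s(3) fD(2)[OF s(1)] s(1)] fD(2)[OF s(1)] by blast
  qed
 next
  assume "dense_below (%r. EX D:FF r. (x .: ck (vset D)) r) q"
  thus "fCarrier M x q"
  proof (rule reg_elim[OF reg_ground(1) _ q])
  fix r assume r: "r:P" "r <~ q" "EX D:FF r. (x .: ck (vset D)) r"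
  then obtain D where D: "D:FF r" "(x .: ck (vset D)) r" by blast
  show "fCarrier M x r"
   by (rule mem_check_elim[OF reg_ground(1) D(2) r(1)], rule respD[OF resp_ground(1) x check_name])
   (use sub(1)[OF r(1) D(1)] sv[OF D(1) r(1)] in \<open>auto simp: fCarrier_check\<close>)
  qed
 qed
 qed
 have 9: "(\<^bold>\<forall>i. \<^bold>\<forall>j. \<^bold>\<forall>A. \<^bold>\<forall>B. (fSucc i j .& fMaps F i A .& fMaps F j B) .-> fEx C (%N. fQuotientIso R M B A N)) p" for p
 proof (intro fAllI fImpI)
 fix i j A B q assume N': "i:Nm" "j:Nm" "A:Nm" "B:Nm" and q: "q:P" and "(fSucc i j .& fMaps F i A .& fMaps F j B) q"
 hence h: "fSucc i j q" "fMaps F i A q" "fMaps F j B q" by (auto simp: fAnd_def)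
 show "fEx C (%N. fQuotientIso R M B A N) q"
  unfolding fEx_iff
 proof (rule F_cases2[OF reg_dense_below q h(2) N'(1,3) h(3) N'(2,4)])
  fix r D E assume r: "r:P" "r <~ q" "D:FF r" "E:FF r" "(i .= ck (\<rho> r D)) r" "(A .= ck (vset D)) r"
  "(j .= ck (\<rho> r E)) r" "(B .= ck (vset E)) r"
  have "fSucc (ck (\<rho> r D)) j r"
  by (rule respD[OF resp_defined(6)[OF N'(2)] check_name N'(1) r(1) fEq_sym[OF r(5)] regD[OF reg_fSucc[OF N'(1)] h(1) q r(1,2)]])
  hence "fSucc (ck (\<rho> r D)) (ck (\<rho> r E)) r"
  by (rule respD[OF resp_defined(7)[OF check_name] check_name N'(2) r(1) fEq_sym[OF r(7)]])
  hence s: "\<rho> r E = vsuc (\<rho> r D)" using fSucc_check_iff[OF r(1)] by simp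
  then obtain K where K: "K:C" "sq R M D E K"
  using rk_succ[OF fc[OF r(1)] M(2,1) r(3,4)] by (auto simp: \<rho>_def)
  have DE: "D =< E" using rmem[OF r(3,4,1)] s by auto
  have "fQuotientIso R M B A K t" if t: "t:P" "t <~ r" for t
  proof -
  have "fQuotientIso R M (ck (vset E)) (ck (vset D)) K t"
   using fQuotientIso_check[OF M _ _ fD(3)[OF r(1,3)] fD(3)[OF r(1,4)] DE K(2) t(1)] C[OF K(1)] by blast
  hence "fQuotientIso R M (ck (vset E)) A K t"
   by (rule respD[OF resp_defined(4) N'(3) check_name t(1) fEq_antimono[OF r(6) N'(3) check_name r(1) t]])
  thus ?thesis
   by (rule respD[OF resp_defined(5)[OF N'(3)] N'(4) check_name t(1) fEq_antimono[OF r(8) N'(4) check_name r(1) t]])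
  qed
  thus "dense_below (%r. EX N:C. fQuotientIso R M B A N r) r"
  using K(1) by (intro dense_below_here[OF r(1)]) blast
 qed
 qed
 have "fFiltration R C M \<eta> F p" if "p:P" for p
 unfolding fFiltration_def using 1[OF that] 2[OF that] 3 4 5 6 7 8 9 by (intro fAndI)
 hence "dense_below (%r. EX F:Nm. fFiltration R C M \<eta> F r) p" if "p:P" for p
 by (intro dense_below_here[OF that] bexI[OF _ N(2)])
 hence "fEX (fFiltration R C M \<eta>) p" if "p:P" for p using that by (simp add: fEx_iff)
 hence "dense_below (%r. EX \<eta>:Nm. fEX (fFiltration R C M \<eta>) r) p" if "p:P" for p
 by (intro dense_below_here[OF that] bexI[OF _ N(1)])
 thus ?thesis unfolding forces_filtered_def by (simp add: fEx_iff)
qed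

end

section \<open>From goodness to a \<sigma>-closed poset\<close>

lemma fchain_Union:
 fixes T :: "nat => 'm set" and FF
 assumes M: "lmod R M" and fc: "!!n. fchain R C M Z (T n) (FF n)"
 and ext: "!!n. FF n =< FF (Suc n)" "!!n A. A:FF (Suc n)==>A \<notin> FF n==>T n =< A"
 shows "fchain R C M Z (\<Union>n. T n) (insert (\<Union>n. T n) (\<Union>n. FF n))"
proof -
 note f = fchainD[OF fc]
 let ?U = "\<Union>n. T n" and ?F = "insert (\<Union>n. T n) (\<Union>n. FF n)"
 have TS: "T n =< T (Suc n)" for n using f(2)[of n] ext(1)[of n] f(5)[of "T n" "Suc n"] by blast
 have mono: "FF m =< FF n" "T m =< T n" if "m <= n" for m n
 using lift_Suc_mono_le[of FF, OF ext(1) that] lift_Suc_mono_le[of T, OF TS that] by auto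
 \<comment> \<open>A member which is missing from one chain lies above the top of that chain. Hence
   below each top the union looks like a single chain, and only the new top needs separate
   treatment.\<close>
 have above: "T n =< A" if A: "A:?F" "A \<notin> FF n" for A n
 proof (cases "A = ?U")
 case False
 then obtain k where k: "A:FF k" using A(1) by auto
 have "A:FF n | T n =< A" using k
 proof (induction k)
  case 0
  thus ?case using mono(1)[of 0 n] by auto
 next
  case (Suc k)
  show ?case
  proof (cases "A:FF k")
  case False
  hence "T k =< A" using ext(2) Suc.prems by blast
  thus ?thesis using mono(2)[of n k] mono(1)[of "Suc k" n] Suc.prems by (cases "n <= k") auto
  qed (use Suc in blast)
 qed
 thus ?thesis using A by blast
 qed blast
 have chainT: "T m =< T n | T n =< T m" for m n using mono(2) nat_le_linear by blast
 have sub: "submodule ?U R M"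
 by (rule lmod.submodule_Union_chain[OF M]) (use f(3)[OF f(2)] chainT in auto)
 have le: "A =< ?U" if "A:?F" for A using that f(5) by blast
 show ?thesis unfolding fchain_def
 proof (intro conjI ballI allI impI)
 show "Z:?F" using f(1) by blast
 show "submodule A R M" if "A:?F" for A using that sub f(3) by blast
 show "Z =< A" if "A:?F" for A using that f(4)[of A] f(4)[OF f(2)[of 0]] by auto
 show "A =< ?U" if "A:?F" for A by (rule le[OF that])
 fix A B assume A: "A:?F" and B: "B:?F"
 show "A =< B | B =< A"
 proof (cases "A = ?U | B = ?U")
  case False
  then obtain m n where "A:FF m" "B:FF n" using A B by auto
  hence "A:FF (max m n)" "B:FF (max m n)" using mono(1)[of m "max m n"] mono(1)[of n "max m n"] by auto
  thus ?thesis using f(6) by blast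
 qed (use le[OF A] le[OF B] in auto)
 next
 fix GG assume GG: "GG =< ?F & GG ~= {}"
 show "\<Union>GG:?F"
 proof (cases "EX n. GG =< FF n")
  case True
  then obtain n where n: "GG =< FF n" by blast
  have "\<Union>GG:FF n" using f(7)[OF n] GG by blast
  thus ?thesis by blast
 next
  case False
  have "T n =< \<Union>GG" for n
  proof -
  obtain A where A: "A:GG" "A \<notin> FF n" using False by blast
  have "T n =< A" by (rule above) (use A GG in auto)
  thus ?thesis using A(1) by blast
  qed
  moreover have "\<Union>GG =< ?U" using le GG by blast
  ultimately have "\<Union>GG = ?U" by blast
  thus ?thesis by simp
 qed
 show "\<Inter>GG:GG"
 proof (cases "EX n. GG Int FF n ~= {}")
  case True
  then obtain n where n: "GG Int FF n ~= {}" by blast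
  have i: "\<Inter>(GG Int FF n):GG Int FF n" using f(8)[of "GG Int FF n" n] n by blast
  have "\<Inter>(GG Int FF n) =< A" if "A:GG" for A
  using above[of A n] that GG i f(5)[of "\<Inter>(GG Int FF n)" n] by blast
  hence "\<Inter>GG = \<Inter>(GG Int FF n)" by blast
  thus ?thesis using i by simp
 next
  case False
  hence "GG = {?U}" using GG by blast
  thus ?thesis by simp
 qed
 next
 fix A B assume A: "A:?F" and B: "B:?F" and AB: "A << B & (ALL D:?F. ~ (A << D & D << B))"
 show "EX N:C. sq R M A B N"
 proof (cases "EX n. B:FF n")
  case True
  then obtain n where n: "B:FF n" by blast
  have An: "A:FF n"
  proof (rule ccontr)
  assume "A \<notin> FF n"
  from above[OF A this] f(5)[OF n] AB show False by auto
  qed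
  show ?thesis by (rule f(9)[OF An n]) (use AB in auto)
 next
  case False
  hence BU: "B = ?U" using B by blast
  then obtain n where n: "A:FF n" using A AB by blast
  have "T m =< A" for m
  proof -
  let ?m = "max m n"
  have "T ?m:FF ?m" by (rule f(2))
  hence "T ?m:?F" "T ?m ~= ?U" using False BU by auto
  moreover have "A =< T ?m" using f(5)[of A ?m] mono(1)[of n ?m] n by auto
  ultimately have "A = T ?m" using AB BU le by blast
  thus ?thesis using mono(2)[of m ?m] by simp
  qed
  hence "?U =< A" by (rule UN_least)
  moreover have "A << ?U" using AB BU by simp
  ultimately have False by (simp add: less_le_not_le)
  thus ?thesis ..
 qed
 qed simp
qed

text \<open>Transports the conditions, which are chains in a submodule of \<open>M\<close>, to the
  isomorphic copy \<open>N\<close>, whose filtration is to be forced.\<close>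

lemma (in lmod_hom) fchain_image:
 fixes C :: "('r, 'c::zfc) module set"
 assumes inj: "inj_on h U" and C: "!!K. K:C==>lmodule R K" and surj: "h ` U = carrier N"
 and fc: "fchain R C M {0[M]} T FF" and T: "T =< U"
 shows "fchain R C N {0[N]} (h ` T) ((`) h ` FF)"
proof -
 note f = fchainD[OF fc]
 have "x = 0[M]" if "x:U" "h x = 0[N]" for x
 by (rule inj_onD[OF inj _ that(1) M.submoduleD(2)[OF U]]) (simp add: that hom_zero)
 hence ker: "{x:U. h x = 0[N]} = {0[M]}" using hom_zero M.submoduleD(2)[OF U] by blast
 have le: "A =< U" if "A:FF" for A using f(5)[OF that] T by blast
 show ?thesis unfolding fchain_def
 proof (intro conjI ballI allI impI)
 show "{0[N]}:(`) h ` FF" using imageI[OF f(1), of "(`) h"] hom_zero by simp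
 show "h ` T:(`) h ` FF" using f(2) by blast
 fix A' assume "A':(`) h ` FF"
 then obtain A where A: "A:FF" "A' = h ` A" by blast
 show "submodule A' R N" using submodule_image[OF f(3)[OF A(1)] le[OF A(1)]] A(2) by simp
 thus "{0[N]} =< A'" using N.submoduleD(2) by blast
 show "A' =< h ` T" using A f(5) by blast
 fix B' assume "B':(`) h ` FF"
 then obtain B where B: "B:FF" "B' = h ` B" by blast
 show "A' =< B' | B' =< A'" using f(6)[OF A(1) B(1)] A(2) B(2) by blast
 assume AB: "A' << B' & (ALL D:(`) h ` FF. ~ (A' << D & D << B'))"
 have iff: "h ` D << h ` E <-> D << E" if "D:FF" "E:FF" for D E
  using inj_on_image_mem_iff[OF inj _ le[OF that(1)]] inj_on_image_mem_iff[OF inj _ le[OF that(2)]] le[OF that(1)] le[OF that(2)]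
  by blast
 have "A << B" "!!D. D:FF==>~ (A << D & D << B)"
  using AB iff A B by (metis, metis imageI)
 then obtain K where K: "K:C" "sq R M A B K" using f(9)[OF A(1) B(1)] by blast
 have "sq R N (h ` A) (h ` B) K <-> sq R M A B K"
 proof (rule sq_image_iff[OF surj ker])
  show "lmodule R K" if "K:C" for K by (rule C[OF that])
 qed (use f(3,4)[OF A(1)] f(3)[OF B(1)] \<open>A << B\<close> le[OF B(1)] in auto)
 hence "sq R N (h ` A) (h ` B) K" using K(2) by simp
 thus "EX N':C. sq R N A' B' N'" using K(1) A(2) B(2) by blast
 next
 fix GG' assume "GG' =< (`) h ` FF & GG' ~= {}"
 then obtain GG where GG: "GG =< FF" "GG ~= {}" "GG' = (`) h ` GG" by (metis image_empty subset_imageE)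
 show "\<Union>GG':(`) h ` FF" using imageI[OF f(7)[OF GG(1,2)], of "(`) h"] GG(3) by (simp add: image_Union)
 have "h ` \<Inter>GG:GG'" using f(8)[OF GG(1,2)] GG(3) by blast
 moreover have "\<Inter>GG' = h ` \<Inter>GG" using calculation GG(3) by blast
 ultimately show "\<Inter>GG':GG'" by simp
 qed
qed

text \<open>Cutting the spans of club sets down to the submodule gives \<open>t x\<close>, and
  \<open>subfiltered_sub\<close> filters these traces and their quotients. Goodness of
  \<open>M\<close> thus serves its submodules directly: the club stays on \<open>M\<close> and only
  the chains are cut down.\<close>

theorem (in qh_class) good_module_potentially_filtered:
 fixes M M' :: "('r, 'v) module"
 assumes hom: "lmod_hom R M M' N h" and small: "small (carrier M)"
 and inj: "inj_on h N" and surj: "h ` N = carrier M'" and good: "good_module R C M"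
 shows "potentially_filtered R C M'"
proof -
 interpret h: lmod_hom R M M' N h by (rule hom)
 note N = h.U
 obtain DD where DD: "club_family (carrier M) DD" "!!x. x:DD==>good_set R C M x"
 using good unfolding good_module_def by blast
 have DDD: "countable x" "x =< carrier M" if "x:DD" for x using DD(1) that by (auto simp: club_family_def)
 define t where "t x = N Int h.M.span x" for x
 have tm: "t x =< t y" if "x =< y" "y =< carrier M" for x y unfolding t_def using h.M.span_mono[OF that] by blast
 have ts: "submodule (t x) R M" if "x =< carrier M" for x
 unfolding t_def by (rule h.M.submodule_Int[OF N h.M.submodule_span[OF that]])
 have sf: "subfiltered R C M {0[M]} (t x) & subfiltered R C M (t x) (t y)"
 if x: "x:DD" and y: "countable y" "x =< y" "y =< carrier M" for x y
 proof -
 have g: "subfiltered R C M {0[M]} (h.M.span x)" "subfiltered R C M (h.M.span x) (h.M.span y)"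
  using DD(2)[OF x] y DDD[OF x] unfolding good_set_def h.M.span_def by auto
 have "t y Int h.M.span x = t x" using h.M.span_mono[OF y(2,3)] by (auto simp: t_def)
 thus ?thesis
  using subfiltered_sub[OF h.M.lmod_axioms small h.M.submodule_span[OF DDD(2)[OF x]] h.M.submodule_span[OF y(3)]
   h.M.span_mono[OF y(2,3)] ts[OF y(3)] _ g] by (simp add: t_def)
 qed
 \<comment> \<open>The poset has to live in the universe, so a set and a chain are coded as a pair
   of elements; \<open>X\<close> and \<open>G\<close> decode them again.\<close>
 define cond where "cond x FF = vpair (vset x) (vset (vset ` FF))" for x and FF :: "'v set set"
 define X where "X p = elts (THE a. EX b. p = vpair a b)" for p :: 'v
 define G where "G p = elts ` elts (THE b. EX a. p = vpair a b)" for p :: 'v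
 have dec: "X (cond x FF) = x" "G (cond x FF) = FF" if "x =< carrier M" "FF =< Pow (carrier M)" for x FF
 proof -
 have "small A" if "A:FF" for A using small_subset[OF small] that \<open>FF =< Pow (carrier M)\<close> by blast
 hence "elts ` vset ` FF = FF" by (force simp: image_image elts_vset)
 moreover have "small (vset ` FF)" by (rule small_subset[OF small_Pow[OF small]]) (use that in blast)
 ultimately show "X (cond x FF) = x" "G (cond x FF) = FF"
  using small_subset[OF small that(1)] by (simp_all add: X_def G_def cond_def elts_vset)
 qed
 define P where "P = {cond x FF |x FF. x:DD & fchain R C M {0[M]} (t x) FF}"
 have PI: "cond x FF:P & X (cond x FF) = x & G (cond x FF) = FF" if "x:DD" "fchain R C M {0[M]} (t x) FF" for x FF
 using that dec[OF DDD(2)[OF that(1)] fchain_Pow[OF that(2) small h.M.lmod_axioms]] unfolding P_def by blast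
 have PD: "X p:DD" "fchain R C M {0[M]} (t (X p)) (G p)" if "p:P" for p
 using that PI unfolding P_def by auto
 \<comment> \<open>End extension: a stronger condition may add members only above the old trace
   \<open>t (X p)\<close>.\<close>
 define le where "le q p <-> X p =< X q & G p =< G q & (ALL A:G q - G p. t (X p) =< A)" for q p
 have ne: "P ~= {}"
 proof -
 obtain x where "x:DD" using DD(1) unfolding club_family_def by (metis countable_empty empty_subsetI)
 then obtain FF where "fchain R C M {0[M]} (t x) FF" using sf[of x x] DDD[of x] by (auto simp: subfiltered_def)
 thus ?thesis using PI \<open>x:DD\<close> by blast
 qed
 have fp: "forcing_poset P le"
 proof (unfold_locales)
 have "P =< (%(x, y). vpair x y) ` ((vset ` Pow (carrier M)) \<times> (vset ` Pow (vset ` Pow (carrier M))))"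
 proof
  fix p assume "p:P"
  then obtain x FF where p: "p = cond x FF" "x:DD" "fchain R C M {0[M]} (t x) FF" unfolding P_def by blast
  thus "p:(%(x, y). vpair x y) ` ((vset ` Pow (carrier M)) \<times> (vset ` Pow (vset ` Pow (carrier M))))"
  using DDD(2)[OF p(2)] image_mono[OF fchain_Pow[OF p(3) small h.M.lmod_axioms], of vset] unfolding cond_def
  by (intro image_eqI[of _ _ "(vset x, vset (vset ` FF))"]) (auto intro!: imageI)
 qed
 thus "small P" by (rule small_subset[OF small_image2[OF small_Pow[OF small] small_Pow[OF small_Pow[OF small]]]])
 show "P ~= {}" by (rule ne)
 show "le p p" for p unfolding le_def by blast
 fix p q r assume p: "p:P" "q:P" "r:P" "le p q" "le q r"
 hence "t (X r) =< t (X q)" unfolding le_def using tm[of "X r" "X q"] DDD(2)[OF PD(1)[OF p(2)]] by blast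
 thus "le p r" using p(4,5) unfolding le_def by blast
 qed
 have sc: "forcing_poset.sigma_closed P le"
 unfolding forcing_poset.sigma_closed_def[OF fp]
 proof (intro allI impI)
 fix s :: "nat => 'v" assume s: "ALL n. s n:P & le (s (Suc n)) (s n)"
 define x where "x = (\<Union>n. X (s n))"
 have "ALL n. X (s n):DD & X (s n) =< X (s (Suc n))" using PD(1) s by (simp add: le_def)
 hence xD: "x:DD" using DD(1) unfolding club_family_def x_def by simp
 have mono: "X (s m) =< X (s n)" if "m <= n" for m n
  by (rule lift_Suc_mono_le[of "%n. X (s n)", OF _ that]) (use s in \<open>simp add: le_def\<close>)
 have sc: "X (s n) =< carrier M" for n using DDD(2)[OF PD(1)] s by simp
 have "h.M.span (\<Union>(range (%n. X (s n)))) = (\<Union>A\<in>range (%n. X (s n)). h.M.span A)"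
 proof (rule h.M.span_Union_chain)
  fix A B assume "A:range (%n. X (s n))" "B:range (%n. X (s n))"
  then obtain m n where "A = X (s m)" "B = X (s n)" by blast
  thus "A =< B | B =< A" using mono[of m n] mono[of n m] nat_le_linear[of m n] by blast
 qed (use sc in auto)
 hence tx: "t x = (\<Union>n. t (X (s n)))" unfolding t_def x_def by blast
 \<comment> \<open>The lower bound: the union of the chains with its own union as new top. The
   underlying set is in the club because the club is closed under countable unions.\<close>
 have fc: "fchain R C M {0[M]} (t x) (insert (t x) (\<Union>n. G (s n)))"
  unfolding tx by (rule fchain_Union[OF h.M.lmod_axioms]) (use s PD(2) in \<open>auto simp: le_def\<close>)
 note c = PI[OF xD fc]
 \<comment> \<open>End extension is iterated along the sequence, so that members added at any later
   stage lie above each earlier trace.\<close>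
 have upk: "G (s m) =< G (s (m + k)) & (ALL A:G (s (m + k)) - G (s m). t (X (s m)) =< A)" for m k
 proof (induction k)
  case (Suc k)
  have t: "t (X (s m)) =< t (X (s (m + k)))" using tm[OF mono[of m "m + k"] sc] by simp
  have S: "G (s (m + k)) =< G (s (m + Suc k))" "ALL A:G (s (m + Suc k)) - G (s (m + k)). t (X (s (m + k))) =< A"
  using s unfolding le_def by simp_all
  have "t (X (s m)) =< A" if "A:G (s (m + Suc k)) - G (s m)" for A
  using that Suc S(2) t by (cases "A:G (s (m + k))") blast+
  thus ?case using Suc S(1) by blast
 qed auto
 have up: "t (X (s m)) =< A" if "A:G (s n)" "A \<notin> G (s m)" for A m n
 proof (cases "m <= n")
  case True
  thus ?thesis using upk[of m "n - m"] that by simp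
 next
  case False
  hence "G (s n) =< G (s m)" using upk[of n "m - n"] by simp
  thus ?thesis using that by blast
 qed
 have "le (cond x (insert (t x) (\<Union>n. G (s n)))) (s m)" for m
  unfolding le_def using c up tx by (auto simp: x_def)
 thus "EX q:P. ALL n. le q (s n)" using c by blast
 qed
 have "forcing_poset.forces_filtered P le R C M'"
 proof (rule forcing_poset.forces_filtered_generic[OF fp h.N.lmod_axioms, where T = "%p. h ` t (X p)" and FF = "%p. (`) h ` G p"])
 show "small (carrier M')" using small_image[OF small_subset[OF small h.M.submoduleD(1)[OF N]], of h] surj by simp
 show "lmod R K & small (carrier K)" if "K:C" for K using C_lmod[OF that] vmod[OF that] by (simp add: vmodule_def)
 show "fchain R C M' {0[M']} (h ` t (X p)) ((`) h ` G p)" if "p:P" for p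
  by (rule h.fchain_image[OF inj C_lmodule surj PD(2)[OF that]]) (auto simp: t_def)
 show "(`) h ` G p =< (`) h ` G q & (ALL A:(`) h ` G q - (`) h ` G p. h ` t (X p) =< A)"
  if "le q p" for p q using that unfolding le_def by blast
 fix p m' assume p: "p:P" and "m':carrier M'"
 then obtain m where m: "m:N" "m' = h m" using surj by blast
 have mM: "m:carrier M" using h.M.submoduleD(1)[OF N] m by blast
 note x = PD[OF p]
 \<comment> \<open>To catch \<open>m\<close>, pass to a club set containing it and the old set, and
   continue the chain by a filtration of the new trace over the old one.\<close>
 obtain y where y: "y:DD" "insert m (X p) =< y"
  using DD(1) DDD[OF x(1)] mM unfolding club_family_def by (metis countable_insert insert_subset)
 note yD = DDD[OF y(1)]
 obtain GG where GG: "fchain R C M (t (X p)) (t y) GG" using sf[OF x(1) yD(1) _ yD(2)] y(2) by (auto simp: subfiltered_def)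
 note c = PI[OF y(1) fchain_Un[OF x(2) GG]]
 have "m:t y" using m(1) h.M.span_superset[of y] y(2) by (auto simp: t_def)
 hence "m':h ` t (X (cond y (G p Un GG)))" using m(2) c by simp
 moreover have "le (cond y (G p Un GG)) p" unfolding le_def using c y(2) fchainD(4)[OF GG] by auto
 ultimately show "EX q:P. le q p & m':h ` t (X q)" using c by blast
 qed
 thus ?thesis using fp sc unfolding potentially_filtered_def by blast
qed

text \<open>Covers submodules and isomorphic copies at once. Read contrapositively, it makes the
  class of modules that are not potentially filtered closed upwards and under isomorphism.\<close>

corollary (in qh_class) potentially_filtered_embed:
 fixes M M' :: "('r, 'v) module"
 assumes cp: "!!N. N:C==>countably_presented R N"
 and hom: "lmod_hom R M M' N h" and small: "small (carrier M)" and "inj_on h N" "h ` N = carrier M'"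
 and pf: "potentially_filtered R C M"
 shows "potentially_filtered R C M'"
proof -
 interpret h: lmod_hom R M M' N h by (rule hom)
 have "vmodule R M" using h.M.lmodule_axioms small by (simp add: vmodule_def)
 hence "good_module R C M" using potentially_filtered_good vmod cp qh pf by blast
 thus ?thesis using good_module_potentially_filtered assms by blast
qed

section \<open>Modules as structures\<close>

definition solves :: "('r, 'm) module => (nat => nat => 'r) => (nat => 'm) => (nat => 'm) => nat => nat => bool" where
 "solves M a x b m n <-> (ALL i<m. finsum M (%j. a i j *[M] x j) {..<n} = b i)"

lemma pure_in_iff:
 "pure_in R U M <-> submodule U R M & (ALL m n a b x. (ALL i<m. ALL j<n. a i j:carrier R) & (ALL i<m. b i:U) &
  (ALL j<n. x j:carrier M) & solves M a x b m n --> (EX x. (ALL j<n. x j:U) & solves M a x b m n))"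
proof -
 have *: "(ALL m n a b. A m n a & B m b & (EX x. X n x & S m n a b x) --> E m n a b) <->
  (ALL m n a b x. A m n a & B m b & X n x & S m n a b x --> E m n a b)" for A B X S E
 by blast
 show ?thesis unfolding pure_in_def solves_def by (rule conj_cong[OF refl *])
qed

lemma (in lmod_hom) hom_finsum:
 fixes n :: nat
 assumes "ALL j<n. f j:U"
 shows "finsum M f {..<n}:U & h (finsum M f {..<n}) = finsum N (%j. h (f j)) {..<n}"
 using assms
proof (induction n)
 case (Suc n)
 have "f j:carrier M" "h (f j):carrier N" if "j < Suc n" for j
 using Suc.prems that M.submoduleD(1)[OF U] hom_closed by auto
 hence "finsum M f {..<Suc n} = f n +[M] finsum M f {..<n}"
 "finsum N (%j. h (f j)) {..<Suc n} = h (f n) +[N] finsum N (%j. h (f j)) {..<n}"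
 unfolding lessThan_Suc by (subst M.M.finsum_insert N.M.finsum_insert; auto)+
 thus ?case using Suc hom_add M.submoduleD(3)[OF U] by simp
qed (use hom_zero M.submoduleD(2)[OF U] in simp)

lemma (in lmod_hom) hom_solves:
 assumes a: "ALL i<m. ALL j<n. a i j:carrier R" and x: "ALL j<n. x j:U" and s: "solves M a x b m n"
 shows "solves N a (%j. h (x j)) (%i. h (b i)) m n"
 unfolding solves_def
proof (intro allI impI)
 fix i assume i: "i < m"
 have "h (b i) = h (finsum M (%j. a i j *[M] x j) {..<n})" using s i by (simp add: solves_def)
 also have "\<dots> = finsum N (%j. h (a i j *[M] x j)) {..<n}"
 using hom_finsum[of n "%j. a i j *[M] x j"] M.submoduleD(4)[OF U] a i x by blast
 also have "\<dots> = finsum N (%j. a i j *[N] h (x j)) {..<n}"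
 by (rule N.M.finsum_cong') (use hom_smult x a i hom_closed N.smult_closed in auto)
 finally show "finsum N (%j. a i j *[N] h (x j)) {..<n} = h (b i)" by simp
qed

context
 fixes R :: "'r ring"
begin

lemma mod_structsD:
 assumes "A:mod_structs R"
 shows "lmod R (module_of A)" "small (univ A)" "is_struct (mod_lang R) A" "carrier (module_of A) = univ A"
 using assms by (auto simp: mod_structs_def lmod_def module_of_def is_struct_def)

lemma is_struct_mod_iff:
 "is_struct (mod_lang R) A <-> small (univ A) & fn A Zero []:univ A &
  (ALL x:univ A. ALL y:univ A. fn A Plus [x, y]:univ A) & (ALL r:carrier R. ALL x:univ A. fn A (Scal r) [x]:univ A) &
  (ALL f xs. ~ (f:funs (mod_lang R) & length xs = farity (mod_lang R) f & set xs =< univ A) --> fn A f xs = undefined) &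
  (ALL p xs. ~ rl A p xs)"
 unfolding is_struct_def mod_lang_def by (auto simp: length_Suc_conv numeral_2_eq_2)

lemma substructure_mod_iff:
 "substructure (mod_lang R) A B <-> is_struct (mod_lang R) A & is_struct (mod_lang R) B & univ A =< univ B &
  fn A Zero [] = fn B Zero [] & (ALL x:univ A. ALL y:univ A. fn A Plus [x, y] = fn B Plus [x, y]) &
  (ALL r:carrier R. ALL x:univ A. fn A (Scal r) [x] = fn B (Scal r) [x])"
 unfolding substructure_def mod_lang_def by (auto simp: length_Suc_conv numeral_2_eq_2)

lemma struct_iso_mod_iff:
 "struct_iso (mod_lang R) h A B <-> bij_betw h (univ A) (univ B) &
  h (fn A Zero []) = fn B Zero [] & (ALL x:univ A. ALL y:univ A. h (fn A Plus [x, y]) = fn B Plus [h x, h y]) &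
  (ALL r:carrier R. ALL x:univ A. h (fn A (Scal r) [x]) = fn B (Scal r) [h x])"
 unfolding struct_iso_def mod_lang_def by (auto simp: length_Suc_conv numeral_2_eq_2)

lemmas mod_iffs = is_struct_mod_iff substructure_mod_iff struct_iso_mod_iff

lemma substructure_submodule:
 assumes A: "A:mod_structs R" and B: "B:mod_structs R" and AB: "substructure (mod_lang R) A B"
 shows "lmod_hom R (module_of B) (module_of A) (univ A) (%x. x)" "lmod_hom R (module_of A) (module_of B) (univ A) (%x. x)"
 "submodule (univ A) R (module_of B)"
proof -
 note b = mod_structsD[OF B] and a = mod_structsD[OF A]
 show s: "submodule (univ A) R (module_of B)"
 using AB a(3) unfolding lmod.submodule_iff[OF b(1)] mod_iffs by (auto simp: module_of_def)
 have "submodule (univ A) R (module_of A)" using lmod.submodule_carrier[OF a(1)] a(4) by simp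
 thus "lmod_hom R (module_of B) (module_of A) (univ A) (%x. x)" "lmod_hom R (module_of A) (module_of B) (univ A) (%x. x)"
 using s a b AB unfolding lmod_hom_def lmod_hom_axioms_def mod_hom_submodule_of mod_iffs by (auto simp: module_of_def)
qed

lemma substructure_solves:
 assumes A: "A:mod_structs R" and B: "B:mod_structs R" and AB: "substructure (mod_lang R) A B"
 and a: "ALL i<m. ALL j<n. a i j:carrier R" and x: "ALL j<n. x j:univ A"
 shows "solves (module_of A) a x b m n <-> solves (module_of B) a x b m n"
 using lmod_hom.hom_solves[OF substructure_submodule(1)[OF A B AB] a x] lmod_hom.hom_solves[OF substructure_submodule(2)[OF A B AB] a x]
 by blast

lemma pure_subI:
 assumes B: "B:mod_structs R" and A: "A:mod_structs R" and AB: "substructure (mod_lang R) A B"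
 and "!!m n a b x. (ALL i<m. ALL j<n. a i j:carrier R)==>(ALL i<m. b i:univ A)==>(ALL j<n. x j:univ B) ==>
  solves (module_of B) a x b m n==>EX x. (ALL j<n. x j:univ A) & solves (module_of B) a x b m n"
 shows "pure_sub R A B"
 unfolding pure_sub_def pure_in_iff mod_structsD(4)[OF B]
 using AB substructure_submodule(3)[OF A B AB] assms(4) by (intro conjI allI impI) blast+

lemma pure_subD:
 assumes "pure_sub R A B" "ALL i<m. ALL j<n. a i j:carrier R" "ALL i<m. b i:univ A" "ALL j<n. x j:univ B"
 "solves (module_of B) a x b m n"
 obtains y where "ALL j<n. y j:univ A" "solves (module_of B) a y b m n"
proof -
 have "carrier (module_of B) = univ B" by (simp add: module_of_def)
 hence "EX y. (ALL j<n. y j:univ A) & solves (module_of B) a y b m n"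
 using assms unfolding pure_sub_def pure_in_iff by (metis (no_types, lifting))
 thus thesis using that by blast
qed

lemma substructure_trans:
 "substructure (mod_lang R) A B==>substructure (mod_lang R) B D==>substructure (mod_lang R) A D"
 unfolding substructure_mod_iff by (auto simp: subset_iff)

lemma struct_iso_hom:
 assumes M: "M:mod_structs R" and N: "is_struct (mod_lang R) N" and h: "struct_iso (mod_lang R) h M N"
 shows "N:mod_structs R" "lmod_hom R (module_of M) (module_of N) (univ M) h"
 "lmod_hom R (module_of N) (module_of M) (univ N) (inv_into (univ M) h)" "bij_betw h (univ M) (univ N)"
proof -
 note m = mod_structsD[OF M]
 show b: "bij_betw h (univ M) (univ N)" using h by (simp add: struct_iso_mod_iff)
 have U: "submodule (univ M) R (module_of M)" using lmod.submodule_carrier[OF m(1)] m(4) by simp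
 have hom: "mod_hom R (submodule_of (module_of M) (univ M)) (module_of N) h"
 using h b unfolding mod_hom_submodule_of struct_iso_mod_iff by (auto simp: module_of_def bij_betw_def)
 have lN: "lmod R (module_of N)"
 by (rule lmod_surj_image[OF m(1) U hom]) (use h b in \<open>auto simp: module_of_def bij_betw_def struct_iso_mod_iff\<close>)
 thus "N:mod_structs R" using N by (simp add: mod_structs_def lmod_def)
 show "lmod_hom R (module_of M) (module_of N) (univ M) h"
 by (intro lmod_hom.intro lmod_hom_axioms.intro m(1) lN U hom)
 let ?g = "inv_into (univ M) h"
 have g: "?g (h x) = x" "h x:univ N" if "x:univ M" for x using b that by (auto simp: bij_betw_def)
 have ex: "EX y:univ M. x = h y" if "x:univ N" for x using b that by (auto simp: bij_betw_def)
 have "mod_hom R (submodule_of (module_of N) (univ N)) (module_of M) ?g"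
 unfolding mod_hom_submodule_of
 proof (intro conjI ballI)
 fix x assume x: "x:univ N"
 then obtain x' where x': "x':univ M" "x = h x'" using ex by blast
 show "?g x:carrier (module_of M)" using g x' m(4) by simp
 show "?g (r *[module_of N] x) = r *[module_of M] ?g x" if "r:carrier R" for r
 proof -
  have "fn M (Scal r) [x']:univ M" using m(3) x' that by (simp add: is_struct_mod_iff)
  hence "?g (h (fn M (Scal r) [x'])) = fn M (Scal r) [x']" by (rule g)
  thus ?thesis using h x' that g(1)[OF x'(1)] by (simp add: module_of_def struct_iso_mod_iff)
 qed
 fix y assume y: "y:univ N"
 then obtain y' where y': "y':univ M" "y = h y'" using ex by blast
 have "fn M Plus [x', y']:univ M" using m(3) x' y' by (simp add: is_struct_mod_iff)
 hence "?g (h (fn M Plus [x', y'])) = fn M Plus [x', y']" by (rule g)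
 thus "?g (x +[module_of N] y) = ?g x +[module_of M] ?g y"
  using h x' y' g(1)[OF x'(1)] g(1)[OF y'(1)] by (simp add: module_of_def struct_iso_mod_iff)
 qed
 moreover have "submodule (univ N) R (module_of N)" using lmod.submodule_carrier[OF lN] by (simp add: module_of_def)
 ultimately show "lmod_hom R (module_of N) (module_of M) (univ N) ?g"
 by (intro lmod_hom.intro lmod_hom_axioms.intro m(1) lN)
qed

lemma pure_sub_refl: "A:mod_structs R==>pure_sub R A A"
 by (rule pure_subI) (auto simp: substructure_mod_iff mod_structsD)

lemma pure_sub_trans:
 assumes K: "A:mod_structs R" "B:mod_structs R" "D:mod_structs R" and AB: "pure_sub R A B" and BD: "pure_sub R B D"
 shows "pure_sub R A D"
proof (rule pure_subI[OF K(3,1)])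
 have s: "substructure (mod_lang R) A B" "substructure (mod_lang R) B D" using AB BD by (auto simp: pure_sub_def)
 thus "substructure (mod_lang R) A D" by (rule substructure_trans)
 have AsB: "univ A =< univ B" using s by (simp add: substructure_mod_iff)
 fix m n :: nat and a :: "nat => nat => 'r" and b x
 assume a: "ALL i<m. ALL j<n. a i j:carrier R" and b: "ALL i<m. b i:univ A" and x: "ALL j<n. x j:univ D"
 and S: "solves (module_of D) a x b m n"
 have bB: "ALL i<m. b i:univ B" using b AsB by blast
 obtain y where y: "ALL j<n. y j:univ B" "solves (module_of D) a y b m n" by (rule pure_subD[OF BD a bB x S])
 obtain z where z: "ALL j<n. z j:univ A" "solves (module_of B) a z b m n"
 by (rule pure_subD[OF AB a b y(1) substructure_solves[OF K(2,3) s(2) a y(1), THEN iffD2, OF y(2)]])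
 have "ALL j<n. z j:univ B" using z(1) AsB by blast
 hence "solves (module_of D) a z b m n"
 using substructure_solves[OF K(2,3) s(2) a] z(2) by blast
 thus "EX x. (ALL j<n. x j:univ A) & solves (module_of D) a x b m n" using z(1) by blast
qed

text \<open>A solution can be taken in \<open>A\<close> by purity in \<open>D\<close>, and it solves
  the system in \<open>B\<close>, where sums are computed as in \<open>D\<close>.\<close>

lemma pure_sub_coherent:
 assumes K: "A:mod_structs R" "B:mod_structs R" "D:mod_structs R" and AB: "substructure (mod_lang R) A B"
 and AD: "pure_sub R A D" and BD: "substructure (mod_lang R) B D"
 shows "pure_sub R A B"
proof (rule pure_subI[OF K(2,1) AB])
 have le: "univ A =< univ B" "univ B =< univ D" using AB BD by (auto simp: substructure_mod_iff)
 fix m n :: nat and a :: "nat => nat => 'r" and b x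
 assume a: "ALL i<m. ALL j<n. a i j:carrier R" and b: "ALL i<m. b i:univ A" and x: "ALL j<n. x j:univ B"
 and S: "solves (module_of B) a x b m n"
 have xD: "ALL j<n. x j:univ D" using x le by blast
 have "solves (module_of D) a x b m n" using substructure_solves[OF K(2,3) BD a x] S by blast
 then obtain z where z: "ALL j<n. z j:univ A" "solves (module_of D) a z b m n" by (rule pure_subD[OF AD a b xD])
 have "ALL j<n. z j:univ B" using z(1) le by blast
 hence "solves (module_of B) a z b m n"
 using substructure_solves[OF K(2,3) BD a] z(2) by blast
 thus "EX x. (ALL j<n. x j:univ A) & solves (module_of B) a x b m n" using z(1) by blast
qed

lemma pure_sub_antisym: "pure_sub R A B==>pure_sub R B A==>A = B"
proof -
 assume "pure_sub R A B" "pure_sub R B A"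
 hence AB: "substructure (mod_lang R) A B" "substructure (mod_lang R) B A" by (auto simp: pure_sub_def)
 hence u: "univ A = univ B" and st: "is_struct (mod_lang R) A" "is_struct (mod_lang R) B" by (auto simp: substructure_def)
 have "fn A f xs = fn B f xs" for f xs
 proof (cases "f:funs (mod_lang R) & length xs = farity (mod_lang R) f & set xs =< univ A")
 case True
 thus ?thesis using AB(1) by (auto simp: substructure_def)
 next
 \<comment> \<open>Outside the intended arguments both functions are \<open>undefined\<close>; this
   convention of \<open>is_struct\<close> turns agreement into equality of records.\<close>
 case False
 hence "fn A f xs = undefined" "fn B f xs = undefined" using st u unfolding is_struct_def by auto
 thus ?thesis by simp
 qed
 moreover have "rl A = rl B" using st by (intro ext) (simp add: is_struct_mod_iff)
 ultimately show "A = B" using u by (intro fo_struct.equality ext) auto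
qed

lemma pure_sub_iso:
 assumes K: "M:mod_structs R" "N:mod_structs R" and MN: "pure_sub R M N"
 and st: "is_struct (mod_lang R) M'" "is_struct (mod_lang R) N'"
 and hN: "struct_iso (mod_lang R) h N N'" and hM: "struct_iso (mod_lang R) h M M'"
 shows "pure_sub R M' N'"
proof -
 note n = struct_iso_hom[OF K(2) st(2) hN] and m = struct_iso_hom[OF K(1) st(1) hM]
 have s: "substructure (mod_lang R) M N" using MN by (simp add: pure_sub_def)
 have le: "univ M =< univ N" using s by (simp add: substructure_mod_iff)
 have uM: "univ M' = h ` univ M" and uN: "univ N' = h ` univ N" using m(4) n(4) by (auto simp: bij_betw_def)
 show ?thesis
 proof (rule pure_subI[OF n(1) m(1)])
 show "substructure (mod_lang R) M' N'"
 proof -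
  have "fn M' Plus [h x, h y] = fn N' Plus [h x, h y]" "r:carrier R==>fn M' (Scal r) [h x] = fn N' (Scal r) [h x]"
  if "x:univ M" "y:univ M" for x y r
  using s hM hN that le unfolding substructure_mod_iff struct_iso_mod_iff by (metis subsetD)+
  moreover have "fn M' Zero [] = fn N' Zero []" using s hM hN unfolding substructure_mod_iff struct_iso_mod_iff by metis
  ultimately show ?thesis using st image_mono[OF le, of h] unfolding substructure_mod_iff uM uN by auto
 qed
 let ?g = "inv_into (univ N) h"
 have g: "h (?g y) = y" "?g y:univ N" if "y:univ N'" for y using that uN by (auto simp: f_inv_into_f inv_into_into)
 have gM: "?g y:univ M" if yM: "y:univ M'" for y
 proof -
  obtain x where "x:univ M" "y = h x" using yM uM by blast
  thus ?thesis using n(4) le by (auto simp: bij_betw_def)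
 qed
 fix m' n' :: nat and a :: "nat => nat => 'r" and b x
 assume a: "ALL i<m'. ALL j<n'. a i j:carrier R" and b: "ALL i<m'. b i:univ M'" and x: "ALL j<n'. x j:univ N'"
  and S: "solves (module_of N') a x b m' n'"
 have bN: "ALL i<m'. b i:univ N'" using b uM uN le by blast
 have S': "solves (module_of N) a (%j. ?g (x j)) (%i. ?g (b i)) m' n'" by (rule lmod_hom.hom_solves[OF n(3) a x S])
 have bM: "ALL i<m'. ?g (b i):univ M" and xN: "ALL j<n'. ?g (x j):univ N" using gM b g(2) x by auto
 obtain y where y: "ALL j<n'. y j:univ M" "solves (module_of N) a y (%i. ?g (b i)) m' n'"
  by (rule pure_subD[OF MN a bM xN S'])
 have yN: "ALL j<n'. y j:univ N" using y(1) le by blast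
 have "solves (module_of N') a (%j. h (y j)) (%i. h (?g (b i))) m' n'" by (rule lmod_hom.hom_solves[OF n(2) a yN y(2)])
 hence "solves (module_of N') a (%j. h (y j)) b m' n'"
  using g(1) bN by (simp add: solves_def)
 thus "EX x. (ALL j<n'. x j:univ M') & solves (module_of N') a x b m' n'"
  using y(1) uM by (intro exI[of _ "%j. h (y j)"]) simp
 qed
qed

text \<open>The union of a chain of structures, indexed by a set of ordinals.\<close>

context
 fixes M :: "'v::zfc => ('r mod_sym, unit, 'v) fo_struct" and \<delta> :: 'v
 assumes \<delta>: "vord \<delta>" "elts \<delta> ~= {}" and all_M: "ALL i:elts \<delta>. M i:mod_structs R"
 and all_mono: "ALL j:elts \<delta>. ALL i:elts j. substructure (mod_lang R) (M i) (M j)"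
begin

lemma M: "i:elts \<delta>==>M i:mod_structs R"
 and mono: "j:elts \<delta>==>i:elts j==>substructure (mod_lang R) (M i) (M j)"
 using all_M all_mono by auto

definition Un_struct :: "('r mod_sym, unit, 'v) fo_struct" where
 "Un_struct = \<lparr>univ = (\<Union>i\<in>elts \<delta>. univ (M i)),
  fn = (%f xs. if f:funs (mod_lang R) & length xs = farity (mod_lang R) f & set xs =< (\<Union>i\<in>elts \<delta>. univ (M i))
  then fn (M (SOME i. i:elts \<delta> & set xs =< univ (M i))) f xs else undefined),
  rl = (%_ _. False)\<rparr>"

lemma M_mono: "i:elts \<delta>==>j:elts \<delta>==>substructure (mod_lang R) (M i) (M j) | substructure (mod_lang R) (M j) (M i)"
proof -
 assume ij: "i:elts \<delta>" "j:elts \<delta>"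
 then consider "i:elts j" | "i = j" | "j:elts i" using vord_linear[of i j] vord_mem[OF \<delta>(1)] by blast
 thus ?thesis using mono ij mod_structsD(3)[OF M[OF ij(1)]] by cases (auto simp: substructure_def)
qed

text \<open>Finitely many parameters and unknowns of a system of equations lie in one member of the
  chain, which can also be taken above a given one; purity and the module axioms in the union are
  checked there.\<close>

lemma finite_in_one:
 assumes "finite F" "F =< univ Un_struct" "i:elts \<delta>"
 shows "EX j:elts \<delta>. F =< univ (M j) & substructure (mod_lang R) (M i) (M j)"
 using assms(1,2)
proof (induction F)
 case empty
 thus ?case using M_mono[OF assms(3,3)] assms(3) by blast
next
 case (insert x F)
 then obtain j where j: "j:elts \<delta>" "F =< univ (M j)" "substructure (mod_lang R) (M i) (M j)" by auto
 obtain k where k: "k:elts \<delta>" "x:univ (M k)" using insert.prems by (auto simp: Un_struct_def)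
 show ?case
 proof (cases "substructure (mod_lang R) (M j) (M k)")
 case True
 hence "insert x F =< univ (M k)" using j k by (auto simp: substructure_mod_iff)
 thus ?thesis using k(1) substructure_trans[OF j(3) True] by blast
 next
 case False
 hence "substructure (mod_lang R) (M k) (M j)" using M_mono[OF j(1) k(1)] by blast
 hence "insert x F =< univ (M j)" using j k by (auto simp: substructure_mod_iff)
 thus ?thesis using j by blast
 qed
qed

lemma fn_Un_struct:
 assumes f: "f:funs (mod_lang R)" "length xs = farity (mod_lang R) f" and i: "i:elts \<delta>" "set xs =< univ (M i)"
 shows "fn Un_struct f xs = fn (M i) f xs"
proof -
 define j where "j = (SOME j. j:elts \<delta> & set xs =< univ (M j))"
 have j: "j:elts \<delta> & set xs =< univ (M j)" unfolding j_def by (rule someI[of _ i]) (use i in blast)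
 have "set xs =< (\<Union>i\<in>elts \<delta>. univ (M i))" using i by blast
 hence "fn Un_struct f xs = fn (M j) f xs" using f unfolding Un_struct_def j_def by simp
 also have "\<dots> = fn (M i) f xs" using M_mono[of i j] i j f unfolding substructure_def by metis
 finally show ?thesis .
qed

lemma small_Un_struct: "small (univ Un_struct)"
 unfolding Un_struct_def by (simp, rule small_UN) (use M mod_structsD(2) in auto)

lemma substructure_Un_struct: "i:elts \<delta>==>substructure (mod_lang R) (M i) Un_struct"
 and is_struct_Un_struct: "is_struct (mod_lang R) Un_struct"
proof -
 have "fn Un_struct f xs:univ Un_struct"
 if f: "f:funs (mod_lang R)" "length xs = farity (mod_lang R) f" "set xs =< univ Un_struct" for f xs
 proof -
 obtain i where "i:elts \<delta>" using \<delta> by blast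
 then obtain j where j: "j:elts \<delta>" "set xs =< univ (M j)" using finite_in_one[OF _ f(3)] by blast
 hence "fn (M j) f xs:univ (M j)" using mod_structsD(3)[OF M[OF j(1)]] f unfolding is_struct_def by blast
 thus ?thesis using fn_Un_struct[OF f(1,2) j] j(1) by (auto simp: Un_struct_def)
 qed
 thus st: "is_struct (mod_lang R) Un_struct"
 using small_Un_struct unfolding is_struct_def by (auto simp: Un_struct_def)
 show "substructure (mod_lang R) (M i) Un_struct" if "i:elts \<delta>" for i
 using st mod_structsD(3)[OF M[OF that]] that unfolding substructure_def
 by (auto simp: fn_Un_struct) (auto simp: Un_struct_def mod_lang_def)
qed

lemma Un_struct_mod: "Un_struct:mod_structs R"
proof -
 obtain i0 where i0: "i0:elts \<delta>" using \<delta> by blast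
 let ?U = "module_of Un_struct"
 have ops: "carrier (module_of (M i)) =< carrier ?U" "0[?U] = 0[module_of (M i)]"
 "x:carrier (module_of (M i))==>y:carrier (module_of (M i))==>x +[?U] y = x +[module_of (M i)] y"
 "x:carrier (module_of (M i))==>r:carrier R==>r *[?U] x = r *[module_of (M i)] x" if "i:elts \<delta>" for i x y r
 using substructure_Un_struct[OF that] unfolding substructure_mod_iff by (auto simp: module_of_def)
 have l: "lmod R (module_of (M i))" if "i:elts \<delta>" for i by (rule mod_structsD(1)[OF M[OF that]])
 have one: "EX i:elts \<delta>. x:carrier (module_of (M i)) & y:carrier (module_of (M i)) & z:carrier (module_of (M i))"
 if "x:carrier ?U" "y:carrier ?U" "z:carrier ?U" for x y z
 using finite_in_one[of "{x, y, z}" i0] that i0 by (auto simp: module_of_def)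
 have "abelian_group ?U"
 proof (rule abelian_groupI)
 show "0[?U]:carrier ?U" using is_struct_Un_struct by (simp add: module_of_def is_struct_mod_iff)
 fix x assume x: "x:carrier ?U"
 then obtain i where i: "i:elts \<delta>" "x:carrier (module_of (M i))" using one[of x x x] by blast
 interpret lmod R "module_of (M i)" by (rule l[OF i(1)])
 show "0[?U] +[?U] x = x" using ops(2,3)[OF i(1)] i(2) by simp
 show "EX y:carrier ?U. y +[?U] x = 0[?U]"
  using ops[OF i(1)] i(2) M.l_neg[OF i(2)] by (intro bexI[of _ "\<ominus>\<^bsub>module_of (M i)\<^esub> x"]) auto
 next
 fix x y assume xy: "x:carrier ?U" "y:carrier ?U"
 then obtain i where i: "i:elts \<delta>" "x:carrier (module_of (M i))" "y:carrier (module_of (M i))" using one[of x y y] by blast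
 interpret lmod R "module_of (M i)" by (rule l[OF i(1)])
 show "x +[?U] y:carrier ?U" using ops(1,3)[OF i(1)] i(2,3) by auto
 show "x +[?U] y = y +[?U] x" using ops(3)[OF i(1)] i(2,3) M.a_comm by auto
 next
 fix x y z assume xyz: "x:carrier ?U" "y:carrier ?U" "z:carrier ?U"
 then obtain i where i: "i:elts \<delta>" "x:carrier (module_of (M i))" "y:carrier (module_of (M i))" "z:carrier (module_of (M i))"
  using one[of x y z] by blast
 interpret lmod R "module_of (M i)" by (rule l[OF i(1)])
 show "x +[?U] y +[?U] z = x +[?U] (y +[?U] z)" using ops(3)[OF i(1)] i(2-4) M.a_assoc by auto
 qed
 moreover have "lmodule_axioms R ?U"
 proof (unfold lmodule_axioms_def, intro conjI allI impI)
 fix a x assume a: "a:carrier R" and x: "x:carrier ?U"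
 then obtain i where i: "i:elts \<delta>" "x:carrier (module_of (M i))" using one[of x x x] by blast
 interpret lmod R "module_of (M i)" by (rule l[OF i(1)])
 show "a *[?U] x:carrier ?U" using ops(1,4)[OF i(1)] i(2) smult_closed a by auto
 show "(a +[R] b) *[?U] x = a *[?U] x +[?U] b *[?U] x"
  "(a \<otimes>\<^bsub>R\<^esub> b) *[?U] x = a *[?U] (b *[?U] x)" if "b:carrier R" for b
  using ops(3,4)[OF i(1)] i(2) smult_closed smult_l_distr smult_assoc a that by auto
 next
 fix a x y assume a: "a:carrier R" and xy: "x:carrier ?U" "y:carrier ?U"
 then obtain i where i: "i:elts \<delta>" "x:carrier (module_of (M i))" "y:carrier (module_of (M i))" using one[of x y y] by blast
 interpret lmod R "module_of (M i)" by (rule l[OF i(1)])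
 show "a *[?U] (x +[?U] y) = a *[?U] x +[?U] a *[?U] y"
  using ops(3,4)[OF i(1)] i(2,3) smult_closed smult_r_distr a by auto
 next
 fix x assume x: "x:carrier ?U"
 then obtain i where i: "i:elts \<delta>" "x:carrier (module_of (M i))" using one[of x x x] by blast
 interpret lmod R "module_of (M i)" by (rule l[OF i(1)])
 show "\<one>\<^bsub>R\<^esub> *[?U] x = x" using ops(4)[OF i(1,2)] smult_one[OF i(2)] by simp
 qed
 moreover have "ring R" using l[OF i0] by (simp add: lmod_def lmodule_def)
 ultimately show ?thesis using is_struct_Un_struct by (simp add: mod_structs_def lmodule_def)
qed

lemma is_union_Un_struct: "is_union (mod_lang R) (elts \<delta>) M Un_struct"
 using substructure_Un_struct by (auto simp: is_union_def) (auto simp: Un_struct_def)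

lemma finite_sequences_in_one:
 assumes "ALL j<n. x j:univ Un_struct" "ALL j<m. b j:univ Un_struct" "i:elts \<delta>"
 obtains k where "k:elts \<delta>" "ALL j<(n::nat). x j:univ (M k)" "ALL j<(m::nat). b j:univ (M k)" "substructure (mod_lang R) (M i) (M k)"
proof -
 have "EX k:elts \<delta>. x ` {..<n} Un b ` {..<m} =< univ (M k) & substructure (mod_lang R) (M i) (M k)"
 by (rule finite_in_one) (use assms in auto)
 thus thesis using that by blast
qed

lemma pure_Un_struct:
 assumes p: "ALL j:elts \<delta>. ALL i:elts j. pure_sub R (M i) (M j)" and i: "i:elts \<delta>"
 shows "pure_sub R (M i) Un_struct"
proof (rule pure_subI[OF Un_struct_mod M[OF i] substructure_Un_struct[OF i]])
 fix m n :: nat and a :: "nat => nat => 'r" and b x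
 assume a: "ALL i<m. ALL j<n. a i j:carrier R" and b: "ALL i'<m. b i':univ (M i)" and x: "ALL j<n. x j:univ Un_struct"
 and S: "solves (module_of Un_struct) a x b m n"
 have bU: "ALL i'<m. b i':univ Un_struct" using b i by (auto simp: Un_struct_def)
 obtain k where k: "k:elts \<delta>" "ALL j<n. x j:univ (M k)" and "ALL j<m. b j:univ (M k)"
 and ks: "substructure (mod_lang R) (M i) (M k)"
 by (rule finite_sequences_in_one[OF x bU i])
 have "pure_sub R (M i) (M k)"
 proof -
 consider "i:elts k" | "i = k" | "k:elts i" using vord_linear[of i k] vord_mem[OF \<delta>(1)] i k(1) by blast
 thus ?thesis
 proof cases
  \<comment> \<open>Here \<open>k\<close> is below \<open>i\<close> although \<open>M i\<close> is a
    substructure of \<open>M k\<close>; then both structures coincide.\<close>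
  case 3
  hence "M k = M i" using pure_sub_antisym[OF p[rule_format, OF i 3]] pure_sub_coherent[OF M[OF i] M[OF k(1)] M[OF i] ks pure_sub_refl[OF M[OF i]]] mono[OF i 3] by blast
  thus ?thesis using pure_sub_refl M[OF i] by simp
 qed (use p k(1) pure_sub_refl M[OF i] in auto)
 qed
 moreover have "solves (module_of (M k)) a x b m n"
 using substructure_solves[OF M[OF k(1)] Un_struct_mod substructure_Un_struct[OF k(1)] a k(2)] S by blast
 ultimately obtain y where y: "ALL j<n. y j:univ (M i)" "solves (module_of (M k)) a y b m n" by (rule pure_subD[OF _ a b k(2)])
 have "ALL j<n. y j:univ (M k)" using y(1) ks by (auto simp: substructure_mod_iff)
 hence "solves (module_of Un_struct) a y b m n"
 using substructure_solves[OF M[OF k(1)] Un_struct_mod substructure_Un_struct[OF k(1)] a] y(2) by blast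
 thus "EX x. (ALL j<n. x j:univ (M i)) & solves (module_of Un_struct) a x b m n" using y(1) by blast
qed

lemma Un_struct_pure:
 assumes N: "N:mod_structs R" and p: "ALL i:elts \<delta>. pure_sub R (M i) N"
 shows "pure_sub R Un_struct N"
proof -
 obtain i where i: "i:elts \<delta>" using \<delta> by blast
 have s: "substructure (mod_lang R) (M i) N" if "i:elts \<delta>" for i using p that by (simp add: pure_sub_def)
 have "fn Un_struct f xs = fn N f xs"
 if f: "f:funs (mod_lang R)" "length xs = farity (mod_lang R) f" "set xs =< univ Un_struct" for f xs
 proof -
 obtain j where j: "j:elts \<delta>" "set xs =< univ (M j)" using finite_in_one[OF _ f(3) i] by blast
 thus ?thesis using fn_Un_struct[OF f(1,2) j] s[OF j(1)] f unfolding substructure_def by metis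
 qed
 moreover have "univ Un_struct =< univ N" using s by (force simp: Un_struct_def substructure_mod_iff)
 ultimately have sU: "substructure (mod_lang R) Un_struct N"
 using is_struct_Un_struct mod_structsD(3)[OF N] unfolding substructure_def by (auto simp: mod_lang_def)
 show ?thesis
 proof (rule pure_subI[OF N Un_struct_mod sU])
 fix m n :: nat and a :: "nat => nat => 'r" and b x
 assume a: "ALL i<m. ALL j<n. a i j:carrier R" and b: "ALL i<m. b i:univ Un_struct" and x: "ALL j<n. x j:univ N"
  and S: "solves (module_of N) a x b m n"
 obtain k where k: "k:elts \<delta>" "ALL j<m. b j:univ (M k)"
 proof -
  have "EX j:elts \<delta>. b ` {..<m} =< univ (M j) & substructure (mod_lang R) (M i) (M j)"
  by (rule finite_in_one) (use b i in auto)
  thus thesis using that by blast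
 qed
 obtain y where y: "ALL j<n. y j:univ (M k)" "solves (module_of N) a y b m n" by (rule pure_subD[OF p[rule_format, OF k(1)] a k(2) x S])
 thus "EX x. (ALL j<n. x j:univ Un_struct) & solves (module_of N) a x b m n" using k(1) by (auto simp: Un_struct_def)
 qed
qed

end

text \<open>By \<open>closed\<close> the class contains every module that extends one of its
  members. The union of a chain extends its first members, and so belongs to the class; the
  remaining axioms are properties of purity.\<close>

theorem AEC_not_potentially_filtered:
 fixes C :: "('r, 'v::zfc) module set" and \<kappa> :: "'v rel"
 assumes closed: "!!M M' N h. lmod_hom R M M' N h==>small (carrier M)==>inj_on h N==>h ` N = carrier M' ==>
  potentially_filtered R C M==>potentially_filtered R C M'"
 defines "K == {M:mod_structs R. ~ potentially_filtered R C (module_of M)}"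
 assumes \<kappa>: "vcardinal \<kappa>" "LS_property K (pure_sub R) \<kappa>"
 shows "AEC (mod_lang R) K (pure_sub R)"
proof -
 have KD: "M:mod_structs R" if "M:K" for M using that by (simp add: K_def)
 have up: "B:K" if "A:K" "B:mod_structs R" "substructure (mod_lang R) A B" for A B
 using closed[OF substructure_submodule(1)[OF KD[OF that(1)] that(2,3)]] that mod_structsD(2)[OF that(2)] unfolding K_def
 by (auto simp: module_of_def)
 have chain: "EX U:K. is_union (mod_lang R) (elts \<delta>) M U & (ALL i:elts \<delta>. pure_sub R (M i) U) &
  (ALL N:K. (ALL i:elts \<delta>. pure_sub R (M i) N) --> pure_sub R U N)"
 if "continuous_chain (mod_lang R) K (pure_sub R) \<delta> M" for \<delta> M
 proof -
 have c: "vord \<delta>" "elts \<delta> ~= {}" and cK: "ALL i:elts \<delta>. M i:K" and p: "ALL j:elts \<delta>. ALL i:elts j. pure_sub R (M i) (M j)"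
  using that by (auto simp: continuous_chain_def)
 have m: "ALL i:elts \<delta>. M i:mod_structs R" using cK KD by blast
 have s: "ALL j:elts \<delta>. ALL i:elts j. substructure (mod_lang R) (M i) (M j)" using p by (simp add: pure_sub_def)
 note U = Un_struct_mod[OF c m s]
 obtain i where i: "i:elts \<delta>" "M i:K" using c cK by blast
 have "Un_struct M \<delta>:K" using up[OF i(2) U substructure_Un_struct[OF c m s i(1)]] .
 thus ?thesis
 proof (intro bexI[of _ "Un_struct M \<delta>"] conjI ballI impI)
  show "is_union (mod_lang R) (elts \<delta>) M (Un_struct M \<delta>)" by (rule is_union_Un_struct[OF c m s])
  show "pure_sub R (M i) (Un_struct M \<delta>)" if "i:elts \<delta>" for i by (rule pure_Un_struct[OF c m s p that])
  show "pure_sub R (Un_struct M \<delta>) N" if "N:K" "ALL i:elts \<delta>. pure_sub R (M i) N" for N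
  by (rule Un_struct_pure[OF c m s KD[OF that(1)] that(2)])
 qed
 qed
 have iso: "N:K" if "M:K" "is_struct (mod_lang R) N" "struct_iso (mod_lang R) h M N" for M N h
 proof -
 note i = struct_iso_hom[OF KD[OF that(1)] that(2,3)]
 have "bij_betw (inv_into (univ M) h) (univ N) (univ M)" by (rule bij_betw_inv_into[OF i(4)])
 hence "~ potentially_filtered R C (module_of N)"
  using closed[OF i(3)] that(1) mod_structsD(2)[OF i(1)] unfolding K_def bij_betw_def by (auto simp: module_of_def)
 thus ?thesis using i(1) by (simp add: K_def)
 qed
 have po: "partial_order_on K {(M, N). M:K & N:K & pure_sub R M N}"
 unfolding partial_order_on_def preorder_on_def
 proof (intro conjI)
 show "trans {(M, N). M:K & N:K & pure_sub R M N}"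
  using pure_sub_trans[OF KD KD KD] unfolding trans_def by auto
 qed (use pure_sub_refl KD pure_sub_antisym in \<open>auto simp: refl_on_def antisym_def\<close>)
 show ?thesis
 unfolding AEC_def
 apply (intro conjI)
 subgoal using KD mod_structsD(3) by blast
 subgoal by (rule po)
 subgoal using iso by blast
 subgoal by (intro ballI allI impI, elim conjE) (rule pure_sub_iso[OF KD KD])
 subgoal by (simp add: pure_sub_def)
 subgoal by (intro ballI impI, elim conjE) (rule pure_sub_coherent[OF KD KD KD], auto simp: pure_sub_def)
 subgoal using chain by blast
 subgoal using \<kappa> by blast
 done
qed

end

section \<open>Cardinals and hereditarily small sets\<close>

lemma ex_inj_nat: "EX f :: nat => 'v::zfc. inj f"
proof -
 define s :: "nat => 'v" where "s n = (vsuc ^^ n) (vset {})" for n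
 have s: "s (Suc n) = vsuc (s n)" for n by (simp add: s_def)
 have "s m:elts (s (m + Suc k))" for m k by (induction k) (auto simp: s)
 hence "s m ~= s n" if "m < n" for m n using that less_imp_Suc_add[OF that] mem_not_refl by (metis add_Suc_right)
 thus ?thesis by (intro exI[of _ s] linorder_injI)
qed

text \<open>The successor cardinal is a relation on HOL sets of elements. It is at most the size of
  the power set, whose codes form a set, so it has a copy inside the universe.\<close>

lemma vcardinal_cardSuc:
 fixes A :: "'v::zfc set"
 assumes A: "small A" "infinite A"
 obtains \<theta> :: "'v rel" where "vcardinal \<theta>" "\<theta> =o cardSuc |A|" "Cinfinite \<theta>" "regularCard \<theta>"
proof -
 have inf: "Cinfinite |A|" using A(2) by (simp add: cinfinite_def Field_card_of card_of_card_order_on)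
 have "cardSuc |A| <=o |Pow A|" by (rule cardSuc_least) (auto simp: card_of_Pow card_of_Card_order)
 moreover have "|Pow A| =o |vset ` Pow A|" using vset_inj_on_Pow[OF A(1)] by (rule card_of_ordIsoI[OF inj_on_imp_bij_betw])
 ultimately have "cardSuc |A| <=o |vset ` Pow A|" by (rule ordLeq_ordIso_trans)
 moreover have f: "|Field (cardSuc |A| )| =o cardSuc |A|" by (simp add: card_of_Field_ordIso cardSuc_Card_order card_of_Card_order)
 ultimately have le: "|Field (cardSuc |A| )| <=o |vset ` Pow A|" using ordIso_ordLeq_trans by blast
 obtain B where B: "B =< vset ` Pow A" "|Field (cardSuc |A| )| =o |B|"
 using iffD1[OF internalize_card_of_ordLeq2 le] by auto
 have iso: "|B| =o cardSuc |A|" by (rule ordIso_transitive[OF ordIso_symmetric[OF B(2)] f])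
 have cs: "Cinfinite (cardSuc |A| )" by (rule Cinfinite_cardSuc[OF inf])
 have reg: "regularCard (cardSuc |A| )" by (rule infinite_cardSuc_regularCard) (simp_all add: A(2) Field_card_of card_of_card_order_on)
 show thesis
 proof (rule that)
 show "vcardinal |B|" using small_subset[OF small_Pow[OF A(1)] B(1)] by (simp add: vcardinal_def card_of_card_order_on Field_card_of)
 show "|B| =o cardSuc |A|" by (rule iso)
 show "Cinfinite |B|" by (rule Cinfinite_cong[OF ordIso_symmetric[OF iso] cs])
 show "regularCard |B|" by (rule regularCard_ordIso[OF ordIso_symmetric[OF iso] cs reg])
 qed
qed

lemma aleph1_copy:
 obtains \<kappa> :: "'v::zfc rel" where "vcardinal \<kappa>" "\<kappa> =o aleph1" "Cinfinite \<kappa>"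
proof -
 obtain f :: "nat => 'v" where f: "inj f" using ex_inj_nat by blast
 have "|range f| =o |UNIV :: nat set|" by (rule ordIso_symmetric[OF card_of_ordIsoI[OF inj_on_imp_bij_betw[OF f]]])
 hence "|range f| =o natLeq" using card_of_nat ordIso_transitive by blast
 hence "cardSuc |range f| =o aleph1" using cardSuc_invar_ordIso card_of_Card_order natLeq_Card_order by blast
 moreover obtain \<theta> :: "'v rel" where "vcardinal \<theta>" "\<theta> =o cardSuc |range f|" "Cinfinite \<theta>"
 using vcardinal_cardSuc[OF small_nat[of f]] range_inj_infinite[OF f] by blast
 ultimately show thesis using that ordIso_transitive by blast
qed

text \<open>If \<open>omega1\<close> were countable, it would be a set, a countable ordinal, and
  thus an element of itself.\<close>

lemma aleph1_le_omega1: "aleph1 <=o |omega1 :: 'v::zfc set|"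
proof (rule cardSuc_least[OF natLeq_Card_order card_of_Card_order], rule ccontr)
 assume "~ natLeq <o |omega1 :: 'v set|"
 hence "|omega1 :: 'v set| <=o natLeq" using not_ordLess_iff_ordLeq[OF card_of_Well_order natLeq_Well_order] by blast
 hence c: "countable (omega1 :: 'v set)" by (simp add: countable_card_le_natLeq)
 have tr: "elts x =< omega1" if "x:omega1" for x :: 'v
 proof
 fix y assume y: "y:elts x"
 have x: "vord x" "countable (elts x)" using that by (simp_all add: omega1_def)
 have "elts y =< elts x" using x(1) y unfolding vord_def by blast
 thus "y:omega1" using vord_mem[OF x(1) y] countable_subset[OF _ x(2)] by (simp add: omega1_def)
 qed
 have s: "small (omega1 :: 'v set)" by (rule countable_small[OF c])
 have "vord (vset (omega1 :: 'v set))" by (rule vord_vset[OF s]) (simp add: omega1_def, rule tr)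
 hence "vset (omega1 :: 'v set):omega1" using c elts_vset[OF s] by (simp add: omega1_def)
 thus False using mem_not_refl[of "vset (omega1 :: 'v set)"] elts_vset[OF s] by simp
qed

lemma trcl_mono: "y:elts x==>trcl y =< trcl (x :: 'v::zfc)" and trcl_elts: "elts x =< trcl x"
 unfolding trcl_def by (auto intro: trancl_trans)

lemma trcl_step: "u:insert x (trcl x)==>z:elts u==>z:trcl (x :: 'v::zfc)"
 unfolding trcl_def by (auto intro: trancl_trans)

lemma trcl_unfold: "trcl x = elts x Un (\<Union>y\<in>elts x. trcl (y :: 'v::zfc))"
proof
 show "trcl x =< elts x Un (\<Union>y\<in>elts x. trcl y)"
 proof
 fix y assume "y:trcl x"
 hence "(y, x):{(y, x). y:elts x}\<^sup>+" by (simp add: trcl_def)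
 thus "y:elts x Un (\<Union>y\<in>elts x. trcl y)" by (cases rule: tranclE) (auto simp: trcl_def)
 qed
qed (use trcl_mono trcl_elts in blast)

lemma small_trcl: "small (trcl (x :: 'v::zfc))"
proof (induction x rule: elts_induct)
 case (step x)
 show ?case by (subst trcl_unfold, intro small_Un small_UN small_elts step)
qed

text \<open>A set \<open>x\<close> is determined by an isomorphic copy of the membership relation on its transitive
 closure, together with the point corresponding to \<open>x\<close>.\<close>

definition codes :: "'v::zfc => ('v => 'v) => 'v set" where
 "codes x e = {vpair (e u) (e v) |u v. v:insert x (trcl x) & u:elts v}"

lemma codes_inject:
 assumes e: "inj_on e (insert x (trcl x))" "inj_on e' (insert x' (trcl x'))" and eq: "codes x e = codes x' e'" "e x = e' x'"
 shows "x = x'"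
proof -
 have "u = u'" if "u:insert x (trcl x)" "u':insert x' (trcl x')" "e u = e' u'" for u u'
 using that
 proof (induction u arbitrary: u' rule: elts_induct)
 case (step u)
 have "z:elts u'" if z: "z:elts u" for z
 proof -
  have "vpair (e z) (e u):codes x' e'" using z step.prems(1) eq(1) unfolding codes_def by blast
  then obtain z' v' where v: "e z = e' z'" "e u = e' v'" "v':insert x' (trcl x')" "z':elts v'" unfolding codes_def by auto
  have v': "v' = u'" by (rule inj_onD[OF e(2) trans[OF sym[OF v(2)] step.prems(3)] v(3) step.prems(2)])
  have "z:insert x (trcl x)" "z':insert x' (trcl x')" using trcl_step[OF step.prems(1) z] trcl_step[OF v(3,4)] by auto
  hence "z = z'" by (rule step.IH[OF z _ _ v(1)])
  thus ?thesis using v(4) v' by simp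
 qed
 moreover have "z':elts u" if z: "z':elts u'" for z'
 proof -
  have "vpair (e' z') (e' u'):codes x e" using z step.prems(2) eq(1) unfolding codes_def by blast
  then obtain z v where v: "e' z' = e z" "e' u' = e v" "v:insert x (trcl x)" "z:elts v" unfolding codes_def by auto
  have v': "v = u" by (rule inj_onD[OF e(1) trans[OF sym[OF v(2)] sym[OF step.prems(3)]] v(3) step.prems(1)])
  have "z:insert x (trcl x)" "z':insert x' (trcl x')" using trcl_step[OF v(3,4)] trcl_step[OF step.prems(2) z] by auto
  hence "z = z'" by (rule step.IH[OF v(4)[unfolded v'] _ _ sym[OF v(1)]])
  thus ?thesis using v(4) v' by simp
 qed
 ultimately show ?case by (intro extensionality) blast
 qed
 thus ?thesis using eq(2) by blast
qed

text \<open>A transitive closure of size below \<open>\<theta>\<close> can be copied into the field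
  of \<open>\<theta>\<close>. The codes are then relations on that field with a marked point, and
  these form a set.\<close>

lemma small_Hset:
 fixes \<theta> :: "'v::zfc rel"
 assumes \<theta>: "vcardinal \<theta>" "Cinfinite \<theta>"
 shows "small (Hset \<theta>)"
proof -
 let ?F = "Field \<theta>"
 have F: "small ?F" using \<theta>(1) by (simp add: vcardinal_def)
 have "EX e. inj_on e (insert x (trcl x)) & e ` insert x (trcl x) =< ?F" if "x:Hset \<theta>" for x
 proof -
 have F: "|?F| =o \<theta>" "infinite ?F" "Card_order \<theta>" using \<theta>(2) card_of_Field_ordIso by (auto simp: cinfinite_def)
 have "|trcl x| <=o \<theta>" using that ordLess_imp_ordLeq by (simp add: Hset_def)
 moreover have "|{x}| <=o \<theta>" by (rule ordLeq_ordIso_trans[OF card_of_singl_ordLeq F(1)]) (use F(2) in auto)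
 ultimately have "|{x} Un trcl x| <=o \<theta>" using F by (intro card_of_Un_ordLeq_infinite_Field) auto
 hence "|insert x (trcl x)| <=o |?F|" using ordLeq_ordIso_trans[OF _ ordIso_symmetric[OF F(1)]] by simp
 thus ?thesis using card_of_ordLeq by blast
 qed
 then obtain e where e: "!!x. x:Hset \<theta>==>inj_on (e x) (insert x (trcl x)) & e x ` insert x (trcl x) =< ?F" by metis
 define F2 where "F2 = (%(x, y). vpair x y) ` (?F \<times> ?F)"
 have F2: "small F2" unfolding F2_def by (rule small_image2[OF F F])
 define c where "c x = vpair (e x x) (vset (codes x (e x)))" for x
 have cF: "codes x (e x) =< F2" if "x:Hset \<theta>" for x
 proof
 fix z assume "z:codes x (e x)"
 then obtain u v where z: "z = vpair (e x u) (e x v)" "v:insert x (trcl x)" "u:elts v" unfolding codes_def by blast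
 have "u:trcl x" by (rule trcl_step[OF z(2,3)])
 hence "e x u:?F" "e x v:?F" using e[OF that] z(2) by blast+
 thus "z:F2" using z(1) by (auto simp: F2_def)
 qed
 have "inj_on c (Hset \<theta>)"
 proof (rule inj_onI)
 fix x y assume xy: "x:Hset \<theta>" "y:Hset \<theta>" "c x = c y"
 hence "codes x (e x) = codes y (e y)" "e x x = e y y"
  using vset_inject[OF small_subset[OF F2 cF] small_subset[OF F2 cF]] unfolding c_def by auto
 thus "x = y" using codes_inject[of "e x" x "e y" y] e[OF xy(1)] e[OF xy(2)] by simp
 qed
 moreover have "c ` Hset \<theta> =< (%(x, y). vpair x y) ` (?F \<times> (vset ` Pow F2))"
 proof (rule image_subsetI)
 fix x assume x: "x:Hset \<theta>"
 have "e x x:?F" using e[OF x] by blast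
 thus "c x:(%(x, y). vpair x y) ` (?F \<times> (vset ` Pow F2))"
  using cF[OF x] unfolding c_def by (intro image_eqI[of _ _ "(e x x, vset (codes x (e x)))"]) auto
 qed
 hence "small (c ` Hset \<theta>)" by (rule small_subset[OF small_image2[OF F small_Pow[OF F2]]])
 ultimately show ?thesis using small_image[of "c ` Hset \<theta>" "inv_into (Hset \<theta>) c"] by simp
qed

lemma ex_Hset:
 fixes X :: "'v::zfc"
 obtains \<theta> :: "'v rel" where "vcardinal \<theta>" "regularCard \<theta>" "X:Hset \<theta>" "small (Hset \<theta>)"
proof -
 obtain f :: "nat => 'v" where f: "inj f" using ex_inj_nat by blast
 \<comment> \<open>A copy of the natural numbers is added to make the set infinite, so that its
   successor cardinal is regular.\<close>
 let ?A = "trcl X Un range f"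
 have "small ?A" "infinite ?A" using small_Un[OF small_trcl small_nat] range_inj_infinite[OF f] by auto
 then obtain \<theta> :: "'v rel" where t: "vcardinal \<theta>" "\<theta> =o cardSuc |?A|" "Cinfinite \<theta>" "regularCard \<theta>" by (rule vcardinal_cardSuc)
 have "|trcl X| <=o |?A|" by (rule card_of_mono1) blast
 hence "|trcl X| <o cardSuc |?A|" using cardSuc_greater[OF card_of_Card_order] ordLeq_ordLess_trans by blast
 hence "X:Hset \<theta>" using ordLess_ordIso_trans[OF _ ordIso_symmetric[OF t(2)]] by (simp add: Hset_def)
 thus thesis using that t small_Hset by blast
qed

section \<open>Reflection\<close>

lemma lmod_span_submodule:
 assumes "lmod R M" "submodule Y R M" "B =< Y"
 shows "mod_span R (submodule_of M Y) B = mod_span R M B"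
proof -
 interpret lmod R M by (rule assms(1))
 interpret Y: lmod R "submodule_of M Y" by (rule lmod_submodule[OF assms(2)])
 have B: "B =< carrier M" using assms submoduleD(1) by blast
 have "span B =< Y" by (rule span_minimal[OF assms(2,3)])
 hence "submodule (span B) R (submodule_of M Y)" using submodule_of_iff[OF assms(2)] submodule_span[OF B] by blast
 hence "Y.span B =< span B" by (rule Y.span_minimal) (rule span_superset)
 moreover have "submodule (Y.span B) R M" using Y.submodule_span assms(3) submodule_of_iff[OF assms(2)] by simp
 hence "span B =< Y.span B" by (rule span_minimal) (rule Y.span_superset)
 ultimately show ?thesis by (simp add: span_def Y.span_def)
qed

lemma subfiltered_submodule_of:
 fixes M :: "('r, 'm) module" and C :: "('r, 'c) module set"
 assumes "lmod R M" "submodule Y R M" "subfiltered R C (submodule_of M Y) Z Z'"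
 shows "subfiltered R C M Z Z'"
proof -
 have sq: "sq R (submodule_of M Y) A B N <-> sq R M A B N" for A B and N :: "('r, 'c) module" by (simp add: sq_def)
 have sub: "submodule A R M" if "submodule A R (submodule_of M Y)" for A
 using that lmod.submodule_of_iff[OF assms(1,2)] by blast
 obtain FF where FF: "fchain R C (submodule_of M Y) Z Z' FF" using assms(3) unfolding subfiltered_def by (rule exE)
 have "fchain R C M Z Z' FF"
 using FF sub unfolding fchain_def sq by (elim conjE, intro conjI)
  (assumption | (rule ballI, drule (1) bspec, elim conjE, intro conjI, erule sub, assumption, assumption))+
 thus ?thesis unfolding subfiltered_def by (rule exI)
qed

lemma ctbl_sets_iff: "s:ctbl_sets X <-> elts s =< X & countable (elts s) & infinite (elts s)"
proof -
 have "|elts s| =o natLeq <-> countable (elts s) & infinite (elts s)"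
 proof
 assume "|elts s| =o natLeq"
 hence "|elts s| =o |UNIV :: nat set|" using ordIso_transitive[OF _ ordIso_symmetric[OF card_of_nat]] by blast
 then obtain f where f: "bij_betw f (elts s) (UNIV :: nat set)" using card_of_ordIso by blast
 thus "countable (elts s) & infinite (elts s)"
  using bij_betw_finite[OF f] countableI[of f] by (auto simp: bij_betw_def)
 next
 assume "countable (elts s) & infinite (elts s)"
 hence "bij_betw (to_nat_on (elts s)) (elts s) UNIV" by (simp add: to_nat_on_infinite)
 hence "|elts s| =o |UNIV :: nat set|" by (rule card_of_ordIsoI)
 thus "|elts s| =o natLeq" using card_of_nat ordIso_transitive by blast
 qed
 thus ?thesis by (simp add: ctbl_sets_def)
qed

context qh_class
begin

text \<open>A club that avoids the bad sets consists of good ones, and would witness goodness of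
  \<open>M\<close>.\<close>

lemma bad_stationary:
 fixes M :: "('r, 'v) module"
 assumes unc: "uncountable (carrier M)" and bad: "~ good_module R C M"
 shows "stationary (carrier M) {s:ctbl_sets (carrier M). ~ good_set R C M (elts s)}"
 unfolding stationary_def
proof (intro conjI allI impI notI)
 fix D assume D: "club (carrier M) D" "{s:ctbl_sets (carrier M). ~ good_set R C M (elts s)} Int D = {}"
 hence Dc: "D =< ctbl_sets (carrier M)" "ALL x:ctbl_sets (carrier M). EX y:D. elts x =< elts y"
 "!!s :: nat => 'v. (ALL n. s n:D & elts (s n) =< elts (s (Suc n)))==>EX y:D. elts y = (\<Union>n. elts (s n))"
 by (simp_all add: club_def)
 have "infinite (carrier M)" using unc countable_finite by blast
 \<comment> \<open>\<open>club\<close> is about countably infinite sets and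
   \<open>club_family\<close> about all countable ones; adding a fixed infinite set bridges the
   difference.\<close>
 then obtain I where I: "countable I" "infinite I" "I =< carrier M" using infinite_countable_subset' by blast
 have "club_family (carrier M) (elts ` D)"
 unfolding club_family_def
 proof (intro conjI allI impI ballI)
 show "countable x" "x =< carrier M" if "x:elts ` D" for x using that Dc(1) ctbl_sets_iff by auto
 fix x assume x: "countable x & x =< carrier M"
 have e: "elts (vset (x Un I)) = x Un I" using x I(1) by (intro elts_vset countable_small) simp
 hence "vset (x Un I):ctbl_sets (carrier M)" using x I unfolding ctbl_sets_iff by simp
 then obtain y where "y:D" "elts (vset (x Un I)) =< elts y" using Dc(2) by blast
 thus "EX y:elts ` D. x =< y" using e by blast
 next
 fix s :: "nat => 'v set" assume s: "ALL n. s n:elts ` D & s n =< s (Suc n)"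
 hence v: "elts (vset (s n)) = s n & vset (s n):D" for n by (metis imageE vset_elts)
 then obtain y where "y:D" "elts y = (\<Union>n. elts (vset (s n)))" using Dc(3)[of "%n. vset (s n)"] s by auto
 thus "\<Union>(range s):elts ` D" using v by (metis (no_types, lifting) SUP_cong imageI)
 qed
 moreover have "good_set R C M x" if "x:elts ` D" for x using that D(2) Dc(1) by blast
 ultimately show False using bad unfolding good_module_def by blast
qed blast

text \<open>Sets above an infinite set are infinite, so discarding the finite members preserves
  unboundedness and closure.\<close>

lemma club_of_family:
 fixes X :: "'v set"
 assumes DD: "club_family X DD"
 shows "club X {s:ctbl_sets X. elts s:DD}"
 unfolding club_def
proof (intro conjI ballI allI impI)
 fix x assume x: "x:ctbl_sets X"
 hence "countable (elts x) & elts x =< X" by (simp add: ctbl_sets_iff)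
 moreover have "ALL x. countable x & x =< X --> (EX y:DD. x =< y)" using DD by (simp add: club_family_def)
 ultimately obtain y where y: "y:DD" "elts x =< y" by blast
 have yc: "countable y" "y =< X" using DD y(1) by (auto simp: club_family_def)
 hence "elts (vset y) = y" by (intro elts_vset countable_small)
 moreover have "infinite y" using x y(2) finite_subset unfolding ctbl_sets_iff by blast
 ultimately show "EX y:{s:ctbl_sets X. elts s:DD}. elts x =< elts y"
 using y yc by (intro bexI[of _ "vset y"]) (auto simp: ctbl_sets_iff)
next
 fix s :: "nat => 'v" assume s: "ALL n. s n:{s:ctbl_sets X. elts s:DD} & elts (s n) =< elts (s (Suc n))"
 let ?u = "\<Union>n. elts (s n)"
 have u: "?u:DD" using DD s unfolding club_family_def by simp
 have uc: "countable ?u" "?u =< X" using DD u by (auto simp: club_family_def)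
 have e: "elts (vset ?u) = ?u" by (rule elts_vset[OF countable_small[OF uc(1)]])
 have "infinite ?u" using s finite_subset[of "elts (s 0)" ?u] unfolding ctbl_sets_iff by blast
 thus "EX y:{s:ctbl_sets X. elts s:DD}. elts y = ?u"
 using u uc e by (intro bexI[of _ "vset ?u"]) (auto simp: ctbl_sets_iff)
qed blast

text \<open>The submodule is the intersection of \<open>M\<close> with a structure reflecting the
  bad sets. Were it potentially filtered, it would be good, and some reflected bad set
  \<open>s\<close> would be good in it; but the witness of the badness of \<open>s\<close> in
  \<open>M\<close> has been made to lie in the submodule.\<close>

lemma reflection:
 fixes M :: "('r, 'v) module"
 assumes RP: "RP_internal TYPE('v)" and cR: "|carrier R| <=o aleph1" and cp: "!!N. N:C==>countably_presented R N"
 and M: "vmodule R M" and unc: "uncountable (carrier M)" and bad: "~ good_module R C M"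
 obtains Y where "submodule Y R M" "|Y| <=o aleph1" "~ potentially_filtered R C (submodule_of M Y)"
proof -
 interpret lmod R M using M by (simp add: vmodule_def lmod_def)
 define X where "X = vset (carrier M)"
 have X: "elts X = carrier M" using M unfolding X_def vmodule_def by (intro elts_vset) simp
 define S where "S = {s:ctbl_sets (elts X). ~ good_set R C M (elts s)}"
 have S: "stationary (elts X) S" using bad_stationary[OF unc bad] by (simp add: S_def X)
 have "EX y. countable y & elts s =< y & y =< carrier M &
  ~ (subfiltered R C M {0[M]} (span y) & subfiltered R C M (span (elts s)) (span y))" if "s:S" for s
 using that unfolding S_def good_set_def span_def by blast
 \<comment> \<open>\<open>w s\<close> is a countable set above \<open>s\<close> at which
   \<open>s\<close> fails to be good.\<close>
 then obtain w where w: "!!s. s:S==>countable (w s) & elts s =< w s & w s =< carrier M &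
  ~ (subfiltered R C M {0[M]} (span (w s)) & subfiltered R C M (span (elts s)) (span (w s)))" by metis
 obtain \<theta> :: "'v rel" where \<theta>: "vcardinal \<theta>" "regularCard \<theta>" "X:Hset \<theta>" "small (Hset \<theta>)" by (rule ex_Hset)
 have XH: "carrier M =< Hset \<theta>"
 proof
 fix m assume "m:carrier M"
 hence "|trcl m| <=o |trcl X|" using trcl_mono X by (intro card_of_mono1) blast
 thus "m:Hset \<theta>" using \<theta>(3) ordLeq_ordLess_trans unfolding Hset_def by blast
 qed
 have "|carrier R| <=o |omega1 :: 'v set|" using ordLeq_transitive[OF cR aleph1_le_omega1] .
 then obtain f :: "'v => 'r" where f: "f ` omega1 = carrier R" using card_of_ordLeq2[of "carrier R" "omega1 :: 'v set"] R.zero_closed by blast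
 \<comment> \<open>The functions of the structure: 0, 1 and 2 are zero, addition and multiplication
   by the ring element \<open>f i\<close> with index \<open>i\<close> in \<open>omega1\<close>;
   number n + 3 maps a bad set \<open>s\<close> to the n-th element of \<open>w s\<close>.\<close>
 define val :: "nat => 'v list => 'v" where
 "val n xs = (if n = 0 then 0[M] else if n = 1 then xs ! 0 +[M] xs ! 1 else if n = 2 then f (xs ! 0) *[M] xs ! 1
  else from_nat_into (w (xs ! 0)) (n - 3))" for n xs
 define L :: "(nat, nat) lang" where
 "L = \<lparr>funs = UNIV, farity = (%n. if n = 0 then 0 else if n <= 2 then 2 else 1), rels = {0, 1, 2}, rarity = (%n. if n = 0 then 2 else 1)\<rparr>"
 \<comment> \<open>Values outside \<open>Hset \<theta>\<close> are replaced by \<open>X\<close>, an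
   element of it, only to make the functions total.\<close>
 define A :: "(nat, nat, 'v) fo_struct" where
 "A = \<lparr>univ = Hset \<theta>,
  fn = (%n xs. if length xs = farity L n & set xs =< Hset \<theta> then if val n xs:Hset \<theta> then val n xs else X else undefined),
  rl = (%p xs. p:rels L & length xs = rarity L p & set xs =< Hset \<theta> &
   (if p = 0 then xs ! 0:elts (xs ! 1) else if p = 1 then xs ! 0:elts X else xs ! 0:S))\<rparr>"
 have "is_struct L A" using \<theta>(3,4) by (auto simp: is_struct_def A_def L_def)
 hence "expands_H L A \<theta> X S"
 unfolding expands_H_def
 by (intro conjI bexI[of _ 0] bexI[of _ 1] bexI[of _ 2]) (auto simp: A_def L_def)
 moreover have "uncountable (elts X)" using unc X by simp
 ultimately obtain N where N: "elementary_substructure L N A" "|univ N| =o aleph1" "omega1 =< univ N"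
 "stationary (univ N Int elts X) (S Int univ N Int ctbl_sets (univ N Int elts X))"
 using RP S \<theta> unfolding RP_internal_def by blast
 have sub: "substructure L N A" using N(1) by (simp add: elementary_substructure_def)
 have NH: "univ N =< Hset \<theta>" using sub by (simp add: substructure_def A_def)
 have val: "val n xs:univ N" if "length xs = farity L n" "set xs =< univ N" "val n xs:carrier M" for n xs
 proof -
 have "fn N n xs = fn A n xs" "fn N n xs:univ N" using sub that by (auto simp: substructure_def is_struct_def L_def)
 moreover have "set xs =< Hset \<theta>" "val n xs:Hset \<theta>" using that NH XH by blast+
 ultimately show ?thesis using that(1) by (simp add: A_def)
 qed
 define Y where "Y = univ N Int carrier M"
 have "0[M]:univ N" using val[of "[]" 0] by (simp add: val_def L_def)
 moreover have "x +[M] y:univ N" if "x:Y" "y:Y" for x y using val[of "[x, y]" 1] that by (simp add: val_def L_def Y_def)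
 moreover have "r *[M] x:univ N" if r: "r:carrier R" and x: "x:Y" for r x
 proof -
 obtain i where i: "i:omega1" "r = f i" using r f by blast
 thus ?thesis using val[of "[i, x]" 2] N(3) x r smult_closed by (auto simp: val_def L_def Y_def)
 qed
 ultimately have Y: "submodule Y R M" unfolding submodule_iff by (auto simp: Y_def smult_closed)
 have "|Y| <=o aleph1" using ordLeq_ordIso_trans[OF card_of_mono1 N(2)] by (simp add: Y_def)
 moreover have "~ potentially_filtered R C (submodule_of M Y)"
 proof
 assume pf: "potentially_filtered R C (submodule_of M Y)"
 have "vmodule R (submodule_of M Y)"
  using lmod_submodule[OF Y] small_subset[of "carrier M" Y] M by (auto simp: vmodule_def lmod_def Y_def)
 hence "good_module R C (submodule_of M Y)" using potentially_filtered_good[OF _ _ qh pf] vmod cp by blast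
 then obtain DD where DD: "club_family Y DD" "!!x. x:DD==>good_set R C (submodule_of M Y) x"
  unfolding good_module_def by auto
 have "club (univ N Int elts X) {s:ctbl_sets Y. elts s:DD}" using club_of_family[OF DD(1)] by (simp add: Y_def X)
 then obtain s where s: "s:S" "s:univ N" "s:ctbl_sets Y" "elts s:DD" using N(4) unfolding stationary_def by blast
 have sY: "elts s =< Y" "infinite (elts s)" using s(3) by (auto simp: ctbl_sets_iff)
 have ws: "w s ~= {}" using w[OF s(1)] sY(2) by (metis finite.emptyI subset_empty)
 \<comment> \<open>As \<open>s\<close> itself is an element of the structure, so are all the values
   enumerating \<open>w s\<close>. This is why the internal form of reflection is wanted, in which
   the reflected sets belong to the structure.\<close>
 have "w s =< univ N"
 proof
  fix m assume m: "m:w s"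
  then obtain n where "m = from_nat_into (w s) n" using w[OF s(1)] from_nat_into_surj by metis
  thus "m:univ N" using val[of "[s]" "n + 3"] s(2) m w[OF s(1)] by (auto simp: val_def L_def)
 qed
 hence wY: "w s =< Y" using w[OF s(1)] by (auto simp: Y_def)
 hence "subfiltered R C (submodule_of M Y) {0[M]} (span (w s)) & subfiltered R C (submodule_of M Y) (span (elts s)) (span (w s))"
  using DD(2)[OF s(4), unfolded good_set_def, rule_format, of "w s"] w[OF s(1)] lmod_span_submodule[OF lmod_axioms Y wY] lmod_span_submodule[OF lmod_axioms Y sY(1)]
  by (simp add: span_def)
 thus False using w[OF s(1)] subfiltered_submodule_of[OF lmod_axioms Y, of C] by blast
 qed
 ultimately show thesis using that Y by blast
qed

end

section \<open>The downward Loewenheim--Skolem property\<close>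

lemma card_UN_le:
 assumes "Cinfinite r" "|I| <=o r" "!!i. i:I==>|B i| <=o r"
 shows "|\<Union>i\<in>I. B i| <=o r"
 by (rule card_of_UNION_ordLeq_infinite_Field) (use assms in \<open>auto simp: cinfinite_def\<close>)

lemma card_lists_le:
 assumes r: "Cinfinite r" and B: "|B| <=o r"
 shows "|lists B| <=o r"
proof -
 have rF: "~ finite (Field r)" "Card_order r" using r by (auto simp: cinfinite_def)
 have nat: "|UNIV :: nat set| <=o r" by (rule ordIso_ordLeq_trans[OF card_of_nat natLeq_ordLeq_cinfinite[OF r]])
 have "|{xs:lists B. length xs = n}| <=o r" for n
 proof (induction n)
 case 0
 have "{xs:lists B. length xs = 0} = {[]}" by auto
 moreover have "|{[]}| <=o |UNIV :: nat set|" by (rule card_of_singl_ordLeq) simp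
 ultimately show ?case using ordLeq_transitive[OF _ nat] by simp
 next
 case (Suc n)
 have sub: "{xs:lists B. length xs = Suc n} =< (%(x, xs). x # xs) ` (B \<times> {xs:lists B. length xs = n})"
  by (auto simp: length_Suc_conv image_iff)
 have "|B \<times> {xs:lists B. length xs = n}| <=o r"
  by (rule card_of_Times_ordLeq_infinite_Field[OF rF(1) B Suc rF(2)])
 thus ?case by (rule ordLeq_transitive[OF ordLeq_transitive[OF card_of_mono1[OF sub] card_of_image]])
 qed
 hence "|\<Union>n. {xs:lists B. length xs = n}| <=o r" by (rule card_UN_le[OF r nat])
 moreover have "(\<Union>n. {xs:lists B. length xs = n}) = lists B" by auto
 ultimately show ?thesis by simp
qed

lemma card_cl:
 assumes r: "Cinfinite r" and A: "|A| <=o r"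
 shows "|cl \<phi> A| <=o r"
proof -
 have rF: "~ finite (Field r)" "Card_order r" using r by (auto simp: cinfinite_def)
 have nat: "|UNIV :: nat set| <=o r" by (rule ordIso_ordLeq_trans[OF card_of_nat natLeq_ordLeq_cinfinite[OF r]])
 define E where "E k = ((%B. B Un (\<Union>n. \<phi> n ` lists B)) ^^ k) A" for k
 have E: "|E k| <=o r" for k
 proof (induction k)
 case (Suc k)
 have "|\<Union>n. \<phi> n ` lists (E k)| <=o r"
  by (rule card_UN_le[OF r nat ordLeq_transitive[OF card_of_image card_lists_le[OF r Suc]]])
 thus ?case using card_of_Un_ordLeq_infinite_Field[OF rF(1) Suc _ rF(2)] by (simp add: E_def)
 qed (simp add: E_def A)
 have mono: "E k =< E l" if "k <= l" for k l by (rule lift_Suc_mono_le[of E, OF _ that]) (auto simp: E_def)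
 have "cl \<phi> A =< (\<Union>k. E k)"
 proof (rule cl_minimal)
 show "A =< (\<Union>k. E k)" using UN_upper[of 0 UNIV E] by (simp add: E_def)
 fix n xs assume xs: "xs:lists (\<Union>k. E k)"
 have "EX k. xs:lists (E k)" using xs
 proof (induction xs)
  case (Cons x xs)
  then obtain k l where "x:E k" "xs:lists (E l)" by auto
  hence "x # xs:lists (E (max k l))" using mono[of k "max k l"] mono[of l "max k l"] by auto
  thus ?case by blast
 qed auto
 then obtain k where "xs:lists (E k)" by blast
 hence "\<phi> n xs:E (Suc k)" by (auto simp: E_def)
 thus "\<phi> n xs:(\<Union>k. E k)" by blast
 qed
 thus ?thesis by (rule ordLeq_transitive[OF card_of_mono1 card_UN_le[OF r nat E]])
qed

text \<open>Closes \<open>G\<close> under the module operations and under chosen solutions of all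
  solvable finite systems. The number of operations is countable, since the coefficients are
  arguments; ring elements therefore take part in the closure.\<close>

lemma pure_closure:
 fixes B :: "('r mod_sym, unit, 'v::zfc) fo_struct" and r :: "'z rel"
 assumes B: "B:mod_structs R" and G: "G =< univ B" and r: "Cinfinite r" "|G| <=o r" "|carrier R| <=o r"
 obtains A' where "A':mod_structs R" "G =< univ A'" "pure_sub R A' B" "|univ A'| <=o r"
proof -
 note b = mod_structsD[OF B]
 interpret lmod R "module_of B" by (rule b(1))
 let ?M = "module_of B"
 note ops = submodule_iff
 have rF: "~ finite (Field r)" "Card_order r" using r by (auto simp: cinfinite_def)
 define sol where "sol m n a b' = (SOME x. (ALL j<n. x j:univ B) & solves ?M a x b' m n)"
 for m n :: nat and a :: "nat => nat => 'r" and b' :: "nat => 'v"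
 \<comment> \<open>For a system with \<open>m\<close> equations and \<open>n\<close> unknowns the
   list holds the coefficients row by row and then the right-hand sides; \<open>k - 3\<close> codes
   \<open>m\<close>, \<open>n\<close> and the index \<open>j\<close> of the unknown to be
   returned.\<close>
 define v :: "nat => ('v + 'r) list => 'v" where "v k xs =
  (if k = 0 then 0[?M] else if k = 1 then projl (xs ! 0) +[?M] projl (xs ! 1)
  else if k = 2 then projr (xs ! 0) *[?M] projl (xs ! 1)
  else case prod_decode (k - 3) of (m, k') => case prod_decode k' of (n, j) =>
  sol m n (%i j. projr (xs ! (i * n + j))) (%i. projl (xs ! (m * n + i))) j)" for k xs
 define \<phi> :: "nat => ('v + 'r) list => 'v + 'r" where "\<phi> k xs = Inl (if v k xs:univ B then v k xs else 0[?M])" for k xs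
 define H where "H = cl \<phi> (Inl ` G Un Inr ` carrier R)"
 have H0: "Inl ` G =< H" "Inr ` carrier R =< H" unfolding H_def by (auto intro: cl.base)
 have Hs: "\<phi> k xs:H" if "set xs =< H" for k xs unfolding H_def by (rule cl.step) (use that in \<open>auto simp: H_def\<close>)
 define U where "U = {x. Inl x:H}"
 have z: "0[?M]:univ B" using M.zero_closed b(4) by simp
 have "H =< Inl ` univ B Un Inr ` carrier R" unfolding H_def by (rule cl_minimal) (use G z in \<open>auto simp: \<phi>_def\<close>)
 hence UB: "U =< univ B" unfolding U_def by auto
 have vU: "v k xs:U" if "set xs =< H" "v k xs:univ B" for k xs using Hs[OF that(1), of k] that(2) by (simp add: U_def \<phi>_def)
 have "|H| <=o r"
 unfolding H_def
 by (intro card_cl r card_of_Un_ordLeq_infinite_Field rF ordLeq_transitive[OF card_of_image r(2)] ordLeq_transitive[OF card_of_image r(3)])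
 moreover have "U =< projl ` H" unfolding U_def by (force simp: image_iff)
 ultimately have cU: "|U| <=o r" using ordLeq_transitive[OF ordLeq_transitive[OF card_of_mono1 card_of_image]] by blast
 have zU: "0[?M]:U" using vU[of "[]" 0] z by (simp add: v_def)
 have aU: "x +[?M] y:U" if "x:U" "y:U" for x y
 using vU[of "[Inl x, Inl y]" 1] that UB M.a_closed[of x y] b(4) by (auto simp: v_def U_def)
 have sU: "s *[?M] x:U" if "s:carrier R" "x:U" for s x
 using vU[of "[Inr s, Inl x]" 2] that UB H0(2) smult_closed[of s x] b(4) by (auto simp: v_def U_def)
 have U: "submodule U R ?M" unfolding submodule_iff using UB b(4) zU aU sU by simp
 define A' :: "('r mod_sym, unit, 'v) fo_struct" where "A' = \<lparr>univ = U, fn = (%f xs. if f:funs (mod_lang R) & length xs = farity (mod_lang R) f & set xs =< U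
  then fn B f xs else undefined), rl = (%_ _. False)\<rparr>"
 have uA: "univ A' = U" by (simp add: A'_def)
 have ops: "fn A' Zero [] = fn B Zero []" "x:U==>y:U==>fn A' Plus [x, y] = fn B Plus [x, y]"
 "s:carrier R==>x:U==>fn A' (Scal s) [x] = fn B (Scal s) [x]" for x y s
 by (auto simp: A'_def mod_lang_def)
 have clB: "fn B Zero []:U" "x:U==>y:U==>fn B Plus [x, y]:U"
 "s:carrier R==>x:U==>fn B (Scal s) [x]:U" for x y s
 using zU aU sU by (simp_all add: module_of_def)
 have und: "ALL f xs. ~ (f:funs (mod_lang R) & length xs = farity (mod_lang R) f & set xs =< U) --> fn A' f xs = undefined"
 "ALL p xs. ~ rl A' p xs"
 by (auto simp: A'_def)
 have st: "is_struct (mod_lang R) A'"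
 unfolding is_struct_mod_iff uA using small_subset[OF b(2) UB] ops clB und by (intro conjI) simp_all
 have sub: "substructure (mod_lang R) A' B" unfolding substructure_mod_iff uA using st b(3) UB ops by auto
 have "mod_hom R (submodule_of ?M U) (module_of A') (%x. x)"
 unfolding mod_hom_submodule_of using ops uA by (simp add: module_of_def)
 hence "lmod R (module_of A')"
 by (rule lmod_surj_image[OF lmod_axioms U]) (simp_all add: module_of_def uA ops)
 hence A': "A':mod_structs R" using st by (simp add: mod_structs_def lmod_def)
 have "pure_sub R A' B"
 proof (rule pure_subI[OF B A' sub])
 fix m n :: nat and a :: "nat => nat => 'r" and b' x
 assume a: "ALL i<m. ALL j<n. a i j:carrier R" and b': "ALL i<m. b' i:univ A'" and x: "ALL j<n. x j:univ B"
  and S: "solves ?M a x b' m n"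
 define xs where "xs = map (%k. Inr (a (k div n) (k mod n))) [0..<m * n] @ map (%i. Inl (b' i)) [0..<m]"
 have xa: "xs ! (i * n + j) = Inr (a i j)" if "i < m" "j < n" for i j
 proof -
  have "i * n + j < Suc i * n" using that by simp
  also have "\<dots> <= m * n" using that by (intro mult_le_mono1) simp
  finally show ?thesis using that by (simp add: xs_def nth_append)
 qed
 have xb: "xs ! (m * n + i) = Inl (b' i)" if "i < m" for i using that by (simp add: xs_def nth_append)
 have dm: "k div n < m & k mod n < n" if "k < m * n" for k using that by (auto simp: less_mult_imp_div_less intro!: mod_less_divisor gr0I)
 have xsH: "set xs =< H" using dm a b' H0(2) uA by (auto simp: xs_def U_def)
 \<comment> \<open>Beyond the ranges of \<open>m\<close> and \<open>n\<close> the decoded values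
   need not agree with \<open>a\<close> and \<open>b'\<close>, and the choice \<open>sol\<close>
   depends on the whole functions. Hence the decoded system is solved and afterwards compared with
   the given one.\<close>
 define a2 b2 where "a2 i j = projr (xs ! (i * n + j))" and "b2 i = projl (xs ! (m * n + i))" for i j
 have ab: "a2 i j = a i j" "b2 i = b' i" if "i < m" "j < n" for i j using xa xb that by (auto simp: a2_def b2_def)
 have eq: "solves ?M a2 y b2 m n <-> solves ?M a y b' m n" if "ALL j<n. y j:univ B" for y
 proof -
  have "finsum ?M (%j. a2 i j *[?M] y j) {..<n} = finsum ?M (%j. a i j *[?M] y j) {..<n}" if i: "i < m" for i
  by (rule M.finsum_cong') (use ab i a \<open>ALL j<n. y j:univ B\<close> smult_closed b(4) in auto)
  thus ?thesis using xb by (simp add: solves_def b2_def)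
 qed
 have "EX y. (ALL j<n. y j:univ B) & solves ?M a2 y b2 m n" using x S eq by blast
 hence sol: "(ALL j<n. sol m n a2 b2 j:univ B) & solves ?M a2 (sol m n a2 b2) b2 m n"
  unfolding sol_def by (rule someI_ex)
 have "sol m n a2 b2 j:U" if "j < n" for j
  using vU[OF xsH, of "prod_encode (m, prod_encode (n, j)) + 3"] sol that by (simp add: v_def a2_def[abs_def] b2_def[abs_def])
 thus "EX x. (ALL j<n. x j:univ A') & solves ?M a x b' m n" using sol eq uA by blast
 qed
 moreover have "G =< univ A'" using H0(1) uA by (auto simp: U_def)
 ultimately show thesis using that A' cU uA by simp
qed

text \<open>A submodule \<open>Y\<close> of size at most aleph_1 that is not potentially filtered is
  put into the pure closure of \<open>A Un Y\<close>. Since \<open>Y\<close> is a submodule of the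
  result, the result is not potentially filtered either. For a countable module \<open>Y\<close> is
  the whole module, otherwise it comes from reflection.\<close>

theorem (in qh_class) LS_property_not_potentially_filtered:
 fixes \<kappa> :: "'v rel"
 assumes RP: "RP_internal TYPE('v)" and cR: "|carrier R| <=o aleph1" and cp: "!!N. N:C==>countably_presented R N"
 and \<kappa>: "\<kappa> =o aleph1" "Cinfinite \<kappa>"
 shows "LS_property {M:mod_structs R. ~ potentially_filtered R C (module_of M)} (pure_sub R) \<kappa>"
 unfolding LS_property_def
proof (intro ballI allI impI)
 fix B A assume B0: "B:{M:mod_structs R. ~ potentially_filtered R C (module_of M)}" and A: "A =< univ B"
 hence B: "B:mod_structs R" and nB: "~ potentially_filtered R C (module_of B)" by auto
 note b = mod_structsD[OF B]
 interpret lmod R "module_of B" by (rule b(1))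
 let ?M = "module_of B"
 have sB: "submodule_of ?M (carrier ?M) = ?M" by (simp add: module_of_def)
 have vm: "vmodule R ?M" using b by (simp add: vmodule_def lmod_def)
 obtain Y where Y: "submodule Y R ?M" "|Y| <=o aleph1" "~ potentially_filtered R C (submodule_of ?M Y)"
 proof (cases "countable (carrier ?M)")
 case True
 hence "|carrier ?M| <=o natLeq" by (simp add: countable_card_le_natLeq)
 hence "|carrier ?M| <=o aleph1" by (rule ordLeq_transitive[OF _ cardSuc_ordLeq[OF natLeq_Card_order]])
 thus thesis using that[OF submodule_carrier] nB sB by simp
 next
 case False
 have "~ good_module R C ?M"
 proof
  assume g: "good_module R C ?M"
  have "lmod_hom R ?M ?M (carrier ?M) (%x. x)"
  by (intro lmod_hom.intro lmod_hom_axioms.intro lmod_axioms submodule_carrier) (simp add: mod_hom_def)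
  thus False using good_module_potentially_filtered[OF _ _ _ _ g] nB b by (simp add: inj_on_def)
 qed
 thus thesis using reflection[OF RP cR cp vm False] that by blast
 qed
 have c: "Cinfinite ( |A| +c \<kappa>)" using \<kappa>(2) by (simp add: Cinfinite_csum1 Cinfinite_csum)
 have le: "|Z| <=o |A| +c \<kappa>" if "|Z| <=o aleph1" for Z :: "'z set"
 using ordLeq_transitive[OF ordLeq_ordIso_trans[OF that ordIso_symmetric[OF \<kappa>(1)]] ordLeq_csum2] \<kappa>(2) by blast
 have "|A Un Y| <=o |A| +c \<kappa>"
 using c by (intro card_of_Un_ordLeq_infinite_Field ordLeq_csum1 card_of_Card_order le[OF Y(2)]) (auto simp: cinfinite_def)
 moreover have "A Un Y =< univ B" using A submoduleD(1)[OF Y(1)] b(4) by blast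
 ultimately obtain A' where A': "A':mod_structs R" "A Un Y =< univ A'" "pure_sub R A' B" "|univ A'| <=o |A| +c \<kappa>"
 using pure_closure[OF B _ c _ le[OF cR]] by blast
 have sub: "substructure (mod_lang R) A' B" using A'(3) by (simp add: pure_sub_def)
 note s = substructure_submodule[OF A'(1) B sub]
 note a' = mod_structsD[OF A'(1)]
 have same: "x +[module_of A'] y = x +[?M] y" "r:carrier R==>r *[module_of A'] x = r *[?M] x"
 "0[module_of A'] = 0[?M]" if "x:Y" "y:Y" for x y r
 proof -
 have "x:univ A'" "y:univ A'" using that A'(2) by auto
 thus "x +[module_of A'] y = x +[?M] y" "r:carrier R==>r *[module_of A'] x = r *[?M] x"
  "0[module_of A'] = 0[?M]"
  using sub by (simp_all add: substructure_mod_iff module_of_def)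
 qed
 have YA: "submodule Y R (module_of A')"
 unfolding lmod.submodule_iff[OF a'(1)] a'(4)
 proof (intro conjI ballI)
 note z = submoduleD(2)[OF Y(1)]
 show "0[module_of A']:Y" using same(3)[OF z z] z by simp
 fix x assume x: "x:Y"
 show "x +[module_of A'] y:Y" if "y:Y" for y using same(1)[OF x that] submoduleD(3)[OF Y(1) x that] by simp
 show "r *[module_of A'] x:Y" if "r:carrier R" for r using same(2)[OF x x that] submoduleD(4)[OF Y(1) that x] by simp
 qed (use A'(2) in auto)
 have "lmod_hom R (module_of A') (submodule_of ?M Y) Y (%x. x)"
 by (intro lmod_hom.intro lmod_hom_axioms.intro a'(1) lmod_submodule Y(1) YA) (use same in \<open>simp add: mod_hom_submodule_of\<close>)
 hence "~ potentially_filtered R C (module_of A')"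
 using potentially_filtered_embed[OF cp, of "module_of A'" "submodule_of ?M Y" Y "%x. x"] Y(3) a'(2,4) by (auto simp: inj_on_def)
 thus "EX A':{M:mod_structs R. ~ potentially_filtered R C (module_of M)}. A =< univ A' & pure_sub R A' B & |univ A'| <=o |A| +c \<kappa>"
 using A' by blast
qed

theorem (in qh_class) AEC_and_LS_number:
 assumes RP: "RP_internal TYPE('v)" and cR: "|carrier R| <=o aleph1" and cp: "!!N. N:C==>countably_presented R N"
 shows "let K = {M:mod_structs R. ~ potentially_filtered R C (module_of M)} in
 AEC (mod_lang R) K (pure_sub R) & (EX \<kappa>. LS_number K (pure_sub R) \<kappa> & \<kappa> <=o aleph1)"
proof -
 define K where "K = {M:mod_structs R. ~ potentially_filtered R C (module_of M)}"
 obtain \<kappa> :: "'v rel" where \<kappa>: "vcardinal \<kappa>" "\<kappa> =o aleph1" "Cinfinite \<kappa>" by (rule aleph1_copy)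
 have LS: "LS_property K (pure_sub R) \<kappa>" unfolding K_def by (rule LS_property_not_potentially_filtered[OF RP cR cp \<kappa>(2,3)])
 have "AEC (mod_lang R) K (pure_sub R)"
 unfolding K_def by (rule AEC_not_potentially_filtered[OF _ \<kappa>(1) LS[unfolded K_def]]) (rule potentially_filtered_embed[OF cp])
 moreover have "EX \<mu>. LS_number K (pure_sub R) \<mu> & \<mu> <=o aleph1"
 proof -
 let ?S = "{\<mu> :: 'v rel. vcardinal \<mu> & LS_property K (pure_sub R) \<mu>}"
 \<comment> \<open>The least cardinal with the property exists because cardinals are well-ordered;
   the copy of \<open>aleph1\<close> bounds it.\<close>
 obtain \<mu> where m: "\<mu>:?S" "ALL \<nu>:?S. \<mu> <=o \<nu>"
 proof -
  have "?S ~= {}" "ALL r:?S. Card_order r" using \<kappa>(1) LS by (auto simp: vcardinal_def)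
  from exists_minim_Card_order[OF this] show thesis using that by blast
 qed
 hence "\<mu> <=o \<kappa>" using \<kappa>(1) LS by blast
 thus ?thesis using m ordLeq_ordIso_trans[OF _ \<kappa>(2)] unfolding LS_number_def by blast
 qed
 ultimately show ?thesis by (simp add: K_def Let_def)
qed

section \<open>Abelian groups\<close>

lemma ring_int: "ring \<Z>"
 using int_is_cring cring.axioms(1) by blast

lemma carrier_int [simp]: "carrier \<Z> = UNIV" "x +[\<Z>] y = x + y" "x \<otimes>\<^bsub>\<Z>\<^esub> y = x * y" "0[\<Z>] = 0" "\<one>\<^bsub>\<Z>\<^esub> = 1"
 by simp_all

lemma regular_int: "lmod \<Z> (regular_module \<Z>)"
proof -
 have "abelian_group (regular_module \<Z>)"
 by (rule abelian_groupI) (auto simp: regular_module_def intro: exI[of _ "- x" for x])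
 thus ?thesis using ring_int by (simp add: lmod_def lmodule_def lmodule_axioms_def regular_module_def algebra_simps)
qed

text \<open>A copy of the integers in the universe is produced by transport along an injection of
  the natural numbers.\<close>

lemma ex_int_class: "EX N. N:(int_class :: (int, 'v::zfc) module set)"
proof -
 obtain f :: "nat => 'v" where f: "inj f" using ex_inj_nat by blast
 define e where "e i = f (int_encode i)" for i
 have e: "inj e" unfolding e_def by (rule injI) (use f in \<open>simp add: inj_eq int_encode_eq\<close>)
 hence d: "inv_into UNIV e (e i) = i" for i by simp
 define N :: "(int, 'v) module" where "N = \<lparr>carrier = range e, mult = undefined, one = undefined, zero = e 0,
 add = (%x y. e (inv_into UNIV e x + inv_into UNIV e y)), smult = (%r x. e (r * inv_into UNIV e x))\<rparr>"
 have h: "mod_hom \<Z> (regular_module \<Z>) N e" by (auto simp: mod_hom_def regular_module_def N_def d)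
 have "lmod \<Z> N"
 by (rule lmod_surj_image[OF regular_int lmod.submodule_carrier[OF regular_int], of _ e])
  (use h in \<open>auto simp: N_def regular_module_def\<close>)
 moreover have "small (carrier N)" using countable_small[of "range e"] by (simp add: N_def)
 moreover have "mod_iso \<Z> (regular_module \<Z>) N"
 unfolding mod_iso_def using h e by (intro exI[of _ e]) (auto simp: bij_betw_def regular_module_def N_def inj_on_def)
 ultimately show ?thesis unfolding int_class_def vmodule_def lmod_def by blast
qed

text \<open>Homomorphisms into \<open>int\<close> itself replace those into the copies of the
  integers in the universe; values in different copies could not be compared arithmetically.\<close>

definition zhom :: "(int, 'm) module => 'm set => ('m => int) => bool" where
 "zhom M B \<phi> <-> (ALL x:B. ALL y:B. \<phi> (x +[M] y) = \<phi> x + \<phi> y) & (ALL r. ALL x:B. \<phi> (r *[M] x) = r * \<phi> x)"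

lemma zhom_subset: "zhom M B \<phi>==>A =< B==>zhom M A \<phi>"
 unfolding zhom_def by blast

lemma sq_zhom:
 assumes N: "N:int_class" and s: "sq \<Z> M A B N"
 shows "EX \<phi>. zhom M B \<phi> & \<phi> ` B = UNIV & {x:B. \<phi> x = 0} = A"
proof -
 obtain e where e: "mod_hom \<Z> (regular_module \<Z>) N e" "bij_betw e UNIV (carrier N)" and lN: "lmod \<Z> N"
 using N by (auto simp: int_class_def mod_iso_def regular_module_def vmodule_def lmod_def)
 obtain h where h: "mod_hom \<Z> (submodule_of M B) N h" "h ` B = carrier N" "{x:B. h x = 0[N]} = A" using s by (auto simp: sq_def)
 interpret e: lmod_hom \<Z> "regular_module \<Z>" N UNIV e
 using regular_int lN e(1) lmod.submodule_carrier[OF regular_int]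
 by (intro lmod_hom.intro lmod_hom_axioms.intro) (auto simp: regular_module_def mod_hom_def)
 define g where "g = inv_into UNIV e"
 have ge: "g (e i) = i" for i using e(2) by (simp add: g_def bij_betw_def)
 have eg: "e (g x) = x" if "x:carrier N" for x using e(2) that by (auto simp: g_def bij_betw_def f_inv_into_f)
 have e_add: "e (i + j) = e i +[N] e j" and e_sm: "e (r * j) = r *[N] e j" and e0: "e 0 = 0[N]" for i j r
 using e.hom_add[of i j] e.hom_smult[of r j] e.hom_zero by (simp_all add: regular_module_def)
 have hc: "h x:carrier N" if "x:B" for x using h(2) that by blast
 have "zhom M B (%x. g (h x))"
 unfolding zhom_def
 proof (intro conjI ballI allI)
 fix x y r assume x: "x:B"
 show "g (h (r *[M] x)) = r * g (h x)"
  using h(1) x ge[of "r * g (h x)"] e_sm[of r "g (h x)"] eg[OF hc[OF x]] by (simp add: mod_hom_submodule_of)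
 show "g (h (x +[M] y)) = g (h x) + g (h y)" if y: "y:B"
  using h(1) x y ge[of "g (h x) + g (h y)"] e_add[of "g (h x)" "g (h y)"] eg[OF hc[OF x]] eg[OF hc[OF y]]
  by (simp add: mod_hom_submodule_of)
 qed
 moreover have "(%x. g (h x)) ` B = UNIV"
 proof -
 have "i:(%x. g (h x)) ` B" for i
 proof -
  have "e i:h ` B" using e(2) h(2) by (auto simp: bij_betw_def)
  then obtain x where "x:B" "e i = h x" by blast
  thus ?thesis using ge[of i] by (intro image_eqI[of _ _ x]) auto
 qed
 thus ?thesis by blast
 qed
 moreover have "g (h x) = 0 <-> h x = 0[N]" if "x:B" for x using eg[OF hc[OF that]] e0 ge[of 0] by auto
 hence "{x:B. g (h x) = 0} = A" using h(3) by blast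
 ultimately show ?thesis by blast
qed

text \<open>The image of a nonzero homomorphism to the integers consists of the multiples of its
  least positive element \<open>d\<close>; dividing by \<open>d\<close> makes the homomorphism
  surjective without changing its kernel.\<close>

lemma zhom_sq:
 assumes M: "lmod \<Z> M" and B: "submodule B \<Z> M" and \<phi>: "zhom M B \<phi>" "{x:B. \<phi> x = 0} = A" "A ~= B"
 shows "EX N:int_class :: (int, 'v::zfc) module set. sq \<Z> M A B N"
proof -
 interpret lmod \<Z> M by (rule M)
 note B' = submoduleD[OF B]
 have add: "\<phi> (x +[M] y) = \<phi> x + \<phi> y" and sm: "\<phi> (r *[M] x) = r * \<phi> x" if "x:B" "y:B" for x y r
 using \<phi>(1) that by (auto simp: zhom_def)
 have smB: "r *[M] x:B" if "x:B" for x r using B'(4)[of r x] that by simp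
 obtain b where b: "b:B" "\<phi> b ~= 0" using \<phi>(2,3) by blast
 define P where "P n <-> n > 0 & int n:\<phi> ` B" for n
 have "P (nat \<bar>\<phi> b\<bar>)"
 proof -
 have "\<bar>\<phi> b\<bar> = \<phi> (sgn (\<phi> b) *[M] b)" using sm[OF b(1) b(1)] by (simp add: abs_sgn mult.commute)
 thus ?thesis using b smB[OF b(1)] unfolding P_def by auto
 qed
 define d where "d = (LEAST n. P n)"
 have d: "P d" unfolding d_def by (rule LeastI) fact
 then obtain c where c: "c:B" "\<phi> c = int d" and d0: "d > 0" unfolding P_def by auto
 have dvd: "int d dvd \<phi> x" if x: "x:B" for x
 proof (rule ccontr)
 assume nd: "~ int d dvd \<phi> x"
 let ?r = "\<phi> x mod int d"
 have r: "0 < ?r" "?r < int d" 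
 proof -
  have "?r ~= 0" using nd mod_0_imp_dvd by blast
  thus "0 < ?r" "?r < int d" using d0 pos_mod_sign[of "int d" "\<phi> x"] pos_mod_bound[of "int d" "\<phi> x"] by linarith+
 qed
 have "\<phi> (x +[M] (- (\<phi> x div int d)) *[M] c) = ?r"
  using add[OF x smB[OF c(1)]] sm[OF c(1) c(1)] c(2) by (simp add: minus_div_mult_eq_mod)
 hence "int (nat ?r):\<phi> ` B" using B'(3)[OF x smB[OF c(1)]] r(1) by (metis image_eqI int_nat_eq less_le_not_le)
 hence "P (nat ?r)" using r by (simp add: P_def)
 hence "d <= nat ?r" unfolding d_def by (rule Least_le)
 thus False using r by simp
 qed
 obtain N :: "(int, 'v) module" where N: "N:int_class" using ex_int_class by blast
 obtain e where e: "mod_hom \<Z> (regular_module \<Z>) N e" "bij_betw e UNIV (carrier N)" and lN: "lmod \<Z> N"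
 using N by (auto simp: int_class_def mod_iso_def regular_module_def vmodule_def lmod_def)
 interpret e: lmod_hom \<Z> "regular_module \<Z>" N UNIV e
 using regular_int lN e(1) lmod.submodule_carrier[OF regular_int]
 by (intro lmod_hom.intro lmod_hom_axioms.intro) (auto simp: regular_module_def mod_hom_def)
 have e_add: "e (i + j) = e i +[N] e j" and e_sm: "e (r * j) = r *[N] e j" and e0: "e 0 = 0[N]" for i j r
 using e.hom_add[of i j] e.hom_smult[of r j] e.hom_zero by (simp_all add: regular_module_def)
 define h where "h x = e (\<phi> x div int d)" for x
 have "mod_hom \<Z> (submodule_of M B) N h"
 unfolding mod_hom_submodule_of
 proof (intro conjI ballI)
 fix x assume x: "x:B"
 show "h x:carrier N" using e(2) by (auto simp: h_def bij_betw_def)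
 show "h (r *[M] x) = r *[N] h x" for r
  using sm[OF x x] e_sm[of r "\<phi> x div int d"] div_mult_swap[OF dvd[OF x], of r] by (simp add: h_def)
 show "h (x +[M] y) = h x +[N] h y" if "y:B" for y
  using add[OF x that] e_add div_plus_div_distrib_dvd_left[OF dvd[OF x]] by (simp add: h_def)
 qed
 moreover have "h ` B = carrier N"
 proof -
 have "e i:h ` B" for i
 proof (rule image_eqI[of _ _ "i *[M] c"])
  show "e i = h (i *[M] c)" using sm[OF c(1) c(1)] c(2) d0 by (simp add: h_def)
 qed (rule smB[OF c(1)])
 hence "range e =< h ` B" by blast
 moreover have "h ` B =< range e" unfolding h_def by blast
 moreover have "range e = carrier N" using e(2) by (simp add: bij_betw_def)
 ultimately show ?thesis by simp
 qed
 moreover have "h x = 0[N] <-> \<phi> x = 0" if x: "x:B" for x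
 proof -
 have "h x = 0[N] <-> \<phi> x div int d = 0"
  using e(2) e0 unfolding h_def bij_betw_def by (metis injD)
 thus ?thesis using dvd[OF x] by (metis dvd_div_eq_0_iff)
 qed
 hence "{x:B. h x = 0[N]} = A" using \<phi>(2) by blast
 ultimately show ?thesis using N unfolding sq_def by blast
qed

text \<open>Free on one generator without relations, so the presentation has \<open>I = {0}\<close>
  and \<open>B = {}\<close>.\<close>

lemma int_class_presented:
 assumes "N:(int_class :: (int, 'v::zfc) module set)"
 shows "vmodule \<Z> N & countably_presented \<Z> N"
proof -
 obtain e where e: "mod_hom \<Z> (regular_module \<Z>) N e" "bij_betw e UNIV (carrier N)" and v: "vmodule \<Z> N"
 using assms by (auto simp: int_class_def mod_iso_def regular_module_def)
 have lN: "lmod \<Z> N" using v by (simp add: vmodule_def lmod_def)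
 interpret e: lmod_hom \<Z> "regular_module \<Z>" N UNIV e
 using regular_int lN e(1) lmod.submodule_carrier[OF regular_int]
 by (intro lmod_hom.intro lmod_hom_axioms.intro) (auto simp: regular_module_def mod_hom_def)
 have e_add: "e (i + j) = e i +[N] e j" and e_sm: "e (r * j) = r *[N] e j" and e0: "e 0 = 0[N]" for i j r
 using e.hom_add[of i j] e.hom_smult[of r j] e.hom_zero by (simp_all add: regular_module_def)
 let ?F = "free_module \<Z> {0 :: nat}" and ?h = "%c :: nat => int. e (c 0)"
 have F: "lmod \<Z> ?F" by (rule lmod_free_module[OF ring_int])
 have zF: "0[?F] = (%i. 0)" by (simp add: free_module_def)
 have hom: "mod_hom \<Z> ?F N ?h"
 using e(2) by (auto simp: mod_hom_def free_module_def e_add e_sm bij_betw_def)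
 have surj: "?h ` carrier ?F = carrier N"
 proof -
 have "e i:?h ` carrier ?F" for i
  by (rule image_eqI[of _ _ "%k. if k = 0 then i else 0"]) (auto simp: free_module_def)
 moreover have "range e = carrier N" using e(2) by (simp add: bij_betw_def)
 ultimately show ?thesis by (metis (no_types, lifting) image_subset_iff rangeI subset_antisym)
 qed
 have "?h c = 0[N] <-> c = (%i. 0)" if c: "c:carrier ?F" for c
 proof -
 have "?h c = 0[N] <-> c 0 = 0" using e(2) e0 by (metis bij_betw_def injD)
 moreover have "c i = 0" if "i ~= 0" for i using c that by (simp add: free_module_def)
 hence "c 0 = 0 <-> c = (%i. 0)" by (metis HOL.ext)
 ultimately show ?thesis by simp
 qed
 hence "{c:carrier ?F. ?h c = 0[N]} = {0[?F]}"
 using lmod.submoduleD(1,2)[OF F lmod.submodule_carrier[OF F]] zF by auto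
 also have "\<dots> = mod_span \<Z> ?F {}" using lmod.span_empty[OF F] by (simp add: lmod.span_def[OF F])
 finally have "countably_presented \<Z> N"
 unfolding countably_presented_def Let_def using hom surj by (intro exI[of _ "{0}"] exI[of _ ?h] exI[of _ "{}"]) auto
 thus ?thesis using v by simp
qed

text \<open>A factor of the traced chain embeds into a factor of the original one, that is, into the
  integers; a nonzero subgroup of the integers is again a copy of them.\<close>

lemma subfiltered_Int:
 fixes M :: "(int, 'm) module" and C :: "(int, 'v::zfc) module set"
 assumes M: "lmod \<Z> M" and f: "fchain \<Z> C M Z Z' FF" and C: "C = int_class" and U: "submodule U \<Z> M"
 shows "fchain \<Z> C M (U Int Z) (U Int Z') ((\<inter>) U ` FF)"
proof -
 interpret lmod \<Z> M by (rule M)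
 note f' = fchainD[OF f[unfolded C]]
 show ?thesis unfolding fchain_def C
 proof (intro conjI ballI allI impI)
 show "U Int Z:(\<inter>) U ` FF" "U Int Z':(\<inter>) U ` FF" using f'(1,2) by blast+
 show "submodule A \<Z> M" if "A:(\<inter>) U ` FF" for A using that submodule_Int[OF U f'(3)] by blast
 show "U Int Z =< A" "A =< U Int Z'" if "A:(\<inter>) U ` FF" for A using that f'(4,5) by blast+
 show "A =< B | B =< A" if "A:(\<inter>) U ` FF" "B:(\<inter>) U ` FF" for A B
 proof -
  obtain A' B' where "A':FF" "B':FF" "A = U Int A'" "B = U Int B'" using \<open>A:_\<close> \<open>B:_\<close> by blast
  thus ?thesis using f'(6)[of A' B'] by blast
 qed
 next
 fix GG' assume "GG' =< (\<inter>) U ` FF & GG' ~= {}"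
 then obtain GG where GG: "GG =< FF" "GG ~= {}" "GG' = (\<inter>) U ` GG" by (metis image_empty subset_imageE)
 have "\<Union>GG' = U Int \<Union>GG" using GG(3) by blast
 thus "\<Union>GG':(\<inter>) U ` FF" using f'(7)[OF GG(1,2)] by blast
 have "\<Inter>GG' = U Int \<Inter>GG" using GG(2,3) by blast
 thus "\<Inter>GG':GG'" using f'(8)[OF GG(1,2)] GG(3) by blast
 next
 fix A' B' assume "A':(\<inter>) U ` FF" "B':(\<inter>) U ` FF" and AB: "A' << B' & (ALL D:(\<inter>) U ` FF. ~ (A' << D & D << B'))"
 then obtain A B where A: "A:FF" "A' = U Int A" and B: "B:FF" "B' = U Int B" by blast
 \<comment> \<open>Many members may have the same trace on \<open>U\<close>. The union of those with
   trace inside \<open>A'\<close> and the intersection of the others are consecutive, and their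
   traces are \<open>A'\<close> and \<open>B'\<close>.\<close>
 let ?L = "{D:FF. U Int D =< A'}" and ?R = "{D:FF. ~ U Int D =< A'}"
 have L: "\<Union>?L:FF" using f'(7)[of ?L] A by blast
 have R: "\<Inter>?R:?R" using f'(8)[of ?R] B AB by blast
 have LA: "U Int \<Union>?L = A'" using A by blast
 have RB': "U Int \<Inter>?R =< B'" using B AB by blast
 have lt: "\<Union>?L << \<Inter>?R"
 proof -
  have "D =< E" if "D:?L" "E:?R" for D E using f'(6)[of D E] that by blast
  hence "\<Union>?L =< \<Inter>?R" by blast
  moreover have "\<Union>?L ~= \<Inter>?R" using R LA by auto
  ultimately show ?thesis by blast
 qed
 have "A' =< U Int \<Inter>?R" using Int_mono[OF subset_refl[of U] psubset_imp_subset[OF lt]] LA by simp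
 moreover have "~ U Int \<Inter>?R =< A'" using R by simp
 ultimately have AR: "A' << U Int \<Inter>?R" by (simp add: less_le_not_le)
 have RF: "U Int \<Inter>?R:(\<inter>) U ` FF" using R by simp
 have RB: "U Int \<Inter>?R = B'"
 proof (rule ccontr)
  assume "U Int \<Inter>?R ~= B'"
  hence "U Int \<Inter>?R << B'" using RB' by (simp add: psubset_eq)
  thus False using bspec[OF conjunct2[OF AB] RF] AR by simp
 qed
 have nb: "~ (\<Union>?L << D & D << \<Inter>?R)" if D: "D:FF" for D
 proof (cases "U Int D =< A'")
  case True
  hence "D =< \<Union>?L" using D by blast
  thus ?thesis by blast
 next
  case False
  hence "\<Inter>?R =< D" using D by blast
  thus ?thesis by blast
 qed
 have "\<Inter>?R:FF" using R by simp
 then obtain N where N: "N:(int_class :: (int, 'v) module set)" "sq \<Z> M (\<Union>?L) (\<Inter>?R) N"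
  using f'(9)[OF L _ lt nb] by auto
 obtain \<phi> where p: "zhom M (\<Inter>?R) \<phi>" "{x:\<Inter>?R. \<phi> x = 0} = \<Union>?L"
  using sq_zhom[OF N] by (elim exE conjE) (rule that)
 have "B' =< \<Inter>?R" unfolding RB[symmetric] by (rule Int_lower2)
 hence z: "zhom M B' \<phi>" by (rule zhom_subset[OF p(1)])
 have g: "{x:U Int X. \<phi> x = 0} = U Int {x:X. \<phi> x = 0}" for X by blast
 have k: "{x:B'. \<phi> x = 0} = A'" unfolding RB[symmetric] g p(2) by (rule LA)
 have sB: "submodule B' \<Z> M" using submodule_Int[OF U f'(3)[OF B(1)]] B(2) by simp
 have "A' ~= B'" using AB by blast
 thus "EX N:int_class. sq \<Z> M A' B' N" by (rule zhom_sq[OF M sB z k])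
 qed
qed

lemma qh_int: "qh_class \<Z> (int_class :: (int, 'v::zfc) module set)"
proof -
 have fc: "filt_class \<Z> (int_class :: (int, 'v) module set)"
 by (rule filt_class.intro[OF ring_int]) (use int_class_presented in blast)
 have "quotient_hereditary \<Z> (int_class :: (int, 'v) module set)"
 unfolding filt_class.quotient_hereditary_iff[OF fc]
 proof (intro allI impI, elim conjE)
 fix M :: "(int, 'v) module" and Z Z' U
 assume M: "lmod \<Z> M" and Z: "Z =< Z'" and U: "submodule U \<Z> M" "U =< Z'"
  and s: "subfiltered \<Z> (int_class :: (int, 'v) module set) M {0[M]} Z" "subfiltered \<Z> (int_class :: (int, 'v) module set) M Z Z'"
 obtain FF where f1: "fchain \<Z> (int_class :: (int, 'v) module set) M {0[M]} Z FF" using s(1) unfolding subfiltered_def by (rule exE)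
 obtain GG where f2: "fchain \<Z> (int_class :: (int, 'v) module set) M Z Z' GG" using s(2) unfolding subfiltered_def by (rule exE)
 note f = f1 f2
 have "U Int {0[M]} = {0[M]}" "U Int Z' = U" using lmod.submoduleD(2)[OF M U(1)] U(2) by auto
 thus "subfiltered \<Z> (int_class :: (int, 'v) module set) M {0[M]} (U Int Z) & subfiltered \<Z> (int_class :: (int, 'v) module set) M (U Int Z) U"
  using subfiltered_Int[OF M f(1) refl U(1)] subfiltered_Int[OF M f(2) refl U(1)] unfolding subfiltered_def by auto
 qed
 thus ?thesis using fc by (simp add: qh_class_def qh_class_axioms_def)
qed

text \<open>Countable groups whose homomorphisms to \<open>\<int>\<close> separate points are free: the double annihilators of
 the initial segments of an enumeration form a filtration.\<close>

lemma countable_separated_subfiltered: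
 fixes M :: "(int, 'm) module"
 assumes M: "lmod \<Z> M" and c: "countable (carrier M)"
 and sep: "!!x. x:carrier M==>x ~= 0[M]==>EX \<phi>. zhom M (carrier M) \<phi> & \<phi> x ~= 0"
 shows "subfiltered \<Z> (int_class :: (int, 'v::zfc) module set) M {0[M]} (carrier M)"
proof -
 interpret lmod \<Z> M by (rule M)
 define a where "a = from_nat_into (carrier M)"
 have aM: "a i:carrier M" for i unfolding a_def using M.zero_closed by (intro from_nat_into) blast
 have a_surj: "EX i. x = a i" if "x:carrier M" for x using from_nat_into_surj[OF c that] unfolding a_def by metis
 define K where "K n \<phi> <-> zhom M (carrier M) \<phi> & (ALL i<n. \<phi> (a i) = 0)" for n :: nat and \<phi>
 define T where "T n = {x:carrier M. ALL \<phi>. K n \<phi> --> \<phi> x = 0}" for n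
 have z0: "\<phi> 0[M] = 0" if "zhom M (carrier M) \<phi>" for \<phi>
 proof -
 have "\<phi> (0 *[M] 0[M]) = 0 * \<phi> 0[M]" using that M.zero_closed unfolding zhom_def by blast
 thus ?thesis using smult_zero[of 0] by simp
 qed
 have T: "submodule (T n) \<Z> M" for n
 proof -
 have K: "\<phi> (x +[M] y) = \<phi> x + \<phi> y" "\<phi> (r *[M] x) = r * \<phi> x" "\<phi> 0[M] = 0"
  if "K n \<phi>" "x:carrier M" "y:carrier M" for \<phi> x y r
  using that z0 unfolding K_def zhom_def by auto
 have "0[M]:T n" using K(3) M.zero_closed unfolding T_def by blast
 thus ?thesis unfolding submodule_iff by (auto simp: T_def K smult_closed)
 qed
 have T0: "T 0 = {0[M]}" using sep z0 unfolding T_def K_def by auto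
 have TS: "T n =< T (Suc n)" for n unfolding T_def K_def by auto
 have "a i:T (Suc i)" for i using aM unfolding T_def K_def by auto
 hence TU: "(\<Union>n. T n) = carrier M" using a_surj by (auto simp: T_def) blast
 have step: "T n = T (Suc n) | (EX N:int_class :: (int, 'v) module set. sq \<Z> M (T n) (T (Suc n)) N)" for n
 proof (cases "EX \<phi>. K n \<phi> & \<phi> (a n) ~= 0")
 case False
 hence "K (Suc n) \<phi> <-> K n \<phi>" for \<phi> unfolding K_def by (auto simp: less_Suc_eq)
 thus ?thesis unfolding T_def by simp
 next
 case True
 then obtain \<phi> where p: "K n \<phi>" "\<phi> (a n) ~= 0" by blast
 have "x:T n" if x: "x:T (Suc n)" "\<phi> x = 0" for x
 proof -
  have "\<psi> x = 0" if q: "K n \<psi>" for \<psi>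
  proof -
  \<comment> \<open>This combination also vanishes at \<open>a n\<close>, so it annihilates
    \<open>T (Suc n)\<close>. Where \<open>\<phi>\<close> vanishes too, it leaves a nonzero multiple
    of \<open>\<psi> x\<close>.\<close>
  have "K (Suc n) (%y. \<phi> (a n) * \<psi> y - \<psi> (a n) * \<phi> y)"
   using p q unfolding K_def zhom_def by (auto simp: less_Suc_eq algebra_simps)
  hence "\<phi> (a n) * \<psi> x - \<psi> (a n) * \<phi> x = 0" using x(1) unfolding T_def by blast
  thus ?thesis using x(2) p(2) by simp
  qed
  thus ?thesis using x(1) unfolding T_def by simp
 qed
 moreover have "\<phi> x = 0" if "x:T n" for x using that p(1) unfolding T_def by blast
 ultimately have "{x:T (Suc n). \<phi> x = 0} = T n" using TS by blast
 moreover have "zhom M (T (Suc n)) \<phi>" using p(1) unfolding K_def zhom_def T_def by auto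
 ultimately show ?thesis using zhom_sq[OF M T] by blast
 qed
 define FF where "FF n = T ` {..n}" for n
 have Tm: "T m =< T n" if "m <= n" for m n by (rule lift_Suc_mono_le[of T, OF TS that])
 have two: "fchain \<Z> (int_class :: (int, 'v) module set) M (T n) (T (Suc n)) {T n, T (Suc n)}" for n
 unfolding fchain_def
 proof (intro conjI ballI allI impI)
 fix GG assume "GG =< {T n, T (Suc n)} & GG ~= {}"
 hence "GG = {T n} | GG = {T (Suc n)} | GG = {T n, T (Suc n)}" by blast
 moreover have "T n Un T (Suc n) = T (Suc n)" "T n Int T (Suc n) = T n" using TS[of n] by blast+
 ultimately show "\<Union>GG:{T n, T (Suc n)}" "\<Inter>GG:GG" by auto
 qed (use T TS[of n] step[of n] in auto)
 have fc: "fchain \<Z> (int_class :: (int, 'v) module set) M {0[M]} (T n) (FF n)" for n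
 proof (induction n)
 case 0
 have "\<Union>GG = {0[M]} & \<Inter>GG = {0[M]} & {0[M]}:GG" if "GG =< {{0[M]}} & GG ~= {}" for GG
 proof -
  have "GG = {{0[M]}}" using that by blast
  thus ?thesis by simp
 qed
 thus ?case using submodule_zero by (auto simp: fchain_def FF_def T0)
 next
 case (Suc n)
 have "FF (Suc n) = FF n Un {T n, T (Suc n)}" by (auto simp: FF_def atMost_Suc)
 thus ?case using fchain_Un[OF Suc two] by simp
 qed
 have "fchain \<Z> (int_class :: (int, 'v) module set) M {0[M]} (\<Union>n. T n) (insert (\<Union>n. T n) (\<Union>n. FF n))"
 by (rule fchain_Union[OF M fc]) (auto simp: FF_def atMost_Suc TS[THEN subsetD])
 thus ?thesis using TU unfolding subfiltered_def by auto
qed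

text \<open>For countable \<open>M\<close> the single set \<open>carrier M\<close> forms a club, so
  goodness amounts to \<open>M\<close> itself being filtered.\<close>

lemma countable_separated_potentially_free:
 fixes M :: "(int, 'v::zfc) module"
 assumes M: "lmod \<Z> M" and c: "countable (carrier M)"
 and sep: "!!x. x:carrier M==>x ~= 0[M]==>EX \<phi>. zhom M (carrier M) \<phi> & \<phi> x ~= 0"
 shows "potentially_free M"
proof -
 interpret lmod \<Z> M by (rule M)
 note s = countable_separated_subfiltered[OF M c sep]
 have sp: "mod_span \<Z> M (carrier M) = carrier M" using span_submodule[OF submodule_carrier] by (simp add: span_def)
 have t: "fchain \<Z> (int_class :: (int, 'v) module set) M (carrier M) (carrier M) {carrier M}"
 proof -
 have "\<Union>GG = carrier M & \<Inter>GG:GG" if "GG =< {carrier M} & GG ~= {}" for GG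
 proof -
  have "GG = {carrier M}" using that by blast
  thus ?thesis by simp
 qed
 thus ?thesis using submodule_carrier unfolding fchain_def by auto
 qed
 have "good_set \<Z> (int_class :: (int, 'v) module set) M (carrier M)"
 unfolding good_set_def
 proof (intro allI impI)
 fix y assume "countable y & carrier M =< y & y =< carrier M"
 hence "y = carrier M" by blast
 thus "subfiltered \<Z> (int_class :: (int, 'v) module set) M {0[M]} (mod_span \<Z> M y) &
  subfiltered \<Z> (int_class :: (int, 'v) module set) M (mod_span \<Z> M (carrier M)) (mod_span \<Z> M y)"
  using s t sp unfolding subfiltered_def by auto
 qed
 moreover have "club_family (carrier M) {carrier M}" using c by (auto simp: club_family_def)
 ultimately have g: "good_module \<Z> (int_class :: (int, 'v) module set) M" unfolding good_module_def by blast
 have "lmod_hom \<Z> M M (carrier M) (%x. x)"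
 by (intro lmod_hom.intro lmod_hom_axioms.intro lmod_axioms submodule_carrier)
  (simp add: mod_hom_def)
 thus ?thesis
 unfolding potentially_free_def
 by (rule qh_class.good_module_potentially_filtered[OF qh_int _ countable_small[OF c] _ _ g]) (auto simp: inj_on_def)
qed

text \<open>The integers are countable, so the scalar multiplications, enumerated through
  \<open>int_decode\<close>, and addition are countably many operations whose closure contains the
  span.\<close>

lemma countable_span:
 fixes M :: "(int, 'm) module"
 assumes M: "lmod \<Z> M" and x: "countable x" "x =< carrier M"
 shows "countable (lmod.span \<Z> M x)"
proof -
 interpret lmod \<Z> M by (rule M)
 define \<phi> where "\<phi> n xs = (if set xs =< carrier M & length xs = 2 & n = 0 then xs ! 0 +[M] xs ! 1
 else if set xs =< carrier M & length xs = 1 & n > 0 then int_decode (n - 1) *[M] xs ! 0 else 0[M])" for n :: nat and xs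
 let ?U = "cl \<phi> x"
 have sub: "?U =< carrier M"
 by (rule cl_minimal[OF x(2)]) (auto simp: \<phi>_def numeral_2_eq_2 length_Suc_conv smult_closed)
 have st: "\<phi> n xs:?U" if "set xs =< ?U" for n xs by (rule cl.step) (use that in auto)
 have "submodule ?U \<Z> M"
 unfolding submodule_iff
 proof (intro conjI ballI sub)
 show "0[M]:?U" using st[of "[]" 0] by (simp add: \<phi>_def)
 fix a assume a: "a:?U"
 have aM: "a:carrier M" using a sub by blast
 show "a +[M] b:?U" if b: "b:?U" for b
 proof -
  have "b:carrier M" using b sub by blast
  thus ?thesis using st[of "[a, b]" 0] a b aM by (simp add: \<phi>_def)
 qed
 show "r *[M] a:?U" for r using st[of "[a]" "Suc (int_encode r)"] a aM by (simp add: \<phi>_def)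
 qed
 hence "span x =< ?U" by (rule span_minimal) (auto intro: cl.base)
 thus ?thesis by (rule countable_subset[OF _ countable_cl[OF x(1)]])
qed

text \<open>The Baer--Specker group: modulo a countable subgroup containing the unit vectors, a suitable element
 \<open>\<Sum>n\<in>A. n! e\<^sub>n\<close> becomes nonzero and divisible by all integers.\<close>

lemma divisible_not_subfiltered:
 fixes M :: "(int, 'm) module"
 assumes M: "lmod \<Z> M" and f: "fchain \<Z> (int_class :: (int, 'v::zfc) module set) M Z Z' FF"
 and e: "e:Z'" "e \<notin> Z" and div: "!!k. f k:Z' & e \<ominus>\<^bsub>M\<^esub> (fact k *[M] f k):Z"
 shows False
proof -
 interpret lmod \<Z> M by (rule M)
 note f' = fchainD[OF f]
 \<comment> \<open>The step of the chain at which \<open>e\<close> appears; its factor gives an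
   integer \<open>\<phi> e\<close> which is nonzero and will be divisible by all factorials.\<close>
 obtain S B N where S: "S:FF" "B:FF" "S << B" "e:B" "e \<notin> S"
  and N: "N:(int_class :: (int, 'v) module set)" "sq \<Z> M S B N"
 by (rule fchain_step[OF f e(1,2)]) (rule that, assumption+)
 obtain \<phi> where p: "zhom M B \<phi>" "{x:B. \<phi> x = 0} = S" using sq_zhom[OF N] by blast
 note B = submoduleD[OF f'(3)[OF S(2)]]
 have Zle: "Z =< S" "Z =< B" using f'(4)[OF S(1)] f'(4)[OF S(2)] by auto
 have pe: "\<phi> e ~= 0" using p(2) S by blast
 have "fact k dvd \<phi> e" for k
 proof -
 let ?t = "fact k *[M] f k" and ?z = "e \<ominus>\<^bsub>M\<^esub> (fact k *[M] f k)"
 note d = div[of k]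
 have fM: "f k:carrier M" and eM: "e:carrier M" using d e submoduleD(1)[OF f'(3)[OF f'(2)]] by blast+
 have tM: "?t:carrier M" using smult_closed[of "fact k" "f k"] fM by simp
 have zB: "?z:B" "?z:S" using d Zle by blast+
 have zM: "?z:carrier M" by (rule M.minus_closed[OF eM tM])
 have "?t +[M] ?z = e" using diff_add_cancel[OF eM tM] M.a_comm[OF tM zM] by simp
 hence teq: "?t = e \<ominus>\<^bsub>M\<^esub> ?z" using add_diff_cancel[OF tM zM] by simp
 have tB: "?t:B" by (subst teq) (rule B(6)[OF S(4) zB(1)])
 \<comment> \<open>The quotients are torsion-free: if \<open>f k\<close> appeared only at a later
   step, the homomorphism of that step would vanish at \<open>fact k *[M] f k\<close>, which lies in
   \<open>B\<close>, and hence at \<open>f k\<close>.\<close>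
 have fB: "f k:B"
 proof (rule ccontr)
  assume nB: "f k \<notin> B"
  hence "f k \<notin> Z" using Zle by blast
  then obtain S' B' N' where S': "f k:B'" "f k \<notin> S'" and
   D: "B =< S' | B' =< B" and N': "N':(int_class :: (int, 'v) module set)" "sq \<Z> M S' B' N'"
  proof (rule fchain_step[OF f conjunct1[OF d]])
  fix S' B' and N' :: "(int, 'v) module"
  assume h: "f k:B'" "f k \<notin> S'" "!!D. D:FF==>D =< S' | B' =< D" "N':int_class" "sq \<Z> M S' B' N'"
  show thesis by (rule that[OF h(1,2) h(3)[OF S(2)] h(4,5)])
  qed
  obtain \<phi>' where p': "zhom M B' \<phi>'" "{x:B'. \<phi>' x = 0} = S'" using sq_zhom[OF N'] by blast
  have "?t:S'" using D nB S'(1) tB by blast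
  hence "fact k * \<phi>' (f k) = 0" using p' S'(1) unfolding zhom_def by auto
  thus False using p'(2) S' by auto
 qed
 have "\<phi> ?z = 0" using p(2) zB(2) by blast
 moreover have "e = ?z +[M] ?t" using diff_add_cancel[OF eM tM] by simp
 hence "\<phi> e = \<phi> ?z + \<phi> ?t" using p(1) zB(1) tB unfolding zhom_def by metis
 ultimately have "\<phi> e = fact k * \<phi> (f k)" using p(1) fB unfolding zhom_def by simp
 thus ?thesis by simp
 qed
 note dvd = this
 \<comment> \<open>Chosen beyond the absolute value of \<open>\<phi> e\<close>: the factorial of
   \<open>n\<close> is at least \<open>n\<close>, too large to divide
   \<open>\<phi> e\<close>.\<close>
 define n where "n = nat \<bar>\<phi> e\<bar> + 1"
 have "\<bar>fact n :: int\<bar> <= \<bar>\<phi> e\<bar>" by (rule dvd_imp_le_int[OF pe dvd])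
 moreover have "int n <= int (fact n)" using fact_ge_self[of n] by (simp only: of_nat_le_iff)
 hence "int n <= \<bar>fact n :: int\<bar>" by simp
 moreover have "int n = \<bar>\<phi> e\<bar> + 1" by (simp add: n_def)
 ultimately show False by linarith
qed

text \<open>The group of all integer sequences. Its coordinates are the homomorphisms that separate
  points, and they restrict to all subgroups; this is kept in the conclusion because countable
  subgroups are free by it.\<close>

lemma ex_not_potentially_free:
 "EX B:mod_structs \<Z> :: (int mod_sym, unit, 'v::zfc) fo_struct set. ~ potentially_free (module_of B) &
  (ALL x:univ B. x ~= 0[module_of B] --> (EX \<phi>. zhom (module_of B) (univ B) \<phi> & \<phi> x ~= 0))"
proof -
 obtain g :: "nat => 'v" where g: "inj g" using ex_inj_nat by blast
 \<comment> \<open>A sequence is coded by its graph, a set of natural numbers transported into the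
   universe by \<open>g\<close>.\<close>
 define cd where "cd u = vset (g ` range (%n. prod_encode (n, int_encode (u n))))" for u :: "nat => int"
 have sm: "small (g ` X)" for X by (rule small_subset[OF small_nat[of g]]) auto
 have cd: "inj cd"
 proof (rule injI)
 fix u u' assume "cd u = cd u'"
 hence "range (%n. prod_encode (n, int_encode (u n))) = range (%n. prod_encode (n, int_encode (u' n)))"
  unfolding cd_def vset_inject[OF sm sm] using g by (simp add: inj_image_eq_iff)
 hence "EX m. prod_encode (n, int_encode (u n)) = prod_encode (m, int_encode (u' m))" for n by blast
 thus "u = u'" by (auto simp: prod_encode_eq int_encode_eq)
 qed
 define dc where "dc = inv_into UNIV cd"
 have dc [simp]: "dc (cd u) = u" for u using cd by (simp add: dc_def)
 have scd: "small (range cd)"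
 by (rule small_subset[OF small_Pow[OF small_nat[of g]]]) (auto simp: cd_def)
 define B :: "(int mod_sym, unit, 'v) fo_struct" where "B = \<lparr>univ = range cd,
 fn = (%f xs. if f:funs (mod_lang \<Z>) & length xs = farity (mod_lang \<Z>) f & set xs =< range cd then
  (case f of Zero => cd (%_. 0) | Plus => cd (%n. dc (xs ! 0) n + dc (xs ! 1) n) | Scal r => cd (%n. r * dc (xs ! 0) n)) else undefined),
 rl = (%_ _. False)\<rparr>"
 let ?M = "module_of B"
 have ops: "carrier ?M = range cd" "0[?M] = cd (%_. 0)" "cd u +[?M] cd u' = cd (%n. u n + u' n)" "r *[?M] cd u = cd (%n. r * u n)" for u u' r
 by (simp_all add: module_of_def B_def mod_lang_def)
 have uB: "univ B = range cd" by (simp add: B_def)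
 have st: "is_struct (mod_lang \<Z>) B"
 unfolding is_struct_mod_iff using scd by (auto simp: B_def mod_lang_def)
 have "abelian_group ?M"
 proof (rule abelian_groupI)
 show "EX y:carrier ?M. y +[?M] x = 0[?M]" if x: "x:carrier ?M" for x
 proof -
  obtain u where "x = cd u" using x ops(1) by auto
  thus ?thesis by (intro bexI[of _ "cd (%n. - u n)"]) (simp_all add: ops)
 qed
 qed (auto simp: ops add_ac)
 hence M: "lmod \<Z> ?M"
 using ring_int by (auto simp: lmod_def lmodule_def lmodule_axioms_def ops algebra_simps)
 hence Bm: "B:mod_structs \<Z>" using st by (simp add: mod_structs_def lmod_def)
 interpret lmod \<Z> ?M by (rule M)
 have diff: "cd u \<ominus>\<^bsub>?M\<^esub> cd u' = cd (%n. u n - u' n)" for u u'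
 proof -
 have "cd (%n. u n - u' n) +[?M] cd u' = cd u" by (simp add: ops)
 thus ?thesis using add_diff_cancel[of "cd (%n. u n - u' n)" "cd u'"] by (simp add: ops)
 qed
 have sep: "EX \<phi>. zhom ?M (univ B) \<phi> & \<phi> x ~= 0" if x: "x:univ B" "x ~= 0[?M]" for x
 proof -
 obtain u where u: "x = cd u" using x uB by auto
 then obtain n where "u n ~= 0" using x(2) ops(2) by (metis ext)
 thus ?thesis using u by (intro exI[of _ "%x. dc x n"]) (auto simp: zhom_def uB ops)
 qed
 have "~ good_module \<Z> (int_class :: (int, 'v) module set) ?M"
 proof
 assume "good_module \<Z> (int_class :: (int, 'v) module set) ?M"
 then obtain DD where DD: "club_family (carrier ?M) DD" "!!x. x:DD==>good_set \<Z> (int_class :: (int, 'v) module set) ?M x"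
  unfolding good_module_def by blast
 define e where "e n = cd (%m. if m = n then 1 else 0)" for n :: nat
 have "countable (range e)" "range e =< carrier ?M" by (auto simp: e_def ops)
 moreover have "ALL x. countable x & x =< carrier ?M --> (EX y:DD. x =< y)" using DD(1) by (simp add: club_family_def)
 ultimately obtain x where x: "x:DD" "range e =< x" by blast
 have xc: "countable x" "x =< carrier ?M" using DD(1) x(1) by (auto simp: club_family_def)
 \<comment> \<open>Distinct sets \<open>A\<close> give distinct sequences, so there are uncountably
   many of them and one lies outside the countable span of \<open>x\<close>.\<close>
 define E where "E A = cd (%n. if n:A then fact n else 0)" for A :: "nat set"
 have "inj E"
 proof (rule injI)
  fix A A' assume "E A = E A'"
  hence "(%n. if n:A then fact n else 0 :: int) = (%n. if n:A' then fact n else 0)" using injD[OF cd] unfolding E_def by blast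
  hence "(n:A) = (n:A')" for n using fact_nonzero[of n, where 'a = int] by (metis (full_types))
  thus "A = A'" by blast
 qed
 have "EX A. E A \<notin> span x"
 proof (rule ccontr)
  assume "\<nexists>A. E A \<notin> span x"
  hence "range E =< span x" by blast
  hence "countable (range E)" using countable_subset countable_span[OF M xc] by blast
  hence "countable (UNIV :: nat set set)" using \<open>inj E\<close> countable_image_inj_on by blast
  hence "range (from_nat_into (UNIV :: nat set set)) = UNIV" by (intro range_from_nat_into) auto
  thus False using Cantors_theorem[of "UNIV :: nat set"] by (metis Pow_UNIV)
 qed
 then obtain A where A: "E A \<notin> span x" by blast
 \<comment> \<open>The tail of \<open>E A\<close> from \<open>k\<close> on, divided by the factorial
   of \<open>k\<close>. What \<open>E A\<close> has beyond the multiple of it is a finite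
   combination of unit vectors and lies in the span of \<open>x\<close>.\<close>
 define f where "f k = cd (%n. if n:A & n >= k then fact n div fact k else 0)" for k :: nat
 define y where "y = x Un insert (E A) (range f)"
 have y: "countable y" "x =< y" "y =< carrier ?M" using xc by (auto simp: y_def E_def f_def ops)
 note ys = subsetD[OF span_superset[of y]]
 have part: "cd (%n. if n:A & n < k then fact n else 0):span x" for k
 proof (induction k)
  case 0
  thus ?case using submoduleD(2)[OF submodule_span[OF xc(2)]] by (simp add: ops)
 next
  case (Suc k)
  show ?case
  proof (cases "k:A")
  case True
  have "e k:span x" using x(2) span_superset by blast
  hence "fact k *[?M] e k:span x" using submoduleD(4)[OF submodule_span[OF xc(2)], of "fact k" "e k"] by simp
  hence "cd (%n. if n:A & n < k then fact n else 0) +[?M] (fact k *[?M] e k):span x"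
   by (rule submoduleD(3)[OF submodule_span[OF xc(2)] Suc])
  moreover have "cd (%n. if n:A & n < k then fact n else 0) +[?M] (fact k *[?M] e k) =
   cd (%n. if n:A & n < Suc k then fact n else 0)"
   using True unfolding e_def ops by (intro arg_cong[of _ _ cd] ext) (auto simp: less_Suc_eq)
  ultimately show ?thesis by simp
  next
  case False
  hence "(%n. if n:A & n < Suc k then fact n else 0 :: int) = (%n. if n:A & n < k then fact n else 0)"
   by (intro ext) (auto simp: less_Suc_eq)
  thus ?thesis using Suc by simp
  qed
 qed
 have "f k:span y & E A \<ominus>\<^bsub>?M\<^esub> (fact k *[?M] f k):span x" for k
 proof -
  have "(%n. (if n:A then fact n else 0) - fact k * (if n:A & n >= k then fact n div fact k else 0)) =
   (%n. if n:A & n < k then fact n else 0 :: int)"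
  by (intro ext) (auto simp: fact_dvd)
  hence "E A \<ominus>\<^bsub>?M\<^esub> (fact k *[?M] f k) = cd (%n. if n:A & n < k then fact n else 0)"
  unfolding E_def f_def ops diff by simp
  thus ?thesis using part ys[of "f k"] by (simp add: y_def)
 qed
 moreover obtain FF where "fchain \<Z> (int_class :: (int, 'v) module set) ?M (span x) (span y) FF"
  using DD(2)[OF x(1)] y unfolding good_set_def subfiltered_def span_def by blast
 moreover have "E A:span y" using ys by (simp add: y_def)
 ultimately show False using divisible_not_subfiltered[OF M _ _ A] by blast
 qed
 hence "~ potentially_free ?M"
 using potentially_filtered_good[of \<Z> ?M int_class] int_class_presented qh_class.qh[OF qh_int] M scd
 unfolding potentially_free_def vmodule_def lmod_def ops(1) by blast
 thus ?thesis using Bm sep by blast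
qed

text \<open>If a countable cardinal had the property, the empty subset of the Baer-Specker group
  would be contained in a countable pure subgroup of the class; but coordinates separate its points,
  so it is potentially free.\<close>

theorem aleph1_le_LS:
 fixes \<mu> :: "'v::zfc rel"
 assumes LS: "LS_property {M:mod_structs \<Z>. ~ potentially_free (module_of M)} (pure_sub \<Z>) \<mu>" and c: "vcardinal \<mu>"
 shows "aleph1 <=o \<mu>"
proof -
 have co: "Card_order \<mu>" using c by (simp add: vcardinal_def)
 show ?thesis
 proof (rule cardSuc_least[OF natLeq_Card_order co], rule ccontr)
 assume "~ natLeq <o \<mu>"
 hence le: "\<mu> <=o natLeq" using not_ordLess_iff_ordLeq[OF card_order_on_well_order_on[OF co] natLeq_Well_order] by blast
 obtain B :: "(int mod_sym, unit, 'v) fo_struct" where B: "B:mod_structs \<Z>" "~ potentially_free (module_of B)"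
  "!!x. x:univ B==>x ~= 0[module_of B]==>EX \<phi>. zhom (module_of B) (univ B) \<phi> & \<phi> x ~= 0"
  using ex_not_potentially_free by blast
 obtain A where A: "A:mod_structs \<Z>" "~ potentially_free (module_of A)" "pure_sub \<Z> A B" "|univ A| <=o |{} :: 'v set| +c \<mu>"
  using LS B(1,2) unfolding LS_property_def by blast
 have "|{} :: 'v set| <=o natLeq" using card_of_empty natLeq_Card_order card_of_empty1 natLeq_Well_order by blast
 hence "|{} :: 'v set| +c \<mu> <=o natLeq" using csum_cinfinite_bound[OF _ le card_of_Card_order co natLeq_Cinfinite] by blast
 hence "|univ A| <=o |UNIV :: nat set|" by (intro ordLeq_ordIso_trans[OF _ ordIso_symmetric[OF card_of_nat]] ordLeq_transitive[OF A(4)])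
 hence cA: "countable (univ A)" by (simp add: countable_card_of_nat)
 have sub: "substructure (mod_lang \<Z>) A B" using A(3) by (simp add: pure_sub_def)
 have ops: "x +[module_of A] y = x +[module_of B] y" "r *[module_of A] x = r *[module_of B] x"
  "0[module_of A] = 0[module_of B]" "x:univ B" if "x:univ A" "y:univ A" for x y r
  using sub that by (auto simp: substructure_mod_iff module_of_def)
 have "potentially_free (module_of A)"
 proof (rule countable_separated_potentially_free)
  fix x assume x: "x:carrier (module_of A)" "x ~= 0[module_of A]"
  hence xA: "x:univ A" by (simp add: module_of_def)
  obtain \<phi> where "zhom (module_of B) (univ B) \<phi>" "\<phi> x ~= 0" using B(3)[of x] ops(3,4)[OF xA xA] x(2) by auto
  moreover from this(1) have "zhom (module_of A) (univ A) \<phi>" using ops unfolding zhom_def by simp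
  ultimately show "EX \<phi>. zhom (module_of A) (carrier (module_of A)) \<phi> & \<phi> x ~= 0" by (auto simp: module_of_def)
 qed (use mod_structsD[OF A(1)] cA in auto)
 thus False using A(2) by simp
 qed
qed

theorem theorem5p11:
  assumes "RP_internal TYPE('v::zfc)"
  shows "(\<forall>(R :: 'r ring) (C :: ('r, 'v) module set).
            ring R \<and> |carrier R| \<le>o aleph1 \<and>
            (\<forall>N\<in>C. vmodule R N \<and> countably_presented R N) \<and> quotient_hereditary R C \<longrightarrow>
            (let K = {M \<in> mod_structs R. \<not> potentially_filtered R C (module_of M)} in
               AEC (mod_lang R) K (pure_sub R) \<and>
               (\<exists>\<kappa>. LS_number K (pure_sub R) \<kappa> \<and> \<kappa> \<le>o aleph1))) \<and>
         (let K = {M \<in> (mod_structs \<Z> :: (int mod_sym, unit, 'v) fo_struct set).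
                     \<not> potentially_free (module_of M)} in
            AEC (mod_lang \<Z>) K (pure_sub \<Z>) \<and>
            (\<exists>\<kappa>. LS_number K (pure_sub \<Z>) \<kappa> \<and> \<kappa> =o aleph1))"
proof (intro conjI allI impI)
  fix R :: "'r ring" and C :: "('r, 'v) module set"
  assume h: "ring R \<and> |carrier R| \<le>o aleph1 \<and> (\<forall>N\<in>C. vmodule R N \<and> countably_presented R N) \<and> quotient_hereditary R C"
  then have "qh_class R C" by (simp add: qh_class_def filt_class_def qh_class_axioms_def)
  then show "let K = {M \<in> mod_structs R. \<not> potentially_filtered R C (module_of M)} in
      AEC (mod_lang R) K (pure_sub R) \<and> (\<exists>\<kappa>. LS_number K (pure_sub R) \<kappa> \<and> \<kappa> \<le>o aleph1)"
    by (rule qh_class.AEC_and_LS_number[OF _ assms]) (use h in auto)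
next
  have "|carrier \<Z>| \<le>o natLeq" by (simp add: countable_card_le_natLeq[symmetric])
  then have c: "|carrier \<Z>| \<le>o aleph1" by (rule ordLeq_transitive[OF _ cardSuc_ordLeq[OF natLeq_Card_order]])
  define K where "K = {M \<in> (mod_structs \<Z> :: (int mod_sym, unit, 'v) fo_struct set). \<not> potentially_free (module_of M)}"
  have "AEC (mod_lang \<Z>) K (pure_sub \<Z>) \<and> (\<exists>\<kappa>. LS_number K (pure_sub \<Z>) \<kappa> \<and> \<kappa> \<le>o aleph1)"
    using qh_class.AEC_and_LS_number[OF qh_int assms c] int_class_presented
    unfolding K_def potentially_free_def Let_def by blast
  then obtain \<kappa> where A: "AEC (mod_lang \<Z>) K (pure_sub \<Z>)" and k: "LS_number K (pure_sub \<Z>) \<kappa>" "\<kappa> \<le>o aleph1" by blast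
  have "aleph1 \<le>o \<kappa>" using aleph1_le_LS[of \<kappa>] k(1) unfolding LS_number_def K_def by blast
  then have "\<kappa> =o aleph1" using k(2) by (simp add: ordIso_iff_ordLeq)
  then show "let K = {M \<in> (mod_structs \<Z> :: (int mod_sym, unit, 'v) fo_struct set). \<not> potentially_free (module_of M)} in
      AEC (mod_lang \<Z>) K (pure_sub \<Z>) \<and> (\<exists>\<kappa>. LS_number K (pure_sub \<Z>) \<kappa> \<and> \<kappa> =o aleph1)"
    using A k(1) unfolding Let_def K_def[symmetric] by blast
qed


end
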